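(* Let $D$ be a flat disk and let $q\in D$ be an arbitrary point. Then for almost all directions $v\in\mathbb{U}_q$, the closure of the billiard trajectory in $D$ starting at $q$ with direction $v$ contains a singular point of $D$ (a singular interior point or a singular boundary point).
   Context: A flat surface is a surface with a metric obtained by gluing Euclidean triangles along their edges by isometries. A flat disk is a closed (compact), oriented topological disk with a flat metric on it (finitely many triangles); its boundary is piecewise geodesic. Every point $p$ has a well-defined angle $\theta_p$. An interior point $p$ is singular if $\theta_p\neq 2\pi$; a boundary point $p$ is singular if $\theta_p\neq\pi$. There are finitely many singular points. Billiard trajectories are straight (locally geodesic) in the interior of $D$ and reflect at non-singular boundary points by the usual law (angle of incidence equals angle of reflection); a trajectory that reaches a singular point ends there, that point being considered part of the trajectory. A trajectory starting at a singular point contains that point. For a non-singular interior point $q$, $\mathbb{U}_q$ is the set of unit tangent vectors at $q$, identified with $\mathbb{R}/2\pi\mathbb{Z}$ and endowed with Lebesgue measure; for a non-singular boundary point $q$, $\mathbb{U}_q$ is the set of unit tangent vectors at $q$ pointing into $D$, with Lebesgue measure (an arc of length $\pi$); for a singular point $q$, it is the space of directions at $q$ with the angular measure (total mass $\theta_q$). "Almost all" means for all $v$ outside a set of measure zero. *)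

theory Defs
  imports "HOL-Analysis.Analysis"
begin

text \<open>
  A flat disk is presented by finitely many Euclidean triangles in the complex plane, together with
  a pairing of their edges.  Edge \<open>(i, j)\<close> runs from \<open>vert i j\<close> to \<open>vert i (j + 1)\<close>, the index \<open>j\<close>
  being taken modulo 3.  A fixed point of \<open>mate\<close> is an edge that is not glued to anything, so it
  lies on the boundary.
\<close>

record 'i triangle_gluing =
  tris :: "'i set"
  vert :: "'i \<Rightarrow> 3 \<Rightarrow> complex"
  mate :: "'i \<times> 3 \<Rightarrow> 'i \<times> 3"

definition triangle :: "'i triangle_gluing \<Rightarrow> 'i \<Rightarrow> complex set" where
  "triangle D i = convex hull (range (vert D i))"

definition triangle_points :: "'i triangle_gluing \<Rightarrow> ('i \<times> complex) set" where
  "triangle_points D = Sigma (tris D) (triangle D)"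

definition edges :: "'i triangle_gluing \<Rightarrow> ('i \<times> 3) set" where
  "edges D = tris D \<times> UNIV"

definition edge_point :: "'i triangle_gluing \<Rightarrow> 'i \<times> 3 \<Rightarrow> real \<Rightarrow> 'i \<times> complex" where
  "edge_point D e s =
     (fst e, linepath (vert D (fst e) (snd e)) (vert D (fst e) (snd e + 1)) s)"

definition edge_length :: "'i triangle_gluing \<Rightarrow> 'i \<times> 3 \<Rightarrow> real" where
  "edge_length D e = dist (vert D (fst e) (snd e)) (vert D (fst e) (snd e + 1))"

text \<open>
  All triangles are positively oriented (see \<open>flat_disk\<close> below), so an edge is glued to its mate with
  the direction reversed; this makes the gluing compatible with the orientations.
\<close>

definition glued :: "'i triangle_gluing \<Rightarrow> (('i \<times> complex) \<times> ('i \<times> complex)) set" where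
  "glued D = {(edge_point D e s, edge_point D (mate D e) (1 - s)) | e s.
                e \<in> edges D \<and> mate D e \<noteq> e \<and> 0 \<le> s \<and> s \<le> 1}"

text \<open>\<open>glued D\<close> is symmetric when \<open>mate D\<close> is an involution, so its reflexive transitive closure is
  the equivalence relation it generates.\<close>

definition pt :: "'i triangle_gluing \<Rightarrow> 'i \<times> complex \<Rightarrow> ('i \<times> complex) set" where
  "pt D x = (glued D)\<^sup>* `` {x}"

definition surface :: "'i triangle_gluing \<Rightarrow> ('i \<times> complex) set set" where
  "surface D = pt D ` triangle_points D"

definition surface_topology :: "'i triangle_gluing \<Rightarrow> ('i \<times> complex) set topology" where
  "surface_topology D = topology (\<lambda>U. U \<subseteq> surface D \<and>
     openin (sum_topology (\<lambda>i. top_of_set (triangle D i)) (tris D))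
            {x \<in> triangle_points D. pt D x \<in> U})"

lemma openin_surface_topology:
  "openin (surface_topology D) U \<longleftrightarrow> U \<subseteq> surface D \<and>
     openin (sum_topology (\<lambda>i. top_of_set (triangle D i)) (tris D))
            {x \<in> triangle_points D. pt D x \<in> U}"
proof -
  let ?X = "sum_topology (\<lambda>i. top_of_set (triangle D i)) (tris D)"
  let ?P = "\<lambda>U. {x \<in> triangle_points D. pt D x \<in> U}"
  have int: "?P (S \<inter> T) = ?P S \<inter> ?P T" for S T
    by auto
  have un: "?P (\<Union>\<K>) = (\<Union>K\<in>\<K>. ?P K)" for \<K>
    by auto
  have "istopology (\<lambda>U. U \<subseteq> surface D \<and> openin ?X (?P U))"
    unfolding istopology_def int un by (blast intro: openin_Int openin_Union)
  then show ?thesis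
    by (simp add: surface_topology_def)
qed

definition flat_disk :: "'i triangle_gluing \<Rightarrow> bool" where
  "flat_disk D \<longleftrightarrow>
     finite (tris D) \<and>
     (\<forall>i\<in>tris D. 0 < Im (cnj (vert D i 1 - vert D i 0) * (vert D i 2 - vert D i 0))) \<and>
     (\<forall>e\<in>edges D. mate D e \<in> edges D \<and> mate D (mate D e) = e \<and>
                  edge_length D (mate D e) = edge_length D e) \<and>
     surface_topology D homeomorphic_space top_of_set (cball (0::complex) 1)"

definition boundary_points :: "'i triangle_gluing \<Rightarrow> ('i \<times> complex) set set" where
  "boundary_points D = {pt D (edge_point D e s) | e s.
                          e \<in> edges D \<and> mate D e = e \<and> 0 \<le> s \<and> s \<le> 1}"

text \<open>
  The metric: the infimum of the lengths of the polygonal paths each of whose segments lies in one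
  triangle.
\<close>

inductive polygonal_length ::
  "'i triangle_gluing \<Rightarrow> ('i \<times> complex) set \<Rightarrow> ('i \<times> complex) set \<Rightarrow> real \<Rightarrow> bool"
  for D where
  start: "p \<in> surface D \<Longrightarrow> polygonal_length D p p 0"
| segment: "polygonal_length D p (pt D (i, z)) l \<Longrightarrow> i \<in> tris D \<Longrightarrow>
    z \<in> triangle D i \<Longrightarrow> w \<in> triangle D i \<Longrightarrow>
    polygonal_length D p (pt D (i, w)) (l + dist z w)"

definition surface_dist ::
  "'i triangle_gluing \<Rightarrow> ('i \<times> complex) set \<Rightarrow> ('i \<times> complex) set \<Rightarrow> real" where
  "surface_dist D p r = Inf {l. polygonal_length D p r l}"

definition points_into :: "'i triangle_gluing \<Rightarrow> 'i \<times> complex \<Rightarrow> complex \<Rightarrow> bool" where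
  "points_into D x u \<longleftrightarrow>
     (\<exists>\<epsilon>>0. \<forall>t\<in>{0..\<epsilon>}. snd x + of_real t * u \<in> triangle D (fst x))"

definition sector :: "'i triangle_gluing \<Rightarrow> 'i \<times> complex \<Rightarrow> real set" where
  "sector D x = {t \<in> {0..<2 * pi}. points_into D x (cis t)}"

text \<open>
  The space of directions at \<open>q\<close> is the union, over the triangle points \<open>x\<close> representing \<open>q\<close>, of the
  sectors of directions at \<open>x\<close> pointing into the triangle; the pair \<open>(x, t)\<close> stands for the
  direction \<open>cis t\<close> at \<open>x\<close>.  A direction along a glued edge is represented by two such pairs; this
  concerns finitely many directions and hence a null set.
\<close>

definition direction_measure ::
  "'i triangle_gluing \<Rightarrow> ('i \<times> complex) set \<Rightarrow> (('i \<times> complex) \<times> real) measure" where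
  "direction_measure D q = restrict_space (count_space q \<Otimes>\<^sub>M lborel) (Sigma q (sector D))"

definition point_angle :: "'i triangle_gluing \<Rightarrow> ('i \<times> complex) set \<Rightarrow> real" where
  "point_angle D p = (\<Sum>x\<in>p. measure lborel (sector D x))"

definition singular_points :: "'i triangle_gluing \<Rightarrow> ('i \<times> complex) set set" where
  "singular_points D =
     {p \<in> surface D. point_angle D p \<noteq> (if p \<in> boundary_points D then pi else 2 * pi)}"

definition locally_geodesic_at ::
  "'i triangle_gluing \<Rightarrow> real set \<Rightarrow> (real \<Rightarrow> ('i \<times> complex) set) \<Rightarrow> real \<Rightarrow> bool" where
  "locally_geodesic_at D J \<gamma> s \<longleftrightarrow>
     (\<exists>\<epsilon>>0. \<forall>t\<in>J \<inter> ball s \<epsilon>. \<forall>t'\<in>J \<inter> ball s \<epsilon>.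
        surface_dist D (\<gamma> t) (\<gamma> t') = \<bar>t - t'\<bar>)"

text \<open>An isometry from a Euclidean half disk, with the diameter included, onto a metric ball of the
  surface.\<close>

definition half_disk_chart ::
  "'i triangle_gluing \<Rightarrow> ('i \<times> complex) set \<Rightarrow> real \<Rightarrow> (complex \<Rightarrow> ('i \<times> complex) set) \<Rightarrow> bool"
  where
  "half_disk_chart D p \<epsilon> f \<longleftrightarrow> f 0 = p \<and>
     f ` {z \<in> ball 0 \<epsilon>. 0 \<le> Im z} = {r \<in> surface D. surface_dist D p r < \<epsilon>} \<and>
     (\<forall>z\<in>ball 0 \<epsilon>. \<forall>w\<in>ball 0 \<epsilon>. 0 \<le> Im z \<longrightarrow> 0 \<le> Im w \<longrightarrow>
        surface_dist D (f z) (f w) = dist z w)"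

text \<open>In the half disk, a path leaving the origin in direction \<open>u\<close> must have arrived from the
  direction \<open>- cnj u\<close>, the mirror image of \<open>u\<close> in the normal to the boundary.\<close>

definition reflects_at ::
  "'i triangle_gluing \<Rightarrow> real set \<Rightarrow> (real \<Rightarrow> ('i \<times> complex) set) \<Rightarrow> real \<Rightarrow> bool" where
  "reflects_at D J \<gamma> s \<longleftrightarrow>
     (\<exists>\<epsilon>>0. \<exists>f u. half_disk_chart D (\<gamma> s) \<epsilon> f \<and> cmod u = 1 \<and> 0 \<le> Im u \<and>
        (\<forall>t\<in>{0..<\<epsilon>}. (s + t \<in> J \<longrightarrow> \<gamma> (s + t) = f (of_real t * u)) \<and>
                     (s - t \<in> J \<longrightarrow> \<gamma> (s - t) = f (of_real t * - cnj u))))"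

text \<open>
  Trajectories have unit speed.  The time domain \<open>J\<close> is \<open>[0, \<infinity>)\<close>, or \<open>[0, L]\<close> if a singular point
  is reached at time \<open>L\<close>; this point then belongs to the trajectory, as does the starting point.
\<close>

definition billiard_trajectory ::
  "'i triangle_gluing \<Rightarrow> 'i \<times> complex \<Rightarrow> complex \<Rightarrow> real set \<Rightarrow>
     (real \<Rightarrow> ('i \<times> complex) set) \<Rightarrow> bool" where
  "billiard_trajectory D x u J \<gamma> \<longleftrightarrow>
     (J = {0..} \<or> (\<exists>L>0. J = {0..L} \<and> \<gamma> L \<in> singular_points D)) \<and>
     continuous_map (top_of_set J) (surface_topology D) \<gamma> \<and>
     (\<exists>\<epsilon>>0. \<forall>t\<in>J \<inter> {0..\<epsilon>}. snd x + of_real t * u \<in> triangle D (fst x) \<and>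
                             \<gamma> t = pt D (fst x, snd x + of_real t * u)) \<and>
     (\<forall>s\<in>interior J. \<gamma> s \<notin> singular_points D \<and>
        (if \<gamma> s \<in> boundary_points D then reflects_at D J \<gamma> s else locally_geodesic_at D J \<gamma> s))"

end

theory Submission imports Defs begin

text \<open>A trajectory that stays away from the \<open>\<epsilon>\<close>-neighbourhood of the singular points unfolds, together
  with a strip around it of width depending only on \<open>\<epsilon>\<close>: the surface is followed by a map from a planar
  strip that is locally an isometric chart, composed at the boundary with the folding of the plane
  onto a half plane. If the directions at \<open>q\<close> of such trajectories were sufficiently dense, relative to
  its length, in some interval, their strips would overlap and fuse, far from \<open>q\<close>, to an unfolding over a
  disk larger than the diameter of the surface. Every point of the surface is then in its image, but
  singular points cannot be. Hence, if there are singular points at all, these directions form a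
  porous set, which is null. A flat disk without singular points does not exist: by simple
  connectivity it would have a global locally isometric map to the plane, whose norm attains its
  maximum although every point is interior to a geodesic segment on which the map is affine.\<close>

text \<open>Gluings and reflections would normally call for a covering space. It is replaced by
  folded charts, that is, charts preceded by the folding of the plane: they turn a reflected
  trajectory into a straight line and treat interior and boundary points alike, at the price of
  injectivity. Uniqueness of continuation therefore rests on rigidity: two folded charts with the
  same centre and radius that agree on a nonempty open set agree throughout, and two lines through
  the centre that agree at one nonzero parameter agree at all. Porosity is used rather than Lebesgue
  density because it needs only a gap of fixed proportion in every interval, and no measurability.
  The proportion does not depend on the interval because strips of length 10 R / \<delta> are used
  over an interval of length \<delta>, so that angle times length stays constant. All this needs
  charts that are isometric for the global distance. Extracting them from the gluing data is the
  bulk of the second half: upper bounds for distances come from cutting segments at the triangles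
  they cross, lower bounds from test functions that are invariant under gluing and 1-Lipschitz on
  each triangle.\<close>

definition upper :: "complex set" where
  "upper = {z. 0 \<le> Im z}"

text \<open>The parameter \<open>H\<close> is meant to be \<open>UNIV\<close> (interior point, no
  folding) or \<open>upper\<close> (boundary point, folding along the real axis), so that one
  argument serves both kinds of point.\<close>

definition fold_into :: "complex set \<Rightarrow> complex \<Rightarrow> complex" where
  "fold_into H z = (if z \<in> H then z else cnj z)"

lemma upper_iff: "z \<in> upper \<longleftrightarrow> 0 \<le> Im z"
  by (simp add: upper_def)

lemma fold_into_UNIV [simp]: "fold_into UNIV z = z"
  by (simp add: fold_into_def)

lemma norm_fold_into [simp]: "norm (fold_into H z) = norm z"
  by (simp add: fold_into_def)

lemma fold_into_mem: "H \<in> {UNIV, upper} \<Longrightarrow> fold_into H z \<in> H"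
  by (auto simp: fold_into_def upper_iff)

lemma fold_into_of_mem [simp]: "z \<in> H \<Longrightarrow> fold_into H z = z"
  by (simp add: fold_into_def)

lemma fold_into_0 [simp]: "fold_into H 0 = 0"
  by (simp add: fold_into_def)

lemma fold_into_eq_cases:
  assumes "H \<in> {UNIV, upper}" "fold_into H a = fold_into H b"
  shows "a = b \<or> (H = upper \<and> a = cnj b)"
  using assms by (auto simp: fold_into_def split: if_splits)

lemma fold_into_upper_cnj: "fold_into upper (cnj z) = fold_into upper z"
  by (auto simp: fold_into_def upper_iff complex_eq_iff)

text \<open>Only points on opposite sides of the real axis matter. Reflecting one of them replaces
  \<open>Im a - Im b\<close> by \<open>Im a + Im b\<close>, whose square is not larger because the
  product of the imaginary parts is at most 0.\<close>

lemma dist_fold_into_le: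
  assumes "H \<in> {UNIV, upper}"
  shows "dist (fold_into H a) (fold_into H b) \<le> dist a b"
proof -
  have "(Re a - Re b)\<^sup>2 + (Im a + Im b)\<^sup>2 \<le> (Re a - Re b)\<^sup>2 + (Im a - Im b)\<^sup>2"
    if "Im a * Im b \<le> 0"
    using that by (simp add: power2_eq_square algebra_simps)
  moreover have "Im a * Im b \<le> 0" if "0 \<le> Im a \<and> Im b < 0 \<or> Im a < 0 \<and> 0 \<le> Im b"
    using that by (auto simp: mult_le_0_iff)
  ultimately show ?thesis
    using assms
    by (auto simp: fold_into_def upper_iff dist_norm cmod_def power2_eq_square algebra_simps)
qed

text \<open>Equality after folding leaves only equality or conjugation of the two points, and either
  relation is inherited by all real multiples. This is the source of the uniqueness of
  trajectories.\<close>

lemma fold_into_scaleR_eq: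
  assumes "H \<in> {UNIV, upper}" "t \<noteq> 0"
    and "fold_into H (of_real t * a) = fold_into H (of_real t * b)"
  shows "fold_into H (of_real s * a) = fold_into H (of_real s * b)"
proof -
  have "of_real t * a = of_real t * b \<or> H = upper \<and> of_real t * a = cnj (of_real t * b)"
    using fold_into_eq_cases[OF assms(1,3)] .
  then have "a = b \<or> H = upper \<and> a = cnj b"
    using assms(2) by auto
  then show ?thesis
  proof
    assume *: "H = upper \<and> a = cnj b"
    then have "of_real s * a = cnj (of_real s * b)"
      by simp
    with * show ?thesis
      by (metis fold_into_upper_cnj)
  qed simp
qed

lemma linear_eq_of_eq_on_open:
  fixes A B :: "'a::real_normed_vector \<Rightarrow> 'b::real_vector"
  assumes "linear A" "linear B" "open V" "v0 \<in> V" and eq: "\<And>v. v \<in> V \<Longrightarrow> A v = B v"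
  shows "A = B"
proof
  fix w :: 'a
  obtain e where e: "e > 0" "ball v0 e \<subseteq> V"
    using assms(3,4) openE by blast
  define t where "t = e / (2 * (norm w + 1))"
  have t: "t > 0"
    using e by (simp add: t_def add_nonneg_pos)
  have "norm (t *\<^sub>R w) < e"
  proof -
    have pos: "0 < 2 * (norm w + 1)"
      by (simp add: add_nonneg_pos)
    have "e * norm w < e * (2 * (norm w + 1))"
      using e(1) add_nonneg_pos[OF norm_ge_zero[of w], of 2] by (intro mult_strict_left_mono) auto
    then have "e * norm w / (2 * (norm w + 1)) < e"
      using pos by (simp only: pos_divide_less_eq)
    then show ?thesis
      using t e(1) by (simp add: t_def)
  qed
  then have "v0 + t *\<^sub>R w \<in> V"
    using e by (auto simp: dist_norm)
  then have "A (v0 + t *\<^sub>R w) = B (v0 + t *\<^sub>R w)" "A v0 = B v0"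
    using eq assms(4) by auto
  then have "t *\<^sub>R A w = t *\<^sub>R B w"
    by (simp add: linear_add[OF assms(1)] linear_add[OF assms(2)]
        linear_scale[OF assms(1)] linear_scale[OF assms(2)])
  then show "A w = B w"
    using t by simp
qed

text \<open>Where \<open>A\<close> and \<open>B\<close> differ once they differ on a neighbourhood,
  and there \<open>A\<close> must follow \<open>C\<close>. Needed because equality after folding
  determines a point only up to conjugation, with a choice that might vary from point to
  point.\<close>

lemma linear_two_alternatives_open:
  fixes A B C :: "complex \<Rightarrow> complex"
  assumes lin: "linear A" "linear B" "linear C" and V: "open V" "V \<noteq> {}"
    and eq: "\<And>v. v \<in> V \<Longrightarrow> A v = B v \<or> A v = C v"
  shows "A = B \<or> A = C"
proof (cases "\<forall>v\<in>V. A v = B v")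
  case True
  then show ?thesis
    using linear_eq_of_eq_on_open[OF lin(1,2) V(1)] V(2) by blast
next
  case False
  then obtain v0 where v0: "v0 \<in> V" "A v0 \<noteq> B v0"
    by blast
  define V' where "V' = V \<inter> {v. A v \<noteq> B v}"
  have "continuous_on UNIV A" "continuous_on UNIV B"
    using lin by (simp_all add: linear_continuous_on linear_conv_bounded_linear)
  then have "open {v. A v \<noteq> B v}"
    by (simp add: open_Collect_neq)
  then have "open V'"
    using V(1) by (auto simp: V'_def)
  moreover have "v0 \<in> V'"
    using v0 by (simp add: V'_def)
  ultimately have "A = C"
    using linear_eq_of_eq_on_open[OF lin(1,3)] eq by (auto simp: V'_def)
  then show ?thesis ..
qed

lemma orthogonal_transformation_norm_eq:
  "orthogonal_transformation L \<Longrightarrow> norm (L v) = norm v"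
  by (simp add: orthogonal_transformation_norm)

lemma orthogonal_transformation_of_real_mult:
  "orthogonal_transformation L \<Longrightarrow> L (of_real t * v) = of_real t * L (v::complex)"
  using linear_scale[OF orthogonal_transformation_linear, of L t v]
  by (simp add: scaleR_conv_of_real)

text \<open>By polarisation \<open>T\<close> preserves inner products, so the images of two
  perpendicular vectors, normalised, form an orthonormal frame and define \<open>L\<close>. The
  probes are real and positive imaginary, hence available in a half disk as well.\<close>

lemma isometry_extends_orthogonal:
  fixes T :: "complex \<Rightarrow> complex"
  assumes H: "H \<in> {UNIV, upper}" and "0 < \<epsilon>"
    and iso: "\<And>z w. z \<in> ball 0 \<epsilon> \<inter> H \<Longrightarrow> w \<in> ball 0 \<epsilon> \<inter> H \<Longrightarrow> dist (T z) (T w) = dist z w"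
    and T0: "T 0 = 0"
  shows "\<exists>L. orthogonal_transformation L \<and> (\<forall>z\<in>ball 0 \<epsilon> \<inter> H. T z = L z)"
proof -
  define \<eta> where "\<eta> = \<epsilon> / 2"
  have \<eta>: "\<eta> > 0" "\<eta> < \<epsilon>"
    using assms(2) by (auto simp: \<eta>_def)
  have z0: "0 \<in> ball 0 \<epsilon> \<inter> H" and z1: "of_real \<eta> \<in> ball 0 \<epsilon> \<inter> H"
    and z2: "\<i> * of_real \<eta> \<in> ball 0 \<epsilon> \<inter> H"
    using H \<eta> by (auto simp: upper_iff norm_mult)
  have nrm: "norm (T z) = norm z" if "z \<in> ball 0 \<epsilon> \<inter> H" for z
    using iso[OF that z0] T0 by simp
  have inn: "T z \<bullet> T w = z \<bullet> w" if "z \<in> ball 0 \<epsilon> \<inter> H" "w \<in> ball 0 \<epsilon> \<inter> H" for z w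
  proof -
    have "(norm (T z - T w))\<^sup>2 = (norm (z - w))\<^sup>2"
      using iso[OF that] by (simp add: dist_norm)
    then show ?thesis
      using nrm[OF that(1)] nrm[OF that(2)]
      by (simp add: dot_norm_neg)
  qed
  define a b where "a = T (of_real \<eta>) /\<^sub>R \<eta>" and "b = T (\<i> * of_real \<eta>) /\<^sub>R \<eta>"
  define L where "L v = Re v *\<^sub>R a + Im v *\<^sub>R b" for v
  have ab: "a \<bullet> a = 1" "b \<bullet> b = 1" "a \<bullet> b = 0"
    using \<eta> inn[OF z1 z1] inn[OF z2 z2] inn[OF z1 z2]
    by (simp_all add: a_def b_def inner_complex_def field_simps)
  have lin: "linear L"
    by (rule linearI) (simp_all add: L_def algebra_simps)
  have "L v \<bullet> L w = v \<bullet> w" for v w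
    using ab by (simp add: L_def inner_add_left inner_add_right inner_commute[of b a]
        inner_complex_def[of v w])
  with lin have orth: "orthogonal_transformation L"
    by (simp add: orthogonal_transformation_def)
  have "T z = L z" if z: "z \<in> ball 0 \<epsilon> \<inter> H" for z
  proof -
    have 1: "T z \<bullet> a = Re z" "T z \<bullet> b = Im z"
      using \<eta> inn[OF z z1] inn[OF z z2]
      by (simp_all add: a_def b_def inner_complex_def[of z] field_simps)
    \<comment> \<open>\<open>T z\<close> and \<open>L z\<close> both have the norm of
      \<open>z\<close>; with this inner product the norm of their difference is 0.\<close>
    have "T z \<bullet> L z = (norm z)\<^sup>2"
      by (simp add: L_def inner_add_right 1 cmod_power2) (simp add: power2_eq_square)
    then have "(norm (T z - L z))\<^sup>2 = 0"
      using nrm[OF z] orthogonal_transformation_norm_eq[OF orth, of z]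
      by (simp add: dot_norm_neg)
    then show ?thesis
      by simp
  qed
  with orth show ?thesis
    by blast
qed

text \<open>Both 1 and -1 must land in the closed upper half plane, so \<open>L 1\<close> is real
  and \<open>L \<i> = \<i>\<close>. Hence \<open>L\<close> is the identity or the reflection in the
  imaginary axis, and both commute with folding.\<close>

lemma orthogonal_upper_cases:
  fixes L :: "complex \<Rightarrow> complex"
  assumes L: "orthogonal_transformation L" and \<epsilon>: "0 < \<epsilon>"
    and sub: "L ` (ball 0 \<epsilon> \<inter> upper) \<subseteq> upper"
  shows "L (fold_into upper w) = fold_into upper (L w)"
proof -
  have lin: "linear L"
    using L by (simp add: orthogonal_transformation_linear)
  define \<eta> where "\<eta> = \<epsilon> / 2"
  have \<eta>: "\<eta> > 0" "\<eta> < \<epsilon>"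
    using \<epsilon> by (auto simp: \<eta>_def)
  have "L (of_real \<eta> * z) \<in> upper" if "z \<in> upper" "norm z = 1" for z
  proof -
    have "of_real \<eta> * z \<in> ball 0 \<epsilon> \<inter> upper"
      using that \<eta> by (simp add: upper_iff norm_mult)
    with sub show ?thesis
      by blast
  qed
  then have up: "L z \<in> upper" if "z \<in> upper" "norm z = 1" for z
    using that \<eta> by (simp add: orthogonal_transformation_of_real_mult[OF L] upper_iff zero_le_mult_iff)
  have "L (-1) = - L 1"
    using linear_neg[OF lin, of 1] by simp
  then have im1: "Im (L 1) = 0"
    using up[of 1] up[of "-1"] by (simp add: upper_iff)
  have "\<bar>Re (L 1)\<bar> = 1"
    using orthogonal_transformation_norm_eq[OF L, of 1] im1
    by (simp add: cmod_def)
  then have re1: "(Re (L 1))\<^sup>2 = 1"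
    by (metis power2_abs one_power2)
  have "L 1 \<bullet> L \<i> = 0"
    using L by (simp add: orthogonal_transformation_def inner_complex_def)
  then have rei: "Re (L \<i>) = 0"
    using im1 re1 by (auto simp: inner_complex_def)
  have imi: "Im (L \<i>) = 1"
    using orthogonal_transformation_norm_eq[OF L, of \<i>] rei up[of \<i>]
    by (simp add: cmod_def upper_iff)
  define c where "c = Re (L 1)"
  have Lz: "L z = Complex (c * Re z) (Im z)" for z
  proof -
    have "z = Re z *\<^sub>R 1 + Im z *\<^sub>R \<i>"
      by (simp add: complex_eq_iff)
    then have "L z = L (Re z *\<^sub>R 1 + Im z *\<^sub>R \<i>)"
      by (rule arg_cong)
    also have "\<dots> = Re z *\<^sub>R L 1 + Im z *\<^sub>R L \<i>"
      by (simp only: linear_add[OF lin] linear_scale[OF lin])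
    finally have "L z = Re z *\<^sub>R L 1 + Im z *\<^sub>R L \<i>" .
    then show ?thesis
      using im1 rei imi by (simp add: complex_eq_iff c_def)
  qed
  show ?thesis
    by (simp add: Lz fold_into_def upper_iff complex_eq_iff)
qed

lemma orthogonal_not_upper:
  fixes L :: "complex \<Rightarrow> complex"
  assumes L: "orthogonal_transformation L" and \<epsilon>: "0 < \<epsilon>"
  shows "L ` (ball 0 \<epsilon> \<inter> upper) \<noteq> ball 0 \<epsilon>"
proof
  assume eq: "L ` (ball 0 \<epsilon> \<inter> upper) = ball 0 \<epsilon>"
  have "L (- \<i> * of_real (\<epsilon> / 2)) \<in> ball 0 \<epsilon>"
    using orthogonal_transformation_norm_eq[OF L] \<epsilon> by (simp add: norm_mult)
  then have "L (- \<i> * of_real (\<epsilon> / 2)) \<in> L ` (ball 0 \<epsilon> \<inter> upper)"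
    by (simp only: eq)
  then obtain v where v: "v \<in> upper" "L v = L (- \<i> * of_real (\<epsilon> / 2))"
    by (elim imageE) auto
  have "v = - \<i> * of_real (\<epsilon> / 2)"
    using injD[OF orthogonal_transformation_inj[OF L] v(2)] .
  with v(1) \<epsilon> show False
    by (simp add: upper_iff)
qed

section \<open>Isometric charts modelled on disks and half disks\<close>

context Metric_space begin

text \<open>The isometry is for the global distance and onto the full metric ball, so two charts
  with the same centre and radius differ by an isometry of the models that fixes 0.\<close>

definition chart :: "complex set \<Rightarrow> 'a \<Rightarrow> real \<Rightarrow> (complex \<Rightarrow> 'a) \<Rightarrow> bool" where
  "chart H p \<epsilon> f \<longleftrightarrow> f 0 = p \<and> f ` (ball 0 \<epsilon> \<inter> H) = {r \<in> M. d p r < \<epsilon>} \<and>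
     (\<forall>z\<in>ball 0 \<epsilon> \<inter> H. \<forall>w\<in>ball 0 \<epsilon> \<inter> H. d (f z) (f w) = dist z w)"

lemma chart_centre_mem:
  assumes "chart H p \<epsilon> f" "0 < \<epsilon>" "0 \<in> H"
  shows "p \<in> M"
proof -
  have "f 0 \<in> f ` (ball 0 \<epsilon> \<inter> H)"
    using assms by auto
  then show ?thesis
    using assms by (auto simp: chart_def)
qed

lemma chart_dist_centre:
  assumes "chart H p \<epsilon> f" "0 < \<epsilon>" "0 \<in> H" "z \<in> ball 0 \<epsilon> \<inter> H"
  shows "d p (f z) = norm z"
proof -
  have "0 \<in> ball 0 \<epsilon> \<inter> H"
    using assms by simp
  then have "d (f 0) (f z) = dist 0 z"
    using assms(1,4) unfolding chart_def by blast
  then show ?thesis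
    using assms by (simp add: chart_def)
qed

lemma chart_shrink:
  assumes "chart H p \<epsilon> f" "0 < \<epsilon>'" "\<epsilon>' \<le> \<epsilon>" "0 \<in> H"
  shows "chart H p \<epsilon>' f"
proof -
  have "f ` (ball 0 \<epsilon>' \<inter> H) = {r \<in> M. d p r < \<epsilon>'}"
  proof (intro equalityI subsetI)
    fix r assume "r \<in> f ` (ball 0 \<epsilon>' \<inter> H)"
    then obtain z where z: "r = f z" "z \<in> ball 0 \<epsilon>' \<inter> H"
      by blast
    then have z': "z \<in> ball 0 \<epsilon> \<inter> H"
      using assms by auto
    moreover have "d p r = norm z"
      using chart_dist_centre[OF assms(1) _ assms(4) z'] assms z by simp
    ultimately show "r \<in> {r \<in> M. d p r < \<epsilon>'}"
      using z assms(1) by (auto simp: chart_def)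
  next
    fix r assume r: "r \<in> {r \<in> M. d p r < \<epsilon>'}"
    then have "r \<in> f ` (ball 0 \<epsilon> \<inter> H)"
      using assms by (auto simp: chart_def)
    then obtain z where z: "r = f z" "z \<in> ball 0 \<epsilon> \<inter> H"
      by blast
    moreover have "d p r = norm z"
      using chart_dist_centre[OF assms(1) _ assms(4) z(2)] assms z by simp
    ultimately show "r \<in> f ` (ball 0 \<epsilon>' \<inter> H)"
      using r by auto
  qed
  then show ?thesis
    using assms unfolding chart_def by auto
qed

text \<open>\<open>A\<close> is a change of frame and \<open>H'\<close> is \<open>H\<close> as seen
  from \<open>w\<close> in that frame. The two need to correspond only within radius \<epsilon>', so
  that a point off the diameter can take \<open>H' = UNIV\<close>.\<close>

lemma chart_recentre:
  assumes ch: "chart H p \<epsilon> f" and H: "0 \<in> H" and A: "orthogonal_transformation A"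
    and w: "w \<in> H" and le: "norm w + \<epsilon>' \<le> \<epsilon>" and \<epsilon>': "0 < \<epsilon>'"
    and H': "\<And>v. v \<in> ball 0 \<epsilon>' \<Longrightarrow> v \<in> H' \<longleftrightarrow> w + A v \<in> H"
  shows "chart H' (f w) \<epsilon>' (\<lambda>v. f (w + A v))"
proof -
  have \<epsilon>: "0 < \<epsilon>"
    using le \<epsilon>' norm_ge_zero[of w] by linarith
  have wb: "w \<in> ball 0 \<epsilon> \<inter> H"
    using w le \<epsilon>' by simp
  have dom: "w + A v \<in> ball 0 \<epsilon> \<inter> H" if "v \<in> ball 0 \<epsilon>' \<inter> H'" for v
  proof -
    have "norm (w + A v) \<le> norm w + norm v"
      using norm_triangle_ineq[of w "A v"] orthogonal_transformation_norm_eq[OF A, of v] by simp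
    then show ?thesis
      using that H'[of v] le by auto
  qed
  have iso: "d (f z) (f w) = dist z w" if "z\<in>ball 0 \<epsilon> \<inter> H" "w\<in>ball 0 \<epsilon> \<inter> H" for z w
    using ch that by (simp add: chart_def)
  have distA: "dist (w + A v) (w + A v') = dist v v'" for v v'
    using orthogonal_transformation_norm_eq[OF A, of "v - v'"]
    by (simp add: dist_norm linear_diff[OF orthogonal_transformation_linear[OF A]])
  have A0: "A 0 = 0"
    using linear_0[OF orthogonal_transformation_linear[OF A]] .
  have img: "(\<lambda>v. f (w + A v)) ` (ball 0 \<epsilon>' \<inter> H') = {r \<in> M. d (f w) r < \<epsilon>'}"
  proof (intro equalityI subsetI)
    fix r assume "r \<in> (\<lambda>v. f (w + A v)) ` (ball 0 \<epsilon>' \<inter> H')"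
    then obtain v where v: "v \<in> ball 0 \<epsilon>' \<inter> H'" "r = f (w + A v)"
      by blast
    have "d (f w) r = dist w (w + A v)"
      using iso[OF wb dom[OF v(1)]] v by simp
    also have "\<dots> = norm v"
      using distA[of 0 v] A0 by simp
    finally have "d (f w) r < \<epsilon>'"
      using v by simp
    moreover have "r \<in> M"
      using dom[OF v(1)] v ch unfolding chart_def by blast
    ultimately show "r \<in> {r \<in> M. d (f w) r < \<epsilon>'}"
      by simp
  next
    fix r assume r: "r \<in> {r \<in> M. d (f w) r < \<epsilon>'}"
    have fwM: "f w \<in> M"
      using wb ch unfolding chart_def by blast
    have pM: "p \<in> M"
      using chart_centre_mem[OF ch \<epsilon> H] .
    have "d p r \<le> d p (f w) + d (f w) r"
      using triangle pM fwM r by blast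
    then have "d p r < \<epsilon>"
      using chart_dist_centre[OF ch \<epsilon> H wb] r le by simp
    then obtain z where z: "r = f z" "z \<in> ball 0 \<epsilon> \<inter> H"
      using ch r unfolding chart_def by blast
    obtain v where v: "A v = z - w"
      using surjD[OF orthogonal_transformation_surj[OF A], of "z - w"] by auto
    have zz: "z = w + A v"
      using v by simp
    have "norm v = dist w z"
      using distA[of 0 v] A0 zz by simp
    also have "\<dots> = d (f w) r"
      using iso[OF wb z(2)] z by simp
    finally have "v \<in> ball 0 \<epsilon>'"
      using r by simp
    moreover have "v \<in> H'"
      using H'[of v] calculation z zz by auto
    ultimately show "r \<in> (\<lambda>v. f (w + A v)) ` (ball 0 \<epsilon>' \<inter> H')"
      using z zz by blast
  qed
  show ?thesis
    unfolding chart_def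
  proof (intro conjI ballI)
    fix u v assume "u \<in> ball 0 \<epsilon>' \<inter> H'" "v \<in> ball 0 \<epsilon>' \<inter> H'"
    then show "d (f (w + A u)) (f (w + A v)) = dist u v"
      using iso[OF dom dom] distA by simp
  qed (use img A0 in auto)
qed

text \<open>Both charts cover the same ball, so going forth by one and back by the other is an
  isometry fixing 0, hence orthogonal. A half disk is not the orthogonal image of a disk, so the two
  models coincide. Commutation with folding lets the transition pass through folded charts.\<close>

lemma chart_transition:
  assumes f: "chart H p \<epsilon> f" and g: "chart H' p \<epsilon> g" and \<epsilon>: "0 < \<epsilon>"
    and H: "H \<in> {UNIV, upper}" and H': "H' \<in> {UNIV, upper}"
  shows "H = H' \<and> (\<exists>T. orthogonal_transformation T \<and> (\<forall>v\<in>ball 0 \<epsilon> \<inter> H. T v \<in> H \<and> f v = g (T v)) \<and>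
     (\<forall>w. T (fold_into H w) = fold_into H (T w)))"
proof -
  have 0: "0 \<in> H" "0 \<in> H'"
    using H H' by (auto simp: upper_iff)
  define T where "T z = (SOME w. w \<in> ball 0 \<epsilon> \<inter> H' \<and> g w = f z)" for z
  have T: "T z \<in> ball 0 \<epsilon> \<inter> H' \<and> g (T z) = f z" if "z \<in> ball 0 \<epsilon> \<inter> H" for z
  proof -
    have "f z \<in> g ` (ball 0 \<epsilon> \<inter> H')"
      using f g that unfolding chart_def by blast
    then obtain w where "w \<in> ball 0 \<epsilon> \<inter> H' \<and> g w = f z"
      by auto
    then show ?thesis
      unfolding T_def by (rule someI)
  qed
  have iso: "dist (T z) (T w) = dist z w" if "z \<in> ball 0 \<epsilon> \<inter> H" "w \<in> ball 0 \<epsilon> \<inter> H" for z w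
  proof -
    have "d (g (T z)) (g (T w)) = dist (T z) (T w)"
      using T[OF that(1)] T[OF that(2)] g unfolding chart_def by blast
    moreover have "d (f z) (f w) = dist z w"
      using f that unfolding chart_def by blast
    ultimately show ?thesis
      using T[OF that(1)] T[OF that(2)] by simp
  qed
  have z0: "0 \<in> ball 0 \<epsilon> \<inter> H"
    using \<epsilon> 0 by simp
  have T0: "T 0 = 0"
  proof -
    have "d p (g (T 0)) = norm (T 0)"
      using chart_dist_centre[OF g \<epsilon> 0(2)] T[OF z0] by blast
    moreover have "g (T 0) = p"
      using T[OF z0] f by (simp add: chart_def)
    moreover have "p \<in> M"
      using chart_centre_mem[OF f \<epsilon> 0(1)] .
    ultimately show ?thesis
      by simp
  qed
  obtain L where L: "orthogonal_transformation L" and TL: "\<forall>z\<in>ball 0 \<epsilon> \<inter> H. T z = L z"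
    using isometry_extends_orthogonal[OF H \<epsilon>, of T] iso T0 by blast
  have img: "L ` (ball 0 \<epsilon> \<inter> H) = ball 0 \<epsilon> \<inter> H'"
  proof (intro equalityI subsetI)
    fix w assume "w \<in> L ` (ball 0 \<epsilon> \<inter> H)"
    then show "w \<in> ball 0 \<epsilon> \<inter> H'"
      using T TL by fastforce
  next
    fix w assume w: "w \<in> ball 0 \<epsilon> \<inter> H'"
    then have "g w \<in> f ` (ball 0 \<epsilon> \<inter> H)"
      using f g unfolding chart_def by blast
    then obtain z where z: "z \<in> ball 0 \<epsilon> \<inter> H" "g w = f z"
      by blast
    then have "g (T z) = g w"
      using T by simp
    moreover have "d (g (T z)) (g w) = dist (T z) w"
      using T[OF z(1)] g w unfolding chart_def by blast
    moreover have "g w \<in> M"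
      using w g unfolding chart_def by blast
    ultimately have "dist (T z) w = 0"
      by simp
    then show "w \<in> L ` (ball 0 \<epsilon> \<inter> H)"
      using TL z by auto
  qed
  have comm: "T' (fold_into H w) = fold_into H (T' w)" if "T' = L" "H = H'" for T' w
  proof (cases "H = UNIV")
    case False
    then have "H = upper"
      using H by simp
    then show ?thesis
      using orthogonal_upper_cases[OF L \<epsilon>] img that by simp
  qed simp
  have eqH: "H = H'"
  proof (rule ccontr)
    assume "H \<noteq> H'"
    then consider "H = UNIV" "H' = upper" | "H = upper" "H' = UNIV"
      using H H' by auto
    then show False
    proof cases
      case 1
      \<comment> \<open>The inverse of \<open>L\<close> would map a half disk onto a disk, which
        reduces this case to the other one.\<close>
      then have i: "L ` ball 0 \<epsilon> = ball 0 \<epsilon> \<inter> upper"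
        using img by simp
      have "- \<i> * of_real (\<epsilon> / 2) \<in> ball 0 \<epsilon>" "\<i> * of_real (\<epsilon> / 2) \<in> ball 0 \<epsilon>"
        using \<epsilon> by (auto simp: norm_mult)
      obtain L' where L': "orthogonal_transformation L'" "\<And>x. L' (L x) = x"
        using orthogonal_transformation_inv[OF L] inv_f_f[OF orthogonal_transformation_inj[OF L]]
        by blast
      have "L' ` (ball 0 \<epsilon> \<inter> upper) = ball 0 \<epsilon>"
        unfolding i[symmetric] by (simp add: image_image L'(2))
      then show False
        using orthogonal_not_upper[OF L'(1) \<epsilon>] by simp
    next
      case 2
      then show False
        using img orthogonal_not_upper[OF L \<epsilon>] by simp
    qed
  qed
  have "\<forall>v\<in>ball 0 \<epsilon> \<inter> H. L v \<in> H \<and> f v = g (L v)"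
    using T TL eqH by auto
  then show ?thesis
    using eqH L comm by blast
qed

end

section \<open>Folded charts in an abstract flat space\<close>

lemma orthogonal_transformation_cnj: "orthogonal_transformation cnj"
  by (simp add: orthogonal_transformation_def linear_iff inner_complex_def)

lemma orthogonal_transformation_id': "orthogonal_transformation id"
  by (simp add: id_def orthogonal_transformation_id)

lemma orthogonal_transformation_mult:
  "norm u = 1 \<Longrightarrow> orthogonal_transformation (\<lambda>v::complex. u * v)"
  by (auto simp: orthogonal_transformation norm_mult algebra_simps intro!: linearI)

text \<open>This is all that the argument about trajectories knows of the surface; \<open>B\<close>
  stands for the boundary. \<open>Sing\<close> may reach outside \<open>M\<close>, which is why
  \<open>Sing \<inter> M\<close> occurs below.\<close>

locale flat_space = Metric_space M d for M :: "'p set" and d +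
  fixes Sing B :: "'p set"
  assumes compact: "compact_space mtopology"
    and finite_Sing: "finite Sing"
    and interior_chart: "p \<in> M - Sing \<Longrightarrow> p \<notin> B \<Longrightarrow> \<exists>\<epsilon>>0. \<exists>f. chart UNIV p \<epsilon> f"
    and boundary_chart: "p \<in> M - Sing \<Longrightarrow> p \<in> B \<Longrightarrow> \<exists>\<epsilon>>0. \<exists>f. chart upper p \<epsilon> f"
begin

text \<open>A full planar disk is mapped even at a boundary point, where the lower half repeats the
  upper one; a trajectory reflecting there is the image of a straight line. The free factor
  \<open>L\<close> makes the notion stable under rotations and reflections of the parameter disk,
  and the empty intersection with \<open>Sing\<close> keeps all values nonsingular.\<close>

definition fchart :: "'p \<Rightarrow> real \<Rightarrow> (complex \<Rightarrow> 'p) \<Rightarrow> bool" where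
  "fchart p \<epsilon> F \<longleftrightarrow> 0 < \<epsilon> \<and> mball p \<epsilon> \<inter> Sing = {} \<and>
     (\<exists>H f L. H \<in> {UNIV, upper} \<and> chart H p \<epsilon> f \<and> orthogonal_transformation L \<and>
        (\<forall>v\<in>ball 0 \<epsilon>. F v = f (fold_into H (L v))))"

lemma fchartE:
  assumes "fchart p \<epsilon> F"
  obtains H f L where "0 < \<epsilon>" "mball p \<epsilon> \<inter> Sing = {}" "H \<in> {UNIV, upper}" "0 \<in> H" "chart H p \<epsilon> f"
    "orthogonal_transformation L" "\<And>v. v \<in> ball 0 \<epsilon> \<Longrightarrow> F v = f (fold_into H (L v))"
    "\<And>v. v \<in> ball 0 \<epsilon> \<Longrightarrow> fold_into H (L v) \<in> ball 0 \<epsilon> \<inter> H"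
proof -
  obtain H f L where *: "0 < \<epsilon>" "mball p \<epsilon> \<inter> Sing = {}" "H \<in> {UNIV, upper}" "chart H p \<epsilon> f"
    "orthogonal_transformation L" "\<And>v. v \<in> ball 0 \<epsilon> \<Longrightarrow> F v = f (fold_into H (L v))"
    using assms unfolding fchart_def by blast
  moreover have "0 \<in> H"
    using *(3) by (auto simp: upper_iff)
  moreover have "fold_into H (L v) \<in> ball 0 \<epsilon> \<inter> H" if "v \<in> ball 0 \<epsilon>" for v
    using that fold_into_mem[OF *(3)] orthogonal_transformation_norm_eq[OF *(5)] by simp
  ultimately show ?thesis
    using that by blast
qed

lemma fchart_pos: "fchart p \<epsilon> F \<Longrightarrow> 0 < \<epsilon>"
  by (simp add: fchart_def)

lemma fchart_shrink:
  assumes "fchart p \<epsilon> F" "0 < \<epsilon>'" "\<epsilon>' \<le> \<epsilon>"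
  shows "fchart p \<epsilon>' F"
  using assms(1)
proof (rule fchartE)
  fix H f L
  assume *: "mball p \<epsilon> \<inter> Sing = {}" "H \<in> {UNIV, upper}" "0 \<in> H" "chart H p \<epsilon> f"
    "orthogonal_transformation L" "\<And>v. v \<in> ball 0 \<epsilon> \<Longrightarrow> F v = f (fold_into H (L v))"
  have "mball p \<epsilon>' \<inter> Sing = {}"
    using *(1) mball_subset_concentric[OF assms(3), of p] by blast
  moreover have "chart H p \<epsilon>' f"
    using chart_shrink[OF *(4) assms(2,3) *(3)] .
  moreover have "\<forall>v\<in>ball 0 \<epsilon>'. F v = f (fold_into H (L v))"
    using *(6) assms by simp
  ultimately show ?thesis
    using assms(2) *(2,5) unfolding fchart_def by blast
qed

lemma fchart_cong:
  assumes "fchart p \<epsilon> F" "\<And>v. norm v < \<epsilon> \<Longrightarrow> F v = G v"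
  shows "fchart p \<epsilon> G"
proof -
  obtain H f L where *: "0 < \<epsilon>" "mball p \<epsilon> \<inter> Sing = {}" "H \<in> {UNIV, upper}" "chart H p \<epsilon> f"
    "orthogonal_transformation L" "\<And>v. v \<in> ball 0 \<epsilon> \<Longrightarrow> F v = f (fold_into H (L v))"
    using assms(1) unfolding fchart_def by blast
  have "\<forall>v\<in>ball 0 \<epsilon>. G v = f (fold_into H (L v))"
    using *(6) assms(2) by simp
  then show ?thesis
    using * unfolding fchart_def by blast
qed

lemma fchart_orthogonal:
  assumes "fchart p \<epsilon> F" "orthogonal_transformation A"
  shows "fchart p \<epsilon> (\<lambda>v. F (A v))"
proof -
  obtain H f L where *: "0 < \<epsilon>" "mball p \<epsilon> \<inter> Sing = {}" "H \<in> {UNIV, upper}" "chart H p \<epsilon> f"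
    "orthogonal_transformation L" "\<And>v. v \<in> ball 0 \<epsilon> \<Longrightarrow> F v = f (fold_into H (L v))"
    using assms(1) unfolding fchart_def by blast
  have "orthogonal_transformation (L \<circ> A)"
    using orthogonal_transformation_compose[OF *(5) assms(2)] .
  moreover have "\<forall>v\<in>ball 0 \<epsilon>. F (A v) = f (fold_into H ((L \<circ> A) v))"
    using *(6) orthogonal_transformation_norm_eq[OF assms(2)] by simp
  ultimately show ?thesis
    using *(1-4) unfolding fchart_def by blast
qed

lemma fchart_centre:
  assumes "fchart p \<epsilon> F"
  shows "p \<in> M" "p \<notin> Sing" "F 0 = p"
proof -
  obtain H f L where *: "0 < \<epsilon>" "mball p \<epsilon> \<inter> Sing = {}" "H \<in> {UNIV, upper}" "0 \<in> H" "chart H p \<epsilon> f"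
    "orthogonal_transformation L" "\<And>v. v \<in> ball 0 \<epsilon> \<Longrightarrow> F v = f (fold_into H (L v))"
    "\<And>v. v \<in> ball 0 \<epsilon> \<Longrightarrow> fold_into H (L v) \<in> ball 0 \<epsilon> \<inter> H"
    using assms by (rule fchartE) blast
  show "p \<in> M"
    using chart_centre_mem[OF *(5,1,4)] .
  then show "p \<notin> Sing"
    using *(1,2) centre_in_mball_iff[of p \<epsilon>] by blast
  have "L 0 = 0"
    using linear_0[OF orthogonal_transformation_linear[OF *(6)]] .
  then show "F 0 = p"
    using *(1,5) *(7)[of 0] by (simp add: chart_def)
qed

text \<open>Folding preserves norms but only shrinks distances, so distances from the centre are
  exact while the others are merely not increased.\<close>

lemma fchart_dist_le:
  assumes "fchart p \<epsilon> F" "norm v < \<epsilon>" "norm w < \<epsilon>"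
  shows "F v \<in> M" "F v \<notin> Sing" "d p (F v) = norm v" "d (F v) (F w) \<le> dist v w"
proof -
  obtain H f L where *: "0 < \<epsilon>" "mball p \<epsilon> \<inter> Sing = {}" "H \<in> {UNIV, upper}" "0 \<in> H" "chart H p \<epsilon> f"
    "orthogonal_transformation L" "\<And>v. v \<in> ball 0 \<epsilon> \<Longrightarrow> F v = f (fold_into H (L v))"
    "\<And>v. v \<in> ball 0 \<epsilon> \<Longrightarrow> fold_into H (L v) \<in> ball 0 \<epsilon> \<inter> H"
    using assms(1) by (rule fchartE) blast
  have v: "v \<in> ball 0 \<epsilon>" and w: "w \<in> ball 0 \<epsilon>"
    using assms by auto
  show FM: "F v \<in> M"
    using *(5) *(7)[OF v] *(8)[OF v] unfolding chart_def by auto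
  show dp: "d p (F v) = norm v"
    using chart_dist_centre[OF *(5,1,4) *(8)[OF v]] *(7)[OF v]
      orthogonal_transformation_norm_eq[OF *(6)] by simp
  show "F v \<notin> Sing"
    using *(2) dp FM assms(2) fchart_centre(1)[OF assms(1)] by (auto simp: mball_def)
  have "d (F v) (F w) = dist (fold_into H (L v)) (fold_into H (L w))"
    using *(5) *(8)[OF v] *(8)[OF w] unfolding *(7)[OF v] *(7)[OF w] chart_def by blast
  also have "\<dots> \<le> dist (L v) (L w)"
    using dist_fold_into_le[OF *(3)] .
  also have "\<dots> = dist v w"
    using orthogonal_transformation_norm_eq[OF *(6), of "v - w"]
    by (simp add: dist_norm linear_diff[OF orthogonal_transformation_linear[OF *(6)]])
  finally show "d (F v) (F w) \<le> dist v w" .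
qed

lemma fchart_onto:
  assumes "fchart p \<epsilon> F" "r \<in> M" "d p r < \<epsilon>"
  obtains v where "norm v = d p r" "F v = r"
proof -
  obtain H f L where *: "0 < \<epsilon>" "mball p \<epsilon> \<inter> Sing = {}" "H \<in> {UNIV, upper}" "0 \<in> H" "chart H p \<epsilon> f"
    "orthogonal_transformation L" "\<And>v. v \<in> ball 0 \<epsilon> \<Longrightarrow> F v = f (fold_into H (L v))"
    "\<And>v. v \<in> ball 0 \<epsilon> \<Longrightarrow> fold_into H (L v) \<in> ball 0 \<epsilon> \<inter> H"
    using assms(1) by (rule fchartE) blast
  have "r \<in> f ` (ball 0 \<epsilon> \<inter> H)"
    using *(5) assms by (auto simp: chart_def)
  then obtain z where z: "z \<in> ball 0 \<epsilon>" "z \<in> H" "r = f z"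
    by blast
  obtain v where v: "z = L v"
    using surjD[OF orthogonal_transformation_surj[OF *(6)]] by blast
  have nv: "norm v < \<epsilon>"
    using z v orthogonal_transformation_norm_eq[OF *(6)] by simp
  then have "F v = r"
    using *(7)[of v] z v by simp
  moreover have "norm v = d p (F v)"
    using fchart_dist_le(3)[OF assms(1) nv nv] by simp
  ultimately show ?thesis
    using that by simp
qed

lemma fchart_exists:
  assumes "p \<in> M - Sing"
  obtains \<epsilon> F where "fchart p \<epsilon> F"
proof -
  obtain H \<epsilon> f where H: "H \<in> {UNIV, upper}" "0 < \<epsilon>" "chart H p \<epsilon> f"
    using interior_chart[OF assms] boundary_chart[OF assms] by blast
  have 0: "0 \<in> H"
    using H(1) by (auto simp: upper_iff)
  define \<delta> where "\<delta> = Min (insert \<epsilon> (d p ` (Sing \<inter> M)))"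
  have fin: "finite (insert \<epsilon> (d p ` (Sing \<inter> M)))"
    using finite_Sing by simp
  have pos: "0 < \<delta>"
    unfolding \<delta>_def using fin H(2) assms by (subst Min_gr_iff) auto
  have le: "\<delta> \<le> \<epsilon>"
    unfolding \<delta>_def using fin by simp
  have "mball p \<delta> \<inter> Sing = {}"
  proof -
    have "\<delta> \<le> d p s" if "s \<in> Sing \<inter> M" for s
      unfolding \<delta>_def using fin that by simp
    then show ?thesis
      by (force simp: mball_def)
  qed
  moreover have "chart H p \<delta> f"
    using chart_shrink[OF H(3) pos le 0] .
  ultimately have "fchart p \<delta> (\<lambda>v. f (fold_into H (id v)))"
    unfolding fchart_def using pos H(1) orthogonal_transformation_id'
    by (intro conjI exI[of _ H] exI[of _ f] exI[of _ id] ballI refl)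
  then show ?thesis
    using that by blast
qed

text \<open>The transition \<open>T\<close> of the underlying charts commutes with folding, so it
  can be moved to the parameter side, where it becomes the inverse of \<open>L'\<close> after
  \<open>T\<close> after \<open>L\<close>.\<close>

lemma fchart_match:
  assumes F: "fchart p \<epsilon> F" and G: "fchart p \<epsilon> G"
  obtains A where "orthogonal_transformation A" "\<And>v. norm v < \<epsilon> \<Longrightarrow> F v = G (A v)"
proof -
  obtain H f L where *: "0 < \<epsilon>" "mball p \<epsilon> \<inter> Sing = {}" "H \<in> {UNIV, upper}" "0 \<in> H" "chart H p \<epsilon> f"
    "orthogonal_transformation L" "\<And>v. v \<in> ball 0 \<epsilon> \<Longrightarrow> F v = f (fold_into H (L v))"
    "\<And>v. v \<in> ball 0 \<epsilon> \<Longrightarrow> fold_into H (L v) \<in> ball 0 \<epsilon> \<inter> H"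
    using F by (rule fchartE) blast
  obtain H' f' L' where **: "0 < \<epsilon>" "mball p \<epsilon> \<inter> Sing = {}" "H' \<in> {UNIV, upper}" "0 \<in> H'" "chart H' p \<epsilon> f'"
    "orthogonal_transformation L'" "\<And>v. v \<in> ball 0 \<epsilon> \<Longrightarrow> G v = f' (fold_into H' (L' v))"
    "\<And>v. v \<in> ball 0 \<epsilon> \<Longrightarrow> fold_into H' (L' v) \<in> ball 0 \<epsilon> \<inter> H'"
    using G by (rule fchartE) blast
  obtain T where H: "H' = H" and T: "orthogonal_transformation T"
    "\<And>v. v\<in>ball 0 \<epsilon> \<inter> H \<Longrightarrow> f v = f' (T v)"
    "\<And>w. T (fold_into H w) = fold_into H (T w)"
    using chart_transition[OF *(5) **(5) *(1) *(3) **(3)] by blast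
  define A where "A = inv L' \<circ> (T \<circ> L)"
  have A: "orthogonal_transformation A"
    unfolding A_def
    by (intro orthogonal_transformation_compose orthogonal_transformation_inv T *(6) **(6))
  have "F v = G (A v)" if "norm v < \<epsilon>" for v
  proof -
    have v: "v \<in> ball 0 \<epsilon>"
      using that by simp
    have Av: "A v \<in> ball 0 \<epsilon>"
      using that orthogonal_transformation_norm_eq[OF A] by simp
    have "L' (A v) = T (L v)"
      unfolding A_def using surj_f_inv_f[OF orthogonal_transformation_surj[OF **(6)]] by simp
    then have "G (A v) = f' (fold_into H (T (L v)))"
      using **(7)[OF Av] H by simp
    also have "\<dots> = f (fold_into H (L v))"
      using T(2)[OF *(8)[OF v]] T(3) by simp
    finally show ?thesis
      using *(7)[OF v] by simp
  qed
  with A that show ?thesis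
    by blast
qed

text \<open>Matching the charts turns the claim into one about two lines through 0 under one
  folding, and those agree as soon as they agree at a nonzero parameter.\<close>

lemma fchart_eq_line:
  assumes F: "fchart p \<epsilon> F" and G: "fchart p \<epsilon> G" and u: "norm u = 1" "norm u' = 1"
    and t: "t \<noteq> 0" "\<bar>t\<bar> < \<epsilon>" and eq: "F (of_real t * u) = G (of_real t * u')"
    and s: "\<bar>s\<bar> < \<epsilon>"
  shows "F (of_real s * u) = G (of_real s * u')"
proof -
  obtain A where A: "orthogonal_transformation A" "\<And>v. norm v < \<epsilon> \<Longrightarrow> F v = G (A v)"
    using fchart_match[OF F G] by blast
  obtain H f L where *: "0 < \<epsilon>" "mball p \<epsilon> \<inter> Sing = {}" "H \<in> {UNIV, upper}" "0 \<in> H" "chart H p \<epsilon> f"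
    "orthogonal_transformation L" "\<And>v. v \<in> ball 0 \<epsilon> \<Longrightarrow> G v = f (fold_into H (L v))"
    "\<And>v. v \<in> ball 0 \<epsilon> \<Longrightarrow> fold_into H (L v) \<in> ball 0 \<epsilon> \<inter> H"
    using G by (rule fchartE) blast
  have nA: "norm (A v) = norm v" for v
    using orthogonal_transformation_norm_eq[OF A(1)] .
  have Gt: "of_real t * A u \<in> ball 0 \<epsilon>" "of_real t * u' \<in> ball 0 \<epsilon>"
    using t u nA by (simp_all add: norm_mult)
  have 1: "G (of_real t * A u) = G (of_real t * u')"
    using eq A(2)[of "of_real t * u"] t u
    by (simp add: norm_mult orthogonal_transformation_of_real_mult[OF A(1)])
  have dz: "dist (fold_into H (L (of_real t * A u))) (fold_into H (L (of_real t * u'))) =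
     d (G (of_real t * A u)) (G (of_real t * u'))"
    using *(5) *(8)[OF Gt(1)] *(8)[OF Gt(2)] unfolding *(7)[OF Gt(1)] *(7)[OF Gt(2)] chart_def by metis
  have "G (of_real t * u') \<in> M"
    using fchart_dist_le(1)[OF G] Gt by simp
  then have "fold_into H (L (of_real t * A u)) = fold_into H (L (of_real t * u'))"
    using dz 1 by simp
  then have "fold_into H (of_real t * L (A u)) = fold_into H (of_real t * L u')"
    by (simp only: orthogonal_transformation_of_real_mult[OF *(6)])
  then have "fold_into H (of_real s * L (A u)) = fold_into H (of_real s * L u')"
    by (rule fold_into_scaleR_eq[OF *(3) t(1)])
  then have "G (of_real s * A u) = G (of_real s * u')"
    using *(7) s u nA by (simp add: norm_mult orthogonal_transformation_of_real_mult[OF *(6)])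
  then show ?thesis
    using A(2)[of "of_real s * u"] s u
    by (simp add: norm_mult orthogonal_transformation_of_real_mult[OF A(1)])
qed

text \<open>After matching, folding cannot tell \<open>L (A v)\<close> from \<open>L v\<close> for
  \<open>v\<close> in \<open>V\<close>. So the linear map \<open>L\<close> after \<open>A\<close>
  equals \<open>L\<close> or its conjugate on an open set, hence everywhere, and folding removes the
  difference.\<close>

lemma fchart_eq_open:
  assumes F: "fchart p \<epsilon> F" and G: "fchart p \<epsilon> G"
    and V: "open V" "V \<noteq> {}" "V \<subseteq> ball 0 \<epsilon>" and eq: "\<And>v. v \<in> V \<Longrightarrow> F v = G v"
    and w: "norm w < \<epsilon>"
  shows "F w = G w"
proof -
  obtain A where A: "orthogonal_transformation A" "\<And>v. norm v < \<epsilon> \<Longrightarrow> F v = G (A v)"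
    using fchart_match[OF F G] by blast
  obtain H f L where *: "0 < \<epsilon>" "mball p \<epsilon> \<inter> Sing = {}" "H \<in> {UNIV, upper}" "0 \<in> H" "chart H p \<epsilon> f"
    "orthogonal_transformation L" "\<And>v. v \<in> ball 0 \<epsilon> \<Longrightarrow> G v = f (fold_into H (L v))"
    "\<And>v. v \<in> ball 0 \<epsilon> \<Longrightarrow> fold_into H (L v) \<in> ball 0 \<epsilon> \<inter> H"
    using G by (rule fchartE) blast
  have nA: "norm (A v) = norm v" for v
    using orthogonal_transformation_norm_eq[OF A(1)] .
  have alt: "L (A v) = L v \<or> (H = upper \<and> L (A v) = cnj (L v))" if v: "v \<in> V" for v
  proof -
    have b: "v \<in> ball 0 \<epsilon>" "A v \<in> ball 0 \<epsilon>"
      using v V nA[of v] by auto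
    have "dist (fold_into H (L (A v))) (fold_into H (L v)) = d (G (A v)) (G v)"
      using *(5) *(8)[OF b(1)] *(8)[OF b(2)] unfolding *(7)[OF b(1)] *(7)[OF b(2)] chart_def by metis
    moreover have "G (A v) = G v"
      using eq[OF v] A(2)[of v] b by simp
    moreover have "G v \<in> M"
      using fchart_dist_le(1)[OF G] b by simp
    ultimately have "fold_into H (L (A v)) = fold_into H (L v)"
      by simp
    then show ?thesis
      using fold_into_eq_cases[OF *(3)] by blast
  qed
  have lin: "linear (\<lambda>v. L (A v))" "linear L" "linear (\<lambda>v. cnj (L v))"
    using linear_compose[OF orthogonal_transformation_linear[OF A(1)] orthogonal_transformation_linear[OF *(6)]]
      orthogonal_transformation_linear[OF *(6)]
      linear_compose[OF orthogonal_transformation_linear[OF *(6)] orthogonal_transformation_linear[OF orthogonal_transformation_cnj]]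
    by (simp_all add: o_def)
  have fold: "fold_into H (L (A v)) = fold_into H (L v)" for v
  proof (cases "H = upper")
    case True
    have "(\<lambda>v. L (A v)) = L \<or> (\<lambda>v. L (A v)) = (\<lambda>v. cnj (L v))"
      using linear_two_alternatives_open[OF lin V(1,2)] alt by blast
    then have "L (A v) = L v \<or> L (A v) = cnj (L v)"
      by metis
    then show ?thesis
      using True fold_into_upper_cnj by metis
  next
    case False
    obtain v0 where "v0 \<in> V"
      using V by blast
    then have "(\<lambda>v. L (A v)) = L"
      using linear_eq_of_eq_on_open[OF lin(1,2) V(1)] alt False by blast
    then show ?thesis
      by metis
  qed
  have "G (A w) = G w"
    using *(7) fold w nA by simp
  then show ?thesis
    using A(2)[OF w] by simp
qed

text \<open>A small disk off the folding line is not folded: above the line the map is an ordinary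
  chart there, below it a chart composed with conjugation. On the line the folding persists about
  the new centre. These are the last three cases; without folding there is nothing to
  distinguish.\<close>

lemma fchart_recentre:
  assumes F: "fchart p \<epsilon> F" and w: "norm w < \<epsilon>"
  obtains \<delta> where "0 < \<delta>" "norm w + \<delta> \<le> \<epsilon>" "fchart (F w) \<delta> (\<lambda>v. F (w + v))"
proof -
  obtain H f L where *: "0 < \<epsilon>" "mball p \<epsilon> \<inter> Sing = {}" "H \<in> {UNIV, upper}" "0 \<in> H" "chart H p \<epsilon> f"
    "orthogonal_transformation L" "\<And>v. v \<in> ball 0 \<epsilon> \<Longrightarrow> F v = f (fold_into H (L v))"
    "\<And>v. v \<in> ball 0 \<epsilon> \<Longrightarrow> fold_into H (L v) \<in> ball 0 \<epsilon> \<inter> H"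
    using F by (rule fchartE) blast
  define a where "a = L w"
  have na: "norm a = norm w"
    using orthogonal_transformation_norm_eq[OF *(6)] by (simp add: a_def)
  have Fw: "F w = f (fold_into H a)"
    using *(7) w by (simp add: a_def)
  have Lw: "L (w + v) = a + L v" for v
    by (simp add: a_def linear_add[OF orthogonal_transformation_linear[OF *(6)]])
  have Fwv: "F (w + v) = f (fold_into H (a + L v))" if "norm v < \<delta>" "norm w + \<delta> \<le> \<epsilon>" for v \<delta>
    using *(7)[of "w + v"] that norm_triangle_ineq[of w v] Lw by simp
  have fc: "fchart (F w) \<delta> (\<lambda>v. F (w + v))"
    if 0: "0 < \<delta>" and le: "norm w + \<delta> \<le> \<epsilon>" and H': "H' \<in> {UNIV, upper}" and A: "orthogonal_transformation A"
      and mem: "\<And>v. v \<in> ball 0 \<delta> \<Longrightarrow> v \<in> H' \<longleftrightarrow> fold_into H a + A v \<in> H"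
      and eq: "\<And>v. norm v < \<delta> \<Longrightarrow> f (fold_into H (a + v)) = f (fold_into H a + A (fold_into H' v))" for \<delta> H' A
  proof -
    have "chart H' (f (fold_into H a)) \<delta> (\<lambda>v. f (fold_into H a + A v))"
      using chart_recentre[OF *(5,4) A fold_into_mem[OF *(3)] _ 0 mem] le na by simp
    moreover have "\<forall>v\<in>ball 0 \<delta>. F (w + v) = (\<lambda>v. f (fold_into H a + A v)) (fold_into H' (L v))"
      using Fwv[OF _ le] eq orthogonal_transformation_norm_eq[OF *(6)] by simp
    moreover have "mball (F w) \<delta> \<inter> Sing = {}"
      using *(2) mball_subset[of p "F w" \<epsilon> \<delta>] fchart_dist_le(1,3)[OF F w w] le
        mball_subset[of "F w" p \<delta> \<epsilon>] fchart_centre(1)[OF F] commute by auto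
    ultimately show ?thesis
      unfolding fchart_def Fw using 0 H' *(6) by blast
  qed
  consider "H = UNIV" | "H = upper" "Im a > 0" | "H = upper" "Im a < 0" | "H = upper" "Im a = 0"
    using *(3) by fastforce
  then show ?thesis
  proof cases
    case 1
    show ?thesis
      by (rule that[OF _ _ fc[of "\<epsilon> - norm w" UNIV id]])
        (use w 1 in \<open>auto simp: orthogonal_transformation_id'\<close>)
  next
    case 2
    define \<delta> where "\<delta> = min (\<epsilon> - norm w) (Im a)"
    have up: "a + v \<in> upper" if "norm v < \<delta>" for v
      using that abs_Im_le_cmod[of v] by (auto simp: upper_iff \<delta>_def)
    have "a \<in> upper"
      using 2 by (simp add: upper_iff)
    then show ?thesis
      by (intro that[OF _ _ fc[of \<delta> UNIV id]])
        (use w 2 up in \<open>auto simp: orthogonal_transformation_id' \<delta>_def\<close>)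
  next
    case 3
    define \<delta> where "\<delta> = min (\<epsilon> - norm w) (- Im a)"
    have up: "a + v \<notin> upper" if "norm v < \<delta>" for v
      using that abs_Im_le_cmod[of v] by (auto simp: upper_iff \<delta>_def)
    have 0: "0 < \<delta>" "norm w + \<delta> \<le> \<epsilon>"
      using w 3 by (auto simp: \<delta>_def)
    then have a: "a \<notin> upper"
      using up[of 0] by simp
    have mem: "cnj a + cnj v \<in> upper" if "norm v < \<delta>" for v
      using up[OF that] by (simp add: upper_iff)
    show ?thesis
    proof (rule that[OF 0 fc[of \<delta> UNIV cnj, OF 0 _ orthogonal_transformation_cnj]])
      show "v \<in> UNIV \<longleftrightarrow> fold_into H a + cnj v \<in> H" if "v \<in> ball 0 \<delta>" for v
        using mem[of v] that a 3(1) by (simp add: fold_into_def)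
      show "f (fold_into H (a + v)) = f (fold_into H a + cnj (fold_into UNIV v))" if "norm v < \<delta>" for v
        using up[OF that] a 3(1) by (simp add: fold_into_def)
    qed simp
  next
    case 4
    then have "a \<in> upper" "a + v \<in> upper \<longleftrightarrow> v \<in> upper" "cnj a = a" for v
      by (auto simp: upper_iff complex_eq_iff)
    then show ?thesis
      by (intro that[OF _ _ fc[of "\<epsilon> - norm w" upper id]])
        (use w 4 in \<open>auto simp: orthogonal_transformation_id' fold_into_def\<close>)
  qed
qed

subsection \<open>Developments and trajectories\<close>

text \<open>An unfolding of the surface over a planar region. Since it is locally a folded chart, it
  need not be locally injective, and all its values are nonsingular.\<close>

definition dev :: "complex set \<Rightarrow> (complex \<Rightarrow> 'p) \<Rightarrow> bool" where
  "dev W \<Phi> \<longleftrightarrow> open W \<and> (\<forall>z\<in>W. \<exists>\<epsilon>>0. ball z \<epsilon> \<subseteq> W \<and> fchart (\<Phi> z) \<epsilon> (\<lambda>v. \<Phi> (z + v)))"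

text \<open>Straightness in a folded chart expresses both the geodesic condition in the interior and
  the reflection law at the boundary.\<close>

definition traj :: "real set \<Rightarrow> (real \<Rightarrow> 'p) \<Rightarrow> bool" where
  "traj S g \<longleftrightarrow> open S \<and> (\<forall>s\<in>S. \<exists>\<epsilon>>0. ball s \<epsilon> \<subseteq> S \<and>
     (\<exists>F u. fchart (g s) \<epsilon> F \<and> norm u = 1 \<and> (\<forall>\<tau>. \<bar>\<tau>\<bar> < \<epsilon> \<longrightarrow> g (s + \<tau>) = F (of_real \<tau> * u))))"

lemma devE:
  assumes "dev W \<Phi>" "z \<in> W" "0 < e"
  obtains \<epsilon> where "0 < \<epsilon>" "\<epsilon> \<le> e" "ball z \<epsilon> \<subseteq> W" "fchart (\<Phi> z) \<epsilon> (\<lambda>v. \<Phi> (z + v))"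
proof -
  obtain \<epsilon> where "0 < \<epsilon>" "ball z \<epsilon> \<subseteq> W" "fchart (\<Phi> z) \<epsilon> (\<lambda>v. \<Phi> (z + v))"
    using assms(1,2) unfolding dev_def by blast
  moreover have "ball z (min e \<epsilon>) \<subseteq> ball z \<epsilon>"
    by (simp add: subset_ball)
  ultimately show ?thesis
    using that[of "min e \<epsilon>"] fchart_shrink[of _ \<epsilon> _ "min e \<epsilon>"] assms(3) by simp
qed

lemma trajE:
  assumes "traj S g" "s \<in> S" "0 < e"
  obtains \<epsilon> F u where "0 < \<epsilon>" "\<epsilon> \<le> e" "ball s \<epsilon> \<subseteq> S" "fchart (g s) \<epsilon> F" "norm u = 1"
    "\<And>\<tau>. \<bar>\<tau>\<bar> < \<epsilon> \<Longrightarrow> g (s + \<tau>) = F (of_real \<tau> * u)"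
proof -
  obtain \<epsilon> F u where "0 < \<epsilon>" "ball s \<epsilon> \<subseteq> S" "fchart (g s) \<epsilon> F" "norm u = 1"
    "\<And>\<tau>. \<bar>\<tau>\<bar> < \<epsilon> \<Longrightarrow> g (s + \<tau>) = F (of_real \<tau> * u)"
    using assms(1,2) unfolding traj_def by blast
  moreover have "ball s (min e \<epsilon>) \<subseteq> ball s \<epsilon>"
    by (simp add: subset_ball)
  ultimately show ?thesis
    using that[of "min e \<epsilon>" F u] fchart_shrink[of _ \<epsilon> _ "min e \<epsilon>"] assms(3) by simp
qed

lemma dev_mem: "dev W \<Phi> \<Longrightarrow> z \<in> W \<Longrightarrow> \<Phi> z \<in> M - Sing"
  unfolding dev_def using fchart_centre by blast

lemma traj_mem: "traj S g \<Longrightarrow> s \<in> S \<Longrightarrow> g s \<in> M - Sing"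
  unfolding traj_def using fchart_centre by blast

lemma dev_local:
  assumes "\<And>z. z \<in> W \<Longrightarrow> \<exists>V \<Psi>. z \<in> V \<and> V \<subseteq> W \<and> dev V \<Psi> \<and> (\<forall>w\<in>V. \<Phi> w = \<Psi> w)"
  shows "dev W \<Phi>"
  unfolding dev_def
proof (intro conjI ballI)
  show "open W"
    using assms by (subst open_subopen) (metis dev_def)
  fix z assume "z \<in> W"
  then obtain V \<Psi> where V: "z \<in> V" "V \<subseteq> W" "dev V \<Psi>" "\<forall>w\<in>V. \<Phi> w = \<Psi> w"
    using assms by blast
  obtain \<epsilon> where e: "0 < \<epsilon>" "ball z \<epsilon> \<subseteq> V" "fchart (\<Psi> z) \<epsilon> (\<lambda>v. \<Psi> (z + v))"
    using devE[OF V(3,1) zero_less_one] by blast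
  have "fchart (\<Phi> z) \<epsilon> (\<lambda>v. \<Phi> (z + v))"
  proof (rule fchart_cong)
    show "fchart (\<Phi> z) \<epsilon> (\<lambda>v. \<Psi> (z + v))"
      using e(3) V by simp
    fix v :: complex assume "norm v < \<epsilon>"
    then have "z + v \<in> V"
      using e(2) by (auto simp: dist_norm)
    then show "\<Psi> (z + v) = \<Phi> (z + v)"
      using V(4) by simp
  qed
  then show "\<exists>\<epsilon>>0. ball z \<epsilon> \<subseteq> W \<and> fchart (\<Phi> z) \<epsilon> (\<lambda>v. \<Phi> (z + v))"
    using e V(2) by blast
qed

lemma traj_local:
  assumes "\<And>s. s \<in> S \<Longrightarrow> \<exists>V h. s \<in> V \<and> V \<subseteq> S \<and> traj V h \<and> (\<forall>t\<in>V. g t = h t)"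
  shows "traj S g"
  unfolding traj_def
proof (intro conjI ballI)
  show "open S"
    using assms by (subst open_subopen) (metis traj_def)
  fix s assume "s \<in> S"
  then obtain V h where V: "s \<in> V" "V \<subseteq> S" "traj V h" "\<forall>t\<in>V. g t = h t"
    using assms by blast
  obtain \<epsilon> F u where e: "0 < \<epsilon>" "ball s \<epsilon> \<subseteq> V" "fchart (h s) \<epsilon> F" "norm u = 1"
    "\<And>\<tau>. \<bar>\<tau>\<bar> < \<epsilon> \<Longrightarrow> h (s + \<tau>) = F (of_real \<tau> * u)"
    by (rule trajE[OF V(3,1) zero_less_one]) blast
  have "g (s + \<tau>) = F (of_real \<tau> * u)" if "\<bar>\<tau>\<bar> < \<epsilon>" for \<tau>
  proof -
    have "s + \<tau> \<in> V"
      using that e(2) by (auto simp: dist_norm)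
    then show ?thesis
      using V(4) e(5)[OF that] by simp
  qed
  moreover have "fchart (g s) \<epsilon> F"
    using e V by simp
  ultimately show "\<exists>\<epsilon>>0. ball s \<epsilon> \<subseteq> S \<and>
     (\<exists>F u. fchart (g s) \<epsilon> F \<and> norm u = 1 \<and> (\<forall>\<tau>. \<bar>\<tau>\<bar> < \<epsilon> \<longrightarrow> g (s + \<tau>) = F (of_real \<tau> * u)))"
    using e(1,2,4) V(2) by blast
qed

lemma dev_subset:
  assumes "dev W \<Phi>" "open V" "V \<subseteq> W"
  shows "dev V \<Phi>"
  unfolding dev_def
proof (intro conjI ballI)
  fix z assume z: "z \<in> V"
  obtain e where e: "0 < e" "ball z e \<subseteq> V"
    using openE[OF assms(2) z] by blast
  obtain \<epsilon> where "0 < \<epsilon>" "\<epsilon> \<le> e" "fchart (\<Phi> z) \<epsilon> (\<lambda>v. \<Phi> (z + v))"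
    by (rule devE[OF assms(1) subsetD[OF assms(3) z] e(1)]) blast
  then show "\<exists>\<epsilon>>0. ball z \<epsilon> \<subseteq> V \<and> fchart (\<Phi> z) \<epsilon> (\<lambda>v. \<Phi> (z + v))"
    using e subset_ball[of \<epsilon> e z] by blast
qed (use assms in auto)

lemma traj_subset:
  assumes "traj S g" "open V" "V \<subseteq> S"
  shows "traj V g"
  unfolding traj_def
proof (intro conjI ballI)
  fix s assume s: "s \<in> V"
  obtain e where e: "0 < e" "ball s e \<subseteq> V"
    using openE[OF assms(2) s] by blast
  obtain \<epsilon> F u where "0 < \<epsilon>" "\<epsilon> \<le> e" "fchart (g s) \<epsilon> F" "norm u = 1"
    "\<And>\<tau>. \<bar>\<tau>\<bar> < \<epsilon> \<Longrightarrow> g (s + \<tau>) = F (of_real \<tau> * u)"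
    by (rule trajE[OF assms(1) subsetD[OF assms(3) s] e(1)]) blast
  then show "\<exists>\<epsilon>>0. ball s \<epsilon> \<subseteq> V \<and>
     (\<exists>F u. fchart (g s) \<epsilon> F \<and> norm u = 1 \<and> (\<forall>\<tau>. \<bar>\<tau>\<bar> < \<epsilon> \<longrightarrow> g (s + \<tau>) = F (of_real \<tau> * u)))"
    using e subset_ball[of \<epsilon> e s] by blast
qed (use assms in auto)

lemma dev_fchart:
  assumes "fchart p \<epsilon> F"
  shows "dev (ball 0 \<epsilon>) F"
  unfolding dev_def
proof (intro conjI ballI)
  fix z :: complex assume "z \<in> ball 0 \<epsilon>"
  then obtain \<delta> where \<delta>: "0 < \<delta>" "norm z + \<delta> \<le> \<epsilon>" "fchart (F z) \<delta> (\<lambda>v. F (z + v))"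
    using fchart_recentre[OF assms] by auto
  moreover have "ball z \<delta> \<subseteq> ball 0 \<epsilon>"
  proof
    fix w assume "w \<in> ball z \<delta>"
    then show "w \<in> ball 0 \<epsilon>"
      using \<delta>(2) norm_triangle_sub[of w z] by (simp add: dist_norm norm_minus_commute)
  qed
  ultimately show "\<exists>\<delta>>0. ball z \<delta> \<subseteq> ball 0 \<epsilon> \<and> fchart (F z) \<delta> (\<lambda>v. F (z + v))"
    by blast
qed simp

lemma dev_compose:
  assumes dev: "dev W \<Phi>" and A: "orthogonal_transformation A"
    and V: "open V" "\<And>z. z \<in> V \<Longrightarrow> a + A z \<in> W"
  shows "dev V (\<lambda>z. \<Phi> (a + A z))"
  unfolding dev_def
proof (intro conjI ballI)
  fix z assume z: "z \<in> V"
  obtain e where e: "0 < e" "ball z e \<subseteq> V"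
    using openE[OF V(1) z] by blast
  obtain \<epsilon> where \<epsilon>: "0 < \<epsilon>" "\<epsilon> \<le> e" "fchart (\<Phi> (a + A z)) \<epsilon> (\<lambda>v. \<Phi> (a + A z + v))"
    using devE[OF dev V(2)[OF z] e(1)] by blast
  have "fchart (\<Phi> (a + A z)) \<epsilon> (\<lambda>v. \<Phi> (a + A (z + v)))"
    using fchart_orthogonal[OF \<epsilon>(3) A]
    by (simp add: linear_add[OF orthogonal_transformation_linear[OF A]] add.assoc)
  then show "\<exists>\<epsilon>>0. ball z \<epsilon> \<subseteq> V \<and> fchart (\<Phi> (a + A z)) \<epsilon> (\<lambda>v. \<Phi> (a + A (z + v)))"
    using \<epsilon> e subset_ball[of \<epsilon> e z] by blast
qed (rule V)

lemma traj_of_dev: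
  assumes dev: "dev W \<Phi>" and u: "norm u = 1"
    and S: "open S" "\<And>t. t \<in> S \<Longrightarrow> a + of_real t * u \<in> W"
  shows "traj S (\<lambda>t. \<Phi> (a + of_real t * u))"
  unfolding traj_def
proof (intro conjI ballI)
  fix s assume s: "s \<in> S"
  obtain e where e: "0 < e" "ball s e \<subseteq> S"
    using openE[OF S(1) s] by blast
  obtain \<epsilon> where \<epsilon>: "0 < \<epsilon>" "\<epsilon> \<le> e"
    "fchart (\<Phi> (a + of_real s * u)) \<epsilon> (\<lambda>v. \<Phi> (a + of_real s * u + v))"
    using devE[OF dev S(2)[OF s] e(1)] by blast
  show "\<exists>\<epsilon>>0. ball s \<epsilon> \<subseteq> S \<and> (\<exists>F v. fchart (\<Phi> (a + of_real s * u)) \<epsilon> F \<and> norm v = 1 \<and>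
       (\<forall>\<tau>. \<bar>\<tau>\<bar> < \<epsilon> \<longrightarrow> \<Phi> (a + of_real (s + \<tau>) * u) = F (of_real \<tau> * v)))"
  proof (intro exI[of _ \<epsilon>] exI[of _ "\<lambda>v. \<Phi> (a + of_real s * u + v)"] exI[of _ u] conjI allI impI)
    show "ball s \<epsilon> \<subseteq> S"
      using \<epsilon> e subset_ball[of \<epsilon> e s] by blast
  qed (use \<epsilon> u in \<open>auto simp: algebra_simps\<close>)
qed (rule S)

text \<open>The set of points near which the two maps agree is open. Its complement is open too: if
  the values at \<open>x\<close> coincide and agreement occurs somewhere in a chart disk about
  \<open>x\<close>, rigidity of folded charts spreads it to \<open>x\<close>; if the values at
  \<open>x\<close> differ, they differ nearby.\<close>

lemma dev_unique:
  assumes W: "connected W" and \<Phi>: "dev W \<Phi>" and \<Psi>: "dev W \<Psi>"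
    and V: "open V" "V \<noteq> {}" "V \<subseteq> W" and eq: "\<And>v. v \<in> V \<Longrightarrow> \<Phi> v = \<Psi> v"
    and z: "z \<in> W"
  shows "\<Phi> z = \<Psi> z"
proof -
  define A where "A = {z \<in> W. \<exists>e>0. ball z e \<subseteq> W \<and> (\<forall>w\<in>ball z e. \<Phi> w = \<Psi> w)}"
  have opA: "open A"
  proof (rule openI)
    fix x assume "x \<in> A"
    then obtain e where e: "e > 0" "ball x e \<subseteq> W" "\<forall>w\<in>ball x e. \<Phi> w = \<Psi> w"
      by (auto simp: A_def)
    have "y \<in> A" if y: "y \<in> ball x e" for y
    proof -
      have "ball y (e - dist x y) \<subseteq> ball x e"
        by (metric)
      then show ?thesis
        using e y unfolding A_def by (auto intro!: exI[of _ "e - dist x y"])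
    qed
    then show "\<exists>r>0. ball x r \<subseteq> A"
      using e(1) by blast
  qed
  have "open (W - A)"
  proof (rule openI)
    fix x assume x: "x \<in> W - A"
    then have xW: "x \<in> W"
      by blast
    obtain e1 where e1: "0 < e1" "ball x e1 \<subseteq> W" "fchart (\<Phi> x) e1 (\<lambda>v. \<Phi> (x + v))"
      by (rule devE[OF \<Phi> xW zero_less_one]) blast
    obtain e where e: "0 < e" "e \<le> e1" "fchart (\<Psi> x) e (\<lambda>v. \<Psi> (x + v))"
      by (rule devE[OF \<Psi> xW e1(1)]) blast
    have e1': "ball x e \<subseteq> W" "fchart (\<Phi> x) e (\<lambda>v. \<Phi> (x + v))"
      using e1 e subset_ball[of e e1 x] fchart_shrink[OF e1(3) e(1,2)] by auto
    show "\<exists>r>0. ball x r \<subseteq> W - A"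
    proof (cases "\<Phi> x = \<Psi> x")
      case True
      have "y \<notin> A" if y: "y \<in> ball x e" for y
      proof
        assume "y \<in> A"
        then obtain r where r: "r > 0" "ball y r \<subseteq> W" "\<forall>w\<in>ball y r. \<Phi> w = \<Psi> w"
          by (auto simp: A_def)
        define V' where "V' = (\<lambda>w. w - x) ` (ball y r \<inter> ball x e)"
        have V'op: "open V'"
          unfolding V'_def by (intro open_translation_subtract) auto
        have "y \<in> ball y r \<inter> ball x e"
          using y r(1) by simp
        then have V'ne: "V' \<noteq> {}"
          unfolding V'_def by blast
        have V'sub: "V' \<subseteq> ball 0 e"
          unfolding V'_def by (auto simp: dist_norm norm_minus_commute)
        have V'eq: "\<Phi> (x + v) = \<Psi> (x + v)" if "v \<in> V'" for v
          using that r(3) unfolding V'_def by auto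
        have all: "\<Phi> (x + v) = \<Psi> (x + v)" if "norm v < e" for v
          using fchart_eq_open[OF e1'(2) _ V'op V'ne V'sub V'eq that] e(3) True by simp
        have "\<Phi> w = \<Psi> w" if "w \<in> ball x e" for w
          using all[of "w - x"] that by (simp add: dist_norm norm_minus_commute)
        then have "x \<in> A"
          unfolding A_def using e(1) e1'(1) x by blast
        then show False
          using x by blast
      qed
      then show ?thesis
        using e1'(1) e(1) by (intro exI[of _ e]) auto
    next
      case False
      \<comment> \<open>Each map moves exactly \<open>norm (y - x)\<close> away from its value at
        \<open>x\<close>, so below half the distance of the two values they cannot meet.\<close>
      define r where "r = min e (d (\<Phi> x) (\<Psi> x) / 2)"
      have M: "\<Phi> x \<in> M" "\<Psi> x \<in> M"
        using dev_mem[OF \<Phi> xW] dev_mem[OF \<Psi> xW] by auto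
      have r: "r > 0" "r \<le> e"
        using e(1) M False by (auto simp: r_def)
      have "y \<notin> A" if y: "y \<in> ball x r" for y
      proof
        assume "y \<in> A"
        then have eqy: "\<Phi> y = \<Psi> y"
          using centre_in_ball by (fastforce simp: A_def)
        have n: "norm (y - x) < e"
          using y r by (simp add: dist_norm norm_minus_commute)
        have "d (\<Phi> x) (\<Phi> y) = norm (y - x)" "d (\<Psi> x) (\<Psi> y) = norm (y - x)" "\<Phi> y \<in> M"
          using fchart_dist_le(1,3)[OF e1'(2) n n] fchart_dist_le(3)[OF e(3) n n] by auto
        moreover have "d (\<Phi> x) (\<Psi> x) \<le> d (\<Phi> x) (\<Phi> y) + d (\<Psi> x) (\<Phi> y)"
          using triangle'[of "\<Phi> x" "\<Phi> y" "\<Psi> x"] M calculation(3) commute by metis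
        ultimately show False
          using y eqy by (simp add: r_def dist_norm norm_minus_commute)
      qed
      then show ?thesis
        using e1'(1) r subset_ball[of r e x] by (intro exI[of _ r]) auto
    qed
  qed
  moreover have "A \<inter> W \<noteq> {}"
  proof -
    obtain v where v: "v \<in> V"
      using V by blast
    then obtain e where "e > 0" "ball v e \<subseteq> V"
      using openE[OF V(1)] by blast
    then have "v \<in> A"
      unfolding A_def using V v eq by blast
    then show ?thesis
      using V v by blast
  qed
  moreover have "A \<inter> (W - A) \<inter> W = {}" "W \<subseteq> A \<union> (W - A)"
    by auto
  ultimately have "(W - A) \<inter> W = {}"
    using connectedD[OF W opA] by blast
  then have "z \<in> A"
    using z by blast
  then show ?thesis
    using centre_in_ball by (fastforce simp: A_def)
qed

text \<open>The argument is that for developments, with rigidity along a line in place of rigidity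
  on an open set.\<close>

lemma traj_unique:
  assumes S: "connected S" and g: "traj S g" and h: "traj S h"
    and V: "open V" "V \<noteq> {}" "V \<subseteq> S" and eq: "\<And>t. t \<in> V \<Longrightarrow> g t = h t"
    and t: "t \<in> S"
  shows "g t = h t"
proof -
  define A where "A = {s \<in> S. \<exists>e>0. ball s e \<subseteq> S \<and> (\<forall>t\<in>ball s e. g t = h t)}"
  have opA: "open A"
  proof (rule openI)
    fix x assume "x \<in> A"
    then obtain e where e: "e > 0" "ball x e \<subseteq> S" "\<forall>w\<in>ball x e. g w = h w"
      by (auto simp: A_def)
    have "y \<in> A" if y: "y \<in> ball x e" for y
    proof -
      have "ball y (e - dist x y) \<subseteq> ball x e"
        by (metric)
      then show ?thesis
        using e y unfolding A_def by (auto intro!: exI[of _ "e - dist x y"])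
    qed
    then show "\<exists>r>0. ball x r \<subseteq> A"
      using e(1) by blast
  qed
  have "open (S - A)"
  proof (rule openI)
    fix x assume x: "x \<in> S - A"
    then have xS: "x \<in> S"
      by blast
    obtain e1 F1 u1 where e1: "0 < e1" "ball x e1 \<subseteq> S" "fchart (g x) e1 F1" "norm u1 = 1"
      "\<And>\<tau>. \<bar>\<tau>\<bar> < e1 \<Longrightarrow> g (x + \<tau>) = F1 (of_real \<tau> * u1)"
      by (rule trajE[OF g xS zero_less_one]) blast
    obtain e F u where e: "0 < e" "e \<le> e1" "fchart (h x) e F" "norm u = 1"
      "\<And>\<tau>. \<bar>\<tau>\<bar> < e \<Longrightarrow> h (x + \<tau>) = F (of_real \<tau> * u)"
      by (rule trajE[OF h xS e1(1)]) blast
    have e1': "ball x e \<subseteq> S" "fchart (g x) e F1"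
      using e1 e subset_ball[of e e1 x] fchart_shrink[OF e1(3) e(1,2)] by auto
    show "\<exists>r>0. ball x r \<subseteq> S - A"
    proof (cases "g x = h x")
      case True
      have "y \<notin> A" if y: "y \<in> ball x e" for y
      proof
        assume "y \<in> A"
        then obtain r where r: "r > 0" "ball y r \<subseteq> S" "\<forall>w\<in>ball y r. g w = h w"
          by (auto simp: A_def)
        \<comment> \<open>Rigidity needs agreement at a nonzero parameter, so a different time is
          chosen when \<open>y\<close> is \<open>x\<close> itself.\<close>
        have "\<exists>t. t \<noteq> 0 \<and> \<bar>t\<bar> < e \<and> x + t \<in> ball y r"
        proof (cases "y = x")
          case True
          then show ?thesis
            using e(1) r(1) by (intro exI[of _ "min e r / 2"]) (auto simp: dist_norm)
        next
          case False
          then show ?thesis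
            using y r(1) by (intro exI[of _ "y - x"]) (auto simp: dist_norm)
        qed
        then obtain t where t: "t \<noteq> 0" "\<bar>t\<bar> < e" "x + t \<in> ball y r"
          by blast
        have "F1 (of_real t * u1) = F (of_real t * u)"
          using r(3) t e1(5)[of t] e(2) e(5)[of t] by simp
        then have all: "g (x + \<tau>) = h (x + \<tau>)" if "\<bar>\<tau>\<bar> < e" for \<tau>
          using fchart_eq_line[OF e1'(2) _ e1(4) e(4) t(1,2) _ that, of F] e(3) True that
            e1(5)[of \<tau>] e(2) e(5)[of \<tau>] by simp
        have "g w = h w" if "w \<in> ball x e" for w
          using all[of "w - x"] that by (simp add: dist_real_def abs_minus_commute)
        then have "x \<in> A"
          unfolding A_def using e(1) e1'(1) x by blast
        then show False
          using x by blast
      qed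
      then show ?thesis
        using e1'(1) e(1) by (intro exI[of _ e]) auto
    next
      case False
      define r where "r = min e (d (g x) (h x) / 2)"
      have M: "g x \<in> M" "h x \<in> M"
        using traj_mem[OF g xS] traj_mem[OF h xS] by auto
      have r: "r > 0" "r \<le> e"
        using e(1) M False by (auto simp: r_def)
      have "y \<notin> A" if y: "y \<in> ball x r" for y
      proof
        assume "y \<in> A"
        then have eqy: "g y = h y"
          using centre_in_ball by (fastforce simp: A_def)
        define \<tau> where "\<tau> = y - x"
        have n: "\<bar>\<tau>\<bar> < e"
          using y r by (simp add: dist_real_def \<tau>_def abs_minus_commute)
        have y': "y = x + \<tau>"
          by (simp add: \<tau>_def)
        have gy: "g y = F1 (of_real \<tau> * u1)" and hy: "h y = F (of_real \<tau> * u)"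
          using e1(5)[of \<tau>] e(5)[of \<tau>] n e(2) y' by auto
        have "d (g x) (g y) = \<bar>\<tau>\<bar>" "g y \<in> M"
          using fchart_dist_le(1,3)[OF e1'(2), of "of_real \<tau> * u1" "of_real \<tau> * u1"] n e1(4) gy
          by (auto simp: norm_mult)
        moreover have "d (h x) (g y) = \<bar>\<tau>\<bar>"
          using fchart_dist_le(1,3)[OF e(3), of "of_real \<tau> * u" "of_real \<tau> * u"] n e(4) hy eqy
          by (auto simp: norm_mult)
        moreover have "d (g x) (h x) \<le> d (g x) (g y) + d (h x) (g y)"
          using triangle'[of "g x" "g y" "h x"] M calculation(2) commute by metis
        ultimately show False
          using y by (simp add: r_def dist_real_def \<tau>_def abs_minus_commute)
      qed
      then show ?thesis
        using e1'(1) r subset_ball[of r e x] by (intro exI[of _ r]) auto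
    qed
  qed
  moreover have "A \<inter> S \<noteq> {}"
  proof -
    obtain v where v: "v \<in> V"
      using V by blast
    then obtain e where "e > 0" "ball v e \<subseteq> V"
      using openE[OF V(1)] by blast
    then have "v \<in> A"
      unfolding A_def using V v eq by blast
    then show ?thesis
      using V v by blast
  qed
  moreover have "A \<inter> (S - A) \<inter> S = {}" "S \<subseteq> A \<union> (S - A)"
    by auto
  ultimately have "(S - A) \<inter> S = {}"
    using connectedD[OF S opA] by blast
  then have "t \<in> A"
    using t by blast
  then show ?thesis
    using centre_in_ball by (fastforce simp: A_def)
qed

end

text \<open>Let \<open>m\<close> be the supremum of the end points of initial intervals on which
  \<open>P\<close> holds. By \<open>left\<close> it satisfies \<open>P\<close>, and by
  \<open>right\<close> it cannot lie below \<open>b\<close>.\<close>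

lemma real_interval_induct:
  fixes P :: "real \<Rightarrow> bool"
  assumes "a \<le> b" and base: "P a"
    and right: "\<And>t. a \<le> t \<Longrightarrow> t < b \<Longrightarrow> P t \<Longrightarrow> \<exists>t'>t. \<forall>s. t < s \<and> s < t' \<longrightarrow> P s"
    and left: "\<And>t. a < t \<Longrightarrow> t \<le> b \<Longrightarrow> (\<And>s. a \<le> s \<Longrightarrow> s < t \<Longrightarrow> P s) \<Longrightarrow> P t"
  shows "P b"
proof -
  define A where "A = {t \<in> {a..b}. \<forall>s\<in>{a..t}. P s}"
  have aA: "a \<in> A"
    using assms(1) base by (auto simp: A_def)
  have bdd: "bdd_above A"
    by (rule bdd_aboveI[of _ b]) (auto simp: A_def)
  define m where "m = Sup A"
  have am: "a \<le> m"
    unfolding m_def by (rule cSup_upper[OF aA bdd])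
  have mb: "m \<le> b"
    unfolding m_def using aA by (intro cSup_least) (auto simp: A_def)
  have below: "P s" if as: "a \<le> s" and sm: "s < m" for s
  proof -
    obtain t where "t \<in> A" "s < t"
      using sm less_cSup_iff[of A s] aA bdd unfolding m_def by blast
    then show ?thesis
      using as by (auto simp: A_def)
  qed
  have Pm: "P m"
    using left[of m] below base am mb by (cases "a = m") auto
  have "m = b"
  proof (rule ccontr)
    assume "m \<noteq> b"
    then have "m < b"
      using mb by simp
    then obtain t' where t': "t' > m" "\<forall>s. m < s \<and> s < t' \<longrightarrow> P s"
      using right[OF am _ Pm] by blast
    define t where "t = (m + min b t') / 2"
    have t: "m < t" "t < t'" "t \<le> b"
      using t'(1) \<open>m < b\<close> by (auto simp: t_def field_simps)
    have "P s" if "a \<le> s" "s \<le> t" for s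
      using that below Pm t'(2) t by (cases s m rule: linorder_cases) auto
    then have "t \<in> A"
      using t am by (auto simp: A_def)
    then have "t \<le> m"
      unfolding m_def by (rule cSup_upper[OF _ bdd])
    then show False
      using t by simp
  qed
  then show ?thesis
    using Pm by simp
qed

lemma Arg_abs_le:
  assumes "0 < Re z"
  shows "\<bar>Arg z\<bar> \<le> \<bar>Im z\<bar> / Re z"
  using abs_arctan_le[of "Im z / Re z"] arg_conv_arctan[OF assms] assms by (simp add: abs_divide)

text \<open>For nonnegative \<open>s\<close>, the open \<open>h\<close>-neighbourhood of the segment
  from 0 to \<open>s\<close> in the maximum norm; the overhang at both ends leaves room for disks
  about the end points.\<close>

definition rect :: "real \<Rightarrow> real \<Rightarrow> complex set" where
  "rect h s = {z. - h < Re z \<and> Re z < s + h \<and> \<bar>Im z\<bar> < h}"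

lemma open_rect: "open (rect h s)"
  unfolding rect_def by (intro open_Collect_conj open_Collect_less continuous_intros)

lemma convex_rect: "convex (rect h s)"
proof -
  have "rect h s = {z. - h < Re z} \<inter> {z. Re z < s + h} \<inter> ({z. - h < Im z} \<inter> {z. Im z < h})"
    by (auto simp: rect_def abs_less_iff)
  then show ?thesis
    by (simp only: convex_Int convex_halfspace_Re_gt convex_halfspace_Re_lt
        convex_halfspace_Im_gt convex_halfspace_Im_lt)
qed

lemma norm_lt_of_components:
  fixes z :: complex
  assumes "\<bar>Re z\<bar> < h" "\<bar>Im z\<bar> < h"
  shows "norm z < 2 * h"
  using cmod_le[of z] assms by linarith

section \<open>Uniform radii and lifting of paths\<close>

context flat_space begin

lemma traj_local_dist:
  assumes "traj S g" "s \<in> S"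
  obtains \<epsilon> where "0 < \<epsilon>" "\<And>\<tau>. \<bar>\<tau>\<bar> < \<epsilon> \<Longrightarrow> s + \<tau> \<in> S \<and> g (s + \<tau>) \<in> M \<and> d (g s) (g (s + \<tau>)) = \<bar>\<tau>\<bar>"
proof -
  obtain \<epsilon> F u where e: "0 < \<epsilon>" "ball s \<epsilon> \<subseteq> S" "fchart (g s) \<epsilon> F" "norm u = 1"
    "\<And>\<tau>. \<bar>\<tau>\<bar> < \<epsilon> \<Longrightarrow> g (s + \<tau>) = F (of_real \<tau> * u)"
    by (rule trajE[OF assms zero_less_one]) blast
  have "s + \<tau> \<in> S \<and> g (s + \<tau>) \<in> M \<and> d (g s) (g (s + \<tau>)) = \<bar>\<tau>\<bar>" if "\<bar>\<tau>\<bar> < \<epsilon>" for \<tau>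
  proof -
    have n: "norm (of_real \<tau> * u) < \<epsilon>"
      using that e(4) by (simp add: norm_mult)
    have "s + \<tau> \<in> ball s \<epsilon>"
      using that by (simp add: dist_norm)
    then show ?thesis
      using fchart_dist_le(1,3)[OF e(3) n n] e(2,4) e(5)[OF that] by (auto simp: norm_mult)
  qed
  with e(1) that show ?thesis
    by blast
qed

text \<open>Unit speed holds locally from any time in both directions, and the triangle inequality
  propagates it along the interval. Globally only an inequality survives, since a trajectory need
  not be shortest.\<close>

lemma traj_lipschitz:
  assumes g: "traj S g" and ab: "a \<le> b" "{a..b} \<subseteq> S"
  shows "d (g a) (g b) \<le> b - a"
proof (rule real_interval_induct[where a = a and b = b and P = "\<lambda>t. d (g a) (g t) \<le> t - a"])
  have M: "g t \<in> M" if "a \<le> t" "t \<le> b" for t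
    using traj_mem[OF g, of t] that ab by auto
  show "a \<le> b" "d (g a) (g a) \<le> a - a"
    using ab M[of a] by auto
  show "\<exists>t'>t. \<forall>s. t < s \<and> s < t' \<longrightarrow> d (g a) (g s) \<le> s - a"
    if t: "a \<le> t" "t < b" "d (g a) (g t) \<le> t - a" for t
  proof -
    have tS: "t \<in> S"
      using t ab by auto
    obtain \<epsilon> where e: "0 < \<epsilon>" "\<And>\<tau>. \<bar>\<tau>\<bar> < \<epsilon> \<Longrightarrow> t + \<tau> \<in> S \<and> g (t + \<tau>) \<in> M \<and> d (g t) (g (t + \<tau>)) = \<bar>\<tau>\<bar>"
      by (rule traj_local_dist[OF g tS]) blast
    have "d (g a) (g s) \<le> s - a" if "t < s" "s < t + \<epsilon>" for s
    proof -
      have "g s \<in> M \<and> d (g t) (g s) = s - t"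
        using e(2)[of "s - t"] that by simp
      then show ?thesis
        using triangle[of "g a" "g t" "g s"] M[of a] M[of t] t by auto
    qed
    then show ?thesis
      using e(1) by (intro exI[of _ "t + \<epsilon>"]) auto
  qed
  show "d (g a) (g t) \<le> t - a"
    if t: "a < t" "t \<le> b" and before: "\<And>s. a \<le> s \<Longrightarrow> s < t \<Longrightarrow> d (g a) (g s) \<le> s - a" for t
  proof -
    have tS: "t \<in> S"
      using t ab by auto
    obtain \<epsilon> where e: "0 < \<epsilon>" "\<And>\<tau>. \<bar>\<tau>\<bar> < \<epsilon> \<Longrightarrow> t + \<tau> \<in> S \<and> g (t + \<tau>) \<in> M \<and> d (g t) (g (t + \<tau>)) = \<bar>\<tau>\<bar>"
      by (rule traj_local_dist[OF g tS]) blast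
    define \<tau> where "\<tau> = min (\<epsilon> / 2) (t - a)"
    have \<tau>: "0 < \<tau>" "\<tau> < \<epsilon>" "a \<le> t - \<tau>"
      using e(1) t by (auto simp: \<tau>_def)
    then have "g (t - \<tau>) \<in> M \<and> d (g t) (g (t - \<tau>)) = \<tau>"
      using e(2)[of "- \<tau>"] by simp
    then show ?thesis
      using triangle'[of "g a" "g (t - \<tau>)" "g t"] M[of a] M[of t] before[of "t - \<tau>"] t \<tau> by auto
  qed
qed

text \<open>The points at distance at least \<open>e\<close> from the singular ones form a compact
  set, covered by finitely many folded chart balls of half the radius. A point in such a half ball
  has a preimage with norm below half the radius, so a disk of radius \<open>r\<close> about that
  preimage stays in the chart.\<close>

lemma uniform_dev:
  assumes e: "0 < e"
  obtains r where "0 < r"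
    "\<And>p. p \<in> M \<Longrightarrow> (\<And>s. s \<in> Sing \<inter> M \<Longrightarrow> e \<le> d p s) \<Longrightarrow> \<exists>\<Psi>. dev (ball 0 r) \<Psi> \<and> \<Psi> 0 = p"
proof -
  define K where "K = {p \<in> M. \<forall>s\<in>Sing \<inter> M. e \<le> d p s}"
  have "K = M - (\<Union>s\<in>Sing \<inter> M. mball s e)"
    by (force simp: K_def mball_def commute not_less)
  then have "closedin mtopology K"
    by (simp add: closedin_def) (auto intro!: openin_Union)
  then have cK: "compactin mtopology K"
    using closedin_compact_space[OF compact] by blast
  have KS: "p \<in> M - Sing" if "p \<in> K" for p
    using that e by (force simp: K_def)
  have "\<exists>\<epsilon> F. fchart p \<epsilon> F" if "p \<in> K" for p
    using fchart_exists[OF KS[OF that]] by blast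
  then obtain E F where EF: "\<And>p. p \<in> K \<Longrightarrow> fchart p (E p) (F p)"
    by metis
  have Epos: "0 < E p" if "p \<in> K" for p
    using fchart_pos[OF EF[OF that]] .
  let ?U = "(\<lambda>p. mball p (E p / 2)) ` K"
  have "K \<subseteq> \<Union> ?U"
  proof
    fix p assume "p \<in> K"
    then have "p \<in> mball p (E p / 2)"
      using Epos KS by auto
    then show "p \<in> \<Union> ?U"
      using \<open>p \<in> K\<close> by blast
  qed
  moreover have "\<forall>U\<in>?U. openin mtopology U"
    by auto
  ultimately obtain \<F> where \<F>: "finite \<F>" "\<F> \<subseteq> ?U" "K \<subseteq> \<Union>\<F>"
    using cK unfolding compactin_def by meson
  obtain C where C: "C \<subseteq> K" "finite C" "\<F> = (\<lambda>p. mball p (E p / 2)) ` C"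
    using finite_subset_image[OF \<F>(1,2)] by blast
  define r where "r = Min (insert 1 ((\<lambda>p. E p / 2) ` C))"
  have fin: "finite (insert 1 ((\<lambda>p. E p / 2) ` C))"
    using C by simp
  have rpos: "0 < r"
    unfolding r_def using fin C(1) Epos by (subst Min_gr_iff) auto
  have rle: "r \<le> E p / 2" if "p \<in> C" for p
    unfolding r_def using that by (intro Min_le[OF fin]) simp
  have "\<exists>\<Psi>. dev (ball 0 r) \<Psi> \<and> \<Psi> 0 = p'" if p': "p' \<in> M" "\<And>s. s \<in> Sing \<inter> M \<Longrightarrow> e \<le> d p' s" for p'
  proof -
    have "p' \<in> K"
      using p' by (auto simp: K_def)
    then obtain p where p: "p \<in> C" "p' \<in> mball p (E p / 2)"
      using \<F>(3) C(3) by blast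
    have pK: "p \<in> K"
      using p C by blast
    obtain v where v: "norm v = d p p'" "F p v = p'"
      by (rule fchart_onto[OF EF[OF pK] p'(1)]) (use p(2) Epos[OF pK] in auto)
    have "dev (ball 0 r) (\<lambda>z. F p (v + id z))"
    proof (rule dev_compose[OF dev_fchart[OF EF[OF pK]] orthogonal_transformation_id'])
      show "v + id z \<in> ball 0 (E p)" if "z \<in> ball 0 r" for z
        using that norm_triangle_ineq[of v z] v(1) p(2) rle[OF p(1)] by auto
    qed simp
    then show ?thesis
      using v(2) by (intro exI[of _ "\<lambda>z. F p (v + id z)"]) simp
  qed
  with rpos that show ?thesis
    by blast
qed

text \<open>A folded chart is onto its metric ball and realises the distance from the centre as a
  norm; this moves a lift forwards. At a limit time the lifts accumulate in a compact disk. Only a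
  lift of each single point with a distance bound is maintained, not a continuous lift of the
  path.\<close>

lemma path_lift:
  assumes \<Phi>: "dev (ball m R) \<Phi>" and T: "0 \<le> T"
    and gM: "\<And>t. 0 \<le> t \<Longrightarrow> t \<le> T \<Longrightarrow> g t \<in> M"
    and lip: "\<And>s t. 0 \<le> s \<Longrightarrow> s \<le> t \<Longrightarrow> t \<le> T \<Longrightarrow> d (g s) (g t) \<le> t - s"
    and start: "\<Phi> \<zeta> = g 0" "dist m \<zeta> + T < R"
  shows "\<exists>z. dist \<zeta> z \<le> T \<and> \<Phi> z = g T"
proof (rule real_interval_induct[where a = 0 and b = T and P = "\<lambda>t. \<exists>z. dist \<zeta> z \<le> t \<and> \<Phi> z = g t"])
  have dom: "z \<in> ball m R" if "dist \<zeta> z \<le> T" for z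
    using dist_triangle[of m z \<zeta>] that start(2) by auto
  show "\<exists>z. dist \<zeta> z \<le> 0 \<and> \<Phi> z = g 0"
    using start by (intro exI[of _ \<zeta>]) simp
  show "\<exists>t'>t. \<forall>s. t < s \<and> s < t' \<longrightarrow> (\<exists>z. dist \<zeta> z \<le> s \<and> \<Phi> z = g s)"
    if t: "0 \<le> t" "t < T" and ex: "\<exists>z. dist \<zeta> z \<le> t \<and> \<Phi> z = g t" for t
  proof -
    obtain z where z: "dist \<zeta> z \<le> t" "\<Phi> z = g t"
      using ex by blast
    have zR: "z \<in> ball m R"
      using dom z t by simp
    obtain \<epsilon> where e: "0 < \<epsilon>" "fchart (\<Phi> z) \<epsilon> (\<lambda>v. \<Phi> (z + v))"
      by (rule devE[OF \<Phi> zR zero_less_one]) blast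
    have "\<exists>z. dist \<zeta> z \<le> s \<and> \<Phi> z = g s" if s: "t < s" "s < min T (t + \<epsilon>)" for s
    proof -
      have le: "d (\<Phi> z) (g s) \<le> s - t"
        using lip[of t s] t s z by simp
      obtain v where v: "norm v = d (\<Phi> z) (g s)" "\<Phi> (z + v) = g s"
        by (rule fchart_onto[OF e(2), of "g s"]) (use gM[of s] t s le in auto)
      have "dist \<zeta> (z + v) \<le> dist \<zeta> z + norm v"
        using dist_triangle[of \<zeta> "z + v" z] by (simp add: dist_norm)
      then show ?thesis
        using v z le by (intro exI[of _ "z + v"]) auto
    qed
    then show ?thesis
      using e(1) t by (intro exI[of _ "min T (t + \<epsilon>)"]) auto
  qed
  show "\<exists>z. dist \<zeta> z \<le> t \<and> \<Phi> z = g t"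
    if t: "0 < t" "t \<le> T" and before: "\<And>s. 0 \<le> s \<Longrightarrow> s < t \<Longrightarrow> \<exists>z. dist \<zeta> z \<le> s \<and> \<Phi> z = g s" for t
  proof -
    \<comment> \<open>Times in \<open>[0, t)\<close> tending to \<open>t\<close>; the first one is
      0.\<close>
    define \<sigma> where "\<sigma> n = t - t / (real n + 1)" for n
    have \<sigma>: "0 \<le> \<sigma> n" "\<sigma> n < t" for n
      using t by (auto simp: \<sigma>_def field_simps)
    have "\<exists>z. dist \<zeta> z \<le> \<sigma> n \<and> \<Phi> z = g (\<sigma> n)" for n
      using before \<sigma> by blast
    then obtain Z where Z: "\<And>n. dist \<zeta> (Z n) \<le> \<sigma> n" "\<And>n. \<Phi> (Z n) = g (\<sigma> n)"
      by metis
    have "\<forall>n. Z n \<in> cball \<zeta> t"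
      using Z(1) \<sigma>(2) by (meson less_imp_le mem_cball order_trans)
    then obtain l r where l: "l \<in> cball \<zeta> t" "strict_mono r" "(Z \<circ> r) \<longlonglongrightarrow> l"
      using compact_cball[of \<zeta> t] unfolding compact_def by metis
    have lR: "l \<in> ball m R"
      using dom l(1) t(2) by simp
    obtain \<epsilon> where e: "0 < \<epsilon>" "fchart (\<Phi> l) \<epsilon> (\<lambda>v. \<Phi> (l + v))"
      by (rule devE[OF \<Phi> lR zero_less_one]) blast
    have "(\<lambda>n. t / (real n + 1)) \<longlonglongrightarrow> 0"
      using tendsto_mult_right_zero[OF LIMSEQ_inverse_real_of_nat, of t]
      by (simp add: divide_inverse add.commute)
    then have lim: "((\<lambda>n. t / (real n + 1)) \<circ> r) \<longlonglongrightarrow> 0"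
      using LIMSEQ_subseq_LIMSEQ l(2) by blast
    have "d (\<Phi> l) (g t) \<le> \<eta>" if \<eta>: "0 < \<eta>" for \<eta>
    proof -
      have "\<forall>\<^sub>F n in sequentially. dist ((Z \<circ> r) n) l < min \<epsilon> (\<eta> / 2)"
        using tendstoD[OF l(3), of "min \<epsilon> (\<eta> / 2)"] e(1) \<eta> by simp
      moreover have "\<forall>\<^sub>F n in sequentially. dist (((\<lambda>n. t / (real n + 1)) \<circ> r) n) 0 < \<eta> / 2"
        using tendstoD[OF lim, of "\<eta> / 2"] \<eta> by simp
      ultimately have "\<forall>\<^sub>F n in sequentially. dist ((Z \<circ> r) n) l < min \<epsilon> (\<eta> / 2) \<and>
         dist (((\<lambda>n. t / (real n + 1)) \<circ> r) n) 0 < \<eta> / 2"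
        by (rule eventually_conj)
      then obtain n where n: "dist ((Z \<circ> r) n) l < min \<epsilon> (\<eta> / 2)"
        "dist (((\<lambda>n. t / (real n + 1)) \<circ> r) n) 0 < \<eta> / 2"
        using eventually_happens'[OF sequentially_bot] by blast
      define v where "v = Z (r n) - l"
      have v: "norm v < \<epsilon>" "norm v < \<eta> / 2" "l + v = Z (r n)"
        using n(1) by (auto simp: v_def dist_norm)
      have "d (\<Phi> l) (\<Phi> (Z (r n))) = norm v" "\<Phi> (Z (r n)) \<in> M"
        using fchart_dist_le(1,3)[OF e(2) v(1) v(1)] v(3) by auto
      moreover have "d (g (\<sigma> (r n))) (g t) \<le> t - \<sigma> (r n)"
        using lip[of "\<sigma> (r n)" t] \<sigma>[of "r n"] t by simp
      moreover have "t - \<sigma> (r n) < \<eta> / 2"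
        using n(2) t by (simp add: \<sigma>_def)
      ultimately show ?thesis
        using triangle[of "\<Phi> l" "\<Phi> (Z (r n))" "g t"] fchart_centre(1)[OF e(2)] gM[of t] t v(2) Z(2)[of "r n"]
        by simp
    qed
    then have "d (\<Phi> l) (g t) \<le> 0"
      using field_le_epsilon[of "d (\<Phi> l) (g t)" 0] by simp
    then have "\<Phi> l = g t"
      using fchart_centre(1)[OF e(2)] gM[of t] t nonneg[of "\<Phi> l" "g t"] zero[of "\<Phi> l" "g t"] by simp
    then show ?thesis
      using l(1) by (intro exI[of _ l]) simp
  qed
qed (use T in simp)

subsection \<open>Developing a strip along a trajectory\<close>

text \<open>Avoidance is known only at positive times; letting the time tend to 0 along the initial
  segment gives it for the starting point.\<close>

lemma traj_start_dist:
  assumes F: "fchart q \<epsilon> F" and g: "traj {0<..} g" and u: "norm u = 1"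
    and st: "0 < \<eta>" "\<And>t. 0 < t \<Longrightarrow> t < \<eta> \<Longrightarrow> g t = F (of_real t * u)"
    and far: "\<And>t. 0 < t \<Longrightarrow> e \<le> d (g t) s" and s: "s \<in> M"
  shows "e \<le> d q s"
proof (rule field_le_epsilon)
  fix \<delta> :: real assume \<delta>: "0 < \<delta>"
  define t where "t = min (min \<epsilon> \<eta>) \<delta> / 2"
  have t: "0 < t" "t < \<epsilon>" "t < \<eta>" "t \<le> \<delta>"
    using fchart_pos[OF F] st(1) \<delta> by (auto simp: t_def)
  have n: "norm (of_real t * u) < \<epsilon>"
    using t u by (simp add: norm_mult)
  have "d q (g t) = t" "g t \<in> M"
    using fchart_dist_le(1,3)[OF F n n] st(2)[of t] t u by (auto simp: norm_mult)
  then show "e \<le> d q s + \<delta>"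
    using far[of t] t triangle''[of "g t" q s] fchart_centre(1)[OF F] s by auto
qed

text \<open>The strip grows by \<open>r/4\<close> at each step. A development on a disk of radius
  \<open>r\<close> about the point at time \<open>s'\<close> is turned so that it agrees with the
  old one near \<open>s'\<close>; it then agrees on the whole overlap, which is convex, and the two
  are merged. The half width \<open>r/2\<close> makes the new part of the rectangle fit into that
  disk.\<close>

lemma strip_dev:
  assumes r: "0 < r"
    "\<And>p. p \<in> M \<Longrightarrow> (\<And>s. s \<in> Sing \<inter> M \<Longrightarrow> e \<le> d p s) \<Longrightarrow> \<exists>\<Psi>. dev (ball 0 r) \<Psi> \<and> \<Psi> 0 = p"
    and F: "fchart q \<epsilon> F" and g: "traj {0<..} g"
    and st: "0 < \<eta>" "\<And>t. 0 < t \<Longrightarrow> t < \<eta> \<Longrightarrow> g t = F (of_real t)"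
    and far: "\<And>t s. 0 < t \<Longrightarrow> s \<in> Sing \<inter> M \<Longrightarrow> e \<le> d (g t) s"
  shows "\<exists>\<Phi>. dev (rect (r/2) (real n * (r/4))) \<Phi> \<and> (\<exists>\<delta>>0. \<forall>z\<in>ball 0 \<delta>. \<Phi> z = F z) \<and>
     (\<forall>t. 0 < t \<and> t < real n * (r/4) + r/2 \<longrightarrow> \<Phi> (of_real t) = g t)"
proof (induction n)
  case 0
  have "e \<le> d q s" if "s \<in> Sing \<inter> M" for s
    using traj_start_dist[OF F g, of 1 \<eta> e s] st far that by simp
  then obtain \<Psi> where \<Psi>: "dev (ball 0 r) \<Psi>" "\<Psi> 0 = q"
    using r(2) fchart_centre(1)[OF F] by blast
  have 0: "0 \<in> ball 0 r"
    using r(1) by simp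
  obtain \<delta> where \<delta>: "0 < \<delta>" "\<delta> \<le> \<epsilon>" "fchart (\<Psi> 0) \<delta> (\<lambda>v. \<Psi> (0 + v))"
    by (rule devE[OF \<Psi>(1) 0 fchart_pos[OF F]]) blast
  have F': "fchart q \<delta> F" and \<Psi>': "fchart q \<delta> \<Psi>"
    using fchart_shrink[OF F \<delta>(1,2)] \<delta>(3) \<Psi>(2) by auto
  \<comment> \<open>The given development at \<open>q\<close> has an arbitrary frame;
    \<open>A\<close> turns it into that of \<open>F\<close>.\<close>
  obtain A where A: "orthogonal_transformation A" "\<And>v. norm v < \<delta> \<Longrightarrow> F v = \<Psi> (A v)"
    using fchart_match[OF F' \<Psi>'] by blast
  define \<Phi> where "\<Phi> z = \<Psi> (0 + A z)" for z
  have sub: "rect (r/2) 0 \<subseteq> ball 0 r"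
    using norm_lt_of_components[of _ "r/2"] by (auto simp: rect_def)
  have dev: "dev (rect (r/2) 0) \<Phi>"
    unfolding \<Phi>_def
    by (rule dev_compose[OF \<Psi>(1) A(1) open_rect])
       (use sub orthogonal_transformation_norm_eq[OF A(1)] in auto)
  have near: "\<Phi> z = F z" if "z \<in> ball 0 \<delta>" for z
    using A(2) that by (simp add: \<Phi>_def)
  define S where "S = {0<..<r/2}"
  have tr: "traj S (\<lambda>t. \<Phi> (0 + of_real t * 1))"
    by (rule traj_of_dev[OF dev]) (auto simp: S_def rect_def)
  have tr': "traj S (\<lambda>t. \<Phi> (of_real t))"
    using tr by simp
  have "\<Phi> (of_real t) = g t" if t: "t \<in> S" for t
  proof (rule traj_unique[OF _ tr' traj_subset[OF g], where V = "{0<..<min (min \<eta> \<delta>) (r/2)}"])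
    show "\<Phi> (of_real v) = g v" if "v \<in> {0<..<min (min \<eta> \<delta>) (r/2)}" for v
      using near[of "of_real v"] that st(2)[of v] by simp
  qed (use t st(1) \<delta>(1) r(1) in \<open>auto simp: S_def\<close>)
  then show ?case
    using dev near \<delta>(1) by (intro exI[of _ \<Phi>]) (auto simp: S_def)
next
  case (Suc n)
  \<comment> \<open>The advance is \<open>h/2\<close>, less than the overhang \<open>h\<close> of
    the old rectangle, so the next centre \<open>s'\<close> already lies in it.\<close>
  define s s' h where "s = real n * (r/4)" and "s' = real (Suc n) * (r/4)" and "h = r/2"
  have ss: "s' = s + h/2" "0 \<le> s" "0 < h"
    using r(1) by (auto simp: s_def s'_def h_def field_simps)
  obtain \<Phi> \<delta> where \<Phi>: "dev (rect h s) \<Phi>" "0 < \<delta>" "\<And>z. z \<in> ball 0 \<delta> \<Longrightarrow> \<Phi> z = F z"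
    "\<And>t. 0 < t \<Longrightarrow> t < s + h \<Longrightarrow> \<Phi> (of_real t) = g t"
    using Suc by (auto simp: s_def h_def)
  have s'pos: "0 < s'"
    using ss by simp
  have gs': "g s' \<in> M"
    using traj_mem[OF g, of s'] s'pos by simp
  obtain \<Psi> where \<Psi>: "dev (ball 0 r) \<Psi>" "\<Psi> 0 = g s'"
    using r(2)[OF gs' far[OF s'pos]] by blast
  have s'r: "of_real s' \<in> rect h s"
    using ss by (auto simp: rect_def)
  obtain e1 where e1: "0 < e1" "ball (of_real s') e1 \<subseteq> rect h s" "fchart (\<Phi> (of_real s')) e1 (\<lambda>v. \<Phi> (of_real s' + v))"
    by (rule devE[OF \<Phi>(1) s'r zero_less_one]) blast
  have 0: "0 \<in> ball 0 r"
    using r(1) by simp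
  obtain e2 where e2: "0 < e2" "e2 \<le> e1" "fchart (\<Psi> 0) e2 (\<lambda>v. \<Psi> (0 + v))"
    by (rule devE[OF \<Psi>(1) 0 e1(1)]) blast
  have F1: "fchart (g s') e2 (\<lambda>v. \<Phi> (of_real s' + v))"
    using fchart_shrink[OF e1(3) e2(1,2)] \<Phi>(4)[of s'] s'pos ss by simp
  have F2: "fchart (g s') e2 \<Psi>"
    using e2(3) \<Psi>(2) by simp
  obtain A where A: "orthogonal_transformation A" "\<And>v. norm v < e2 \<Longrightarrow> \<Phi> (of_real s' + v) = \<Psi> (A v)"
    using fchart_match[OF F1 F2] by blast
  have Alin: "linear A"
    using A(1) by (rule orthogonal_transformation_linear)
  define \<Psi>' where "\<Psi>' z = \<Psi> (- A (of_real s') + A z)" for z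
  have Adiff: "- A (of_real s') + A z = A (z - of_real s')" for z
    by (simp add: linear_diff[OF Alin])
  have dev': "dev (ball (of_real s') r) \<Psi>'"
    unfolding \<Psi>'_def
  proof (rule dev_compose[OF \<Psi>(1) A(1)])
    show "- A (of_real s') + A z \<in> ball 0 r" if "z \<in> ball (of_real s') r" for z
      using that orthogonal_transformation_norm_eq[OF A(1)] unfolding Adiff
      by (simp add: dist_norm norm_minus_commute)
  qed simp
  let ?I = "rect h s \<inter> ball (of_real s') r"
  have agree: "\<Phi> z = \<Psi>' z" if z: "z \<in> ?I" for z
  proof (rule dev_unique[where W = ?I and V = "ball (of_real s') (min e2 r)"])
    show "connected ?I"
      by (intro convex_connected convex_Int convex_rect convex_ball)
    show "dev ?I \<Phi>" "dev ?I \<Psi>'"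
      using dev_subset[OF \<Phi>(1)] dev_subset[OF dev'] open_rect by (simp_all add: open_Int)
    show "ball (of_real s') (min e2 r) \<noteq> {}"
      using e2(1) r(1) by simp
    show "ball (of_real s') (min e2 r) \<subseteq> ?I"
      using e1(2) e2(2) by auto
    show "\<Phi> v = \<Psi>' v" if "v \<in> ball (of_real s') (min e2 r)" for v
      using A(2)[of "v - of_real s'"] that unfolding \<Psi>'_def Adiff by (simp add: dist_norm norm_minus_commute)
  qed (use z in auto)
  define \<Phi>' where "\<Phi>' z = (if z \<in> rect h s then \<Phi> z else \<Psi>' z)" for z
  \<comment> \<open>A new point has real part at least \<open>s + h\<close>, so it differs from
    \<open>s'\<close> by less than \<open>h\<close> in each coordinate, hence by less than
    \<open>2 * h = r\<close>.\<close>
  have cover: "z \<in> ball (of_real s') r" if z: "z \<in> rect h s'" "z \<notin> rect h s" for z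
  proof -
    have "\<bar>Re (z - of_real s')\<bar> < h" "\<bar>Im (z - of_real s')\<bar> < h"
      using z ss by (auto simp: rect_def)
    then have "norm (z - of_real s') < 2 * h"
      by (rule norm_lt_of_components)
    then show ?thesis
      by (simp add: dist_norm norm_minus_commute h_def)
  qed
  have dev2: "dev (rect h s') \<Phi>'"
  proof (rule dev_local)
    fix z assume z: "z \<in> rect h s'"
    show "\<exists>V \<Psi>. z \<in> V \<and> V \<subseteq> rect h s' \<and> dev V \<Psi> \<and> (\<forall>w\<in>V. \<Phi>' w = \<Psi> w)"
    proof (cases "z \<in> rect h s")
      case True
      then show ?thesis
        using z dev_subset[OF \<Phi>(1) open_Int[OF open_rect open_rect] Int_lower1]
        by (intro exI[of _ "rect h s \<inter> rect h s'"] exI[of _ \<Phi>]) (auto simp: \<Phi>'_def)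
    next
      case False
      then show ?thesis
        using z cover[OF z] dev_subset[OF dev' open_Int[OF open_ball open_rect] Int_lower1] agree
        by (intro exI[of _ "ball (of_real s') r \<inter> rect h s'"] exI[of _ \<Psi>']) (auto simp: \<Phi>'_def)
    qed
  qed
  have "\<Phi>' z = F z" if "z \<in> ball 0 (min \<delta> h)" for z
  proof -
    have "z \<in> rect h s"
      using that ss abs_Re_le_cmod[of z] abs_Im_le_cmod[of z] by (auto simp: rect_def)
    then show ?thesis
      using that \<Phi>(3) by (simp add: \<Phi>'_def)
  qed
  moreover have "\<Phi>' (of_real t) = g t" if t: "t \<in> {0<..<s' + h}" for t
  proof (rule traj_unique[where S = "{0<..<s' + h}" and V = "{0<..<s + h}"])
    have "traj {0<..<s' + h} (\<lambda>t. \<Phi>' (0 + of_real t * 1))"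
      by (rule traj_of_dev[OF dev2]) (use ss in \<open>auto simp: rect_def\<close>)
    then show "traj {0<..<s' + h} (\<lambda>t. \<Phi>' (of_real t))"
      by simp
    show "traj {0<..<s' + h} g"
      by (rule traj_subset[OF g]) auto
    show "\<Phi>' (of_real v) = g v" if "v \<in> {0<..<s + h}" for v
      using that ss \<Phi>(4)[of v] by (auto simp: \<Phi>'_def rect_def)
  qed (use t ss in auto)
  ultimately show ?case
    using dev2 \<Phi>(2) ss(3) unfolding s'_def[symmetric] h_def[symmetric]
    by (intro exI[of _ \<Phi>'] conjI exI[of _ "min \<delta> h"]) auto
qed

text \<open>Angles are measured in the folded chart \<open>F\<close>, where an angle pointing beyond
  the boundary stands for a reflected direction. They range over all reals, so that the set of
  avoiding angles can be studied on the line.\<close>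

definition avoids :: "(complex \<Rightarrow> 'p) \<Rightarrow> real \<Rightarrow> real \<Rightarrow> bool" where
  "avoids F e \<theta> \<longleftrightarrow> (\<exists>g. traj {0<..} g \<and> (\<exists>\<eta>>0. \<forall>t. 0 < t \<and> t < \<eta> \<longrightarrow> g t = F (of_real t * cis \<theta>)) \<and>
     (\<forall>t>0. \<forall>s\<in>Sing \<inter> M. e \<le> d (g t) s))"

text \<open>Whatever the angle, the development is normalised to equal the same \<open>F\<close>
  near 0. This common germ is what later lets strips in different directions be fused.\<close>

lemma avoids_dev:
  assumes r: "0 < r"
    "\<And>p. p \<in> M \<Longrightarrow> (\<And>s. s \<in> Sing \<inter> M \<Longrightarrow> e \<le> d p s) \<Longrightarrow> \<exists>\<Psi>. dev (ball 0 r) \<Psi> \<and> \<Psi> 0 = p"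
    and F: "fchart q \<epsilon> F" and av: "avoids F e \<theta>"
  shows "\<exists>\<Phi>. dev {z. cis (- \<theta>) * z \<in> rect (r/2) T} \<Phi> \<and> (\<exists>\<delta>>0. \<forall>z\<in>ball 0 \<delta>. \<Phi> z = F z)"
proof -
  obtain g \<eta> where g: "traj {0<..} g" and st: "0 < \<eta>" "\<And>t. 0 < t \<Longrightarrow> t < \<eta> \<Longrightarrow> g t = F (of_real t * cis \<theta>)"
    and far: "\<And>t s. 0 < t \<Longrightarrow> s \<in> Sing \<inter> M \<Longrightarrow> e \<le> d (g t) s"
    using av unfolding avoids_def by blast
  have orth: "orthogonal_transformation (\<lambda>v. cis \<alpha> * v)" for \<alpha>
    by (rule orthogonal_transformation_mult) simp
  define F' where "F' v = F (cis \<theta> * v)" for v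
  have F': "fchart q \<epsilon> F'"
    unfolding F'_def by (rule fchart_orthogonal[OF F orth])
  have st': "g t = F' (of_real t)" if "0 < t" "t < \<eta>" for t
    using st(2)[OF that] by (simp add: F'_def mult.commute)
  obtain n :: nat where n: "T / (r/4) \<le> real n"
    using real_arch_simple by blast
  then have nT: "T \<le> real n * (r/4)"
    using r(1) by (simp add: field_simps)
  obtain \<Phi> \<delta> where \<Phi>: "dev (rect (r/2) (real n * (r/4))) \<Phi>" "0 < \<delta>" "\<forall>z\<in>ball 0 \<delta>. \<Phi> z = F' z"
    using strip_dev[OF r F' g st(1) st' far, of n] by blast
  define Q where "Q = {z. cis (- \<theta>) * z \<in> rect (r/2) T}"
  have "Q = (\<lambda>z. cis (- \<theta>) * z) -` rect (r/2) T"
    by (auto simp: Q_def)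
  then have "open Q"
    using open_vimage[OF open_rect, of "\<lambda>z. cis (- \<theta>) * z" "r/2" T] by (simp add: continuous_on_mult_left)
  have "dev Q (\<lambda>z. \<Phi> (0 + cis (- \<theta>) * z))"
  proof (rule dev_compose[OF \<Phi>(1) orth \<open>open Q\<close>])
    show "0 + cis (- \<theta>) * z \<in> rect (r/2) (real n * (r/4))" if "z \<in> Q" for z
      using that nT by (auto simp: Q_def rect_def)
  qed
  then have "dev Q (\<lambda>z. \<Phi> (cis (- \<theta>) * z))"
    by simp
  moreover have "\<Phi> (cis (- \<theta>) * z) = F z" if "z \<in> ball 0 \<delta>" for z
  proof -
    have "cis (- \<theta>) * z \<in> ball 0 \<delta>"
      using that by (simp add: norm_mult)
    then have "\<Phi> (cis (- \<theta>) * z) = F' (cis (- \<theta>) * z)"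
      using \<Phi>(3) by blast
    also have "\<dots> = F z"
      by (simp add: F'_def cis_mult flip: mult.assoc)
    finally show ?thesis .
  qed
  ultimately show ?thesis
    using \<Phi>(2) unfolding Q_def by (intro exI[of _ "\<lambda>z. \<Phi> (cis (- \<theta>) * z)"]) blast
qed

end

subsection \<open>Porous sets of directions are null\<close>

text \<open>Removing a hole of proportion \<open>c\<close> leaves two intervals of total length at
  most \<open>1 - c\<close> times the original. After \<open>n\<close> rounds the set is covered
  with measure at most the \<open>n\<close>-th power of \<open>1 - c\<close>, which tends to 0; no
  measurability of \<open>X\<close> enters.\<close>

lemma porous_null:
  fixes X :: "real set"
  assumes c: "0 < c" "c \<le> 1"
    and porous: "\<And>\<alpha> \<beta>. \<alpha> < \<beta> \<Longrightarrow> \<beta> - \<alpha> \<le> 1 \<Longrightarrow>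
      \<exists>a b. \<alpha> \<le> a \<and> a < b \<and> b \<le> \<beta> \<and> c * (\<beta> - \<alpha>) \<le> b - a \<and> {a..b} \<inter> X = {}"
  shows "\<exists>N\<in>null_sets lborel. X \<subseteq> N"
proof -
  have cover: "\<exists>A\<in>sets lborel. X \<inter> {\<alpha>..\<beta>} \<subseteq> A \<and> emeasure lborel A \<le> ennreal ((1 - c) ^ n * (\<beta> - \<alpha>))"
    if "\<alpha> \<le> \<beta>" "\<beta> - \<alpha> \<le> 1" for n \<alpha> \<beta>
    using that
  proof (induction n arbitrary: \<alpha> \<beta>)
    case 0
    then show ?case
      by (intro bexI[of _ "{\<alpha>..\<beta>}"]) auto
  next
    case (Suc n)
    show ?case
    proof (cases "\<alpha> = \<beta>")
      case True
      then show ?thesis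
        by (intro bexI[of _ "{\<alpha>}"]) auto
    next
      case False
      \<comment> \<open>The induction hypothesis is applied to the two remaining intervals, either
        of which may be degenerate.\<close>
      then obtain a b where ab: "\<alpha> \<le> a" "a < b" "b \<le> \<beta>" "c * (\<beta> - \<alpha>) \<le> b - a" "{a..b} \<inter> X = {}"
        using porous[of \<alpha> \<beta>] Suc.prems by force
      obtain A1 where A1: "A1 \<in> sets lborel" "X \<inter> {\<alpha>..a} \<subseteq> A1"
        "emeasure lborel A1 \<le> ennreal ((1 - c) ^ n * (a - \<alpha>))"
        using Suc.IH[of \<alpha> a] ab Suc.prems by auto
      obtain A2 where A2: "A2 \<in> sets lborel" "X \<inter> {b..\<beta>} \<subseteq> A2"
        "emeasure lborel A2 \<le> ennreal ((1 - c) ^ n * (\<beta> - b))"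
        using Suc.IH[of b \<beta>] ab Suc.prems by auto
      have "X \<inter> {\<alpha>..\<beta>} \<subseteq> A1 \<union> A2"
      proof
        fix x assume x: "x \<in> X \<inter> {\<alpha>..\<beta>}"
        then have "x \<notin> {a..b}"
          using ab(5) by blast
        then show "x \<in> A1 \<union> A2"
          using x A1(2) A2(2) by (cases "x \<le> a") auto
      qed
      moreover have "emeasure lborel (A1 \<union> A2) \<le> ennreal ((1 - c) ^ Suc n * (\<beta> - \<alpha>))"
      proof -
        have "emeasure lborel (A1 \<union> A2) \<le> emeasure lborel A1 + emeasure lborel A2"
          using A1(1) A2(1) by (rule emeasure_subadditive)
        also have "\<dots> \<le> ennreal ((1 - c) ^ n * (a - \<alpha>)) + ennreal ((1 - c) ^ n * (\<beta> - b))"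
          using A1(3) A2(3) by (rule add_mono)
        also have "\<dots> = ennreal ((1 - c) ^ n * ((a - \<alpha>) + (\<beta> - b)))"
          using c ab by (subst ennreal_plus[symmetric]) (auto simp: distrib_left intro!: mult_nonneg_nonneg)
        also have "\<dots> \<le> ennreal ((1 - c) ^ n * ((1 - c) * (\<beta> - \<alpha>)))"
          using c ab by (intro ennreal_leI mult_left_mono) (auto simp: algebra_simps)
        finally show ?thesis
          by (simp add: algebra_simps)
      qed
      ultimately show ?thesis
        using A1(1) A2(1) by blast
    qed
  qed
  have unit: "\<exists>N\<in>null_sets lborel. X \<inter> {\<alpha>..\<alpha> + 1} \<subseteq> N" for \<alpha>
  proof -
    have "\<forall>n. \<exists>A\<in>sets lborel. X \<inter> {\<alpha>..\<alpha> + 1} \<subseteq> A \<and> emeasure lborel A \<le> ennreal ((1 - c) ^ n)"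
      using cover[of \<alpha> "\<alpha> + 1"] by auto
    then obtain A where A: "\<And>n. A n \<in> sets lborel" "\<And>n. X \<inter> {\<alpha>..\<alpha> + 1} \<subseteq> A n"
      "\<And>n. emeasure lborel (A n) \<le> ennreal ((1 - c) ^ n)"
      by metis
    define N where "N = (\<Inter>n. A n)"
    have N: "N \<in> sets lborel"
      unfolding N_def using A(1) by (intro sets.countable_INT'') auto
    have "(\<lambda>n. (1 - c) ^ n) \<longlonglongrightarrow> 0"
      using c by (intro LIMSEQ_power_zero) auto
    then have lim: "(\<lambda>n. ennreal ((1 - c) ^ n)) \<longlonglongrightarrow> 0"
      using tendsto_ennrealI by fastforce
    have "emeasure lborel N \<le> ennreal ((1 - c) ^ n)" for n
      using emeasure_mono[of N "A n" lborel] A(1,3) by (force simp: N_def intro: order_trans)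
    then have "emeasure lborel N \<le> 0"
      using LIMSEQ_le_const[OF lim] by blast
    then have "N \<in> null_sets lborel"
      using N by auto
    moreover have "X \<inter> {\<alpha>..\<alpha> + 1} \<subseteq> N"
      using A(2) by (auto simp: N_def)
    ultimately show ?thesis
      by blast
  qed
  then obtain N where N: "\<And>\<alpha>::real. N \<alpha> \<in> null_sets lborel" "\<And>\<alpha>. X \<inter> {\<alpha>..\<alpha> + 1} \<subseteq> N \<alpha>"
    by metis
  have "X \<subseteq> (\<Union>k::int. N (of_int k))"
  proof
    fix x assume "x \<in> X"
    then have "x \<in> X \<inter> {of_int \<lfloor>x\<rfloor>..of_int \<lfloor>x\<rfloor> + 1}"
      by (auto intro: less_imp_le)
    then show "x \<in> (\<Union>k::int. N (of_int k))"
      using N(2) by blast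
  qed
  moreover have "(\<Union>k::int. N (of_int k)) \<in> null_sets lborel"
    using N(1) by (intro null_sets_UN) auto
  ultimately show ?thesis
    by blast
qed

context flat_space begin

text \<open>Were there no gap of proportion \<open>c\<close> between \<alpha> and \<beta>, avoiding
  directions would be dense enough for their strips to cover a disk of radius \<open>R\<close>
  centred halfway along them. The strips agree on overlaps and would give a development of that
  disk.\<close>

lemma avoiding_directions_porous:
  assumes F: "fchart q \<epsilon> F" and e: "0 < e" and R: "0 < R"
    and noBig: "\<And>m \<Phi>. \<not> dev (ball m R) \<Phi>"
  shows "\<exists>c>0. c \<le> 1 \<and> (\<forall>\<alpha> \<beta>. \<alpha> < \<beta> \<longrightarrow> \<beta> - \<alpha> \<le> 1 \<longrightarrow>
      (\<exists>a b. \<alpha> \<le> a \<and> a < b \<and> b \<le> \<beta> \<and> c * (\<beta> - \<alpha>) \<le> b - a \<and> {a..b} \<inter> {\<theta>. avoids F e \<theta>} = {}))"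
proof -
  obtain r where r: "0 < r"
    "\<And>p. p \<in> M \<Longrightarrow> (\<And>s. s \<in> Sing \<inter> M \<Longrightarrow> e \<le> d p s) \<Longrightarrow> \<exists>\<Psi>. dev (ball 0 r) \<Psi> \<and> \<Psi> 0 = p"
    using uniform_dev[OF e] by blast
  define h where "h = r / 2"
  \<comment> \<open>At distance at most \<open>T = 10 * R / \<delta>\<close> an angular error of
    \<open>c * \<delta> / 2\<close> displaces a point by at most \<open>5 * R * c\<close>, hence by
    at most \<open>h / 2\<close>, which is within the half width \<open>h\<close>. The bound 1/4
    keeps the tested subintervals inside the given interval.\<close>
  define c where "c = min (1/4) (h / (10 * R))"
  have h: "0 < h" and c: "0 < c" "c \<le> 1/4" "c \<le> h / (10 * R)"
    using r R by (auto simp: h_def c_def)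
  have cR: "10 * R * c \<le> h"
    using c(3) R by (simp add: field_simps)
  have "\<exists>a b. \<alpha> \<le> a \<and> a < b \<and> b \<le> \<beta> \<and> c * (\<beta> - \<alpha>) \<le> b - a \<and> {a..b} \<inter> {\<theta>. avoids F e \<theta>} = {}"
    if \<alpha>\<beta>: "\<alpha> < \<beta>" "\<beta> - \<alpha> \<le> 1" for \<alpha> \<beta>
  proof (rule ccontr)
    assume no: "\<not> ?thesis"
    define \<delta> \<mu> T where "\<delta> = \<beta> - \<alpha>" and "\<mu> = (\<alpha> + \<beta>) / 2" and "T = 10 * R / \<delta>"
    have \<delta>: "0 < \<delta>" "\<delta> \<le> 1"
      using \<alpha>\<beta> by (auto simp: \<delta>_def)
    have T\<delta>: "T * \<delta> = 10 * R"
      using \<delta> by (simp add: T_def)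
    have TR: "10 * R \<le> T"
      using \<delta> R by (simp add: T_def field_simps)
    \<comment> \<open>Otherwise the closed interval of radius \<open>c * \<delta> / 2\<close> about
      \<theta>' would be the excluded gap.\<close>
    have dense: "\<exists>\<theta>. avoids F e \<theta> \<and> \<bar>\<theta> - \<theta>'\<bar> \<le> c * \<delta> / 2" if th: "\<bar>\<theta>' - \<mu>\<bar> < \<delta> / 4" for \<theta>'
    proof -
      have "c * \<delta> \<le> \<delta> / 4"
        using c(2) \<delta> by (simp add: field_simps)
      then have "\<alpha> \<le> \<theta>' - c * \<delta> / 2" "\<theta>' + c * \<delta> / 2 \<le> \<beta>"
        using th unfolding \<delta>_def \<mu>_def abs_less_iff by (auto simp: field_simps)
      moreover have "c * \<delta> > 0"
        using c \<delta> by simp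
      ultimately have "{\<theta>' - c * \<delta> / 2..\<theta>' + c * \<delta> / 2} \<inter> {\<theta>. avoids F e \<theta>} \<noteq> {}"
        using no by (auto simp: \<delta>_def)
      then obtain \<theta> where "\<theta>' - c * \<delta> / 2 \<le> \<theta>" "\<theta> \<le> \<theta>' + c * \<delta> / 2" "avoids F e \<theta>"
        by auto
      then show ?thesis
        by (intro exI[of _ \<theta>] conjI) (assumption | linarith)+
    qed
    define Q where "Q \<theta> = {z. cis (- \<theta>) * z \<in> rect h T}" for \<theta>
    have Qconv: "convex (Q \<theta>)" for \<theta>
    proof -
      have "linear (\<lambda>z. cis (- \<theta>) * z)"
        by (simp add: linear_iff algebra_simps)
      then have "convex ((\<lambda>z. cis (- \<theta>) * z) -` rect h T)"
        using convex_linear_vimage convex_rect by blast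
      then show ?thesis
        by (simp add: Q_def vimage_def)
    qed
    have Qball: "ball 0 h \<subseteq> Q \<theta>" for \<theta>
    proof
      fix z :: complex assume "z \<in> ball 0 h"
      then have "norm (cis (- \<theta>) * z) < h"
        by (simp add: norm_mult)
      then show "z \<in> Q \<theta>"
        using abs_Re_le_cmod[of "cis (- \<theta>) * z"] abs_Im_le_cmod[of "cis (- \<theta>) * z"] TR R h
        unfolding Q_def rect_def by auto
    qed
    have "\<exists>\<Phi>. dev (Q \<theta>) \<Phi> \<and> (\<exists>\<delta>>0. \<forall>z\<in>ball 0 \<delta>. \<Phi> z = F z)" if "avoids F e \<theta>" for \<theta>
      using avoids_dev[OF r F that, of T] by (simp add: Q_def h_def)
    then obtain \<Phi> where \<Phi>: "\<And>\<theta>. avoids F e \<theta> \<Longrightarrow> dev (Q \<theta>) (\<Phi> \<theta>)"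
      "\<And>\<theta>. avoids F e \<theta> \<Longrightarrow> \<exists>\<delta>>0. \<forall>z\<in>ball 0 \<delta>. \<Phi> \<theta> z = F z"
      by metis
    have agree: "\<Phi> \<theta>1 z = \<Phi> \<theta>2 z"
      if av: "avoids F e \<theta>1" "avoids F e \<theta>2" and z: "z \<in> Q \<theta>1" "z \<in> Q \<theta>2" for \<theta>1 \<theta>2 z
    proof -
      obtain \<delta>1 \<delta>2 where \<delta>12: "0 < \<delta>1" "\<forall>z\<in>ball 0 \<delta>1. \<Phi> \<theta>1 z = F z" "0 < \<delta>2" "\<forall>z\<in>ball 0 \<delta>2. \<Phi> \<theta>2 z = F z"
        using \<Phi>(2)[OF av(1)] \<Phi>(2)[OF av(2)] by blast
      have op: "open (Q \<theta>1 \<inter> Q \<theta>2)"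
        using \<Phi>(1)[OF av(1)] \<Phi>(1)[OF av(2)] by (auto simp: dev_def)
      \<comment> \<open>Two strips meet in a convex set that contains \<open>ball 0 h\<close>, and
        both developments start as \<open>F\<close>.\<close>
      show ?thesis
      proof (rule dev_unique[where W = "Q \<theta>1 \<inter> Q \<theta>2" and V = "ball 0 (min h (min \<delta>1 \<delta>2))"])
        show "connected (Q \<theta>1 \<inter> Q \<theta>2)"
          by (intro convex_connected convex_Int Qconv)
        show "dev (Q \<theta>1 \<inter> Q \<theta>2) (\<Phi> \<theta>1)" "dev (Q \<theta>1 \<inter> Q \<theta>2) (\<Phi> \<theta>2)"
          using dev_subset[OF \<Phi>(1)[OF av(1)] op] dev_subset[OF \<Phi>(1)[OF av(2)] op] by auto
        show "ball 0 (min h (min \<delta>1 \<delta>2)) \<noteq> {}"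
          using h \<delta>12 by simp
        show "ball 0 (min h (min \<delta>1 \<delta>2)) \<subseteq> Q \<theta>1 \<inter> Q \<theta>2"
          using Qball[of \<theta>1] Qball[of \<theta>2] by auto
        show "\<Phi> \<theta>1 v = \<Phi> \<theta>2 v" if "v \<in> ball 0 (min h (min \<delta>1 \<delta>2))" for v
          using \<delta>12(2,4) that by simp
      qed (use z in auto)
    qed
    \<comment> \<open>Halfway out on the middle direction: far enough for the disk of radius
      \<open>R\<close> to be seen from 0 within the angle \<delta> / 4 of \<mu>, yet within reach of
      strips of length \<open>T\<close>.\<close>
    define m where "m = of_real (T / 2) * cis \<mu>"
    have cover: "\<exists>\<theta>. avoids F e \<theta> \<and> z \<in> Q \<theta>" if z: "z \<in> ball m R" for z
    proof -
      define w where "w = cis (- \<mu>) * z"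
      have zw: "z = cis \<mu> * w"
        by (simp add: w_def cis_mult flip: mult.assoc)
      have "z - m = cis \<mu> * (w - of_real (T / 2))"
        by (simp add: zw m_def algebra_simps)
      then have "norm (z - m) = norm (w - of_real (T / 2))"
        by (simp only: norm_mult norm_cis mult_1)
      then have nw: "norm (w - of_real (T / 2)) < R"
        using z by (simp only: mem_ball dist_norm norm_minus_commute[of m])
      have Rew: "T / 2 - R < Re w" and Imw: "\<bar>Im w\<bar> < R"
        using abs_Re_le_cmod[of "w - of_real (T / 2)"] abs_Im_le_cmod[of "w - of_real (T / 2)"] nw
        by auto
      have "norm w \<le> norm (w - of_real (T / 2)) + T / 2"
        using norm_triangle_sub[of w "of_real (T / 2)"] TR R by simp
      then have normw: "norm w \<le> T"
        using nw TR R by linarith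
      \<comment> \<open>Since \<delta> is at most 1. With the imaginary part below \<open>R\<close>
        in absolute value, this bounds the argument by \<delta> / 4.\<close>
      have "4 * R / \<delta> \<le> T / 2 - R"
        using \<delta> R by (simp add: T_def field_simps)
      then have Rew': "4 * R / \<delta> < Re w"
        using Rew by simp
      then have pos: "0 < Re w"
        using \<delta> R by (meson divide_nonneg_pos less_eq_real_def mult_nonneg_nonneg order_le_less_trans zero_le_numeral)
      have "\<bar>Im w\<bar> / Re w < \<delta> / 4"
      proof -
        have "4 * R < Re w * \<delta>"
          using Rew' \<delta> by (simp add: field_simps)
        then show ?thesis
          using Imw pos by (simp add: field_simps)
      qed
      then have "\<bar>Arg w\<bar> < \<delta> / 4"
        using Arg_abs_le[OF pos] by (rule order_le_less_trans[rotated])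
      then obtain \<theta> where \<theta>: "avoids F e \<theta>" "\<bar>\<theta> - (\<mu> + Arg w)\<bar> \<le> c * \<delta> / 2"
        using dense[of "\<mu> + Arg w"] by auto
      define \<phi> where "\<phi> = \<mu> + Arg w - \<theta>"
      have \<phi>: "\<bar>\<phi>\<bar> \<le> c * \<delta> / 2"
        using \<theta>(2) by (simp add: \<phi>_def abs_minus_commute)
      have w': "w = of_real (norm w) * cis (Arg w)"
        using rcis_cmod_Arg[of w] by (simp add: rcis_def)
      have "cis (- \<theta>) * z = of_real (norm w) * (cis (- \<theta>) * cis \<mu> * cis (Arg w))"
        unfolding zw by (subst w') (simp only: mult_ac)
      also have "cis (- \<theta>) * cis \<mu> * cis (Arg w) = cis \<phi>"
        by (simp add: cis_mult \<phi>_def algebra_simps)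
      finally have z\<phi>: "cis (- \<theta>) * z = of_real (norm w) * cis \<phi>" .
      have "c * \<delta> \<le> 1"
        using c \<delta> mult_mono[of c 1 \<delta> 1] by simp
      then have "\<bar>\<phi>\<bar> < pi / 2"
        using \<phi> pi_gt3 by linarith
      then have cos: "0 \<le> cos \<phi>"
        by (intro cos_ge_zero) (auto simp: abs_less_iff)
      have "norm w * \<bar>sin \<phi>\<bar> \<le> T * (c * \<delta> / 2)"
        using normw \<phi> abs_sin_x_le_abs_x[of \<phi>] TR R by (intro mult_mono) auto
      also have "\<dots> = 5 * R * c"
        using T\<delta> by (simp add: algebra_simps)
      also have "\<dots> < h"
        using cR R c h by linarith
      finally have im: "norm w * \<bar>sin \<phi>\<bar> < h" .
      have "norm w * cos \<phi> \<le> norm w * 1"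
        by (intro mult_left_mono) auto
      then have "norm w * cos \<phi> < T + h"
        using normw h by linarith
      moreover have "0 \<le> norm w * cos \<phi>"
        using cos by simp
      ultimately have "cis (- \<theta>) * z \<in> rect h T"
        using im h by (simp add: z\<phi> rect_def abs_mult)
      then show ?thesis
        using \<theta>(1) by (auto simp: Q_def)
    qed
    \<comment> \<open>The choice may jump from point to point, which does no harm because the
      developments agree wherever two strips overlap.\<close>
    define pick where "pick z = (SOME \<theta>. avoids F e \<theta> \<and> z \<in> Q \<theta>)" for z
    have pick: "avoids F e (pick z)" "z \<in> Q (pick z)" if "z \<in> ball m R" for z
      using someI_ex[OF cover[OF that]] by (auto simp: pick_def)
    have "dev (ball m R) (\<lambda>z. \<Phi> (pick z) z)"
    proof (rule dev_local)
      fix z assume z: "z \<in> ball m R"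
      have op: "open (Q (pick z) \<inter> ball m R)"
        using \<Phi>(1)[OF pick(1)[OF z]] by (auto simp: dev_def)
      show "\<exists>V \<Psi>. z \<in> V \<and> V \<subseteq> ball m R \<and> dev V \<Psi> \<and> (\<forall>w\<in>V. \<Phi> (pick w) w = \<Psi> w)"
      proof (intro exI conjI ballI)
        show "z \<in> Q (pick z) \<inter> ball m R" "Q (pick z) \<inter> ball m R \<subseteq> ball m R"
          using z pick(2)[OF z] by auto
        show "dev (Q (pick z) \<inter> ball m R) (\<Phi> (pick z))"
          by (rule dev_subset[OF \<Phi>(1)[OF pick(1)[OF z]] op]) simp
        show "\<Phi> (pick w) w = \<Phi> (pick z) w" if "w \<in> Q (pick z) \<inter> ball m R" for w
          using agree pick that z by blast
      qed
    qed
    then show False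
      using noBig by blast
  qed
  then show ?thesis
    using c by (intro exI[of _ c]) auto
qed

lemma avoiding_directions_null:
  assumes "fchart q \<epsilon> F" "0 < R" "\<And>m \<Phi>. \<not> dev (ball m R) \<Phi>" "0 < e"
  shows "\<exists>N\<in>null_sets lborel. {\<theta>. avoids F e \<theta>} \<subseteq> N"
proof -
  obtain c where "c > 0" "c \<le> 1" and "\<forall>\<alpha> \<beta>. \<alpha> < \<beta> \<longrightarrow> \<beta> - \<alpha> \<le> 1 \<longrightarrow>
      (\<exists>a b. \<alpha> \<le> a \<and> a < b \<and> b \<le> \<beta> \<and> c * (\<beta> - \<alpha>) \<le> b - a \<and> {a..b} \<inter> {\<theta>. avoids F e \<theta>} = {})"
    using avoiding_directions_porous[OF assms(1,4,2,3)] by blast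
  then show ?thesis
    by (intro porous_null[of c]) auto
qed

subsection \<open>Maximal extension of trajectories\<close>

text \<open>A folded chart at the limit point contains the tail of the trajectory as part of a
  straight line, and this line runs on beyond time \<open>L\<close>.\<close>

lemma traj_extend_nonsingular:
  assumes g: "traj {0<..<L} g" and L: "0 < L" and p: "p \<in> M - Sing"
    and lim: "\<And>t. 0 < t \<Longrightarrow> t < L \<Longrightarrow> d (g t) p \<le> L - t"
  shows "\<exists>L'>L. \<exists>g'. traj {0<..<L'} g' \<and> (\<forall>t\<in>{0<..<L}. g' t = g t)"
proof -
  obtain \<epsilon> F where F: "fchart p \<epsilon> F"
    by (rule fchart_exists[OF p]) blast
  have \<epsilon>: "0 < \<epsilon>"
    using fchart_pos[OF F] .
  \<comment> \<open>At \<open>t0\<close> the point is within \<epsilon> / 3 of \<open>p\<close>, and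
    less than \<epsilon> / 3 of time is left. Running until \<open>L + \<epsilon> / 3\<close> thus
    keeps the line inside the chart disk of radius \<epsilon>.\<close>
  define t0 where "t0 = L - min (\<epsilon> / 4) (L / 2)"
  have t0: "0 < t0" "t0 < L" "L - t0 < \<epsilon> / 3"
    using L \<epsilon> by (auto simp: t0_def min_def)
  have gM: "g t0 \<in> M"
    using traj_mem[OF g] t0 by auto
  have dp: "d p (g t0) < \<epsilon> / 3"
    using lim[OF t0(1,2)] t0(3) commute[of p "g t0"] by simp
  obtain w where w: "norm w = d p (g t0)" "F w = g t0"
    by (rule fchart_onto[OF F gM]) (use dp \<epsilon> in auto)
  have w\<epsilon>: "norm w < \<epsilon>"
    using w dp \<epsilon> by simp
  obtain \<delta> where \<delta>: "0 < \<delta>" "norm w + \<delta> \<le> \<epsilon>" "fchart (F w) \<delta> (\<lambda>v. F (w + v))"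
    by (rule fchart_recentre[OF F w\<epsilon>]) blast
  have t0S: "t0 \<in> {0<..<L}"
    using t0 by simp
  obtain \<delta>' F1 u1 where \<delta>': "0 < \<delta>'" "\<delta>' \<le> \<delta>" "ball t0 \<delta>' \<subseteq> {0<..<L}" "fchart (g t0) \<delta>' F1" "norm u1 = 1"
    "\<And>\<tau>. \<bar>\<tau>\<bar> < \<delta>' \<Longrightarrow> g (t0 + \<tau>) = F1 (of_real \<tau> * u1)"
    by (rule trajE[OF g t0S \<delta>(1)]) blast
  have F2: "fchart (g t0) \<delta>' (\<lambda>v. F (w + v))"
    using fchart_shrink[OF \<delta>(3) \<delta>'(1,2)] w by simp
  obtain A where A: "orthogonal_transformation A" "\<And>v. norm v < \<delta>' \<Longrightarrow> F1 v = F (w + A v)"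
    using fchart_match[OF \<delta>'(4) F2] by blast
  define u2 where "u2 = A u1"
  have u2: "norm u2 = 1"
    using orthogonal_transformation_norm_eq[OF A(1)] \<delta>'(5) by (simp add: u2_def)
  have near: "g (t0 + \<tau>) = F (w + of_real \<tau> * u2)" if "\<bar>\<tau>\<bar> < \<delta>'" for \<tau>
    using \<delta>'(5,6) that A(2)[of "of_real \<tau> * u1"]
    by (simp add: norm_mult u2_def orthogonal_transformation_of_real_mult[OF A(1)])
  define L' where "L' = L + \<epsilon> / 3"
  define a where "a = w - of_real t0 * u2"
  define k where "k t = F (a + of_real t * u2)" for t
  have k: "k t = F (w + of_real (t - t0) * u2)" for t
    by (simp add: k_def a_def algebra_simps)
  have k_traj: "traj {t0<..<L'} k"
    unfolding k_def
  proof (rule traj_of_dev[OF dev_fchart[OF F] u2])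
    fix t assume t: "t \<in> {t0<..<L'}"
    have "norm (w + of_real (t - t0) * u2) \<le> norm w + norm (of_real (t - t0) * u2)"
      by (rule norm_triangle_ineq)
    also have "\<dots> = norm w + (t - t0)"
      using t u2 by (simp add: norm_mult del: of_real_diff)
    also have "\<dots> < \<epsilon>"
      using w dp t t0 by (simp add: L'_def)
    finally show "a + of_real t * u2 \<in> ball 0 \<epsilon>"
      by (simp add: a_def algebra_simps)
  qed simp
  have agree: "g t = k t" if t: "t \<in> {t0<..<L}" for t
  proof (rule traj_unique[where S = "{t0<..<L}" and V = "{t0<..<min L (t0 + \<delta>')}"])
    show "traj {t0<..<L} g"
      by (rule traj_subset[OF g]) (use t0 in auto)
    show "traj {t0<..<L} k"
      by (rule traj_subset[OF k_traj]) (use \<epsilon> in \<open>auto simp: L'_def\<close>)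
    show "g v = k v" if "v \<in> {t0<..<min L (t0 + \<delta>')}" for v
      using near[of "v - t0"] that by (simp add: k)
  qed (use t t0 \<delta>'(1) in auto)
  define g' where "g' t = (if t < L then g t else k t)" for t
  have "traj {0<..<L'} g'"
  proof (rule traj_local)
    fix s assume s: "s \<in> {0<..<L'}"
    show "\<exists>V h. s \<in> V \<and> V \<subseteq> {0<..<L'} \<and> traj V h \<and> (\<forall>t\<in>V. g' t = h t)"
    proof (cases "s < L")
      case True
      then show ?thesis
        using g s \<epsilon> by (intro exI[of _ "{0<..<L}"] exI[of _ g]) (auto simp: g'_def L'_def)
    next
      case False
      then show ?thesis
        using k_traj s \<epsilon> t0 agree by (intro exI[of _ "{t0<..<L'}"] exI[of _ k]) (auto simp: g'_def L'_def)
    qed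
  qed
  moreover have "L' > L"
    using \<epsilon> by (simp add: L'_def)
  ultimately show ?thesis
    by (intro exI[of _ L'] conjI exI[of _ g']) (auto simp: g'_def)
qed

text \<open>Compactness gives a limit along some sequence of times, and the Lipschitz bound turns it
  into a limit along all times with the stated rate.\<close>

lemma traj_limit:
  assumes g: "traj {0<..<L} g" and L: "0 < L"
  shows "\<exists>p\<in>M. \<forall>t. 0 < t \<and> t < L \<longrightarrow> d (g t) p \<le> L - t"
proof -
  \<comment> \<open>The summand 2 keeps even the first time positive.\<close>
  define \<sigma> where "\<sigma> n = L - L / (real n + 2)" for n
  have \<sigma>: "0 < \<sigma> n" "\<sigma> n < L" for n
    using L by (auto simp: \<sigma>_def field_simps add_pos_nonneg)
  have "range (g \<circ> \<sigma>) \<subseteq> M"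
    using traj_mem[OF g] \<sigma> by auto
  then obtain p r where p: "p \<in> M" "strict_mono r" "limitin mtopology ((g \<circ> \<sigma>) \<circ> r) p sequentially"
    using compact unfolding compact_space_sequentially by blast
  have "d (g t) p \<le> L - t" if t: "0 < t" "t < L" for t
  proof (rule field_le_epsilon)
    fix e :: real assume e: "0 < e"
    obtain N where N: "\<And>n. n \<ge> N \<Longrightarrow> d (((g \<circ> \<sigma>) \<circ> r) n) p < e"
      using p(3) e unfolding limit_metric_sequentially by blast
    obtain n0 :: nat where n0: "L / (L - t) < real n0"
      using reals_Archimedean2 by blast
    define n where "n = r (max N n0)"
    have "max N n0 \<le> n"
      unfolding n_def by (rule seq_suble[OF p(2)])
    then have "L / (L - t) < real n + 2"
      using n0 by linarith
    then have ln: "t \<le> \<sigma> n"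
      using t L by (simp add: \<sigma>_def field_simps)
    have "d (g t) (g (\<sigma> n)) \<le> \<sigma> n - t"
      by (rule traj_lipschitz[OF g ln]) (use t \<sigma>[of n] in auto)
    moreover have "d (g (\<sigma> n)) p < e"
      using N[of "max N n0"] by (simp add: n_def)
    moreover have "g t \<in> M" "g (\<sigma> n) \<in> M"
      using traj_mem[OF g] t \<sigma> by auto
    ultimately show "d (g t) p \<le> L - t + e"
      using triangle[of "g t" "g (\<sigma> n)" p] p(1) \<sigma>[of n] by linarith
  qed
  then show ?thesis
    using p(1) by blast
qed

text \<open>Extensions are unique, so all of them combine into one up to the supremum of their
  lengths. If that is finite, the limit point is singular, as otherwise a longer extension would
  exist.\<close>

lemma traj_extend:
  assumes g0: "traj {0<..<\<eta>} g0" and \<eta>: "0 < \<eta>"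
  shows "\<exists>g. (\<forall>t\<in>{0<..<\<eta>}. g t = g0 t) \<and>
    (traj {0<..} g \<or> (\<exists>L\<ge>\<eta>. traj {0<..<L} g \<and> g L \<in> Sing \<inter> M \<and> (\<forall>t. 0 < t \<and> t < L \<longrightarrow> d (g t) (g L) \<le> L - t)))"
proof -
  define C where "C = {L. \<eta> \<le> L \<and> (\<exists>g. traj {0<..<L} g \<and> (\<forall>t\<in>{0<..<\<eta>}. g t = g0 t))}"
  have "\<eta> \<in> C"
    using g0 by (auto simp: C_def)
  have "\<forall>L\<in>C. \<exists>g. traj {0<..<L} g \<and> (\<forall>t\<in>{0<..<\<eta>}. g t = g0 t)"
    by (auto simp: C_def)
  then obtain G where G: "\<And>L. L \<in> C \<Longrightarrow> traj {0<..<L} (G L)"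
    "\<And>L t. L \<in> C \<Longrightarrow> t \<in> {0<..<\<eta>} \<Longrightarrow> G L t = g0 t"
    by metis
  have le: "\<eta> \<le> L" if "L \<in> C" for L
    using that by (simp add: C_def)
  have agree: "G L t = G L' t" if L: "L \<in> C" "L' \<in> C" and t: "0 < t" "t < L" "t < L'" for L L' t
  proof (rule traj_unique[where S = "{0<..<min L L'}" and V = "{0<..<\<eta>}"])
    show "traj {0<..<min L L'} (G L)" "traj {0<..<min L L'} (G L')"
      by (auto intro!: traj_subset[OF G(1)[OF L(1)]] traj_subset[OF G(1)[OF L(2)]])
    show "G L v = G L' v" if "v \<in> {0<..<\<eta>}" for v
      using G(2)[OF L(1) that] G(2)[OF L(2) that] by simp
    show "{0<..<\<eta>} \<subseteq> {0<..<min L L'}"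
      using le[OF L(1)] le[OF L(2)] by auto
  qed (use t \<eta> in auto)
  define g where "g t = G (SOME L. L \<in> C \<and> t < L) t" for t
  have g: "g t = G L t" if "L \<in> C" "0 < t" "t < L" for L t
  proof -
    have "(SOME L. L \<in> C \<and> t < L) \<in> C \<and> t < (SOME L. L \<in> C \<and> t < L)"
      by (rule someI[of "\<lambda>L. L \<in> C \<and> t < L" L]) (use that in simp)
    then show ?thesis
      unfolding g_def using agree that by blast
  qed
  have ext: "g t = g0 t" if "t \<in> {0<..<\<eta>}" for t
    using g[OF \<open>\<eta> \<in> C\<close>, of t] G(2)[OF \<open>\<eta> \<in> C\<close> that] that by simp
  have trj: "traj S g" if S: "\<And>s. s \<in> S \<Longrightarrow> 0 < s \<and> (\<exists>L\<in>C. s < L \<and> {0<..<L} \<subseteq> S)" for S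
  proof (rule traj_local)
    fix s assume "s \<in> S"
    then obtain L where L: "0 < s" "L \<in> C" "s < L" "{0<..<L} \<subseteq> S"
      using S by blast
    then show "\<exists>V h. s \<in> V \<and> V \<subseteq> S \<and> traj V h \<and> (\<forall>t\<in>V. g t = h t)"
      using G(1)[OF L(2)] g[OF L(2)] by (intro exI[of _ "{0<..<L}"] exI[of _ "G L"]) auto
  qed
  show ?thesis
  proof (cases "bdd_above C")
    case False
    have "traj {0<..} g"
    proof (rule trj)
      fix s :: real assume "s \<in> {0<..}"
      moreover obtain L where "L \<in> C" "s < L"
        using False unfolding bdd_above_def by (meson not_le)
      ultimately show "0 < s \<and> (\<exists>L\<in>C. s < L \<and> {0<..<L} \<subseteq> {0<..})"
        by auto
    qed
    then show ?thesis
      using ext by blast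
  next
    case True
    define m where "m = Sup C"
    have up: "L \<le> m" if "L \<in> C" for L
      unfolding m_def by (rule cSup_upper[OF that True])
    have \<eta>m: "\<eta> \<le> m"
      using up[OF \<open>\<eta> \<in> C\<close>] .
    have gm: "traj {0<..<m} g"
    proof (rule trj)
      fix s assume s: "s \<in> {0<..<m}"
      then obtain L where L: "L \<in> C" "s < L"
        using less_cSup_iff[OF _ True, of s] \<open>\<eta> \<in> C\<close> by (auto simp: m_def)
      then show "0 < s \<and> (\<exists>L\<in>C. s < L \<and> {0<..<L} \<subseteq> {0<..<m})"
        using s up[OF L(1)] by (auto intro!: bexI[of _ L])
    qed
    obtain p where p: "p \<in> M" "\<And>t. 0 < t \<Longrightarrow> t < m \<Longrightarrow> d (g t) p \<le> m - t"
      using traj_limit[OF gm] \<eta> \<eta>m by auto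
    have "p \<in> Sing"
    proof (rule ccontr)
      assume "p \<notin> Sing"
      then obtain L' g' where L': "L' > m" "traj {0<..<L'} g'" "\<forall>t\<in>{0<..<m}. g' t = g t"
        using traj_extend_nonsingular[OF gm _ _ p(2)] p(1) \<eta> \<eta>m by auto
      then have "L' \<in> C"
        using ext \<eta>m by (auto simp: C_def intro!: exI[of _ g'])
      then show False
        using up L'(1) by force
    qed
    \<comment> \<open>No extension reaches beyond \<open>m\<close>, so \<open>g m\<close> is an
      arbitrary value and is replaced by the limit.\<close>
    define g2 where "g2 t = (if t = m then p else g t)" for t
    have "traj {0<..<m} g2"
      by (rule traj_local) (use gm in \<open>auto simp: g2_def intro!: exI[of _ "{0<..<m}"] exI[of _ g]\<close>)
    then show ?thesis
      using ext \<eta>m p \<open>p \<in> Sing\<close>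
      by (intro exI[of _ g2] conjI disjI2 exI[of _ m]) (auto simp: g2_def)
  qed
qed

end

context Metric_space begin

subsection \<open>Developing maps to the plane\<close>

text \<open>In contrast to \<open>dev\<close> this maps the space to the plane. It uses unfolded
  charts: a boundary point has only a half disk about it, and \<phi> is inverted by \<open>s\<close>
  up to a rigid motion.\<close>

definition developing :: "'a set \<Rightarrow> ('a \<Rightarrow> complex) \<Rightarrow> bool" where
  "developing A s \<longleftrightarrow> (\<forall>p\<in>A. \<exists>H \<epsilon> \<phi> L. H \<in> {UNIV, upper} \<and> 0 < \<epsilon> \<and> chart H p \<epsilon> \<phi> \<and>
     orthogonal_transformation L \<and> (\<forall>v\<in>ball 0 \<epsilon> \<inter> H. \<phi> v \<in> A \<and> s (\<phi> v) = s p + L v))"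

lemma developingI:
  assumes "\<And>p. p \<in> A \<Longrightarrow> \<exists>H \<epsilon> \<phi> L. H \<in> {UNIV, upper} \<and> 0 < \<epsilon> \<and> chart H p \<epsilon> \<phi> \<and>
     orthogonal_transformation L \<and> (\<forall>v\<in>ball 0 \<epsilon> \<inter> H. \<phi> v \<in> A \<and> s (\<phi> v) = s p + L v)"
  shows "developing A s"
  unfolding developing_def using assms by (rule ballI)

lemma developing_at:
  assumes "H \<in> {UNIV, upper}" "0 < \<epsilon>" "chart H p \<epsilon> \<phi>" "orthogonal_transformation L"
    "\<forall>v\<in>ball 0 \<epsilon> \<inter> H. \<phi> v \<in> A \<and> s (\<phi> v) = s p + L v"
  shows "\<exists>H \<epsilon> \<phi> L. H \<in> {UNIV, upper} \<and> 0 < \<epsilon> \<and> chart H p \<epsilon> \<phi> \<and>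
     orthogonal_transformation L \<and> (\<forall>v\<in>ball 0 \<epsilon> \<inter> H. \<phi> v \<in> A \<and> s (\<phi> v) = s p + L v)"
  by (intro exI conjI) (rule assms)+

lemma developing_atE:
  assumes "developing A s" "p \<in> A"
  obtains H \<epsilon> \<phi> L where "H \<in> {UNIV, upper}" "0 < \<epsilon>" "chart H p \<epsilon> \<phi>"
    "orthogonal_transformation L" "\<forall>v\<in>ball 0 \<epsilon> \<inter> H. \<phi> v \<in> A \<and> s (\<phi> v) = s p + L v"
  using bspec[OF assms(1)[unfolded developing_def] assms(2)] by (elim exE conjE) (rule that)

lemma chart_image: "chart H p \<epsilon> \<phi> \<Longrightarrow> 0 < \<epsilon> \<Longrightarrow> 0 \<in> H \<Longrightarrow> \<phi> ` (ball 0 \<epsilon> \<inter> H) = mball p \<epsilon>"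
  using chart_centre_mem[of H p \<epsilon> \<phi>] by (auto simp: chart_def mball_def)

lemma developingE:
  assumes "developing A s" "p \<in> A" "0 < e"
  obtains H \<epsilon> \<phi> L where "H \<in> {UNIV, upper}" "0 \<in> H" "0 < \<epsilon>" "\<epsilon> \<le> e" "chart H p \<epsilon> \<phi>"
    "orthogonal_transformation L" "\<And>v. v \<in> ball 0 \<epsilon> \<inter> H \<Longrightarrow> \<phi> v \<in> A \<and> s (\<phi> v) = s p + L v"
    "mball p \<epsilon> \<subseteq> A" "p \<in> M"
proof -
  obtain H \<epsilon> \<phi> L where *: "H \<in> {UNIV, upper}" "0 < \<epsilon>" "chart H p \<epsilon> \<phi>"
    "orthogonal_transformation L" "\<forall>v\<in>ball 0 \<epsilon> \<inter> H. \<phi> v \<in> A \<and> s (\<phi> v) = s p + L v"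
    by (rule developing_atE[OF assms(1,2)])
  have 0: "0 \<in> H"
    using *(1) by (auto simp: upper_iff)
  define \<epsilon>' where "\<epsilon>' = min \<epsilon> e"
  have \<epsilon>': "0 < \<epsilon>'" "\<epsilon>' \<le> \<epsilon>" "\<epsilon>' \<le> e"
    using *(2) assms(3) by (auto simp: \<epsilon>'_def)
  have ch: "chart H p \<epsilon>' \<phi>"
    by (rule chart_shrink[OF *(3) \<epsilon>'(1,2) 0])
  have in': "\<phi> v \<in> A \<and> s (\<phi> v) = s p + L v" if "v \<in> ball 0 \<epsilon>' \<inter> H" for v
    using bspec[OF *(5), of v] that \<epsilon>'(2) by simp
  have "mball p \<epsilon>' \<subseteq> A"
    unfolding chart_image[OF ch \<epsilon>'(1) 0, symmetric] using in' by (intro image_subsetI) simp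
  then show ?thesis
    by (intro that[OF *(1) 0 \<epsilon>'(1,3) ch *(4) in'] chart_centre_mem[OF ch \<epsilon>'(1) 0])
qed

text \<open>The charts witnessing the two maps at \<open>p\<close> differ by an orthogonal
  transition, which is absorbed into the linear part of one of them.\<close>

lemma developing_pair:
  assumes "developing A s" "developing A s'" "p \<in> A"
  obtains H \<epsilon> \<phi> L L' where "H \<in> {UNIV, upper}" "0 \<in> H" "0 < \<epsilon>" "chart H p \<epsilon> \<phi>" "mball p \<epsilon> \<subseteq> A" "p \<in> M"
    "orthogonal_transformation L" "orthogonal_transformation L'"
    "\<And>v. v \<in> ball 0 \<epsilon> \<inter> H \<Longrightarrow> s (\<phi> v) = s p + L v" "\<And>v. v \<in> ball 0 \<epsilon> \<inter> H \<Longrightarrow> s' (\<phi> v) = s' p + L' v"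
proof -
  obtain H1 \<epsilon>1 \<phi>1 L1 where 1: "H1 \<in> {UNIV, upper}" "0 \<in> H1" "0 < \<epsilon>1" "chart H1 p \<epsilon>1 \<phi>1"
    "orthogonal_transformation L1" "\<And>v. v \<in> ball 0 \<epsilon>1 \<inter> H1 \<Longrightarrow> \<phi>1 v \<in> A \<and> s (\<phi>1 v) = s p + L1 v"
    by (rule developingE[OF assms(1,3) zero_less_one]) blast
  obtain H \<epsilon> \<phi> L where 2: "H \<in> {UNIV, upper}" "0 \<in> H" "0 < \<epsilon>" "\<epsilon> \<le> \<epsilon>1" "chart H p \<epsilon> \<phi>"
    "orthogonal_transformation L" "\<And>v. v \<in> ball 0 \<epsilon> \<inter> H \<Longrightarrow> \<phi> v \<in> A \<and> s' (\<phi> v) = s' p + L v"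
    "mball p \<epsilon> \<subseteq> A" "p \<in> M"
    by (rule developingE[OF assms(2,3) 1(3)]) blast
  have ch1: "chart H1 p \<epsilon> \<phi>1"
    by (rule chart_shrink[OF 1(4) 2(3,4) 1(2)])
  obtain T where T: "orthogonal_transformation T" "\<And>v. v\<in>ball 0 \<epsilon> \<inter> H \<Longrightarrow> T v \<in> H \<and> \<phi> v = \<phi>1 (T v)"
    and H1: "H = H1"
    using chart_transition[OF 2(5) ch1 2(3) 2(1) 1(1)] by blast
  have eq: "s (\<phi> v) = s p + (L1 \<circ> T) v" if v: "v \<in> ball 0 \<epsilon> \<inter> H" for v
  proof -
    have "T v \<in> ball 0 \<epsilon>1 \<inter> H1"
      using T(2)[OF v] H1 v 2(4) orthogonal_transformation_norm_eq[OF T(1), of v] by simp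
    then show ?thesis
      using 1(6) T(2)[OF v] by simp
  qed
  show ?thesis
    by (rule that[OF 2(1,2,3,5,8,9) orthogonal_transformation_compose[OF 1(5) T(1)] 2(6) eq])
      (use 2(7) in simp_all)
qed

lemma developing_local:
  assumes "\<And>p. p \<in> A \<Longrightarrow> \<exists>B s'. p \<in> B \<and> B \<subseteq> A \<and> developing B s' \<and> (\<forall>q\<in>B. s q = s' q)"
  shows "developing A s"
proof (rule developingI)
  fix p assume p: "p \<in> A"
  obtain B s' where B: "p \<in> B" "B \<subseteq> A" "developing B s'" "\<forall>q\<in>B. s q = s' q"
    using assms[OF p] by blast
  obtain H \<epsilon> \<phi> L where *: "H \<in> {UNIV, upper}" "0 < \<epsilon>" "chart H p \<epsilon> \<phi>"
    "orthogonal_transformation L" "\<forall>v\<in>ball 0 \<epsilon> \<inter> H. \<phi> v \<in> B \<and> s' (\<phi> v) = s' p + L v"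
    by (rule developing_atE[OF B(3,1)])
  have "\<forall>v\<in>ball 0 \<epsilon> \<inter> H. \<phi> v \<in> A \<and> s (\<phi> v) = s p + L v"
    using *(5) B by auto
  then show "\<exists>H \<epsilon> \<phi> L. H \<in> {UNIV, upper} \<and> 0 < \<epsilon> \<and> chart H p \<epsilon> \<phi> \<and>
     orthogonal_transformation L \<and> (\<forall>v\<in>ball 0 \<epsilon> \<inter> H. \<phi> v \<in> A \<and> s (\<phi> v) = s p + L v)"
    by (rule developing_at[OF *(1-4)])
qed

lemma developing_subset:
  assumes "developing A s" "openin mtopology B" "B \<subseteq> A"
  shows "developing B s"
proof (rule developingI)
  fix p assume p: "p \<in> B"
  then obtain r where r: "r > 0" "mball p r \<subseteq> B"
    using assms(2) unfolding openin_mtopology by blast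
  obtain H \<epsilon> \<phi> L where *: "H \<in> {UNIV, upper}" "0 \<in> H" "0 < \<epsilon>" "\<epsilon> \<le> r" "chart H p \<epsilon> \<phi>"
    "orthogonal_transformation L" "\<And>v. v \<in> ball 0 \<epsilon> \<inter> H \<Longrightarrow> \<phi> v \<in> A \<and> s (\<phi> v) = s p + L v"
    by (rule developingE[OF assms(1) subsetD[OF assms(3) p] r(1)]) blast
  have "\<phi> v \<in> B" if "v \<in> ball 0 \<epsilon> \<inter> H" for v
  proof -
    have "\<phi> v \<in> mball p \<epsilon>"
      unfolding chart_image[OF *(5,3,2), symmetric] using that by (rule imageI)
    then show ?thesis
      using r(2) mball_subset_concentric[OF *(4), of p] by (meson subsetD)
  qed
  then have "\<forall>v\<in>ball 0 \<epsilon> \<inter> H. \<phi> v \<in> B \<and> s (\<phi> v) = s p + L v"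
    using *(7) by simp
  then show "\<exists>H \<epsilon> \<phi> L. H \<in> {UNIV, upper} \<and> 0 < \<epsilon> \<and> chart H p \<epsilon> \<phi> \<and>
     orthogonal_transformation L \<and> (\<forall>v\<in>ball 0 \<epsilon> \<inter> H. \<phi> v \<in> B \<and> s (\<phi> v) = s p + L v)"
    by (rule developing_at[OF *(1,3,5,6)])
qed

lemma developing_affine:
  assumes "developing A s" "orthogonal_transformation L0"
  shows "developing A (\<lambda>p. c + L0 (s p))"
proof (rule developingI)
  fix p assume p: "p \<in> A"
  obtain H \<epsilon> \<phi> L where *: "H \<in> {UNIV, upper}" "0 < \<epsilon>" "chart H p \<epsilon> \<phi>"
    "orthogonal_transformation L" "\<forall>v\<in>ball 0 \<epsilon> \<inter> H. \<phi> v \<in> A \<and> s (\<phi> v) = s p + L v"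
    by (rule developing_atE[OF assms(1) p])
  have "\<forall>v\<in>ball 0 \<epsilon> \<inter> H. \<phi> v \<in> A \<and> c + L0 (s (\<phi> v)) = c + L0 (s p) + (L0 \<circ> L) v"
    using *(5) by (simp add: linear_add[OF orthogonal_transformation_linear[OF assms(2)]])
  moreover have "orthogonal_transformation (L0 \<circ> L)"
    by (rule orthogonal_transformation_compose[OF assms(2) *(4)])
  ultimately show "\<exists>H \<epsilon> \<phi> L. H \<in> {UNIV, upper} \<and> 0 < \<epsilon> \<and> chart H p \<epsilon> \<phi> \<and> orthogonal_transformation L \<and>
     (\<forall>v\<in>ball 0 \<epsilon> \<inter> H. \<phi> v \<in> A \<and> c + L0 (s (\<phi> v)) = c + L0 (s p) + L v)"
    by (intro developing_at[OF *(1-3)])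
qed

text \<open>In a common chart both maps are affine. If they agree near any point of the chart ball,
  their linear parts and then their constants coincide, so the ball is either inside or disjoint
  from the set of local agreement.\<close>

lemma developing_unique:
  assumes conn: "connectedin mtopology A" and s: "developing A s" and s': "developing A s'"
    and V: "openin mtopology V" "V \<noteq> {}" "V \<subseteq> A" and eq: "\<And>p. p \<in> V \<Longrightarrow> s p = s' p"
    and q: "q \<in> A"
  shows "s q = s' q"
proof -
  define A1 where "A1 = {p \<in> A. \<exists>e>0. mball p e \<subseteq> A \<and> (\<forall>q\<in>mball p e. s q = s' q)}"
  have AM: "A \<subseteq> M"
    using connectedin_subset_topspace[OF conn] by simp
  have A1V: "p \<in> A1" if U: "openin mtopology U" "p \<in> U" "U \<subseteq> A" "\<And>q. q \<in> U \<Longrightarrow> s q = s' q" for p U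
  proof -
    obtain e where e: "e > 0" "mball p e \<subseteq> U"
      using U(1,2) unfolding openin_mtopology by meson
    then have "\<forall>q\<in>mball p e. s q = s' q"
      using U(4) by (meson subsetD)
    then show ?thesis
      using e U(2,3) unfolding A1_def by auto
  qed
  have op1: "openin mtopology A1"
    unfolding openin_mtopology
  proof (intro conjI allI impI)
    show "A1 \<subseteq> M"
      using AM by (auto simp: A1_def)
    fix p assume "p \<in> A1"
    then obtain e where e: "e > 0" "mball p e \<subseteq> A" "\<forall>q\<in>mball p e. s q = s' q"
      by (auto simp: A1_def)
    then have "mball p e \<subseteq> A1"
      using A1V[OF openin_mball, of _ p e] by blast
    then show "\<exists>r>0. mball p r \<subseteq> A1"
      using e(1) by blast
  qed
  have op2: "openin mtopology (A - A1)"
    unfolding openin_mtopology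
  proof (intro conjI allI impI)
    show "A - A1 \<subseteq> M"
      using AM by blast
    fix p assume p: "p \<in> A - A1"
    then have pA: "p \<in> A"
      by blast
    obtain H \<epsilon> \<phi> L L' where *: "H \<in> {UNIV, upper}" "0 \<in> H" "0 < \<epsilon>" "chart H p \<epsilon> \<phi>" "mball p \<epsilon> \<subseteq> A" "p \<in> M"
      "orthogonal_transformation L" "orthogonal_transformation L'"
      "\<And>v. v \<in> ball 0 \<epsilon> \<inter> H \<Longrightarrow> s (\<phi> v) = s p + L v" "\<And>v. v \<in> ball 0 \<epsilon> \<inter> H \<Longrightarrow> s' (\<phi> v) = s' p + L' v"
      by (rule developing_pair[OF s s' pA]) blast
    have img: "\<phi> ` (ball 0 \<epsilon> \<inter> H) = mball p \<epsilon>"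
      by (rule chart_image[OF *(4,3,2)])
    have "mball p \<epsilon> \<inter> A1 = {}"
    proof (rule ccontr)
      assume "mball p \<epsilon> \<inter> A1 \<noteq> {}"
      then obtain q where q: "q \<in> \<phi> ` (ball 0 \<epsilon> \<inter> H)" "q \<in> A1"
        unfolding img by blast
      obtain v0 where v0: "v0 \<in> ball 0 \<epsilon> \<inter> H" "\<phi> v0 \<in> A1"
        using q by (elim imageE) simp
      then obtain e where e: "e > 0" "\<forall>q\<in>mball (\<phi> v0) e. s q = s' q"
        by (auto simp: A1_def)
      define \<eta> where "\<eta> = min e (\<epsilon> - norm v0)"
      have \<eta>: "0 < \<eta>" "\<eta> \<le> e" "\<eta> \<le> \<epsilon> - norm v0"
        using e(1) v0 by (auto simp: \<eta>_def)
      \<comment> \<open>In a half disk \<open>v0\<close> may lie on the diameter. Removing the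
        diameter leaves a set that is open in the plane, and moving \<open>v0\<close> upwards shows
        that it is nonempty.\<close>
      define U where "U = ball v0 \<eta> \<inter> (if H = UNIV then UNIV else {v. 0 < Im v})"
      have opU: "open U"
        unfolding U_def by (auto intro!: open_Int simp: open_halfspace_Im_gt)
      define v1 where "v1 = v0 + \<i> * of_real (\<eta> / 2)"
      have v1: "v1 \<in> U"
        using \<eta>(1) v0 *(1) by (auto simp: U_def v1_def dist_norm norm_mult upper_iff)
      have UH: "v \<in> ball 0 \<epsilon> \<inter> H" if "v \<in> U" for v
      proof -
        have "norm v < \<epsilon>"
          using that \<eta>(3) norm_triangle_sub[of v v0] by (simp add: U_def dist_norm norm_minus_commute)
        moreover have "v \<in> H"
          using that *(1) by (auto simp: U_def upper_iff split: if_splits)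
        ultimately show ?thesis
          by simp
      qed
      have Ueq: "s p + L v = s' p + L' v" if "v \<in> U" for v
      proof -
        have "d (\<phi> v0) (\<phi> v) = dist v0 v"
          using *(4) v0(1) UH[OF that] unfolding chart_def by blast
        moreover have "\<phi> v \<in> M" "\<phi> v0 \<in> M"
          using imageI[OF v0(1), of \<phi>] imageI[OF UH[OF that], of \<phi>] unfolding img by simp_all
        ultimately have "\<phi> v \<in> mball (\<phi> v0) e"
          using that \<eta>(2) by (auto simp: U_def)
        then show ?thesis
          using bspec[OF e(2)] *(9,10)[OF UH[OF that]] by simp
      qed
      have lin: "linear L" "linear L'"
        using *(7,8) by (auto simp: orthogonal_transformation_linear)
      have "L = L'"
      proof (rule linear_eq_of_eq_on_open[OF lin])
        show "open ((\<lambda>w. w - v1) ` U)"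
          by (rule open_translation_subtract[OF opU])
        show "0 \<in> (\<lambda>w. w - v1) ` U"
          using v1 by (auto intro!: image_eqI[of _ _ v1])
        show "L v = L' v" if v: "v \<in> (\<lambda>w. w - v1) ` U" for v
        proof -
          obtain w where w: "w \<in> U" "v = w - v1"
            using v by blast
          show ?thesis
            using Ueq[OF w(1)] Ueq[OF v1]
            unfolding w(2) linear_diff[OF lin(1)] linear_diff[OF lin(2)]
            by (metis add_diff_cancel_left)
        qed
      qed
      then have "s p = s' p"
        using Ueq[OF v1] by simp
      have "s q = s' q" if q: "q \<in> mball p \<epsilon>" for q
      proof -
        obtain v where v: "v \<in> ball 0 \<epsilon> \<inter> H" "q = \<phi> v"
          using q unfolding img[symmetric] by (elim imageE) simp
        then show ?thesis
          using *(9,10)[OF v(1)] \<open>L = L'\<close> \<open>s p = s' p\<close> by simp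
      qed
      then have "p \<in> A1"
        using A1V[OF openin_mball, of p p \<epsilon>] *(3,5,6) by simp
      then show False
        using p by blast
    qed
    then have "mball p \<epsilon> \<subseteq> A - A1"
      using *(5) by blast
    then show "\<exists>r>0. mball p r \<subseteq> A - A1"
      using *(3) by blast
  qed
  have "A \<inter> A1 \<noteq> {}"
    using A1V[OF V(1) _ V(3)] V(2,3) eq by blast
  then have "A \<inter> (A - A1) = {}"
    using conn op1 op2 unfolding connectedin by blast
  then have "q \<in> A1"
    using q by blast
  then show ?thesis
    using AM q by (auto simp: A1_def)
qed

lemma developing_match:
  assumes "developing A s" "developing A s'" "p \<in> A"
  obtains c L e where "orthogonal_transformation L" "0 < e" "mball p e \<subseteq> A" "p \<in> M"
    "\<And>q. q \<in> mball p e \<Longrightarrow> s q = c + L (s' q)"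
proof -
  obtain H \<epsilon> \<phi> L L' where *: "H \<in> {UNIV, upper}" "0 \<in> H" "0 < \<epsilon>" "chart H p \<epsilon> \<phi>" "mball p \<epsilon> \<subseteq> A" "p \<in> M"
    "orthogonal_transformation L" "orthogonal_transformation L'"
    "\<And>v. v \<in> ball 0 \<epsilon> \<inter> H \<Longrightarrow> s (\<phi> v) = s p + L v" "\<And>v. v \<in> ball 0 \<epsilon> \<inter> H \<Longrightarrow> s' (\<phi> v) = s' p + L' v"
    by (rule developing_pair[OF assms]) blast
  define K where "K = L \<circ> inv L'"
  have K: "orthogonal_transformation K"
    unfolding K_def by (rule orthogonal_transformation_compose[OF *(7) orthogonal_transformation_inv[OF *(8)]])
  have KL: "K (L' v) = L v" for v
    using inv_f_f[OF orthogonal_transformation_inj[OF *(8)]] by (simp add: K_def)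
  have lin: "linear K"
    by (rule orthogonal_transformation_linear[OF K])
  have "s q = (s p - K (s' p)) + K (s' q)" if q: "q \<in> mball p \<epsilon>" for q
  proof -
    obtain v where v: "v \<in> ball 0 \<epsilon> \<inter> H" "q = \<phi> v"
      using q unfolding chart_image[OF *(4,3,2), symmetric] by (elim imageE) simp
    then show ?thesis
      using *(9,10)[OF v(1)] by (simp add: linear_add[OF lin] KL)
  qed
  then show ?thesis
    by (rule that[OF K *(3,5,6)])
qed

text \<open>The inverse of a chart is a developing map on its ball; at the other points of the ball
  the chart is recentred.\<close>

lemma developing_chart:
  assumes ch: "chart H p \<epsilon> f" and H: "H \<in> {UNIV, upper}" and \<epsilon>: "0 < \<epsilon>"
  shows "\<exists>s. developing (mball p \<epsilon>) s"
proof -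
  have 0: "0 \<in> H"
    using H by (auto simp: upper_iff)
  have img: "f ` (ball 0 \<epsilon> \<inter> H) = mball p \<epsilon>"
    by (rule chart_image[OF ch \<epsilon> 0])
  define s where "s = inv_into (ball 0 \<epsilon> \<inter> H) f"
  have inj: "inj_on f (ball 0 \<epsilon> \<inter> H)"
  proof (rule inj_onI)
    fix v w assume vw: "v \<in> ball 0 \<epsilon> \<inter> H" "w \<in> ball 0 \<epsilon> \<inter> H" "f v = f w"
    have "dist v w = d (f v) (f w)"
      using ch vw(1,2) unfolding chart_def by simp
    also have "\<dots> = 0"
      using imageI[OF vw(2), of f] vw(3) unfolding img by simp
    finally show "v = w"
      by simp
  qed
  have sf: "s (f v) = v" if "v \<in> ball 0 \<epsilon> \<inter> H" for v
    unfolding s_def by (rule inv_into_f_f[OF inj that])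
  have "developing (mball p \<epsilon>) s"
  proof (rule developingI)
    fix q assume q: "q \<in> mball p \<epsilon>"
    obtain w where w: "w \<in> ball 0 \<epsilon> \<inter> H" "q = f w"
      using q unfolding img[symmetric] by (elim imageE) simp
    \<comment> \<open>A point on the diameter keeps a half disk; any other point gets a full disk,
      small enough to miss the diameter.\<close>
    define H' \<delta> where "H' = (if H = upper \<and> Im w = 0 then upper else UNIV)"
      and "\<delta> = (if H = upper \<and> Im w > 0 then min (\<epsilon> - norm w) (Im w) else \<epsilon> - norm w)"
    have \<delta>: "0 < \<delta>" "norm w + \<delta> \<le> \<epsilon>"
      using w by (auto simp: \<delta>_def)
    have mem: "v \<in> H' \<longleftrightarrow> w + id v \<in> H" if "v \<in> ball 0 \<delta>" for v
      using that abs_Im_le_cmod[of v] H w by (auto simp: H'_def \<delta>_def upper_iff split: if_splits)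
    have wH: "w \<in> H"
      using w by simp
    have "chart H' q \<delta> (\<lambda>v. f (w + id v))"
      unfolding w(2) by (rule chart_recentre[OF ch 0 orthogonal_transformation_id' wH \<delta>(2,1) mem])
    moreover have "f (w + id v) \<in> mball p \<epsilon> \<and> s (f (w + id v)) = s q + id v" if v: "v \<in> ball 0 \<delta> \<inter> H'" for v
    proof -
      have "w + v \<in> ball 0 \<epsilon> \<inter> H"
        using mem[of v] v \<delta>(2) norm_triangle_ineq[of w v] by auto
      then show ?thesis
        using sf[of "w + v"] sf[OF w(1)] w(2) unfolding img[symmetric] by simp
    qed
    moreover have "H' \<in> {UNIV, upper}"
      by (simp add: H'_def)
    ultimately show "\<exists>H \<epsilon>' \<phi> L. H \<in> {UNIV, upper} \<and> 0 < \<epsilon>' \<and> chart H q \<epsilon>' \<phi> \<and> orthogonal_transformation L \<and>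
       (\<forall>v\<in>ball 0 \<epsilon>' \<inter> H. \<phi> v \<in> mball p \<epsilon> \<and> s (\<phi> v) = s q + L v)"
      by (intro developing_at[OF _ \<delta>(1) _ orthogonal_transformation_id']) blast+
  qed
  then show ?thesis
    by blast
qed

lemma no_compact_developing:
  assumes s: "developing M s" and K: "compact_space mtopology" and ne: "M \<noteq> {}"
  shows False
proof -
  have "continuous_map mtopology Met_TC.mtopology (\<lambda>p. norm (s p))"
    unfolding Met_TC.continuous_map_to_metric
  proof (intro ballI allI impI)
    fix p e assume "p \<in> topspace mtopology" and e: "(0::real) < e"
    then have p: "p \<in> M"
      by simp
    obtain H \<epsilon> \<phi> L where *: "0 \<in> H" "0 < \<epsilon>" "\<epsilon> \<le> e" "chart H p \<epsilon> \<phi>"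
      "orthogonal_transformation L" "\<And>v. v \<in> ball 0 \<epsilon> \<inter> H \<Longrightarrow> \<phi> v \<in> M \<and> s (\<phi> v) = s p + L v"
      by (rule developingE[OF s p e]) blast
    have "norm (s q) \<in> ball (norm (s p)) e" if q: "q \<in> mball p \<epsilon>" for q
    proof -
      obtain v where v: "v \<in> ball 0 \<epsilon> \<inter> H" "q = \<phi> v"
        using q unfolding chart_image[OF *(4,2,1), symmetric] by (elim imageE) simp
      have "\<bar>norm (s p) - norm (s q)\<bar> \<le> norm (s p - s q)"
        by (rule norm_triangle_ineq3)
      also have "\<dots> = norm v"
        using *(6)[OF v(1)] v(2) orthogonal_transformation_norm_eq[OF *(5), of v] by simp
      finally show ?thesis
        using v(1) *(3) by (simp add: dist_real_def)
    qed
    then show "\<exists>U. openin mtopology U \<and> p \<in> U \<and> (\<forall>y\<in>U. norm (s y) \<in> Met_TC.mball (norm (s p)) e)"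
      using p *(2) by (intro exI[of _ "mball p \<epsilon>"]) auto
  qed
  moreover have "compactin mtopology M"
    using K by (simp add: compact_space_def)
  ultimately have "compactin Met_TC.mtopology ((\<lambda>p. norm (s p)) ` M)"
    by (rule image_compactin[rotated])
  then have "compact ((\<lambda>p. norm (s p)) ` M)"
    by simp
  then obtain p where p: "p \<in> M" "\<And>q. q \<in> M \<Longrightarrow> norm (s q) \<le> norm (s p)"
    using compact_attains_sup[of "(\<lambda>p. norm (s p)) ` M"] ne by auto
  obtain H \<epsilon> \<phi> L where *: "H \<in> {UNIV, upper}" "0 < \<epsilon>" "chart H p \<epsilon> \<phi>"
    "orthogonal_transformation L" "\<And>v. v \<in> ball 0 \<epsilon> \<inter> H \<Longrightarrow> \<phi> v \<in> M \<and> s (\<phi> v) = s p + L v"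
    by (rule developingE[OF s p(1) zero_less_one]) blast
  \<comment> \<open>The probes are real, hence on the diameter in the half disk case, so both
    opposite directions are available even at a boundary point.\<close>
  define t where "t = \<epsilon> / 2"
  have t: "0 < t" "of_real t \<in> ball 0 \<epsilon> \<inter> H" "- of_real t \<in> ball 0 \<epsilon> \<inter> H"
    using *(1,2) by (auto simp: t_def upper_iff)
  have Lneg: "L (- of_real t) = - L (of_real t)"
    by (rule linear_neg[OF orthogonal_transformation_linear[OF *(4)]])
  have le: "norm (s p + L (of_real t)) \<le> norm (s p)" "norm (s p - L (of_real t)) \<le> norm (s p)"
    using p(2) *(5)[OF t(2)] *(5)[OF t(3)] Lneg by (metis, metis diff_conv_add_uminus)
  \<comment> \<open>By the parallelogram law this sum exceeds the right hand side by
    \<open>2 * t\<^sup>2\<close>.\<close>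
  have "(norm (s p + L (of_real t)))\<^sup>2 + (norm (s p - L (of_real t)))\<^sup>2 \<le> 2 * (norm (s p))\<^sup>2"
    using power_mono[OF le(1) norm_ge_zero, of 2] power_mono[OF le(2) norm_ge_zero, of 2] by linarith
  moreover have "(norm (s p + L (of_real t)))\<^sup>2 + (norm (s p - L (of_real t)))\<^sup>2 =
     2 * (norm (s p))\<^sup>2 + 2 * (norm (L (of_real t)))\<^sup>2"
    by (simp add: power2_norm_eq_inner inner_add_left inner_add_right inner_diff_left inner_diff_right
        inner_commute)
  moreover have "norm (L (of_real t)) = t"
    using orthogonal_transformation_norm_eq[OF *(4), of "of_real t"] t(1) by simp
  ultimately show False
    using t(1) by simp
qed

text \<open>The developing map is continued outwards over concentric subdisks of the parameter disk.\<close>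

lemma developing_global:
  assumes hom: "homeomorphic_maps mtopology (top_of_set (cball (0::complex) 1)) f g"
    and loc: "\<And>p. p \<in> M \<Longrightarrow> \<exists>H \<epsilon> \<phi>. H \<in> {UNIV, upper} \<and> 0 < \<epsilon> \<and> chart H p \<epsilon> \<phi>"
  shows "\<exists>s. developing M s"
proof -
  define D where "D = cball (0::complex) 1"
  have contf: "continuous_map mtopology (top_of_set D) f" and contg: "continuous_map (top_of_set D) mtopology g"
    and gf: "\<And>p. p \<in> M \<Longrightarrow> g (f p) = p" and fg: "\<And>z. z \<in> D \<Longrightarrow> f (g z) = z"
    using hom by (auto simp: homeomorphic_maps_def D_def)
  have fD: "f p \<in> D" if "p \<in> M" for p
    using contf that continuous_map_image_subset_topspace by fastforce
  have gM: "g z \<in> M" if "z \<in> D" for z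
    using contg that continuous_map_image_subset_topspace by fastforce
  \<comment> \<open>Planar sets are pulled back by the homeomorphism: open sets give open sets and
    convex sets connected ones, so overlaps are controlled by convexity in the plane.\<close>
  define P where "P T = {p \<in> M. f p \<in> T}" for T
  have Pmem: "g z \<in> P T" if "z \<in> D" "z \<in> T" for z T
    using gM[OF that(1)] fg[OF that(1)] that(2) by (simp add: P_def)
  have Pop: "openin mtopology (P T)" if "open T" for T
  proof -
    have "openin mtopology {p \<in> topspace mtopology. f p \<in> D \<inter> T}"
      using contf that by (intro openin_continuous_map_preimage[OF contf]) (simp add: openin_open_Int)
    moreover have "{p \<in> topspace mtopology. f p \<in> D \<inter> T} = P T"
      using fD by (auto simp: P_def)
    ultimately show ?thesis
      by simp
  qed
  have Pconn: "connectedin mtopology (P T)" if "convex T" for T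
  proof -
    have "connectedin (top_of_set D) (D \<inter> T)"
      using that convex_cball[of 0 "1::real"]
      by (auto simp: connectedin_subtopology D_def intro!: convex_connected convex_Int)
    then have "connectedin mtopology (g ` (D \<inter> T))"
      by (rule connectedin_continuous_map_image[OF contg])
    moreover have "g ` (D \<inter> T) = P T"
    proof (intro equalityI subsetI)
      show "p \<in> P T" if "p \<in> g ` (D \<inter> T)" for p
        using that Pmem by blast
      show "p \<in> g ` (D \<inter> T)" if "p \<in> P T" for p
        using that gf fD by (auto simp: P_def intro!: image_eqI[of p g "f p"])
    qed
    ultimately show ?thesis
      by simp
  qed
  define \<G> where "\<G> = {T. open T \<and> (\<exists>s. developing (P T) s)}"
  have "D \<subseteq> \<Union>\<G>"
  proof
    fix z assume z: "z \<in> D"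
    obtain H \<epsilon> \<phi> where *: "H \<in> {UNIV, upper}" "0 < \<epsilon>" "chart H (g z) \<epsilon> \<phi>"
      using loc[OF gM[OF z]] by blast
    obtain s where s: "developing (mball (g z) \<epsilon>) s"
      using developing_chart[OF *(3,1,2)] by blast
    have "openin (top_of_set D) {w \<in> topspace (top_of_set D). g w \<in> mball (g z) \<epsilon>}"
      by (rule openin_continuous_map_preimage[OF contg openin_mball])
    then obtain T where T: "open T" "{w \<in> D. g w \<in> mball (g z) \<epsilon>} = D \<inter> T"
      by (auto simp: openin_open)
    have "P T \<subseteq> mball (g z) \<epsilon>"
    proof
      fix p assume p: "p \<in> P T"
      then have "f p \<in> D \<inter> T"
        using fD by (auto simp: P_def)
      then have "g (f p) \<in> mball (g z) \<epsilon>"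
        using T(2) by blast
      then show "p \<in> mball (g z) \<epsilon>"
        using gf p by (simp add: P_def)
    qed
    then have "developing (P T) s"
      by (rule developing_subset[OF s Pop[OF T(1)]])
    moreover have "z \<in> {w \<in> D. g w \<in> mball (g z) \<epsilon>}"
      using z gM[OF z] *(2) by simp
    then have "z \<in> T"
      unfolding T(2) by blast
    ultimately show "z \<in> \<Union>\<G>"
      using T(1) by (auto simp: \<G>_def)
  qed
  moreover have "compact D"
    by (simp add: D_def)
  moreover have "open T" if "T \<in> \<G>" for T
    using that by (simp add: \<G>_def)
  \<comment> \<open>A Lebesgue number: every disk of radius \<open>l\<close> centred in
    \<open>D\<close> carries a developing map, so the radius can grow by the fixed amount
    \<open>l / 2\<close>.\<close>
  ultimately obtain l where l: "0 < l" "\<And>x. x \<in> D \<Longrightarrow> \<exists>G\<in>\<G>. ball x l \<subseteq> G"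
    using Heine_Borel_lemma[of D \<G>] by metis
  have Pmono: "P S \<subseteq> P T" if "S \<subseteq> T" for S T
    using that by (auto simp: P_def)
  have locsec: "\<exists>s. developing (P (ball x l)) s" if x: "x \<in> D" for x
  proof -
    obtain G where G: "G \<in> \<G>" "ball x l \<subseteq> G"
      using l(2)[OF x] by (elim bexE)
    obtain s where s: "developing (P G) s"
      using G(1) unfolding \<G>_def by (elim CollectE conjE exE)
    show ?thesis
      by (rule exI, rule developing_subset[OF s Pop[OF open_ball] Pmono[OF G(2)]])
  qed
  have "\<exists>s. developing (P (ball 0 (real (Suc n) * (l / 2)))) s" for n
  proof (induction n)
    case 0
    have "0 \<in> D"
      by (simp add: D_def)
    then obtain s where s: "developing (P (ball 0 l)) s"
      using locsec by blast
    have sub: "ball 0 (real (Suc 0) * (l / 2)) \<subseteq> ball (0::complex) l"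
      using l(1) by (intro subset_ball) simp
    show ?case
      by (rule exI, rule developing_subset[OF s Pop[OF open_ball] Pmono[OF sub]])
  next
    case (Suc n)
    define r r' where "r = real (Suc n) * (l / 2)" and "r' = real (Suc (Suc n)) * (l / 2)"
    have r: "l / 2 \<le> r" "r' = r + l / 2"
      using l(1) by (auto simp: r_def r'_def field_simps)
    have rpos: "0 < r"
      using r l(1) by simp
    obtain s where s: "developing (P (ball 0 r)) s"
      using Suc unfolding r_def by (elim exE)
    \<comment> \<open>A local map is composed with a rigid motion so as to continue \<open>s\<close>
      near \<open>g c\<close>; uniqueness on the convex overlap does the rest.\<close>
    have "\<exists>sc. developing (P (ball c l)) sc \<and> (\<forall>p\<in>P (ball c l \<inter> ball 0 r). sc p = s p)"
      if c: "c \<in> D" "norm c < r" for c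
    proof -
      obtain s1 where s1: "developing (P (ball c l)) s1"
        using locsec[OF c(1)] by blast
      let ?T = "ball c l \<inter> ball 0 r"
      have opT: "openin mtopology (P ?T)"
        by (rule Pop) (simp add: open_Int)
      have s1': "developing (P ?T) s1"
        by (rule developing_subset[OF s1 opT Pmono[OF Int_lower1]])
      have s': "developing (P ?T) s"
        by (rule developing_subset[OF s opT Pmono[OF Int_lower2]])
      have gc: "g c \<in> P ?T"
        using Pmem[OF c(1)] c(2) l(1) by simp
      obtain a L e where L: "orthogonal_transformation L" "0 < e" "mball (g c) e \<subseteq> P ?T" "g c \<in> M"
        "\<And>q. q \<in> mball (g c) e \<Longrightarrow> s q = a + L (s1 q)"
        by (rule developing_match[OF s' s1' gc]) blast
      define sc where "sc q = a + L (s1 q)" for q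
      have sc: "developing (P (ball c l)) sc"
        unfolding sc_def by (rule developing_affine[OF s1 L(1)])
      have "sc p = s p" if p: "p \<in> P ?T" for p
      proof (rule developing_unique[OF _ developing_subset[OF sc opT Pmono[OF Int_lower1]] s' openin_mball _ L(3) _ p])
        show "connectedin mtopology (P ?T)"
          by (intro Pconn convex_Int convex_ball)
        show "mball (g c) e \<noteq> {}"
          using L(2,4) by (metis centre_in_mball_iff empty_iff)
      qed (use L(5) in \<open>auto simp: sc_def\<close>)
      with sc show ?thesis
        by (intro exI[of _ sc] conjI ballI)
    qed
    then obtain S where S: "\<And>c. c \<in> D \<Longrightarrow> norm c < r \<Longrightarrow> developing (P (ball c l)) (S c)"
      "\<And>c p. c \<in> D \<Longrightarrow> norm c < r \<Longrightarrow> p \<in> P (ball c l \<inter> ball 0 r) \<Longrightarrow> S c p = s p"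
      by metis
    have agree: "S c p = S c' p"
      if c: "c \<in> D" "norm c < r" "c' \<in> D" "norm c' < r" and p: "p \<in> P (ball c l \<inter> ball c' l)" for c c' p
    proof -
      let ?T = "ball c l \<inter> ball c' l"
      have opT: "openin mtopology (P ?T)" "openin mtopology (P (?T \<inter> ball 0 r))"
        by (auto intro!: Pop)
      \<comment> \<open>The midpoint lies in both small disks, in \<open>D\<close> and in the disk
        of radius \<open>r\<close>. So the triple overlap, where both continuations equal
        \<open>s\<close>, is nonempty.\<close>
      define m where "m = midpoint c c'"
      have nm: "norm m \<le> (norm c + norm c') / 2"
        using norm_triangle_ineq[of c c'] by (simp add: m_def midpoint_def)
      have "f p \<in> ball c l" "f p \<in> ball c' l"
        using p by (auto simp: P_def)
      then have "dist c c' < 2 * l"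
        using dist_triangle2[of c c' "f p"] by (simp add: dist_commute)
      then have mT: "m \<in> ?T"
        by (simp add: m_def dist_midpoint dist_commute[of _ "midpoint c c'"])
      have mD: "m \<in> D" and mr: "m \<in> ball 0 r"
        using nm c(1-4) by (simp_all add: D_def)
      have ne: "g m \<in> P (?T \<inter> ball 0 r)"
        by (rule Pmem[OF mD IntI[OF mT mr]])
      show ?thesis
      proof (rule developing_unique[where A = "P ?T" and V = "P (?T \<inter> ball 0 r)"])
        show "connectedin mtopology (P ?T)"
          by (intro Pconn convex_Int convex_ball)
        show "developing (P ?T) (S c)" "developing (P ?T) (S c')"
          by (rule developing_subset[OF S(1)[OF c(1,2)] opT(1) Pmono[OF Int_lower1]],
            rule developing_subset[OF S(1)[OF c(3,4)] opT(1) Pmono[OF Int_lower2]])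
        show "S c q = S c' q" if "q \<in> P (?T \<inter> ball 0 r)" for q
          using S(2)[OF c(1,2), of q] S(2)[OF c(3,4), of q] that by (auto simp: P_def)
        show "P (?T \<inter> ball 0 r) \<subseteq> P ?T"
          by (rule Pmono) blast
      qed (use ne opT p in auto)
    qed
    have cover: "\<exists>c. c \<in> D \<and> norm c < r \<and> z \<in> ball c l" if z: "z \<in> D" "z \<in> ball 0 r'" for z
    proof (cases "norm z < r")
      case True
      then show ?thesis
        using z l(1) by (intro exI[of _ z]) simp
    next
      case False
      \<comment> \<open>Moving \<open>z\<close> radially inwards to norm \<open>r - l / 4\<close>
        costs less than \<open>3 * l / 4\<close>, since the norm of \<open>z\<close> is below
        \<open>r + l / 2\<close>.\<close>
      define t where "t = (r - l / 4) / norm z"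
      have nz: "0 < norm z"
        using False rpos by linarith
      have t: "0 \<le> t" "t \<le> 1" "t * norm z = r - l / 4"
        using False r l(1) nz by (auto simp: t_def)
      have "norm (of_real t * z) = r - l / 4"
        using t by (simp add: norm_mult)
      moreover have "norm (of_real t * z) \<le> 1"
        using t z(1) mult_mono[of t 1 "norm z" 1] by (simp add: norm_mult D_def)
      moreover have "dist (of_real t * z) z = norm z - (r - l / 4)"
      proof -
        have "of_real t * z - z = of_real (t - 1) * z"
          by (simp add: algebra_simps)
        then have "dist (of_real t * z) z = (1 - t) * norm z"
          using t by (simp add: dist_norm norm_mult del: of_real_diff)
        then show ?thesis
          using t(3) by (simp add: algebra_simps)
      qed
      ultimately show ?thesis
        using z(2) r l(1) by (intro exI[of _ "of_real t * z"]) (auto simp: D_def)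
    qed
    define C where "C p = (SOME c. c \<in> D \<and> norm c < r \<and> f p \<in> ball c l)" for p
    have C: "C p \<in> D" "norm (C p) < r" "f p \<in> ball (C p) l" if "p \<in> P (ball 0 r')" for p
      using someI_ex[OF cover[of "f p"]] that fD by (auto simp: P_def C_def)
    have "developing (P (ball 0 r')) (\<lambda>p. S (C p) p)"
    proof (rule developing_local)
      fix p assume p: "p \<in> P (ball 0 r')"
      let ?B = "P (ball (C p) l \<inter> ball 0 r')"
      have opB: "openin mtopology ?B"
        by (rule Pop) (simp add: open_Int)
      show "\<exists>B s'. p \<in> B \<and> B \<subseteq> P (ball 0 r') \<and> developing B s' \<and> (\<forall>q\<in>B. S (C q) q = s' q)"
      proof (intro exI conjI ballI)
        show "p \<in> ?B" "?B \<subseteq> P (ball 0 r')"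
          using p C(3)[OF p] by (auto simp: P_def)
        show "developing ?B (S (C p))"
          by (rule developing_subset[OF S(1)[OF C(1,2)[OF p]] opB Pmono[OF Int_lower1]])
        fix q assume q: "q \<in> ?B"
        then have q': "q \<in> P (ball 0 r')"
          by (auto simp: P_def)
        have "q \<in> P (ball (C q) l \<inter> ball (C p) l)"
          using q C(3)[OF q'] by (auto simp: P_def)
        then show "S (C q) q = S (C p) q"
          by (rule agree[OF C(1,2)[OF q'] C(1,2)[OF p]])
      qed
    qed
    then show ?case
      unfolding r'_def by blast
  qed
  moreover obtain n :: nat where "2 / l < real n"
    using reals_Archimedean2 by blast
  then have "1 < real (Suc n) * (l / 2)"
    using l(1) by (simp add: field_simps)
  then have "P (ball 0 (real (Suc n) * (l / 2))) = M"
    using fD by (force simp: P_def D_def)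
  ultimately show ?thesis
    by metis
qed

end

section \<open>A disk has a singular point\<close>

context flat_space begin

lemma singular_point_exists:
  assumes hom: "mtopology homeomorphic_space top_of_set (cball (0::complex) 1)"
  shows "Sing \<inter> M \<noteq> {}"
proof
  assume none: "Sing \<inter> M = {}"
  obtain f g where fg: "homeomorphic_maps mtopology (top_of_set (cball (0::complex) 1)) f g"
    using hom by (auto simp: homeomorphic_space_def)
  have "\<exists>H \<epsilon> \<phi>. H \<in> {UNIV, upper} \<and> 0 < \<epsilon> \<and> chart H p \<epsilon> \<phi>" if "p \<in> M" for p
    using interior_chart[of p] boundary_chart[of p] that none by blast
  then obtain s where s: "developing M s"
    using developing_global[OF fg] by blast
  have "g 0 \<in> M"
    using fg continuous_map_image_subset_topspace[of "top_of_set (cball (0::complex) 1)" mtopology g]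
    by (auto simp: homeomorphic_maps_def)
  then show False
    using no_compact_developing[OF s compact] by blast
qed

end

subsection \<open>Triangles as intersections of half planes\<close>

lemma num3_cases: "(j::3) = 0 \<or> j = 1 \<or> j = 2"
  using exhaust_3[of j] by auto

lemma all_num3: "(\<forall>j::3. P j) \<longleftrightarrow> P 0 \<and> P 1 \<and> P 2"
  using num3_cases by metis

lemma num3_simps [simp]: "(3::3) = 0" "(1::3) + 1 = 2" "(2::3) + 1 = 0" "(0::3) - 1 = 2" "(2::3) - 1 = 1"
  by simp_all

text \<open>The three expressions are twice the oriented areas of the subtriangles spanned by
  \<open>z\<close> and one side. Divided by twice the total area they are the barycentric
  coordinates of \<open>z\<close>.\<close>

lemma triangle_half_planes:
  fixes a b c z :: complex
  assumes pos: "0 < Im (cnj (b - a) * (c - a))"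
  shows "z \<in> convex hull {a, b, c} \<longleftrightarrow> 0 \<le> Im (cnj (b - a) * (z - a)) \<and>
     0 \<le> Im (cnj (c - b) * (z - b)) \<and> 0 \<le> Im (cnj (a - c) * (z - c))"
proof
  define A where "A = Im (cnj (b - a) * (c - a))"
  have A: "0 < A"
    using pos by (simp add: A_def)
  {
    assume "z \<in> convex hull {a, b, c}"
    then obtain u v w where uvw: "0 \<le> u" "0 \<le> v" "0 \<le> w" "u + v + w = 1" "z = u *\<^sub>R a + v *\<^sub>R b + w *\<^sub>R c"
      unfolding convex_hull_3 by blast
    have u: "u = 1 - v - w"
      using uvw(4) by simp
    have "Im (cnj (b - a) * (z - a)) = w * A" "Im (cnj (c - b) * (z - b)) = u * A"
      "Im (cnj (a - c) * (z - c)) = v * A"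
      unfolding uvw(5) A_def u by (simp_all add: algebra_simps)
    then show "0 \<le> Im (cnj (b - a) * (z - a)) \<and>
       0 \<le> Im (cnj (c - b) * (z - b)) \<and> 0 \<le> Im (cnj (a - c) * (z - c))"
      using uvw A by simp
  }
  assume z: "0 \<le> Im (cnj (b - a) * (z - a)) \<and>
     0 \<le> Im (cnj (c - b) * (z - b)) \<and> 0 \<le> Im (cnj (a - c) * (z - c))"
  define X Y Z where "X = Im (cnj (c - b) * (z - b))" and "Y = Im (cnj (a - c) * (z - c))"
    and "Z = Im (cnj (b - a) * (z - a))"
  define u v w where "u = X / A" and "v = Y / A" and "w = Z / A"
  have nn: "0 \<le> u" "0 \<le> v" "0 \<le> w"
    using z A by (auto simp: u_def v_def w_def X_def Y_def Z_def)
  have s1: "u + v + w = 1"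
  proof -
    have "X + Y + Z = A"
      by (simp add: A_def X_def Y_def Z_def algebra_simps)
    then show ?thesis
      using A by (simp add: u_def v_def w_def add_divide_distrib[symmetric])
  qed
  have "z = u *\<^sub>R a + v *\<^sub>R b + w *\<^sub>R c"
  proof -
    have "X * Re a + Y * Re b + Z * Re c = A * Re z" "X * Im a + Y * Im b + Z * Im c = A * Im z"
      by (simp_all add: A_def X_def Y_def Z_def algebra_simps)
    then show ?thesis
      using A by (simp add: complex_eq_iff u_def v_def w_def add_divide_distrib[symmetric])
  qed
  then show "z \<in> convex hull {a, b, c}"
    unfolding convex_hull_3 using nn s1 by blast
qed

definition edge_dir :: "'i triangle_gluing \<Rightarrow> 'i \<times> 3 \<Rightarrow> complex" where
  "edge_dir D e = sgn (vert D (fst e) (snd e + 1) - vert D (fst e) (snd e))"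

text \<open>The signed distance from the line through edge \<open>e\<close>, positive on its left
  and hence on the side of a positively oriented triangle.\<close>

definition height :: "'i triangle_gluing \<Rightarrow> 'i \<times> 3 \<Rightarrow> complex \<Rightarrow> real" where
  "height D e z = Im (cnj (edge_dir D e) * (z - vert D (fst e) (snd e)))"

text \<open>Only the edges through \<open>x\<close> impose a condition: one at a point inside an
  edge, two at a vertex, and none at an interior point, where the cone is the whole plane.\<close>

definition tangent_cone :: "'i triangle_gluing \<Rightarrow> 'i \<times> complex \<Rightarrow> complex set" where
  "tangent_cone D x = {v. \<forall>j. height D (fst x, j) (snd x) = 0 \<longrightarrow> 0 \<le> Im (cnj (edge_dir D (fst x, j)) * v)}"

lemma height_add: "height D e (z + v) = height D e z + Im (cnj (edge_dir D e) * v)"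
  by (simp add: height_def algebra_simps)

locale glued_triangles =
  fixes D :: "'i triangle_gluing"
  assumes finite_tris: "finite (tris D)"
    and orient: "i \<in> tris D \<Longrightarrow> 0 < Im (cnj (vert D i 1 - vert D i 0) * (vert D i 2 - vert D i 0))"
    and mate_edges: "e \<in> edges D \<Longrightarrow> mate D e \<in> edges D"
    and mate_mate: "e \<in> edges D \<Longrightarrow> mate D (mate D e) = e"
    and mate_length: "e \<in> edges D \<Longrightarrow> edge_length D (mate D e) = edge_length D e"
begin

lemma edges_iff: "e \<in> edges D \<longleftrightarrow> fst e \<in> tris D"
  by (cases e) (simp add: edges_def)

lemma orient_cyclic:
  assumes "i \<in> tris D"
  shows "0 < Im (cnj (vert D i (j + 1) - vert D i j) * (vert D i (j + 1 + 1) - vert D i (j + 1)))"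
proof -
  have cyc: "0 < Im (cnj (b - a) * (c - b)) \<and> 0 < Im (cnj (c - b) * (a - c)) \<and> 0 < Im (cnj (a - c) * (b - a))"
    if "0 < Im (cnj (b - a) * (c - a))" for a b c
    using that by (simp add: algebra_simps)
  consider "j = 0" | "j = 1" | "j = 2"
    using num3_cases by blast
  then show ?thesis
    by cases (use cyc[OF orient[OF assms]] in simp_all)
qed

lemma edge_length_pos: "e \<in> edges D \<Longrightarrow> 0 < edge_length D e"
  using orient_cyclic[of "fst e" "snd e"] by (auto simp: edge_length_def edges_iff)

lemma norm_edge_dir: "e \<in> edges D \<Longrightarrow> norm (edge_dir D e) = 1"
  using edge_length_pos[of e] by (simp add: edge_dir_def norm_sgn edge_length_def)

lemma edge_vector:
  assumes "e \<in> edges D"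
  shows "vert D (fst e) (snd e + 1) = vert D (fst e) (snd e) + of_real (edge_length D e) * edge_dir D e"
proof -
  have "of_real (norm w) * sgn w = w" for w :: complex
    by (cases "w = 0") (simp_all add: sgn_eq)
  then have "v' = v + of_real (dist v v') * sgn (v' - v)" for v v' :: complex
    by (metis add_diff_cancel_left' add_diff_eq dist_commute dist_norm)
  then show ?thesis
    unfolding edge_dir_def edge_length_def .
qed

lemma edge_dir_cross:
  assumes "i \<in> tris D"
  shows "0 < Im (cnj (edge_dir D (i, j)) * edge_dir D (i, j + 1))"
proof -
  let ?l = "edge_length D (i, j)" and ?m = "edge_length D (i, j + 1)"
  have e: "(i, j) \<in> edges D" "(i, j + 1) \<in> edges D"
    using assms by (auto simp: edges_iff)
  have "0 < Im (cnj (of_real ?l * edge_dir D (i, j)) * (of_real ?m * edge_dir D (i, j + 1)))"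
    using orient_cyclic[OF assms, of j] edge_vector[OF e(1)] edge_vector[OF e(2)] by simp
  also have "\<dots> = ?l * ?m * Im (cnj (edge_dir D (i, j)) * edge_dir D (i, j + 1))"
    by (simp add: algebra_simps)
  finally show ?thesis
    using mult_pos_pos[OF edge_length_pos[OF e(1)] edge_length_pos[OF e(2)]] by (rule zero_less_mult_pos)
qed

lemma edge_point_eq:
  assumes "e \<in> edges D"
  shows "edge_point D e s = (fst e, vert D (fst e) (snd e) + of_real (s * edge_length D e) * edge_dir D e)"
  unfolding edge_point_def linepath_def edge_vector[OF assms]
  by (simp add: scaleR_conv_of_real algebra_simps)

lemma fst_edge_point [simp]: "fst (edge_point D e s) = fst e"
  by (simp add: edge_point_def)

lemma edge_point_1: "edge_point D (i, j) 1 = edge_point D (i, j + 1) 0"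
  by (simp add: edge_point_def linepath_def)

lemma mem_triangle_iff:
  assumes "i \<in> tris D"
  shows "z \<in> triangle D i \<longleftrightarrow> (\<forall>j. 0 \<le> height D (i, j) z)"
proof -
  have "range (vert D i) = {vert D i 0, vert D i 1, vert D i 2}"
    using num3_cases by (auto simp: image_iff) metis
  then have "z \<in> triangle D i \<longleftrightarrow> 0 \<le> Im (cnj (vert D i 1 - vert D i 0) * (z - vert D i 0)) \<and>
     0 \<le> Im (cnj (vert D i 2 - vert D i 1) * (z - vert D i 1)) \<and>
     0 \<le> Im (cnj (vert D i 0 - vert D i 2) * (z - vert D i 2))"
    unfolding triangle_def using triangle_half_planes[OF orient[OF assms]] by simp
  also have "\<dots> \<longleftrightarrow> (\<forall>j. 0 \<le> Im (cnj (vert D i (j + 1) - vert D i j) * (z - vert D i j)))"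
    unfolding all_num3 by simp
  also have "\<dots> \<longleftrightarrow> (\<forall>j. 0 \<le> height D (i, j) z)"
  proof -
    have "Im (cnj (vert D i (j + 1) - vert D i j) * (z - vert D i j)) = edge_length D (i, j) * height D (i, j) z" for j
      using edge_vector[of "(i, j)"] assms by (simp add: edges_iff height_def algebra_simps)
    moreover have "0 < edge_length D (i, j)" for j
      using edge_length_pos[of "(i, j)"] assms by (simp add: edges_iff)
    ultimately have "0 \<le> Im (cnj (vert D i (j + 1) - vert D i j) * (z - vert D i j)) \<longleftrightarrow> 0 \<le> height D (i, j) z" for j
      by (simp only: zero_le_mult_iff) (meson less_le_not_le less_imp_le)
    then show ?thesis
      by (simp only:)
  qed
  finally show ?thesis .
qed

lemma height_edge_point_self: "e \<in> edges D \<Longrightarrow> height D e (snd (edge_point D e s)) = 0"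
  by (simp add: edge_point_eq height_def algebra_simps)

lemma height_edge_point_next:
  assumes "(i, j) \<in> edges D"
  shows "height D (i, j + 1) (snd (edge_point D (i, j) s)) =
     (1 - s) * edge_length D (i, j) * Im (cnj (edge_dir D (i, j)) * edge_dir D (i, j + 1))"
  using edge_vector[OF assms] by (simp add: edge_point_eq[OF assms] height_def algebra_simps)

lemma height_edge_point_prev:
  assumes "(i, j + 1) \<in> edges D"
  shows "height D (i, j) (snd (edge_point D (i, j + 1) s)) =
     s * edge_length D (i, j + 1) * Im (cnj (edge_dir D (i, j)) * edge_dir D (i, j + 1))"
proof -
  have "(i, j) \<in> edges D"
    using assms by (simp add: edges_iff)
  then have ev: "vert D i (j + 1) = vert D i j + of_real (edge_length D (i, j)) * edge_dir D (i, j)"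
    using edge_vector[of "(i, j)"] by simp
  define k where "k = j + 1"
  show ?thesis
    using ev unfolding edge_point_eq[OF assms] height_def fst_conv snd_conv
    unfolding k_def[symmetric] by (simp add: algebra_simps)
qed

text \<open>With \<open>s < 1\<close> the end vertex is excluded, so the only coincidence is the
  start vertex, which lies on the preceding edge as well.\<close>

lemma edge_point_height_zero_iff:
  assumes e: "(i, j) \<in> edges D" and s: "0 \<le> s" "s < 1"
  shows "height D (i, k) (snd (edge_point D (i, j) s)) = 0 \<longleftrightarrow> k = j \<or> (s = 0 \<and> k = j - 1)"
proof -
  have i: "i \<in> tris D"
    using e by (simp add: edges_iff)
  have "k = j \<or> k = j + 1 \<or> k = j - 1"
    using num3_cases[of j] num3_cases[of k] by auto
  moreover have ne: "j + 1 \<noteq> j" "j + 1 \<noteq> j - 1" "j - 1 \<noteq> j"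
    using num3_cases[of j] by auto
  moreover have "height D (i, j + 1) (snd (edge_point D (i, j) s)) \<noteq> 0"
    using height_edge_point_next[OF e] edge_dir_cross[OF i, of j] edge_length_pos[OF e] s by simp
  moreover have "height D (i, j - 1) (snd (edge_point D (i, j) s)) = 0 \<longleftrightarrow> s = 0"
    using height_edge_point_prev[of i "j - 1" s] e edge_dir_cross[OF i, of "j - 1"] edge_length_pos[OF e]
    by simp
  ultimately show ?thesis
    using height_edge_point_self[OF e] by auto
qed

lemma edge_point_mem:
  assumes e: "e \<in> edges D" and s: "0 \<le> s" "s \<le> 1"
  shows "edge_point D e s \<in> triangle_points D"
proof -
  obtain i j where ij: "e = (i, j)"
    by (cases e)
  have i: "i \<in> tris D"
    using e by (simp add: edges_iff ij)
  have "0 \<le> height D (i, k) (snd (edge_point D (i, j) s))" for k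
  proof -
    have "k = j \<or> k = j + 1 \<or> k = j - 1"
      using num3_cases[of j] num3_cases[of k] by auto
    moreover have "0 \<le> height D (i, j + 1) (snd (edge_point D (i, j) s))"
      using height_edge_point_next[of i j] e edge_dir_cross[OF i, of j] edge_length_pos[OF e] s
      by (simp add: ij)
    moreover have "0 \<le> height D (i, j - 1) (snd (edge_point D (i, j) s))"
      using height_edge_point_prev[of i "j - 1" s] e edge_dir_cross[OF i, of "j - 1"] edge_length_pos[OF e] s
      by (simp add: ij)
    ultimately show ?thesis
      using height_edge_point_self[OF e] by (auto simp: ij)
  qed
  then have "snd (edge_point D (i, j) s) \<in> triangle D i"
    by (simp add: mem_triangle_iff[OF i])
  moreover have "edge_point D e s = (i, snd (edge_point D (i, j) s))"
    by (simp add: ij edge_point_def)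
  ultimately show ?thesis
    using i by (simp add: triangle_points_def)
qed

lemma height_zero_edge_point:
  assumes i: "i \<in> tris D" and z: "z \<in> triangle D i" and h: "height D (i, j) z = 0"
  obtains s where "0 \<le> s" "s \<le> 1" "(i, z) = edge_point D (i, j) s"
proof -
  have e: "(i, j) \<in> edges D"
    using i by (simp add: edges_iff)
  define d l x where "d = edge_dir D (i, j)" and "l = edge_length D (i, j)"
    and "x = Re (cnj d * (z - vert D i j))"
  have l: "0 < l"
    using edge_length_pos[OF e] by (simp add: l_def)
  have "cnj d * (z - vert D i j) = of_real x"
    using h by (simp add: complex_eq_iff x_def height_def d_def)
  then have "d * (cnj d * (z - vert D i j)) = d * of_real x"
    by simp
  moreover have "d * cnj d = 1"
    using norm_edge_dir[OF e] by (simp add: complex_norm_square[symmetric] d_def)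
  ultimately have zz: "z - vert D i j = of_real x * d"
    by (simp add: mult.assoc[symmetric] mult.commute)
  define s where "s = x / l"
  have ep: "(i, z) = edge_point D (i, j) s"
    using zz l by (simp add: edge_point_eq[OF e] s_def l_def[symmetric] d_def[symmetric] algebra_simps)
  then have sz: "z = snd (edge_point D (i, j) s)"
    by (metis snd_conv)
  have "0 \<le> height D (i, j + 1) z" "0 \<le> height D (i, j - 1) z"
    using z mem_triangle_iff[OF i] by auto
  then have "0 \<le> 1 - s" "0 \<le> s"
    using height_edge_point_next[OF e, of s] height_edge_point_prev[of i "j - 1" s] e
      edge_dir_cross[OF i, of j] edge_dir_cross[OF i, of "j - 1"] l
    unfolding sz by (auto simp: zero_le_mult_iff l_def mult_less_0_iff)
  then show ?thesis
    using that ep by simp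
qed

lemma edge_point_inj:
  assumes "e \<in> edges D" "0 \<le> s" "s < 1" "e' \<in> edges D" "0 \<le> s'" "s' < 1"
    and eq: "edge_point D e s = edge_point D e' s'"
  shows "e = e' \<and> s = s'"
proof -
  obtain i j where ij: "e = (i, j)"
    by (cases e)
  obtain i' j' where ij': "e' = (i', j')"
    by (cases e')
  have ii: "i' = i"
    using arg_cong[OF eq, of fst] by (simp add: ij ij')
  have e: "(i, j) \<in> edges D" "(i, j') \<in> edges D"
    using assms ij ij' ii by auto
  have sn: "snd (edge_point D (i, j) s) = snd (edge_point D (i, j') s')"
    using eq by (simp add: ij ij' ii)
  have "height D (i, j') (snd (edge_point D (i, j) s)) = 0" "height D (i, j) (snd (edge_point D (i, j') s')) = 0"
    using height_edge_point_self[OF e(2), of s'] height_edge_point_self[OF e(1), of s] sn by auto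
  then have "j' = j \<or> (s = 0 \<and> j' = j - 1)" "j = j' \<or> (s' = 0 \<and> j = j' - 1)"
    using edge_point_height_zero_iff[OF e(1) assms(2,3)] edge_point_height_zero_iff[OF e(2) assms(5,6)]
    by auto
  then have jj: "j' = j"
    using num3_cases[of j] by auto
  have "of_real (s * edge_length D (i, j)) * edge_dir D (i, j) =
        of_real (s' * edge_length D (i, j)) * edge_dir D (i, j)"
    using sn by (simp add: jj edge_point_eq[OF e(1)])
  moreover have "edge_dir D (i, j) \<noteq> 0"
    using norm_edge_dir[OF e(1)] by auto
  ultimately have "s = s'"
    using edge_length_pos[OF e(1)] by (simp del: of_real_mult)
  then show ?thesis
    by (simp add: ij ij' ii jj)
qed

subsection \<open>Corners\<close>

text \<open>The half-open parameter range names each point of a triangle's perimeter exactly once, a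
  vertex being attributed to the edge that starts there. Points inside an edge count as corners of
  angle \<open>pi\<close>.\<close>

definition corners :: "(('i \<times> 3) \<times> real) set" where
  "corners = edges D \<times> {0..<1}"

definition corner_point :: "('i \<times> 3) \<times> real \<Rightarrow> 'i \<times> complex" where
  "corner_point \<kappa> = edge_point D (fst \<kappa>) (snd \<kappa>)"

text \<open>Looking from the point into the triangle, the edge of the corner lies on the right. On
  the left is the preceding edge at a vertex, and otherwise the same edge. Parameters of left sides
  range over \<open>{0<..1}\<close>.\<close>

definition left_side :: "('i \<times> 3) \<times> real \<Rightarrow> ('i \<times> 3) \<times> real" where
  "left_side \<kappa> = (if snd \<kappa> = 0 then ((fst (fst \<kappa>), snd (fst \<kappa>) - 1), 1) else \<kappa>)"

definition right_side :: "('i \<times> 3) \<times> real \<Rightarrow> ('i \<times> 3) \<times> real" where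
  "right_side \<kappa> = (if snd \<kappa> = 1 then ((fst (fst \<kappa>), snd (fst \<kappa>) + 1), 0) else \<kappa>)"

text \<open>One step counterclockwise around the point, across the left side. If that side is free,
  the result is its mirror point on the same edge; this has no geometric meaning here but keeps the
  map injective on corners, which makes orbits periodic.\<close>

definition next_corner :: "('i \<times> 3) \<times> real \<Rightarrow> ('i \<times> 3) \<times> real" where
  "next_corner \<kappa> = (mate D (fst (left_side \<kappa>)), 1 - snd (left_side \<kappa>))"

definition glued_left :: "('i \<times> 3) \<times> real \<Rightarrow> bool" where
  "glued_left \<kappa> \<longleftrightarrow> mate D (fst (left_side \<kappa>)) \<noteq> fst (left_side \<kappa>)"

lemma corner_point_left_side: "edge_point D (fst (left_side \<kappa>)) (snd (left_side \<kappa>)) = corner_point \<kappa>"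
  using edge_point_1[of "fst (fst \<kappa>)" "snd (fst \<kappa>) - 1"] by (simp add: left_side_def corner_point_def)

lemma left_side_mem:
  "\<kappa> \<in> corners \<Longrightarrow> fst (left_side \<kappa>) \<in> edges D \<and> 0 < snd (left_side \<kappa>) \<and> snd (left_side \<kappa>) \<le> 1"
  by (cases \<kappa>) (auto simp: corners_def left_side_def edges_iff)

lemma left_right_side: "0 < s \<Longrightarrow> s \<le> 1 \<Longrightarrow> left_side (right_side (e, s)) = (e, s)"
  by (cases e) (auto simp: left_side_def right_side_def)

lemma right_left_side: "\<kappa> \<in> corners \<Longrightarrow> right_side (left_side \<kappa>) = \<kappa>"
  by (cases \<kappa>) (auto simp: left_side_def right_side_def corners_def)

lemma right_side_mem: "e \<in> edges D \<Longrightarrow> 0 < s \<Longrightarrow> s \<le> 1 \<Longrightarrow> right_side (e, s) \<in> corners"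
  by (auto simp: corners_def right_side_def edges_iff)

lemma next_corner_mem: "\<kappa> \<in> corners \<Longrightarrow> next_corner \<kappa> \<in> corners"
  using left_side_mem[of \<kappa>] by (simp add: next_corner_def corners_def mate_edges)

lemma next_corner_inj: "inj_on next_corner corners"
proof (rule inj_onI)
  fix \<kappa> \<kappa>' assume k: "\<kappa> \<in> corners" "\<kappa>' \<in> corners" and eq: "next_corner \<kappa> = next_corner \<kappa>'"
  have "mate D (mate D (fst (left_side \<kappa>))) = mate D (mate D (fst (left_side \<kappa>')))"
    "snd (left_side \<kappa>) = snd (left_side \<kappa>')"
    using eq by (auto simp: next_corner_def)
  then have "left_side \<kappa> = left_side \<kappa>'"
    using mate_mate left_side_mem[OF k(1)] left_side_mem[OF k(2)] by (simp add: prod_eq_iff)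
  then show "\<kappa> = \<kappa>'"
    using right_left_side[OF k(1)] right_left_side[OF k(2)] by metis
qed

lemma corner_point_inj: "inj_on corner_point corners"
proof (rule inj_onI)
  fix \<kappa> \<kappa>' assume k: "\<kappa> \<in> corners" "\<kappa>' \<in> corners" "corner_point \<kappa> = corner_point \<kappa>'"
  then have "fst \<kappa> = fst \<kappa>' \<and> snd \<kappa> = snd \<kappa>'"
    by (intro edge_point_inj) (simp_all add: corners_def corner_point_def mem_Times_iff)
  then show "\<kappa> = \<kappa>'"
    by (simp add: prod_eq_iff)
qed

lemma corner_point_mem: "\<kappa> \<in> corners \<Longrightarrow> corner_point \<kappa> \<in> triangle_points D"
  unfolding corner_point_def by (rule edge_point_mem) (simp_all add: corners_def mem_Times_iff)

lemma corner_ex: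
  assumes "x \<in> triangle_points D" "height D (fst x, j) (snd x) = 0"
  obtains \<kappa> where "\<kappa> \<in> corners" "x = corner_point \<kappa>"
proof -
  obtain i z where x: "x = (i, z)" "i \<in> tris D" "z \<in> triangle D i"
    using assms(1) by (auto simp: triangle_points_def)
  obtain s where s: "0 \<le> s" "s \<le> 1" "(i, z) = edge_point D (i, j) s"
    using height_zero_edge_point[OF x(2,3)] assms(2) x(1) by auto
  show ?thesis
  proof (cases "s = 1")
    case True
    then show ?thesis
      using that[of "((i, j + 1), 0)"] s x edge_point_1[of i j] by (simp add: corners_def corner_point_def edges_iff)
  next
    case False
    then show ?thesis
      using that[of "((i, j), s)"] s x by (simp add: corners_def corner_point_def edges_iff)
  qed
qed

lemma glued_next:
  assumes "\<kappa> \<in> corners" "glued_left \<kappa>"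
  shows "(corner_point \<kappa>, corner_point (next_corner \<kappa>)) \<in> glued D"
proof -
  let ?e = "fst (left_side \<kappa>)" and ?s = "snd (left_side \<kappa>)"
  have "(edge_point D ?e ?s, edge_point D (mate D ?e) (1 - ?s)) \<in> glued D"
    unfolding glued_def mem_Collect_eq
    by (intro exI[of _ ?e] exI[of _ ?s] conjI refl)
      (use left_side_mem[OF assms(1)] assms(2) in \<open>auto simp: glued_left_def\<close>)
  then show ?thesis
    unfolding corner_point_left_side by (simp add: corner_point_def next_corner_def)
qed

lemma glued_sym:
  assumes "(X, Y) \<in> glued D"
  shows "(Y, X) \<in> glued D"
proof -
  obtain e s where es: "X = edge_point D e s" "Y = edge_point D (mate D e) (1 - s)" "e \<in> edges D"
    "mate D e \<noteq> e" "0 \<le> s" "s \<le> 1"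
    using assms unfolding glued_def by blast
  have "(edge_point D (mate D e) (1 - s), edge_point D (mate D (mate D e)) (1 - (1 - s))) \<in> glued D"
    unfolding glued_def mem_Collect_eq
    by (intro exI[of _ "mate D e"] exI[of _ "1 - s"] conjI refl)
      (use es mate_edges mate_mate in auto)
  then show ?thesis
    using es mate_mate by simp
qed

text \<open>Every identification is a counterclockwise step or the reverse of one. An edge point
  with parameter 0 is not on the left side of its corner, and is therefore read from the mate, where
  the parameter is 1.\<close>

lemma glued_cases:
  assumes "(X, Y) \<in> glued D"
  obtains \<kappa> where "\<kappa> \<in> corners" "glued_left \<kappa>" "X = corner_point \<kappa>" "Y = corner_point (next_corner \<kappa>)"
    | \<kappa> where "\<kappa> \<in> corners" "glued_left \<kappa>" "Y = corner_point \<kappa>" "X = corner_point (next_corner \<kappa>)"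
proof -
  obtain e s where es: "X = edge_point D e s" "Y = edge_point D (mate D e) (1 - s)" "e \<in> edges D"
    "mate D e \<noteq> e" "0 \<le> s" "s \<le> 1"
    using assms unfolding glued_def by blast
  show ?thesis
  proof (cases "0 < s")
    case True
    let ?\<kappa> = "right_side (e, s)"
    have L: "left_side ?\<kappa> = (e, s)"
      using left_right_side True es by simp
    have "X = corner_point ?\<kappa>"
      using corner_point_left_side[of ?\<kappa>] L es by simp
    moreover have "Y = corner_point (next_corner ?\<kappa>)"
      using L es by (simp add: next_corner_def corner_point_def)
    moreover have "?\<kappa> \<in> corners"
      using right_side_mem True es by simp
    ultimately show ?thesis
      using that(1)[of ?\<kappa>] L es by (simp add: glued_left_def)
  next
    case False
    then have s: "s = 0"
      using es by simp
    let ?\<kappa> = "right_side (mate D e, 1)"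
    have L: "left_side ?\<kappa> = (mate D e, 1)"
      using left_right_side by simp
    have "Y = corner_point ?\<kappa>"
      using corner_point_left_side[of ?\<kappa>] L es s by simp
    moreover have "X = corner_point (next_corner ?\<kappa>)"
      using L es s mate_mate by (simp add: next_corner_def corner_point_def)
    moreover have "?\<kappa> \<in> corners"
      using right_side_mem es mate_edges by simp
    ultimately show ?thesis
      using that(2)[of ?\<kappa>] L es mate_mate by (simp add: glued_left_def)
  qed
qed

lemma pt_eq_iff: "pt D X = pt D Y \<longleftrightarrow> Y \<in> pt D X"
proof
  assume "pt D X = pt D Y"
  then show "Y \<in> pt D X"
    by (simp add: pt_def)
next
  have sym: "sym ((glued D)\<^sup>*)"
    using glued_sym by (intro sym_rtrancl symI)
  assume "Y \<in> pt D X"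
  then have XY: "(X, Y) \<in> (glued D)\<^sup>*" "(Y, X) \<in> (glued D)\<^sup>*"
    using sym by (auto simp: pt_def dest: symD)
  then show "pt D X = pt D Y"
    unfolding pt_def by (auto intro: rtrancl_trans)
qed

lemma mem_pt_self: "X \<in> pt D X"
  by (simp add: pt_def)

lemma glued_triangle_points:
  assumes "(X, Y) \<in> glued D"
  shows "X \<in> triangle_points D" "Y \<in> triangle_points D"
  using assms by (auto simp: glued_def intro!: edge_point_mem mate_edges)

lemma pt_triangle_points:
  assumes "X \<in> triangle_points D" "Y \<in> pt D X"
  shows "Y \<in> triangle_points D"
  using assms(2) unfolding pt_def Image_singleton mem_Collect_eq
  by (induction rule: rtrancl_induct) (use assms(1) glued_triangle_points in auto)

lemma surface_mem_iff: "p \<in> surface D \<longleftrightarrow> (\<exists>x. x \<in> triangle_points D \<and> p = pt D x)"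
  by (auto simp: surface_def)

lemma surface_rep:
  assumes "p \<in> surface D" "x \<in> p"
  shows "x \<in> triangle_points D" "p = pt D x"
proof -
  obtain y where y: "y \<in> triangle_points D" "p = pt D y"
    using assms(1) by (auto simp: surface_mem_iff)
  then show "x \<in> triangle_points D" "p = pt D x"
    using assms(2) pt_triangle_points pt_eq_iff by auto
qed

lemma pt_invariant:
  assumes inv: "\<And>X Y. (X, Y) \<in> glued D \<Longrightarrow> V X = V Y" and "Y \<in> pt D X"
  shows "V Y = V X"
  using assms(2) unfolding pt_def Image_singleton mem_Collect_eq
  by (induction rule: rtrancl_induct) (use inv in auto)

end

text \<open>In polar form the two conditions say that the sines of \<phi> and of \<theta> - \<phi>
  are nonnegative, which confines the argument to the wedge. For \<theta> = \<open>pi\<close> the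
  wedge is the closed upper half plane.\<close>

lemma polar_wedge:
  assumes \<theta>: "0 < \<theta>" "\<theta> \<le> pi"
  shows "0 \<le> Im w \<and> 0 \<le> Im (cnj (- cis \<theta>) * w) \<longleftrightarrow> (\<exists>r \<phi>. 0 \<le> r \<and> 0 \<le> \<phi> \<and> \<phi> \<le> \<theta> \<and> w = of_real r * cis \<phi>)"
proof
  have rot: "Im (cnj (- cis \<theta>) * (of_real r * cis \<phi>)) = r * sin (\<theta> - \<phi>)" for r \<phi>
    by (simp add: sin_diff algebra_simps)
  {
    assume "\<exists>r \<phi>. 0 \<le> r \<and> 0 \<le> \<phi> \<and> \<phi> \<le> \<theta> \<and> w = of_real r * cis \<phi>"
    then obtain r \<phi> where w: "0 \<le> r" "0 \<le> \<phi>" "\<phi> \<le> \<theta>" "w = of_real r * cis \<phi>"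
      by blast
    have "0 \<le> sin \<phi>" "0 \<le> sin (\<theta> - \<phi>)"
      using w \<theta> by (auto intro!: sin_ge_zero)
    then show "0 \<le> Im w \<and> 0 \<le> Im (cnj (- cis \<theta>) * w)"
      using w(1) unfolding w(4) rot by simp
  }
  assume im: "0 \<le> Im w \<and> 0 \<le> Im (cnj (- cis \<theta>) * w)"
  show "\<exists>r \<phi>. 0 \<le> r \<and> 0 \<le> \<phi> \<and> \<phi> \<le> \<theta> \<and> w = of_real r * cis \<phi>"
  proof (cases "w = 0")
    case True
    then show ?thesis
      using \<theta> by (intro exI[of _ 0]) auto
  next
    case False
    define \<phi> where "\<phi> = Arg w"
    have w: "w = of_real (norm w) * cis \<phi>"
      using rcis_cmod_Arg[of w] by (simp add: rcis_def \<phi>_def)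
    have b: "- pi < \<phi>" "\<phi> \<le> pi"
      using Arg_bounded[of w] by (auto simp: \<phi>_def)
    have "Im w = norm w * sin \<phi>"
      by (subst w) simp
    then have s1: "0 \<le> sin \<phi>"
      using im False by (simp add: zero_le_mult_iff)
    have \<phi>0: "0 \<le> \<phi>"
    proof (rule ccontr)
      assume "\<not> 0 \<le> \<phi>"
      then have "0 < sin (- \<phi>)"
        using b by (intro sin_gt_zero) auto
      then show False
        using s1 by simp
    qed
    have "Im (cnj (- cis \<theta>) * w) = norm w * sin (\<theta> - \<phi>)"
      by (subst w) (rule rot)
    then have s2: "0 \<le> sin (\<theta> - \<phi>)"
      using im False by (simp add: zero_le_mult_iff)
    have "\<phi> \<le> \<theta>"
    proof (rule ccontr)
      assume "\<not> \<phi> \<le> \<theta>"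
      then have "0 < sin (\<phi> - \<theta>)"
        using b \<theta> by (intro sin_gt_zero) auto
      then show False
        using s2 sin_minus[of "\<theta> - \<phi>"] by simp
    qed
    then show ?thesis
      using w \<phi>0 by (intro exI[of _ "norm w"] exI[of _ \<phi>]) simp
  qed
qed

lemma cis_eq_iff_2pi: "cis a = cis b \<longleftrightarrow> (\<exists>n::int. a = b + 2 * pi * of_int n)"
  using sin_cos_eq_iff[of a b] by (auto simp: complex_eq_iff cis.sel algebra_simps)

text \<open>An arc starting at \<delta> may run past \<open>2 * pi\<close>; as a subset of
  \<open>{0..<2 * pi}\<close> it is then the union of two intervals, whose lengths still add up to
  \<theta>.\<close>

lemma arc_measure:
  assumes \<delta>: "0 \<le> \<delta>" "\<delta> < 2 * pi" and \<theta>: "0 < \<theta>" "\<theta> \<le> pi"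
  defines "A \<equiv> {t \<in> {0..<2 * pi}. \<exists>\<phi>. 0 \<le> \<phi> \<and> \<phi> \<le> \<theta> \<and> cis t = cis (\<delta> + \<phi>)}"
  shows "A \<in> sets borel" "measure lborel A = \<theta>"
proof -
  have mem: "t \<in> A \<longleftrightarrow> 0 \<le> t \<and> t < 2 * pi \<and> (\<delta> \<le> t \<and> t \<le> \<delta> + \<theta> \<or> t \<le> \<delta> + \<theta> - 2 * pi)" for t
  proof
    assume "t \<in> A"
    then obtain \<phi> where t: "0 \<le> t" "t < 2 * pi" "0 \<le> \<phi>" "\<phi> \<le> \<theta>" "cis t = cis (\<delta> + \<phi>)"
      by (auto simp: A_def)
    then obtain n :: int where n: "t = \<delta> + \<phi> + 2 * pi * of_int n"
      using cis_eq_iff_2pi by blast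
    have "n < 1"
    proof (rule ccontr)
      assume "\<not> n < 1"
      then have "2 * pi * 1 \<le> 2 * pi * of_int n"
        by (intro mult_left_mono) auto
      then show False
        using t n \<delta> by linarith
    qed
    moreover have "- 2 < n"
    proof (rule ccontr)
      assume "\<not> - 2 < n"
      then have "2 * pi * of_int n \<le> 2 * pi * (- 2)"
        by (intro mult_left_mono) auto
      then show False
        using t n \<delta> \<theta> by linarith
    qed
    ultimately have "n = 0 \<or> n = - 1"
      by linarith
    then show "0 \<le> t \<and> t < 2 * pi \<and> (\<delta> \<le> t \<and> t \<le> \<delta> + \<theta> \<or> t \<le> \<delta> + \<theta> - 2 * pi)"
      using t n by auto
  next
    assume t: "0 \<le> t \<and> t < 2 * pi \<and> (\<delta> \<le> t \<and> t \<le> \<delta> + \<theta> \<or> t \<le> \<delta> + \<theta> - 2 * pi)"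
    then consider "\<delta> \<le> t" "t \<le> \<delta> + \<theta>" | "t \<le> \<delta> + \<theta> - 2 * pi"
      by blast
    then show "t \<in> A"
    proof cases
      case 1
      then show ?thesis
        using t unfolding A_def by (auto intro!: exI[of _ "t - \<delta>"])
    next
      case 2
      have "cis t = cis (\<delta> + (t + 2 * pi - \<delta>))"
        unfolding cis_eq_iff_2pi by (intro exI[of _ "- 1"]) simp
      moreover have "0 \<le> t + 2 * pi - \<delta>"
        using t \<delta> by linarith
      ultimately show ?thesis
        using t 2 unfolding A_def by (auto intro!: exI[of _ "t + 2 * pi - \<delta>"])
    qed
  qed
  show "A \<in> sets borel" and "measure lborel A = \<theta>"
  proof -
    consider "\<delta> + \<theta> < 2 * pi" | "2 * pi \<le> \<delta> + \<theta>"
      by linarith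
    then have "A \<in> sets borel \<and> measure lborel A = \<theta>"
    proof cases
      case 1
      have "A = {\<delta>..\<delta> + \<theta>}"
      proof (rule set_eqI)
        fix t show "t \<in> A \<longleftrightarrow> t \<in> {\<delta>..\<delta> + \<theta>}"
          unfolding mem atLeastAtMost_iff using 1 \<delta> \<theta> by arith
      qed
      then show ?thesis
        using \<theta> by simp
    next
      case 2
      have "A = {0..\<delta> + \<theta> - 2 * pi} \<union> {\<delta>..<2 * pi}"
      proof (rule set_eqI)
        fix t show "t \<in> A \<longleftrightarrow> t \<in> {0..\<delta> + \<theta> - 2 * pi} \<union> {\<delta>..<2 * pi}"
          unfolding mem Un_iff atLeastAtMost_iff atLeastLessThan_iff using 2 \<delta> \<theta> pi_gt_zero by arith
      qed
      moreover have "measure lborel ({0..\<delta> + \<theta> - 2 * pi} \<union> {\<delta>..<2 * pi}) =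
          measure lborel {0..\<delta> + \<theta> - 2 * pi} + measure lborel {\<delta>..<2 * pi}"
        using \<theta> pi_gt_zero 2 \<delta> by (intro measure_Un_AE AE_I2) (auto intro!: fmeasurableI simp: ennreal_less_top)
      ultimately show ?thesis
        using 2 \<delta> by simp
    qed
    then show "A \<in> sets borel" and "measure lborel A = \<theta>"
      by auto
  qed
qed

context glued_triangles begin

subsection \<open>Angles and tangent cones at corners\<close>

definition corner_dir :: "('i \<times> 3) \<times> real \<Rightarrow> complex" where
  "corner_dir \<kappa> = edge_dir D (fst \<kappa>)"

definition left_dir :: "('i \<times> 3) \<times> real \<Rightarrow> complex" where
  "left_dir \<kappa> = edge_dir D (fst (left_side \<kappa>))"

text \<open>The interior angle, from the right side counterclockwise to the left side traversed
  backwards. Inside an edge the quotient is -1, whose \<open>Arg\<close> is \<open>pi\<close> as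
  required.\<close>

definition corner_angle :: "('i \<times> 3) \<times> real \<Rightarrow> real" where
  "corner_angle \<kappa> = Arg (- left_dir \<kappa> / corner_dir \<kappa>)"

lemma norm_corner_dir: "\<kappa> \<in> corners \<Longrightarrow> norm (corner_dir \<kappa>) = 1"
  unfolding corner_dir_def by (rule norm_edge_dir) (simp add: corners_def mem_Times_iff)

lemma norm_left_dir: "\<kappa> \<in> corners \<Longrightarrow> norm (left_dir \<kappa>) = 1"
  unfolding left_dir_def using left_side_mem[of \<kappa>] norm_edge_dir by blast

lemma corner_angle:
  assumes \<kappa>: "\<kappa> \<in> corners"
  shows "0 < corner_angle \<kappa>" "corner_angle \<kappa> \<le> pi"
    "- left_dir \<kappa> = corner_dir \<kappa> * cis (corner_angle \<kappa>)"
proof -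
  let ?r = "- left_dir \<kappa> / corner_dir \<kappa>"
  have nr: "norm ?r = 1"
    using norm_corner_dir[OF \<kappa>] norm_left_dir[OF \<kappa>] by (simp add: norm_divide)
  have cd: "corner_dir \<kappa> \<noteq> 0"
    using norm_corner_dir[OF \<kappa>] by auto
  have r: "?r = cis (corner_angle \<kappa>)"
    using rcis_cmod_Arg[of ?r] nr by (simp add: rcis_def corner_angle_def)
  show "- left_dir \<kappa> = corner_dir \<kappa> * cis (corner_angle \<kappa>)"
    using cd by (simp flip: r)
  have b: "- pi < corner_angle \<kappa>" "corner_angle \<kappa> \<le> pi"
    using Arg_bounded[of ?r] by (auto simp: corner_angle_def)
  then show "corner_angle \<kappa> \<le> pi"
    by simp
  show "0 < corner_angle \<kappa>"
  proof (cases "snd \<kappa> = 0")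
    case False
    then have "left_dir \<kappa> = corner_dir \<kappa>"
      by (simp add: left_dir_def corner_dir_def left_side_def)
    then have "cis (corner_angle \<kappa>) = - 1"
      using r cd by simp
    then have "cos (corner_angle \<kappa>) = - 1"
      by (metis cis.sel(1) one_complex.simps(1) uminus_complex.simps(1))
    moreover have "cos (- corner_angle \<kappa>) > - 1" if "corner_angle \<kappa> \<le> 0"
      using that b cos_monotone_0_pi[of "- corner_angle \<kappa>" pi] by simp
    ultimately show ?thesis
      by force
  next
    case True
    obtain i j where ij: "fst \<kappa> = (i, j)"
      by (cases "fst \<kappa>")
    have i: "i \<in> tris D"
      using \<kappa> ij by (simp add: corners_def mem_Times_iff edges_iff)
    have "0 < Im (cnj (left_dir \<kappa>) * corner_dir \<kappa>)"
      using edge_dir_cross[OF i, of "j - 1"] True by (simp add: left_dir_def corner_dir_def left_side_def ij)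
    also have "Im (cnj (left_dir \<kappa>) * corner_dir \<kappa>) = Im ?r"
    proof -
      have "cnj (corner_dir \<kappa>) * corner_dir \<kappa> = 1"
        using norm_corner_dir[OF \<kappa>] by (simp add: complex_norm_square[symmetric] mult.commute)
      then have "(- left_dir \<kappa> * cnj (corner_dir \<kappa>)) * corner_dir \<kappa> = - left_dir \<kappa>"
        by (simp only: mult.assoc mult_1_right)
      then have "?r = - left_dir \<kappa> * cnj (corner_dir \<kappa>)"
        using cd by (metis nonzero_mult_div_cancel_right)
      then show ?thesis
        by (simp add: algebra_simps)
    qed
    finally have "0 < sin (corner_angle \<kappa>)"
      unfolding r by simp
    moreover have "sin (corner_angle \<kappa>) \<le> 0" if "corner_angle \<kappa> \<le> 0"
      using that b sin_ge_zero[of "- corner_angle \<kappa>"] by simp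
    ultimately show ?thesis
      by force
  qed
qed

lemma tangent_cone_corner:
  assumes \<kappa>: "\<kappa> \<in> corners"
  shows "tangent_cone D (corner_point \<kappa>) =
    {v. 0 \<le> Im (cnj (corner_dir \<kappa>) * v) \<and> 0 \<le> Im (cnj (left_dir \<kappa>) * v)}"
proof -
  obtain i j s where k: "\<kappa> = ((i, j), s)"
    by (metis surj_pair)
  have e: "(i, j) \<in> edges D" "0 \<le> s" "s < 1"
    using \<kappa> by (auto simp: k corners_def)
  have "height D (i, m) (snd (corner_point \<kappa>)) = 0 \<longleftrightarrow> m = j \<or> (s = 0 \<and> m = j - 1)" for m
    using edge_point_height_zero_iff[OF e] by (simp add: k corner_point_def)
  moreover have "fst (corner_point \<kappa>) = i"
    by (simp add: k corner_point_def)
  ultimately show ?thesis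
    by (auto simp: tangent_cone_def corner_dir_def left_dir_def left_side_def k)
qed

lemma tangent_cone_polar:
  assumes \<kappa>: "\<kappa> \<in> corners"
  shows "v \<in> tangent_cone D (corner_point \<kappa>) \<longleftrightarrow>
    (\<exists>r \<phi>. 0 \<le> r \<and> 0 \<le> \<phi> \<and> \<phi> \<le> corner_angle \<kappa> \<and> v = corner_dir \<kappa> * (of_real r * cis \<phi>))"
proof -
  let ?w = "v / corner_dir \<kappa>"
  have cd: "corner_dir \<kappa> \<noteq> 0" and cc: "cnj (corner_dir \<kappa>) * corner_dir \<kappa> = 1"
    using norm_corner_dir[OF \<kappa>] by (auto simp: complex_norm_square[symmetric] mult.commute)
  have v: "v = corner_dir \<kappa> * ?w"
    using cd by simp
  have "cnj (corner_dir \<kappa>) * v = ?w"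
    by (subst v) (simp only: cc mult.assoc[symmetric] mult_1)
  moreover have "cnj (left_dir \<kappa>) * v = cnj (- cis (corner_angle \<kappa>)) * ?w"
  proof -
    have "left_dir \<kappa> = corner_dir \<kappa> * (- cis (corner_angle \<kappa>))"
      using corner_angle(3)[OF \<kappa>] by (metis minus_equation_iff mult_minus_right)
    then have "cnj (left_dir \<kappa>) * v = cnj (- cis (corner_angle \<kappa>)) * (cnj (corner_dir \<kappa>) * v)"
      by (simp only: complex_cnj_mult mult_ac)
    then show ?thesis
      by (simp only: \<open>cnj (corner_dir \<kappa>) * v = ?w\<close>)
  qed
  ultimately have "v \<in> tangent_cone D (corner_point \<kappa>) \<longleftrightarrow>
      0 \<le> Im ?w \<and> 0 \<le> Im (cnj (- cis (corner_angle \<kappa>)) * ?w)"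
    unfolding tangent_cone_corner[OF \<kappa>] mem_Collect_eq by (simp only:)
  also have "\<dots> \<longleftrightarrow> (\<exists>r \<phi>. 0 \<le> r \<and> 0 \<le> \<phi> \<and> \<phi> \<le> corner_angle \<kappa> \<and> ?w = of_real r * cis \<phi>)"
    by (rule polar_wedge[OF corner_angle(1,2)[OF \<kappa>]])
  also have "\<dots> \<longleftrightarrow> (\<exists>r \<phi>. 0 \<le> r \<and> 0 \<le> \<phi> \<and> \<phi> \<le> corner_angle \<kappa> \<and> v = corner_dir \<kappa> * (of_real r * cis \<phi>))"
    using cd by (simp add: divide_eq_eq mult.commute)
  finally show ?thesis .
qed

lemma abs_Im_edge_dir: "e \<in> edges D \<Longrightarrow> \<bar>Im (cnj (edge_dir D e) * v)\<bar> \<le> norm v"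
  using abs_Im_le_cmod[of "cnj (edge_dir D e) * v"] norm_edge_dir[of e] by (simp add: norm_mult)

text \<open>The distance to the nearest edge line that misses \<open>x\<close>, within which the
  triangle cannot be told from the tangent cone. Edges through \<open>x\<close> contribute the
  positive default 1.\<close>

definition gap :: "'i \<times> complex \<Rightarrow> real" where
  "gap x = Min (range (\<lambda>j. if height D (fst x, j) (snd x) = 0 then 1 else height D (fst x, j) (snd x)))"

lemma gap_pos:
  assumes "x \<in> triangle_points D"
  shows "0 < gap x"
proof -
  have i: "fst x \<in> tris D" "snd x \<in> triangle D (fst x)"
    using assms by (auto simp: triangle_points_def)
  have "0 \<le> height D (fst x, j) (snd x)" for j
    using i mem_triangle_iff[OF i(1)] by blast
  then show ?thesis
    unfolding gap_def by (subst Min_gr_iff) (auto simp: less_le)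
qed

lemma gap_le: "height D (fst x, j) (snd x) \<noteq> 0 \<Longrightarrow> gap x \<le> height D (fst x, j) (snd x)"
  unfolding gap_def by (rule Min_le) (auto intro!: image_eqI[of _ _ j])

lemma mem_triangle_tangent_cone:
  assumes x: "x \<in> triangle_points D" and v: "norm v < gap x"
  shows "snd x + v \<in> triangle D (fst x) \<longleftrightarrow> v \<in> tangent_cone D x"
proof -
  have i: "fst x \<in> tris D" "snd x \<in> triangle D (fst x)"
    using x by (auto simp: triangle_points_def)
  have e: "(fst x, j) \<in> edges D" for j
    using i by (simp add: edges_iff)
  have "0 \<le> height D (fst x, j) (snd x + v) \<longleftrightarrow>
     (height D (fst x, j) (snd x) = 0 \<longrightarrow> 0 \<le> Im (cnj (edge_dir D (fst x, j)) * v))" for j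
  proof (cases "height D (fst x, j) (snd x) = 0")
    case False
    then show ?thesis
      using gap_le[OF False] abs_Im_edge_dir[OF e, of j v] v unfolding height_add by linarith
  qed (simp add: height_add)
  then show ?thesis
    unfolding mem_triangle_iff[OF i(1)] tangent_cone_def by simp
qed

text \<open>Height changes by at most the distance moved, so a point of \<open>e\<close> closer than
  the gap forces the height of \<open>x\<close> over \<open>e\<close> to vanish.\<close>

lemma gap_isolates:
  assumes x: "x \<in> triangle_points D" and e: "e \<in> edges D" "fst e = fst x"
    and near: "dist (snd x) (snd (edge_point D e t)) < gap x"
  obtains s where "0 \<le> s" "s \<le> 1" "x = edge_point D e s"
proof -
  obtain i j where ij: "e = (i, j)"
    by (cases e)
  have i: "fst x \<in> tris D" "snd x \<in> triangle D (fst x)"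
    using x by (auto simp: triangle_points_def)
  have "height D e (snd x) = 0"
  proof (rule ccontr)
    assume "height D e (snd x) \<noteq> 0"
    then have g: "gap x \<le> height D e (snd x)"
      using gap_le[of x j] e ij by simp
    let ?v = "snd (edge_point D e t) - snd x"
    have "height D e (snd x + ?v) = 0"
      using height_edge_point_self[OF e(1)] by simp
    then have "height D e (snd x) \<le> norm ?v"
      using abs_Im_edge_dir[OF e(1), of ?v] unfolding height_add by linarith
    then show False
      using g near by (simp add: dist_norm norm_minus_commute)
  qed
  then obtain s where "0 \<le> s" "s \<le> 1" "(fst x, snd x) = edge_point D (fst x, j) s"
    using height_zero_edge_point[OF i, of j] e ij by auto
  then show ?thesis
    using that e ij by simp
qed

lemma tangent_cone_scale:
  assumes "v \<in> tangent_cone D x" "0 \<le> t"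
  shows "of_real t * v \<in> tangent_cone D x"
proof -
  have eq: "Im (cnj a * (of_real t * v)) = t * Im (cnj a * v)" for a
    by (simp add: algebra_simps)
  show ?thesis
    using assms unfolding tangent_cone_def mem_Collect_eq eq by (blast intro: mult_nonneg_nonneg)
qed

lemma tangent_cone_unscale:
  assumes "of_real t * v \<in> tangent_cone D x" "0 < t"
  shows "v \<in> tangent_cone D x"
  using tangent_cone_scale[OF assms(1), of "1 / t"] assms(2) by (simp add: mult.assoc[symmetric])

lemma points_into_iff:
  assumes x: "x \<in> triangle_points D" and u: "norm u = 1"
  shows "points_into D x u \<longleftrightarrow> u \<in> tangent_cone D x"
proof
  assume "points_into D x u"
  then obtain \<epsilon> where \<epsilon>: "\<epsilon> > 0" "\<forall>t\<in>{0..\<epsilon>}. snd x + of_real t * u \<in> triangle D (fst x)"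
    by (auto simp: points_into_def)
  define t where "t = min \<epsilon> (gap x / 2)"
  have t: "0 < t" "t \<le> \<epsilon>" "t < gap x"
    using \<epsilon>(1) gap_pos[OF x] by (auto simp: t_def)
  then have "of_real t * u \<in> tangent_cone D x"
    using \<epsilon>(2) mem_triangle_tangent_cone[OF x, of "of_real t * u"] u by (simp add: norm_mult)
  then show "u \<in> tangent_cone D x"
    using tangent_cone_unscale t(1) by blast
next
  assume c: "u \<in> tangent_cone D x"
  have "snd x + of_real t * u \<in> triangle D (fst x)" if "t \<in> {0..gap x / 2}" for t
    using mem_triangle_tangent_cone[OF x, of "of_real t * u"] u that tangent_cone_scale[OF c, of t] gap_pos[OF x]
    by (simp add: norm_mult)
  then show "points_into D x u"
    unfolding points_into_def using gap_pos[OF x] by (intro exI[of _ "gap x / 2"]) auto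
qed

lemma sector_corner:
  assumes \<kappa>: "\<kappa> \<in> corners"
  shows "sector D (corner_point \<kappa>) \<in> sets borel"
    "measure lborel (sector D (corner_point \<kappa>)) = corner_angle \<kappa>"
proof -
  define \<delta> where "\<delta> = Arg2pi (corner_dir \<kappa>)"
  have \<delta>: "0 \<le> \<delta>" "\<delta> < 2 * pi"
    by (auto simp: \<delta>_def Arg2pi_lt_2pi Arg2pi_ge_0)
  have d: "corner_dir \<kappa> = cis \<delta>"
    using Arg2pi_eq[of "corner_dir \<kappa>"] norm_corner_dir[OF \<kappa>] by (simp add: \<delta>_def cis_conv_exp)
  have "points_into D (corner_point \<kappa>) (cis t) \<longleftrightarrow> (\<exists>\<phi>. 0 \<le> \<phi> \<and> \<phi> \<le> corner_angle \<kappa> \<and> cis t = cis (\<delta> + \<phi>))" for t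
  proof -
    have "points_into D (corner_point \<kappa>) (cis t) \<longleftrightarrow>
       (\<exists>r \<phi>. 0 \<le> r \<and> 0 \<le> \<phi> \<and> \<phi> \<le> corner_angle \<kappa> \<and> cis t = cis \<delta> * (of_real r * cis \<phi>))"
      using points_into_iff[OF corner_point_mem[OF \<kappa>], of "cis t"] tangent_cone_polar[OF \<kappa>, of "cis t"]
      by (simp add: d)
    also have "\<dots> \<longleftrightarrow> (\<exists>\<phi>. 0 \<le> \<phi> \<and> \<phi> \<le> corner_angle \<kappa> \<and> cis t = cis (\<delta> + \<phi>))"
    proof
      assume "\<exists>r \<phi>. 0 \<le> r \<and> 0 \<le> \<phi> \<and> \<phi> \<le> corner_angle \<kappa> \<and> cis t = cis \<delta> * (of_real r * cis \<phi>)"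
      then obtain r \<phi> where r: "0 \<le> r" "0 \<le> \<phi>" "\<phi> \<le> corner_angle \<kappa>" "cis t = cis \<delta> * (of_real r * cis \<phi>)"
        by blast
      \<comment> \<open>Comparing norms fixes the radius to 1, which leaves a condition on the angle
        alone.\<close>
      have "norm (cis \<delta> * (of_real r * cis \<phi>)) = r"
        using r(1) by (simp add: norm_mult)
      then have "r = 1"
        by (metis r(4) norm_cis)
      then have "cis t = cis (\<delta> + \<phi>)"
        using r(4) by (simp add: cis_mult)
      then show "\<exists>\<phi>. 0 \<le> \<phi> \<and> \<phi> \<le> corner_angle \<kappa> \<and> cis t = cis (\<delta> + \<phi>)"
        using r by blast
    next
      assume "\<exists>\<phi>. 0 \<le> \<phi> \<and> \<phi> \<le> corner_angle \<kappa> \<and> cis t = cis (\<delta> + \<phi>)"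
      then obtain \<phi> where "0 \<le> \<phi>" "\<phi> \<le> corner_angle \<kappa>" "cis t = cis (\<delta> + \<phi>)"
        by blast
      then show "\<exists>r \<phi>. 0 \<le> r \<and> 0 \<le> \<phi> \<and> \<phi> \<le> corner_angle \<kappa> \<and> cis t = cis \<delta> * (of_real r * cis \<phi>)"
        by (intro exI[of _ "1::real"] exI[of _ \<phi>]) (simp add: cis_mult)
    qed
    finally show ?thesis .
  qed
  then have "sector D (corner_point \<kappa>) =
     {t \<in> {0..<2 * pi}. \<exists>\<phi>. 0 \<le> \<phi> \<and> \<phi> \<le> corner_angle \<kappa> \<and> cis t = cis (\<delta> + \<phi>)}"
    by (simp add: sector_def)
  then show "sector D (corner_point \<kappa>) \<in> sets borel"
    "measure lborel (sector D (corner_point \<kappa>)) = corner_angle \<kappa>"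
    using arc_measure[OF \<delta> corner_angle(1,2)[OF \<kappa>]] by simp_all
qed

lemma sector_interior:
  assumes x: "x \<in> triangle_points D" "\<And>j. height D (fst x, j) (snd x) \<noteq> 0"
  shows "tangent_cone D x = UNIV" "sector D x = {0..<2 * pi}"
proof -
  show "tangent_cone D x = UNIV"
    using x(2) by (simp add: tangent_cone_def)
  then show "sector D x = {0..<2 * pi}"
    using points_into_iff[OF x(1)] by (auto simp: sector_def)
qed

lemma pt_interior:
  assumes "\<And>j. height D (fst x, j) (snd x) \<noteq> 0"
  shows "pt D x = {x}"
proof -
  have "(x, y) \<notin> glued D" for y
  proof
    assume "(x, y) \<in> glued D"
    then obtain e s where "x = edge_point D e s" "e \<in> edges D"
      unfolding glued_def by blast
    then show False
      using assms[of "snd e"] height_edge_point_self[of e s] by simp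
  qed
  then have "(x, y) \<in> (glued D)\<^sup>* \<Longrightarrow> y = x" for y
    by (metis converse_rtranclE)
  then show ?thesis
    by (auto simp: pt_def)
qed

subsection \<open>Fans of corners around a point\<close>

text \<open>The corners met in counterclockwise order around a point of the surface; consecutive
  ones share a glued side.\<close>

definition fan :: "(nat \<Rightarrow> ('i \<times> 3) \<times> real) \<Rightarrow> nat \<Rightarrow> bool" where
  "fan \<kappa> n \<longleftrightarrow> 0 < n \<and> (\<forall>k<n. \<kappa> k \<in> corners) \<and> inj_on \<kappa> {..<n} \<and>
     (\<forall>k. Suc k < n \<longrightarrow> glued_left (\<kappa> k) \<and> \<kappa> (Suc k) = next_corner (\<kappa> k))"

definition closed_fan :: "(nat \<Rightarrow> ('i \<times> 3) \<times> real) \<Rightarrow> nat \<Rightarrow> bool" where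
  "closed_fan \<kappa> n \<longleftrightarrow> fan \<kappa> n \<and> glued_left (\<kappa> (n - 1)) \<and> \<kappa> 0 = next_corner (\<kappa> (n - 1))"

text \<open>The situation at a boundary point: the first corner has a free right side and the last a
  free left side.\<close>

definition open_fan :: "(nat \<Rightarrow> ('i \<times> 3) \<times> real) \<Rightarrow> nat \<Rightarrow> bool" where
  "open_fan \<kappa> n \<longleftrightarrow> fan \<kappa> n \<and> \<not> glued_left (\<kappa> (n - 1)) \<and> mate D (fst (\<kappa> 0)) = fst (\<kappa> 0)"

text \<open>Along an orbit the parameter stays among 0, the initial one and its complement to 1, so
  the orbit is finite. Injectivity makes it return to its start.\<close>

lemma next_corner_periodic:
  assumes \<kappa>: "\<kappa> \<in> corners"
  obtains N where "0 < N" "(next_corner ^^ N) \<kappa> = \<kappa>"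
proof -
  define \<sigma> where "\<sigma> m = (next_corner ^^ m) \<kappa>" for m
  have \<sigma>c: "\<sigma> m \<in> corners" for m
    by (induction m) (auto simp: \<sigma>_def \<kappa> intro: next_corner_mem)
  define S where "S = {0, snd \<kappa>, 1 - snd \<kappa>}"
  have "snd (next_corner \<kappa>') \<in> S" if "\<kappa>' \<in> corners" "snd \<kappa>' \<in> S" for \<kappa>'
    using that by (auto simp: S_def next_corner_def left_side_def)
  then have "snd (\<sigma> m) \<in> S" for m
    by (induction m) (use \<sigma>c in \<open>auto simp: \<sigma>_def S_def\<close>)
  then have "\<sigma> m \<in> edges D \<times> S" for m
    using \<sigma>c[of m] by (simp add: corners_def mem_Times_iff)
  then have "range \<sigma> \<subseteq> edges D \<times> S"
    by (rule image_subsetI)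
  moreover have "finite (edges D \<times> S)"
    using finite_tris by (simp add: edges_def S_def)
  ultimately have "finite (range \<sigma>)"
    by (rule finite_subset)
  then obtain a b where "a < b" "\<sigma> a = \<sigma> b"
    using infinite_UNIV_nat finite_imageD[of \<sigma> UNIV] by (metis injI linorder_neqE_nat)
  then have "\<exists>N>0. \<sigma> N = \<sigma> 0"
  proof (induction a arbitrary: b)
    case 0
    then show ?case
      by (intro exI[of _ b]) simp
  next
    case (Suc a)
    then obtain b' where b': "b = Suc b'"
      by (metis Suc_lessE)
    have "next_corner (\<sigma> a) = next_corner (\<sigma> b')"
      using Suc.prems by (simp add: b' \<sigma>_def)
    then have "\<sigma> a = \<sigma> b'"
      using inj_onD[OF next_corner_inj _ \<sigma>c \<sigma>c] by blast
    then show ?case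
      using Suc.IH[of b'] Suc.prems b' by simp
  qed
  then show ?thesis
    using that by (auto simp: \<sigma>_def)
qed

text \<open>If all left sides on the periodic orbit are glued, one least period is a closed fan.
  Otherwise the fan starts just after the last free left side before the orbit returns to \<kappa>0,
  and ends at the next free one.\<close>

lemma fan_exists:
  assumes \<kappa>0: "\<kappa>0 \<in> corners"
  shows "\<exists>\<kappa> n. (closed_fan \<kappa> n \<or> open_fan \<kappa> n) \<and> (\<exists>k<n. \<kappa> k = \<kappa>0)"
proof -
  obtain N where N: "0 < N" "(next_corner ^^ N) \<kappa>0 = \<kappa>0"
    by (rule next_corner_periodic[OF \<kappa>0])
  define \<sigma> where "\<sigma> m = (next_corner ^^ m) \<kappa>0" for m
  have \<sigma>0: "\<sigma> 0 = \<kappa>0" and \<sigma>S: "\<sigma> (Suc m) = next_corner (\<sigma> m)" for m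
    by (auto simp: \<sigma>_def)
  have \<sigma>c: "\<sigma> m \<in> corners" for m
    by (induction m) (auto simp: \<sigma>_def \<kappa>0 intro: next_corner_mem)
  have per: "\<sigma> (m + N) = \<sigma> m" for m
    by (simp add: \<sigma>_def funpow_add N(2))
  have cancel: "\<sigma> k = \<sigma> 0" if "\<sigma> (a + k) = \<sigma> a" for a k
    using that
  proof (induction a)
    case (Suc a)
    then have "next_corner (\<sigma> (a + k)) = next_corner (\<sigma> a)"
      by (simp add: \<sigma>S)
    then show ?case
      using inj_onD[OF next_corner_inj _ \<sigma>c \<sigma>c] Suc.IH by blast
  qed simp
  show ?thesis
  proof (cases "\<forall>m. glued_left (\<sigma> m)")
    case True
    define n where "n = (LEAST n. 0 < n \<and> \<sigma> n = \<sigma> 0)"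
    have n: "0 < n" "\<sigma> n = \<sigma> 0"
      using LeastI[of "\<lambda>n. 0 < n \<and> \<sigma> n = \<sigma> 0" N] N by (auto simp: n_def \<sigma>_def)
    have least: "\<not> (0 < k \<and> \<sigma> k = \<sigma> 0)" if "k < n" for k
      using not_less_Least[of k] that unfolding n_def by blast
    have "inj_on \<sigma> {..<n}"
    proof (rule linorder_inj_onI)
      fix a b assume "a < b" "a \<in> {..<n}" "b \<in> {..<n}"
      then show "\<sigma> a \<noteq> \<sigma> b"
        using cancel[of a "b - a"] least[of "b - a"] by auto
    qed auto
    moreover have "\<sigma> 0 = next_corner (\<sigma> (n - 1))"
      using n \<sigma>S[of "n - 1"] by simp
    ultimately have "closed_fan \<sigma> n"
      using True n(1) \<sigma>c \<sigma>S by (simp add: closed_fan_def fan_def)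
    then show ?thesis
      using n(1) \<sigma>0 by blast
  next
    case False
    then obtain m where m: "\<not> glued_left (\<sigma> m)"
      by blast
    have perq: "\<sigma> (a + q * N) = \<sigma> a" for a q
      by (induction q) (auto simp: per add.assoc[symmetric] add.commute[of N])
    define Bad where "Bad = {m. m < N \<and> \<not> glued_left (\<sigma> m)}"
    have "m mod N \<in> Bad"
      using m perq[of "m mod N" "m div N"] N(1) by (simp add: Bad_def)
    then have Bad: "finite Bad" "Bad \<noteq> {}"
      by (auto simp: Bad_def)
    define m0 where "m0 = Max Bad"
    have m0: "m0 < N" "\<not> glued_left (\<sigma> m0)"
      using Max_in[OF Bad] by (auto simp: m0_def Bad_def)
    have m0max: "glued_left (\<sigma> k)" if "m0 < k" "k < N" for k
    proof (rule ccontr)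
      assume "\<not> glued_left (\<sigma> k)"
      then have "k \<in> Bad"
        using that(2) by (simp add: Bad_def)
      then have "k \<le> m0"
        using Max_ge[OF Bad(1)] by (simp add: m0_def)
      then show False
        using that(1) by simp
    qed
    \<comment> \<open>As \<open>\<sigma> N\<close> is \<kappa>0 and no side strictly between
      \<open>m0\<close> and \<open>N\<close> is free, \<kappa>0 is met before the fan ends.\<close>
    define \<kappa> where "\<kappa> k = \<sigma> (m0 + 1 + k)" for k
    have \<kappa>S: "\<kappa> (Suc k) = next_corner (\<kappa> k)" for k
      using \<sigma>S[of "m0 + 1 + k"] by (simp add: \<kappa>_def)
    have \<kappa>c: "\<kappa> k \<in> corners" for k
      by (simp add: \<kappa>_def \<sigma>c)
    have "\<not> glued_left (\<kappa> (N - 1))"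
      using m0(2) per[of m0] N(1) by (simp add: \<kappa>_def)
    then obtain l where l: "\<not> glued_left (\<kappa> l)" "\<And>k. k < l \<Longrightarrow> glued_left (\<kappa> k)"
      using exists_least_iff[of "\<lambda>l. \<not> glued_left (\<kappa> l)"] by blast
    have free0: "mate D (fst (\<kappa> 0)) = fst (\<kappa> 0)"
    proof -
      have "\<kappa> 0 = next_corner (\<sigma> m0)"
        using \<sigma>S[of m0] by (simp add: \<kappa>_def)
      then show ?thesis
        using m0(2) by (simp add: next_corner_def glued_left_def)
    qed
    have nofree: "False" if k: "k < l" "\<kappa> (Suc k) = \<kappa> 0" for k
    proof -
      have "mate D (fst (left_side (\<kappa> k))) = fst (\<kappa> 0)"
        using k(2) \<kappa>S[of k] by (metis fst_conv next_corner_def)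
      then have "fst (left_side (\<kappa> k)) = fst (\<kappa> 0)"
        using mate_mate left_side_mem[OF \<kappa>c, of k] free0 by metis
      then have "\<not> glued_left (\<kappa> k)"
        using free0 by (simp add: glued_left_def)
      then show False
        using l(2)[OF k(1)] by simp
    qed
    have "inj_on \<kappa> {..<Suc l}"
    proof (rule linorder_inj_onI)
      fix a b assume ab: "a < b" "a \<in> {..<Suc l}" "b \<in> {..<Suc l}"
      show "\<kappa> a \<noteq> \<kappa> b"
      proof
        assume eq: "\<kappa> a = \<kappa> b"
        have shift: "\<kappa> (a - c) = \<kappa> (b - c)" if "c \<le> a" for c
          using that
        proof (induction c)
          case (Suc c)
          have "next_corner (\<kappa> (a - Suc c)) = next_corner (\<kappa> (b - Suc c))"
            using Suc \<kappa>S[of "a - Suc c"] \<kappa>S[of "b - Suc c"] ab(1)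
            by (simp add: Suc_diff_Suc)
          then show ?case
            using inj_onD[OF next_corner_inj _ \<kappa>c \<kappa>c] by blast
        qed (use eq in simp)
        have blt: "b - a - 1 < l"
          using ab(1,3) unfolding lessThan_iff by arith
        from shift[of a] have "\<kappa> (Suc (b - a - 1)) = \<kappa> 0"
          using ab(1) by (simp add: Suc_diff_Suc)
        then show False
          using nofree[of "b - a - 1"] blt by simp
      qed
    qed auto
    then have "open_fan \<kappa> (Suc l)"
      using l \<kappa>S \<kappa>c free0 by (simp add: open_fan_def fan_def)
    moreover have "\<kappa> (N - m0 - 1) = \<kappa>0"
      using m0(1) per[of 0] \<sigma>0 by (simp add: \<kappa>_def)
    moreover have "N - m0 - 1 < Suc l"
    proof (rule ccontr)
      assume "\<not> N - m0 - 1 < Suc l"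
      then have "m0 + 1 + l < N"
        by simp
      then show False
        using m0max[of "m0 + 1 + l"] l(1) by (simp add: \<kappa>_def)
    qed
    ultimately show ?thesis
      by blast
  qed
qed

lemma fan_corner: "fan \<kappa> n \<Longrightarrow> k < n \<Longrightarrow> \<kappa> k \<in> corners"
  by (simp add: fan_def)

text \<open>No identification leads out of a fan: a step past its end either wraps around or would
  need a free side to be glued. So the fan exhausts the equivalence class.\<close>

lemma fan_class:
  assumes f: "closed_fan \<kappa> n \<or> open_fan \<kappa> n" and k: "k < n"
  shows "pt D (corner_point (\<kappa> k)) = (\<lambda>k. corner_point (\<kappa> k)) ` {..<n}"
proof -
  have fan: "fan \<kappa> n"
    using f by (auto simp: closed_fan_def open_fan_def)
  note kc = fan_corner[OF fan]
  have step: "glued_left (\<kappa> k)" "\<kappa> (Suc k) = next_corner (\<kappa> k)" if "Suc k < n" for k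
    using fan that by (auto simp: fan_def)
  let ?P = "(\<lambda>k. corner_point (\<kappa> k)) ` {..<n}"
  have n: "0 < n"
    using fan by (simp add: fan_def)
  have closed: "Y \<in> ?P" if X: "X \<in> ?P" and g: "(X, Y) \<in> glued D" for X Y
  proof -
    obtain m where m: "m < n" "X = corner_point (\<kappa> m)"
      using X by blast
    from g show ?thesis
    proof (cases rule: glued_cases)
      case (1 \<kappa>')
      then have k': "\<kappa>' = \<kappa> m"
        using m kc inj_onD[OF corner_point_inj] by metis
      show ?thesis
      proof (cases "Suc m < n")
        case True
        then show ?thesis
          using step(2)[OF True] 1 k' by (intro image_eqI[of _ _ "Suc m"]) simp_all
      next
        case False
        then have m1: "m = n - 1"
          using m by simp
        then have "closed_fan \<kappa> n"
          using f 1(2) k' by (auto simp: open_fan_def)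
        then have "next_corner (\<kappa> m) = \<kappa> 0"
          by (simp add: closed_fan_def m1)
        then show ?thesis
          using 1 k' n by auto
      qed
    next
      case (2 \<kappa>')
      then have k': "next_corner \<kappa>' = \<kappa> m"
        using m kc next_corner_mem inj_onD[OF corner_point_inj] by metis
      show ?thesis
      proof (cases "m = 0")
        case False
        then have "Suc (m - 1) < n"
          using m by simp
        then have "\<kappa> m = next_corner (\<kappa> (m - 1))"
          using step(2)[of "m - 1"] False by simp
        then have "\<kappa>' = \<kappa> (m - 1)"
          using k' inj_onD[OF next_corner_inj _ 2(1) kc[of "m - 1"]] m(1) by auto
        then show ?thesis
          using 2(3) m(1) by auto
      next
        case True
        have "closed_fan \<kappa> n"
        proof (rule ccontr)
          assume "\<not> closed_fan \<kappa> n"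
          then have fr: "mate D (fst (\<kappa> 0)) = fst (\<kappa> 0)"
            using f by (simp add: open_fan_def)
          have "mate D (fst (left_side \<kappa>')) = fst (\<kappa> 0)"
            using k' True by (metis fst_conv next_corner_def)
          then have "fst (left_side \<kappa>') = fst (\<kappa> 0)"
            using mate_mate left_side_mem[OF 2(1)] fr by metis
          then show False
            using 2(2) fr by (simp add: glued_left_def)
        qed
        then have "next_corner (\<kappa> (n - 1)) = \<kappa> 0"
          by (simp add: closed_fan_def)
        then have "\<kappa>' = \<kappa> (n - 1)"
          using k' True inj_onD[OF next_corner_inj _ 2(1) kc[of "n - 1"]] n by auto
        then show ?thesis
          using 2(3) n by auto
      qed
    qed
  qed
  have reach: "corner_point (\<kappa> m) \<in> pt D (corner_point (\<kappa> 0))" if "m < n" for m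
    using that
  proof (induction m)
    case 0
    show ?case
      by (rule mem_pt_self)
  next
    case (Suc m)
    then have "corner_point (\<kappa> m) \<in> pt D (corner_point (\<kappa> 0))"
      by simp
    moreover have "(corner_point (\<kappa> m), corner_point (\<kappa> (Suc m))) \<in> glued D"
      using glued_next[OF kc step(1)] step(2) Suc.prems by simp
    ultimately show ?case
      unfolding pt_def by (auto intro: rtrancl_into_rtrancl)
  qed
  have "pt D (corner_point (\<kappa> k)) = pt D (corner_point (\<kappa> 0))"
    using reach[OF k] pt_eq_iff[of "corner_point (\<kappa> 0)"] by metis
  moreover have "Y \<in> ?P" if "Y \<in> pt D (corner_point (\<kappa> 0))" for Y
    using that unfolding pt_def Image_singleton mem_Collect_eq
    by (induction rule: rtrancl_induct) (use closed n in auto)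
  ultimately show ?thesis
    using reach by auto
qed

lemma fan_point_angle:
  assumes f: "closed_fan \<kappa> n \<or> open_fan \<kappa> n"
  shows "point_angle D (pt D (corner_point (\<kappa> 0))) = (\<Sum>k<n. corner_angle (\<kappa> k))"
proof -
  have fan: "fan \<kappa> n"
    using f by (auto simp: closed_fan_def open_fan_def)
  then have n: "0 < n" "inj_on \<kappa> {..<n}"
    by (auto simp: fan_def)
  have "inj_on (\<lambda>k. corner_point (\<kappa> k)) {..<n}"
    using comp_inj_on[OF n(2), of corner_point] inj_on_subset[OF corner_point_inj] fan_corner[OF fan]
    by (auto simp: o_def image_subset_iff)
  then have "point_angle D (pt D (corner_point (\<kappa> 0))) = (\<Sum>k<n. measure lborel (sector D (corner_point (\<kappa> k))))"
    unfolding point_angle_def fan_class[OF f n(1)] by (simp add: sum.reindex)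
  also have "\<dots> = (\<Sum>k<n. corner_angle (\<kappa> k))"
    using sector_corner(2) fan_corner[OF fan] by (intro sum.cong) auto
  finally show ?thesis .
qed

lemma open_fan_boundary:
  assumes "open_fan \<kappa> n"
  shows "pt D (corner_point (\<kappa> 0)) \<in> boundary_points D"
proof -
  have "\<kappa> 0 \<in> corners" "mate D (fst (\<kappa> 0)) = fst (\<kappa> 0)"
    using assms by (auto simp: open_fan_def fan_def)
  then show ?thesis
    unfolding boundary_points_def corner_point_def corners_def mem_Times_iff mem_Collect_eq
    by (intro exI[of _ "fst (\<kappa> 0)"] exI[of _ "snd (\<kappa> 0)"]) auto
qed

lemma closed_fan_interior:
  assumes c: "closed_fan \<kappa> n"
  shows "pt D (corner_point (\<kappa> 0)) \<notin> boundary_points D"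
proof
  have fan: "fan \<kappa> n" and n: "0 < n"
    using c by (auto simp: closed_fan_def fan_def)
  note kc = fan_corner[OF fan]
  have gl: "glued_left (\<kappa> k)" if "k < n" for k
  proof (cases "Suc k < n")
    case False
    then have "k = n - 1"
      using that by simp
    then show ?thesis
      using c by (simp add: closed_fan_def)
  qed (use fan in \<open>auto simp: fan_def\<close>)
  have prev: "\<exists>m<n. \<kappa> k = next_corner (\<kappa> m)" if "k < n" for k
  proof (cases k)
    case 0
    then show ?thesis
      using c n by (intro exI[of _ "n - 1"]) (auto simp: closed_fan_def)
  next
    case (Suc m)
    then show ?thesis
      using fan that by (intro exI[of _ m]) (auto simp: fan_def)
  qed
  assume "pt D (corner_point (\<kappa> 0)) \<in> boundary_points D"
  then obtain e s where e: "pt D (corner_point (\<kappa> 0)) = pt D (edge_point D e s)"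
    "e \<in> edges D" "mate D e = e" "0 \<le> s" "s \<le> 1"
    unfolding boundary_points_def by blast
  have "edge_point D e s \<in> (\<lambda>k. corner_point (\<kappa> k)) ` {..<n}"
    using e(1) mem_pt_self fan_class[of \<kappa> n 0] c n by metis
  then obtain k where k: "k < n" "edge_point D e s = corner_point (\<kappa> k)"
    by blast
  show False
  \<comment> \<open>A free edge that starts at the point would be the right side of a fan corner,
    across which its predecessor was left; any other free edge is the left side of a fan corner.
    Both kinds of side are glued in a closed fan.\<close>
  proof (cases "s = 0")
    case True
    then have "(e, s) \<in> corners"
      using e by (simp add: corners_def)
    moreover have "corner_point (e, s) = corner_point (\<kappa> k)"
      using k by (simp add: corner_point_def)
    ultimately have kk: "\<kappa> k = (e, s)"
      by (metis inj_onD[OF corner_point_inj] kc[OF k(1)])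
    obtain m where m: "m < n" "\<kappa> k = next_corner (\<kappa> m)"
      using prev[OF k(1)] by blast
    then have "mate D (fst (left_side (\<kappa> m))) = e"
      using kk by (simp add: next_corner_def)
    then have "fst (left_side (\<kappa> m)) = e"
      using mate_mate left_side_mem[OF kc[OF m(1)]] e(3) by metis
    then show False
      using gl[OF m(1)] e(3) by (simp add: glued_left_def)
  next
    case False
    then have L: "left_side (right_side (e, s)) = (e, s)" "right_side (e, s) \<in> corners"
      using left_right_side right_side_mem e by auto
    then have "corner_point (right_side (e, s)) = corner_point (\<kappa> k)"
      using corner_point_left_side[of "right_side (e, s)"] k by simp
    then have "\<kappa> k = right_side (e, s)"
      by (metis inj_onD[OF corner_point_inj] L(2) kc[OF k(1)])
    then show False
      using gl[OF k(1)] L(1) e(3) by (simp add: glued_left_def)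
  qed
qed

lemma interior_not_boundary:
  assumes "\<And>j. height D (fst x, j) (snd x) \<noteq> 0"
  shows "pt D x \<notin> boundary_points D"
proof
  assume "pt D x \<in> boundary_points D"
  then obtain e s where "pt D x = pt D (edge_point D e s)" "e \<in> edges D"
    unfolding boundary_points_def by blast
  then have "edge_point D e s = x"
    using pt_interior[OF assms] mem_pt_self by (metis singletonD)
  then show False
    using assms[of "snd e"] height_edge_point_self[OF \<open>e \<in> edges D\<close>, of s] by auto
qed

lemma corner_or_interior:
  assumes "x \<in> triangle_points D"
  obtains (interior) "\<And>j. height D (fst x, j) (snd x) \<noteq> 0"
    | (corner) \<kappa> n k where "closed_fan \<kappa> n \<or> open_fan \<kappa> n" "k < n" "x = corner_point (\<kappa> k)"
proof (cases "\<forall>j. height D (fst x, j) (snd x) \<noteq> 0")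
  case False
  then obtain \<kappa>0 where "\<kappa>0 \<in> corners" "x = corner_point \<kappa>0"
    using corner_ex[OF assms] by blast
  then show ?thesis
    using fan_exists[of \<kappa>0] corner by blast
qed (use interior in blast)

lemma finite_class:
  assumes "p \<in> surface D"
  shows "finite p"
proof -
  obtain x where x: "x \<in> triangle_points D" "p = pt D x"
    using assms surface_mem_iff by blast
  show ?thesis
    using x(1)
  proof (cases rule: corner_or_interior)
    case interior
    then show ?thesis
      using pt_interior x(2) by simp
  next
    case (corner \<kappa> n k)
    then show ?thesis
      using fan_class x(2) by simp
  qed
qed

end

subsection \<open>The polygonal metric\<close>

text \<open>Induction on the number of cells: the segment is followed to its last point in the cell
  of its start, where one Lipschitz bound applies, and the rest is covered by the remaining
  cells.\<close>

lemma segment_cover_dist_le: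
  fixes g :: "complex \<Rightarrow> 'p" and d :: "'p \<Rightarrow> 'p \<Rightarrow> real" and C :: "'b \<Rightarrow> complex set"
  assumes "finite I" and closed: "\<And>i. i \<in> I \<Longrightarrow> closed (C i)" and convex: "\<And>i. i \<in> I \<Longrightarrow> convex (C i)"
    and N: "convex N"
    and local: "\<And>i a b. i \<in> I \<Longrightarrow> a \<in> C i \<inter> N \<Longrightarrow> b \<in> C i \<inter> N \<Longrightarrow> d (g a) (g b) \<le> dist a b"
    and triangle: "\<And>a b c. a \<in> N \<Longrightarrow> b \<in> N \<Longrightarrow> c \<in> N \<Longrightarrow> d (g a) (g c) \<le> d (g a) (g b) + d (g b) (g c)"
    and cover: "closed_segment z w \<subseteq> (\<Union>i\<in>I. C i)" and zw: "z \<in> N" "w \<in> N"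
  shows "d (g z) (g w) \<le> dist z w"
  using assms(1) closed convex local cover zw(1)
proof (induction "card I" arbitrary: I z rule: less_induct)
  case less
  obtain i where i: "i \<in> I" "z \<in> C i"
    using less.prems(5) by auto
  define \<gamma> where "\<gamma> t = linepath z w t" for t
  define A where "A = {t \<in> {0..1}. \<gamma> t \<in> C i}"
  have \<gamma>cont: "continuous_on UNIV \<gamma>"
    unfolding \<gamma>_def linepath_def by (intro continuous_intros)
  have "A = {0..1} \<inter> \<gamma> -` C i"
    by (auto simp: A_def)
  then have "compact A"
    using closed_vimage[OF less.prems(2)[OF i(1)] \<gamma>cont] by (simp add: compact_Int_closed)
  moreover have "0 \<in> A"
    using i by (simp add: A_def \<gamma>_def linepath_def)
  ultimately obtain s where s: "s \<in> A" "\<And>t. t \<in> A \<Longrightarrow> t \<le> s"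
    using compact_attains_sup[of A] by blast
  have s01: "0 \<le> s" "s \<le> 1" "\<gamma> s \<in> C i"
    using s(1) by (auto simp: A_def)
  have \<gamma>seg: "\<gamma> t \<in> closed_segment z w" if "0 \<le> t" "t \<le> 1" for t
    using that unfolding \<gamma>_def by (intro linepath_in_path) auto
  have segN: "closed_segment z w \<subseteq> N"
    by (rule closed_segment_subset[OF less.prems(6) zw(2) N])
  have \<gamma>N: "\<gamma> s \<in> N"
    using \<gamma>seg[OF s01(1,2)] segN by blast
  have step: "d (g z) (g (\<gamma> s)) \<le> dist z (\<gamma> s)"
    using less.prems(4)[OF i(1)] i(2) s01(3) \<gamma>N less.prems(6) by simp
  show ?case
  proof (cases "s = 1")
    case True
    then show ?thesis
      using step by (simp add: \<gamma>_def linepath_def)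
  next
    case False
    then have s1: "s < 1"
      using s01 by simp
    \<comment> \<open>After the last visit only other cells are met; as their union is closed, it
      contains the point at \<open>s\<close> too.\<close>
    have "\<gamma> t \<in> (\<Union>j\<in>I - {i}. C j)" if t: "s < t" "t \<le> 1" for t
    proof -
      have "\<gamma> t \<notin> C i"
        using s(2)[of t] t s01 by (auto simp: A_def)
      moreover have "\<gamma> t \<in> (\<Union>j\<in>I. C j)"
        using \<gamma>seg[of t] t s01 less.prems(5) by auto
      ultimately show ?thesis
        by auto
    qed
    then have "\<gamma> ` {s<..1} \<subseteq> (\<Union>j\<in>I - {i}. C j)"
      by auto
    moreover have "closed (\<Union>j\<in>I - {i}. C j)"
      using less.prems(1,2) by (intro closed_UN) auto
    ultimately have "\<gamma> ` closure {s<..1} \<subseteq> (\<Union>j\<in>I - {i}. C j)"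
      by (rule image_closure_subset[OF continuous_on_subset[OF \<gamma>cont subset_UNIV], rotated])
    then have img: "\<gamma> ` {s..1} \<subseteq> (\<Union>j\<in>I - {i}. C j)"
      using s1 by simp
    have seg: "closed_segment (\<gamma> s) w \<subseteq> (\<Union>j\<in>I - {i}. C j)"
    proof
      fix x assume "x \<in> closed_segment (\<gamma> s) w"
      then obtain u where u: "0 \<le> u" "u \<le> 1" "x = (1 - u) *\<^sub>R \<gamma> s + u *\<^sub>R w"
        by (auto simp: closed_segment_def)
      have "x = \<gamma> (s + u * (1 - s))"
        unfolding u(3) \<gamma>_def linepath_def by (simp add: algebra_simps)
      moreover have "s + u * (1 - s) \<in> {s..1}"
      proof -
        have "u * (1 - s) \<le> 1 * (1 - s)"
          using u s1 by (intro mult_right_mono) auto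
        moreover have "0 \<le> u * (1 - s)"
          using u s1 by simp
        ultimately show ?thesis
          by simp
      qed
      ultimately show "x \<in> (\<Union>j\<in>I - {i}. C j)"
        using img by blast
    qed
    have "card (I - {i}) < card I"
      using less.prems(1) i(1) by (intro psubset_card_mono) auto
    then have rest: "d (g (\<gamma> s)) (g w) \<le> dist (\<gamma> s) w"
    proof (rule less.hyps)
      show "d (g a) (g b) \<le> dist a b" if "j \<in> I - {i}" "a \<in> C j \<inter> N" "b \<in> C j \<inter> N" for j a b
        by (rule less.prems(4)[of j]) (use that in auto)
    qed (use less.prems(1-3) seg \<gamma>N in auto)
    have "dist z (\<gamma> s) = s * dist z w" "dist (\<gamma> s) w = (1 - s) * dist z w"
    proof -
      have "z - \<gamma> s = s *\<^sub>R (z - w)" "\<gamma> s - w = (1 - s) *\<^sub>R (z - w)"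
        by (simp_all add: \<gamma>_def linepath_def algebra_simps)
      then show "dist z (\<gamma> s) = s * dist z w" "dist (\<gamma> s) w = (1 - s) * dist z w"
        using s01 by (simp_all add: dist_norm)
    qed
    then have "dist z (\<gamma> s) + dist (\<gamma> s) w = dist z w"
      by (simp add: algebra_simps)
    then show ?thesis
      using triangle[OF less.prems(6) \<gamma>N zw(2)] step rest by linarith
  qed
qed

context glued_triangles begin

lemma surface_rep_ex: "p \<in> surface D \<Longrightarrow> \<exists>x. x \<in> p"
  unfolding surface_mem_iff using mem_pt_self by blast

lemma pt_mem_surface: "i \<in> tris D \<Longrightarrow> z \<in> triangle D i \<Longrightarrow> pt D (i, z) \<in> surface D"
  by (auto simp: surface_def triangle_points_def)

lemma polygonal_length_surface: "polygonal_length D p r l \<Longrightarrow> p \<in> surface D \<and> r \<in> surface D \<and> 0 \<le> l"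
  by (induction rule: polygonal_length.induct) (auto intro: pt_mem_surface)

lemma polygonal_length_trans:
  assumes "polygonal_length D q r m" "polygonal_length D p q l"
  shows "polygonal_length D p r (l + m)"
  using assms
proof (induction rule: polygonal_length.induct)
  case (segment q i z m w)
  then show ?case
    using polygonal_length.segment[of D p i z "l + m" w] by (simp add: add.assoc)
qed simp

lemma polygonal_length_segment:
  assumes "i \<in> tris D" "z \<in> triangle D i" "w \<in> triangle D i"
  shows "polygonal_length D (pt D (i, z)) (pt D (i, w)) (dist z w)"
  using polygonal_length.segment[OF polygonal_length.start[OF pt_mem_surface[OF assms(1,2)]] assms] by simp

lemma polygonal_length_sym: "polygonal_length D p r l \<Longrightarrow> polygonal_length D r p l"
proof (induction rule: polygonal_length.induct)
  case (segment p i z l w)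
  have "polygonal_length D (pt D (i, w)) (pt D (i, z)) (dist w z)"
    using polygonal_length_segment segment by blast
  from polygonal_length_trans[OF segment.IH this] show ?case
    by (simp add: dist_commute add.commute)
qed (rule polygonal_length.start)

lemma surface_dist_le: "polygonal_length D p r l \<Longrightarrow> surface_dist D p r \<le> l"
  unfolding surface_dist_def by (rule cInf_lower) (auto intro!: bdd_belowI[of _ 0] dest: polygonal_length_surface)

lemma surface_dist_segment:
  "i \<in> tris D \<Longrightarrow> z \<in> triangle D i \<Longrightarrow> w \<in> triangle D i \<Longrightarrow> surface_dist D (pt D (i, z)) (pt D (i, w)) \<le> dist z w"
  by (rule surface_dist_le[OF polygonal_length_segment])

text \<open>Extended by 0 off the surface, since \<^const>\<open>Metric_space\<close> asks for a nonnegative function on the whole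
  type and \<^const>\<open>surface_dist\<close> is an infimum of the empty set there.\<close>

definition sdist :: "('i \<times> complex) set \<Rightarrow> ('i \<times> complex) set \<Rightarrow> real" where
  "sdist p r = (if p \<in> surface D \<and> r \<in> surface D then surface_dist D p r else 0)"

text \<open>A test function that is compatible with the gluing and 1-Lipschitz on triangles cannot
  change faster than length accumulates. It thus bounds the infimum defining the distance from
  below, which no inspection of single paths could do.\<close>

lemma lipschitz_invariant_polygonal:
  assumes inv: "\<And>X Y. (X, Y) \<in> glued D \<Longrightarrow> V X = V Y"
    and lip: "\<And>i z w. i \<in> tris D \<Longrightarrow> z \<in> triangle D i \<Longrightarrow> w \<in> triangle D i \<Longrightarrow> \<bar>V (i, z) - V (i, w)\<bar> \<le> dist z w"
    and l: "polygonal_length D p r l"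
  shows "\<forall>x\<in>p. \<forall>y\<in>r. \<bar>V x - V y\<bar> \<le> (l::real)"
  using l
proof (induction rule: polygonal_length.induct)
  case (start p)
  show ?case
  proof (intro ballI)
    fix x y assume xy: "x \<in> p" "y \<in> p"
    have y: "y \<in> pt D x"
      using surface_rep(2)[OF start xy(1)] xy(2) by simp
    have "V y = V x"
      by (rule pt_invariant[of V, OF _ y]) (rule inv)
    then show "\<bar>V x - V y\<bar> \<le> 0"
      by simp
  qed
next
  case (segment p i z l w)
  show ?case
  proof (intro ballI)
    fix x y assume x: "x \<in> p" and y: "y \<in> pt D (i, w)"
    have "V y = V (i, w)"
      by (rule pt_invariant[of V, OF _ y]) (rule inv)
    moreover have "\<bar>V x - V (i, z)\<bar> \<le> l"
      using segment.IH x mem_pt_self by blast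
    ultimately show "\<bar>V x - V y\<bar> \<le> l + dist z w"
      using lip[OF segment.hyps(2-4)] by linarith
  qed
qed

definition class_gap :: "('i \<times> complex) set \<Rightarrow> real" where
  "class_gap p = Min (insert 1 (gap ` p))"

lemma class_gap:
  assumes "p \<in> surface D"
  shows "0 < class_gap p" "x \<in> p \<Longrightarrow> class_gap p \<le> gap x"
proof -
  have fin: "finite (insert 1 (gap ` p))"
    using finite_class[OF assms] by simp
  have "0 < gap x" if "x \<in> p" for x
    using gap_pos surface_rep(1)[OF assms that] by blast
  then show "0 < class_gap p"
    unfolding class_gap_def using fin by (subst Min_gr_iff) auto
  show "class_gap p \<le> gap x" if "x \<in> p"
    unfolding class_gap_def using that by (intro Min_le[OF fin]) simp
qed

text \<open>The test functions: near each representative \<open>x\<close> of \<open>p\<close> a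
  local function \<open>\<rho> x\<close> is prescribed. The minimum is needed because
  \<open>p\<close> may have several representatives in one triangle, and \<open>K\<close> truncates
  away from \<open>p\<close>.\<close>

definition cone_fun :: "('i \<times> complex) set \<Rightarrow> real \<Rightarrow> ('i \<times> complex \<Rightarrow> complex \<Rightarrow> real) \<Rightarrow> 'i \<times> complex \<Rightarrow> real" where
  "cone_fun p K \<rho> X = Min (insert K ((\<lambda>x. \<rho> x (snd X)) ` {x \<in> p. fst x = fst X}))"

lemma cone_fun_le:
  assumes "p \<in> surface D"
  shows "cone_fun p K \<rho> X \<le> K" "x \<in> p \<Longrightarrow> fst x = fst X \<Longrightarrow> cone_fun p K \<rho> X \<le> \<rho> x (snd X)"
  unfolding cone_fun_def using finite_class[OF assms] by (auto intro!: Min_le)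

lemma cone_fun_cases:
  assumes "p \<in> surface D"
  obtains "cone_fun p K \<rho> X = K" | x where "x \<in> p" "fst x = fst X" "cone_fun p K \<rho> X = \<rho> x (snd X)"
proof -
  have "cone_fun p K \<rho> X \<in> insert K ((\<lambda>x. \<rho> x (snd X)) ` {x \<in> p. fst x = fst X})"
    unfolding cone_fun_def using finite_class[OF assms] by (intro Min_in) auto
  then show ?thesis
    using that by blast
qed

text \<open>If a local function is below \<open>K\<close> at a point of an edge, its representative
  is so near that it lies on this edge itself. The glued representative then gives the same value
  across the edge, so the minimum cannot increase under gluing, in either direction.\<close>

lemma cone_fun_invariant:
  assumes p: "p \<in> surface D"
    and far: "\<And>x b. x \<in> p \<Longrightarrow> \<rho> x b < K \<Longrightarrow> dist (snd x) b < class_gap p"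
    and match: "\<And>e s t. e \<in> edges D \<Longrightarrow> mate D e \<noteq> e \<Longrightarrow> 0 \<le> s \<Longrightarrow> s \<le> 1 \<Longrightarrow> 0 \<le> t \<Longrightarrow> t \<le> 1 \<Longrightarrow> edge_point D e s \<in> p \<Longrightarrow>
       \<rho> (edge_point D (mate D e) (1 - s)) (snd (edge_point D (mate D e) (1 - t))) =
       \<rho> (edge_point D e s) (snd (edge_point D e t))"
    and XY: "(X, Y) \<in> glued D"
  shows "cone_fun p K \<rho> X = cone_fun p K \<rho> Y"
proof -
  have le: "cone_fun p K \<rho> Y \<le> cone_fun p K \<rho> X" if XY: "(X, Y) \<in> glued D" for X Y
  proof -
    obtain e t where e: "X = edge_point D e t" "Y = edge_point D (mate D e) (1 - t)" "e \<in> edges D"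
      "mate D e \<noteq> e" "0 \<le> t" "t \<le> 1"
      using XY unfolding glued_def by blast
    show ?thesis
    proof (cases rule: cone_fun_cases[OF p, of K \<rho> X])
      case 1
      then show ?thesis
        using cone_fun_le(1)[OF p] by simp
    next
      case (2 x)
      show ?thesis
      proof (cases "\<rho> x (snd X) < K")
        case False
        then show ?thesis
          using cone_fun_le(1)[OF p, of K \<rho> Y] 2 by simp
      next
        case True
        have xt: "x \<in> triangle_points D"
          using surface_rep(1)[OF p 2(1)] .
        have near: "dist (snd x) (snd (edge_point D e t)) < gap x"
          using far[OF 2(1) True] class_gap(2)[OF p 2(1)] e(1) by simp
        have fe: "fst e = fst x"
          using 2(2) e(1) by simp
        obtain s where s: "0 \<le> s" "s \<le> 1" "x = edge_point D e s"
          by (rule gap_isolates[OF xt e(3) fe near])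
        define y where "y = edge_point D (mate D e) (1 - s)"
        have "(x, y) \<in> glued D"
          unfolding glued_def mem_Collect_eq y_def
          by (intro exI[of _ e] exI[of _ s] conjI) (use s e in simp_all)
        then have "y \<in> pt D x"
          unfolding pt_def by auto
        then have yp: "y \<in> p"
          using surface_rep(2)[OF p 2(1)] by simp
        have "fst y = fst Y"
          by (simp add: y_def e(2))
        then have "cone_fun p K \<rho> Y \<le> \<rho> y (snd Y)"
          using cone_fun_le(2)[OF p yp] by simp
        also have "\<dots> = \<rho> x (snd X)"
          unfolding y_def e(1,2) s(3) using match[OF e(3,4) s(1,2) e(5,6)] 2(1) s(3) by simp
        finally show ?thesis
          using 2(3) by simp
      qed
    qed
  qed
  show ?thesis
    using le[OF XY] le[OF glued_sym[OF XY]] by simp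
qed

lemma cone_fun_lipschitz:
  assumes p: "p \<in> surface D" and lip: "\<And>x b b'. x \<in> p \<Longrightarrow> \<bar>\<rho> x b - \<rho> x b'\<bar> \<le> dist b b'"
  shows "\<bar>cone_fun p K \<rho> (i, z) - cone_fun p K \<rho> (i, w)\<bar> \<le> dist z w"
proof -
  have le: "cone_fun p K \<rho> (i, w) \<le> cone_fun p K \<rho> (i, z) + dist z w" for z w
  proof (cases rule: cone_fun_cases[OF p, of K \<rho> "(i, z)"])
    case 1
    then show ?thesis
      using cone_fun_le(1)[OF p, of K \<rho> "(i, w)"] zero_le_dist[of z w] by linarith
  next
    case (2 x)
    then show ?thesis
      using cone_fun_le(2)[OF p 2(1), of "(i, w)" K \<rho>] lip[OF 2(1), of w z] dist_commute[of z w] by simp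
  qed
  show ?thesis
    using le[of w z] le[of z w] by (simp add: abs_le_iff dist_commute)
qed

lemma dist_edge_points:
  assumes "e \<in> edges D"
  shows "dist (snd (edge_point D e s)) (snd (edge_point D e t)) = \<bar>s - t\<bar> * edge_length D e"
proof -
  have "snd (edge_point D e s) - snd (edge_point D e t) = of_real ((s - t) * edge_length D e) * edge_dir D e"
    by (simp add: edge_point_eq[OF assms] algebra_simps)
  then show ?thesis
    using norm_edge_dir[OF assms] edge_length_pos[OF assms]
    by (simp add: dist_norm norm_mult del: of_real_mult of_real_diff) (simp add: abs_mult)
qed

end

text \<open>The distance is an infimum of lengths, and this condition ensures that such an infimum
  is never taken over the empty set.\<close>

locale connected_gluing = glued_triangles +
  assumes polygonally_connected: "p \<in> surface D \<Longrightarrow> r \<in> surface D \<Longrightarrow> \<exists>l. polygonal_length D p r l"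
begin

lemma surface_dist_ge:
  assumes "p \<in> surface D" "r \<in> surface D" "\<And>l. polygonal_length D p r l \<Longrightarrow> B \<le> l"
  shows "B \<le> surface_dist D p r"
  unfolding surface_dist_def by (rule cInf_greatest) (use polygonally_connected[OF assms(1,2)] assms(3) in auto)

lemma lipschitz_invariant:
  assumes inv: "\<And>X Y. (X, Y) \<in> glued D \<Longrightarrow> V X = V Y"
    and lip: "\<And>i z w. i \<in> tris D \<Longrightarrow> z \<in> triangle D i \<Longrightarrow> w \<in> triangle D i \<Longrightarrow> \<bar>V (i, z) - V (i, w)\<bar> \<le> dist z w"
    and "p \<in> surface D" "r \<in> surface D" "x \<in> p" "y \<in> r"
  shows "\<bar>V x - V y\<bar> \<le> surface_dist D p r"
  by (rule surface_dist_ge[OF assms(3,4)]) (use lipschitz_invariant_polygonal[OF inv lip] assms(5,6) in blast)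

text \<open>The test function is the distance to the nearest representative of \<open>p\<close> in
  the same triangle, truncated at the class gap. It is at most 0 at \<open>p\<close>, so at
  \<open>y\<close> it is bounded by the surface distance.\<close>

lemma near_representative:
  assumes p: "p \<in> surface D" and r: "r \<in> surface D" and y: "y \<in> r"
    and near: "surface_dist D p r < class_gap p"
  obtains x where "x \<in> p" "fst x = fst y" "dist (snd x) (snd y) \<le> surface_dist D p r"
proof -
  let ?V = "cone_fun p (class_gap p) (\<lambda>x b. dist (snd x) b)"
  have inv: "?V X = ?V Y" if "(X, Y) \<in> glued D" for X Y
  proof (rule cone_fun_invariant[OF p _ _ that])
    fix e s t assume "e \<in> edges D"
    then show "dist (snd (edge_point D (mate D e) (1 - s))) (snd (edge_point D (mate D e) (1 - t))) =
       dist (snd (edge_point D e s)) (snd (edge_point D e t))"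
      using dist_edge_points mate_edges mate_length by (simp add: abs_minus_commute)
  qed
  have lip: "\<bar>?V (i, z) - ?V (i, w)\<bar> \<le> dist z w" for i z w
  proof (rule cone_fun_lipschitz[OF p])
    fix x b b'
    show "\<bar>dist (snd x) b - dist (snd x) b'\<bar> \<le> dist b b'" if "x \<in> p"
      using dist_triangle[of "snd x" b b'] dist_triangle[of "snd x" b' b] dist_commute[of b b']
      by (simp add: abs_le_iff)
  qed
  obtain x0 where x0: "x0 \<in> p"
    using surface_rep_ex[OF p] by blast
  have "?V x0 \<le> 0"
    using cone_fun_le(2)[OF p x0 refl, of "class_gap p" "\<lambda>x b. dist (snd x) b"] by simp
  moreover have "\<bar>?V x0 - ?V y\<bar> \<le> surface_dist D p r"
    by (rule lipschitz_invariant[OF inv lip p r x0 y])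
  ultimately have Vy: "?V y \<le> surface_dist D p r"
    by linarith
  show ?thesis
  proof (cases rule: cone_fun_cases[OF p, of "class_gap p" "\<lambda>x b. dist (snd x) b" y])
    case 1
    then show ?thesis
      using Vy near by simp
  next
    case (2 x)
    then show ?thesis
      using that Vy by simp
  qed
qed

lemma metric: "Metric_space (surface D) sdist"
proof
  show nn: "0 \<le> sdist p r" for p r
    unfolding sdist_def using surface_dist_ge[of p r 0] polygonal_length_surface by auto
  have "polygonal_length D p r = polygonal_length D r p" for p r
    using polygonal_length_sym by blast
  then show "sdist p r = sdist r p" for p r
    unfolding sdist_def surface_dist_def by auto
  show "(sdist p r = 0) = (p = r)" if p: "p \<in> surface D" and r: "r \<in> surface D" for p r
  proof
    assume "p = r"
    then show "sdist p r = 0"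
      using nn[of p p] surface_dist_le[OF polygonal_length.start[OF p]] p by (simp add: sdist_def)
  next
    assume z: "sdist p r = 0"
    then have sd: "surface_dist D p r = 0"
      using p r by (simp add: sdist_def)
    obtain y where y: "y \<in> r"
      using surface_rep_ex[OF r] by blast
    \<comment> \<open>Distance 0 yields a representative of \<open>p\<close> at distance 0 from
      \<open>y\<close>, which is what makes the pseudometric a metric.\<close>
    have near: "surface_dist D p r < class_gap p"
      using sd class_gap(1)[OF p] by simp
    obtain x where x: "x \<in> p" "fst x = fst y" "dist (snd x) (snd y) \<le> surface_dist D p r"
      by (rule near_representative[OF p r y near])
    then have "x = y"
      using sd by (simp add: prod_eq_iff)
    then show "p = r"
      using surface_rep(2)[OF p x(1)] surface_rep(2)[OF r y] by simp
  qed
  show "sdist p s \<le> sdist p r + sdist r s" if p: "p \<in> surface D" and r: "r \<in> surface D" and s: "s \<in> surface D" for p r s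
  proof -
    have "surface_dist D p s - surface_dist D r s \<le> surface_dist D p r"
    proof (rule surface_dist_ge[OF p r])
      fix l assume l: "polygonal_length D p r l"
      have "surface_dist D p s - l \<le> surface_dist D r s"
      proof (rule surface_dist_ge[OF r s])
        fix m assume "polygonal_length D r s m"
        then show "surface_dist D p s - l \<le> m"
          using surface_dist_le[OF polygonal_length_trans[OF _ l]] by fastforce
      qed
      then show "surface_dist D p s - surface_dist D r s \<le> l"
        by simp
    qed
    then show ?thesis
      using p r s by (simp add: sdist_def)
  qed
qed

end

sublocale connected_gluing \<subseteq> surf: Metric_space "surface D" sdist
  by (rule metric)

context connected_gluing begin

text \<open>Distances in a triangle dominate surface distances, so metrically open sets are open in
  the quotient. Conversely a small metric ball is reached from the finitely many representatives of
  its centre inside single triangles.\<close>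

lemma surface_topology_metric: "surf.mtopology = surface_topology D"
proof (rule topology_eq[THEN iffD2], intro allI iffI)
  let ?X = "sum_topology (\<lambda>i. top_of_set (triangle D i)) (tris D)"
  have opn: "openin ?X {x \<in> triangle_points D. pt D x \<in> U} \<longleftrightarrow>
    (\<forall>i\<in>tris D. \<forall>z\<in>triangle D i. pt D (i, z) \<in> U \<longrightarrow>
       (\<exists>e>0. \<forall>w\<in>triangle D i. dist w z < e \<longrightarrow> pt D (i, w) \<in> U))" for U
  proof -
    have "openin ?X {x \<in> triangle_points D. pt D x \<in> U} \<longleftrightarrow>
      (\<forall>i\<in>tris D. openin (top_of_set (triangle D i)) {z \<in> triangle D i. pt D (i, z) \<in> U})"
      unfolding openin_sum_topology by (auto simp: triangle_points_def intro!: arg_cong2[where f = openin])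
    also have "\<dots> \<longleftrightarrow> (\<forall>i\<in>tris D. \<forall>z\<in>triangle D i. pt D (i, z) \<in> U \<longrightarrow>
       (\<exists>e>0. \<forall>w\<in>triangle D i. dist w z < e \<longrightarrow> pt D (i, w) \<in> U))"
      unfolding openin_euclidean_subtopology_iff by auto
    finally show ?thesis .
  qed
  fix U
  {
    assume "openin surf.mtopology U"
    then have U: "U \<subseteq> surface D" "\<And>p. p \<in> U \<Longrightarrow> \<exists>r>0. surf.mball p r \<subseteq> U"
      by (auto simp: surf.openin_mtopology)
    have "\<exists>e>0. \<forall>w\<in>triangle D i. dist w z < e \<longrightarrow> pt D (i, w) \<in> U"
      if i: "i \<in> tris D" "z \<in> triangle D i" "pt D (i, z) \<in> U" for i z
    proof -
      obtain r where r: "r > 0" "surf.mball (pt D (i, z)) r \<subseteq> U"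
        using U(2)[OF i(3)] by blast
      have "pt D (i, w) \<in> U" if w: "w \<in> triangle D i" "dist w z < r" for w
      proof -
        have "surface_dist D (pt D (i, z)) (pt D (i, w)) < r"
          using surface_dist_segment[OF i(1,2) w(1)] w(2) by (simp add: dist_commute)
        then have "pt D (i, w) \<in> surf.mball (pt D (i, z)) r"
          using pt_mem_surface[OF i(1,2)] pt_mem_surface[OF i(1) w(1)] by (simp add: sdist_def)
        then show ?thesis
          using r(2) by blast
      qed
      then show ?thesis
        using r(1) by blast
    qed
    then show "openin (surface_topology D) U"
      unfolding openin_surface_topology opn using U(1) by blast
  }
  assume "openin (surface_topology D) U"
  then have U: "U \<subseteq> surface D"
    "\<And>i z. i \<in> tris D \<Longrightarrow> z \<in> triangle D i \<Longrightarrow> pt D (i, z) \<in> U \<Longrightarrow> \<exists>e>0. \<forall>w\<in>triangle D i. dist w z < e \<longrightarrow> pt D (i, w) \<in> U"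
    unfolding openin_surface_topology opn by auto
  show "openin surf.mtopology U"
    unfolding surf.openin_mtopology
  proof (intro conjI allI impI U(1))
    fix p assume pU: "p \<in> U"
    then have p: "p \<in> surface D"
      using U(1) by blast
    have "\<exists>e>0. \<forall>w\<in>triangle D (fst x). dist w (snd x) < e \<longrightarrow> pt D (fst x, w) \<in> U" if "x \<in> p" for x
      using U(2)[of "fst x" "snd x"] surface_rep[OF p that] pU by (auto simp: triangle_points_def)
    then obtain E where E: "\<And>x. x \<in> p \<Longrightarrow> E x > 0"
      "\<And>x w. x \<in> p \<Longrightarrow> w \<in> triangle D (fst x) \<Longrightarrow> dist w (snd x) < E x \<Longrightarrow> pt D (fst x, w) \<in> U"
      by metis
    define r where "r = Min (insert (class_gap p) (E ` p))"
    have fin: "finite (insert (class_gap p) (E ` p))"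
      using finite_class[OF p] by simp
    have rpos: "r > 0"
      unfolding r_def using fin E(1) class_gap(1)[OF p] by (subst Min_gr_iff) auto
    have rle: "r \<le> class_gap p" "x \<in> p \<Longrightarrow> r \<le> E x" for x
      unfolding r_def by (intro Min_le[OF fin]; simp)+
    have "q \<in> U" if q: "q \<in> surf.mball p r" for q
    proof -
      have qs: "q \<in> surface D" and dq: "surface_dist D p q < r"
        using q by (auto simp: sdist_def)
      obtain y where y: "y \<in> q"
        using surface_rep_ex[OF qs] by blast
      have near: "surface_dist D p q < class_gap p"
        using dq rle(1) by simp
      obtain x where x: "x \<in> p" "fst x = fst y" "dist (snd x) (snd y) \<le> surface_dist D p q"
        by (rule near_representative[OF p qs y near])
      have "snd y \<in> triangle D (fst x)"
        using surface_rep(1)[OF qs y] x(2) by (auto simp: triangle_points_def)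
      moreover have "dist (snd y) (snd x) < E x"
        using x(3) dq rle(2)[OF x(1)] by (simp add: dist_commute)
      ultimately have "pt D (fst x, snd y) \<in> U"
        using E(2)[OF x(1)] by blast
      then show ?thesis
        using surface_rep(2)[OF qs y] x(2) by simp
    qed
    then show "\<exists>r>0. surf.mball p r \<subseteq> U"
      using rpos by blast
  qed
qed

subsection \<open>Charts from fans\<close>

lemma closed_tangent_cone: "closed (tangent_cone D x)"
proof -
  have "tangent_cone D x = (\<Inter>j\<in>{j. height D (fst x, j) (snd x) = 0}. {v. 0 \<le> Im (cnj (edge_dir D (fst x, j)) * v)})"
    unfolding tangent_cone_def by blast
  moreover have "closed {v. 0 \<le> Im (cnj a * v)}" for a
    by (intro closed_Collect_le continuous_intros)
  ultimately show ?thesis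
    by (simp only:) (intro closed_INT ballI)
qed

lemma convex_tangent_cone: "convex (tangent_cone D x)"
proof (rule convexI)
  fix v w :: complex and a b :: real
  assume vw: "v \<in> tangent_cone D x" "w \<in> tangent_cone D x" and ab: "0 \<le> a" "0 \<le> b" "a + b = 1"
  have "Im (cnj c * (a *\<^sub>R v + b *\<^sub>R w)) = a * Im (cnj c * v) + b * Im (cnj c * w)" for c
    by (simp add: algebra_simps)
  then show "a *\<^sub>R v + b *\<^sub>R w \<in> tangent_cone D x"
    using vw ab unfolding tangent_cone_def mem_Collect_eq by (metis add_nonneg_nonneg mult_nonneg_nonneg)
qed

lemma zero_mem_tangent_cone: "0 \<in> tangent_cone D x"
  by (simp add: tangent_cone_def)

text \<open>The factor \<open>c x\<close> turns the cone of \<open>x\<close> into its place in the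
  plane. The placed cones cover \<open>H\<close>, glued sides are placed compatibly, and
  \<open>f\<close> is well defined on overlaps. Distances are bounded above by cutting segments of
  the convex set \<open>H\<close> at the cones, and below by a test function.\<close>

lemma chart_of_cones:
  assumes p: "p \<in> surface D" and H: "convex H"
    and c: "\<And>x. x \<in> p \<Longrightarrow> norm (c x) = 1"
    and compat: "\<And>e s. e \<in> edges D \<Longrightarrow> mate D e \<noteq> e \<Longrightarrow> 0 \<le> s \<Longrightarrow> s \<le> 1 \<Longrightarrow> edge_point D e s \<in> p \<Longrightarrow>
       c (edge_point D (mate D e) (1 - s)) * edge_dir D (mate D e) = - (c (edge_point D e s) * edge_dir D e)"
    and cover: "\<And>w. w \<in> H \<longleftrightarrow> (\<exists>x\<in>p. \<exists>v\<in>tangent_cone D x. w = c x * v)"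
    and wd: "0 < \<epsilon>1" "\<And>x y v v'. x \<in> p \<Longrightarrow> y \<in> p \<Longrightarrow> v \<in> tangent_cone D x \<Longrightarrow> v' \<in> tangent_cone D y \<Longrightarrow>
       c x * v = c y * v' \<Longrightarrow> norm v < \<epsilon>1 \<Longrightarrow> pt D (fst x, snd x + v) = pt D (fst y, snd y + v')"
  shows "\<exists>\<epsilon>>0. \<exists>f. surf.chart H p \<epsilon> f \<and> (\<forall>x\<in>p. \<forall>v\<in>tangent_cone D x. norm v < \<epsilon> \<longrightarrow>
     c x * v \<in> H \<and> f (c x * v) = pt D (fst x, snd x + v))"
proof -
  have coverI: "c x * v \<in> H" if "x \<in> p" "v \<in> tangent_cone D x" for x v
    unfolding cover using that by blast
  \<comment> \<open>Several representatives may share a triangle; \<open>sep\<close> keeps their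
    neighbourhoods apart. Pairs in different triangles are included, which only makes it
    smaller.\<close>
  define sep where "sep = Min (insert 1 ((\<lambda>(x, y). dist (snd x) (snd y)) ` {(x, y) \<in> p \<times> p. snd x \<noteq> snd y}))"
  have fin: "finite (insert 1 ((\<lambda>(x, y). dist (snd x) (snd y)) ` {(x, y) \<in> p \<times> p. snd x \<noteq> snd y}))"
  proof -
    have "finite (p \<times> p)"
      using finite_class[OF p] by simp
    then have "finite {(x, y) \<in> p \<times> p. snd x \<noteq> snd y}"
      by (rule rev_finite_subset) blast
    then show ?thesis
      by simp
  qed
  have sep0: "0 < sep"
    unfolding sep_def by (subst Min_gr_iff[OF fin]) auto
  have sep: "sep \<le> dist (snd x) (snd y)" if "x \<in> p" "y \<in> p" "snd x \<noteq> snd y" for x y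
    unfolding sep_def
    by (rule Min_le[OF fin], intro insertI2 image_eqI[of _ _ "(x, y)"]) (use that in simp_all)
  define \<epsilon>0 where "\<epsilon>0 = min (min (class_gap p) \<epsilon>1) sep"
  have \<epsilon>0: "0 < \<epsilon>0" "\<epsilon>0 \<le> class_gap p" "\<epsilon>0 \<le> \<epsilon>1" "\<epsilon>0 \<le> sep"
    using class_gap(1)[OF p] wd(1) sep0 by (auto simp: \<epsilon>0_def)
  \<comment> \<open>On the ball of radius \<epsilon>0 the map is 1-Lipschitz. The factor 4 leaves
    room for the lower bound, where up to three norms below \<epsilon> have to be subtracted from
    \<epsilon>0.\<close>
  define \<epsilon> where "\<epsilon> = \<epsilon>0 / 4"
  have \<epsilon>: "0 < \<epsilon>" "\<epsilon>0 = 4 * \<epsilon>"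
    using \<epsilon>0 by (auto simp: \<epsilon>_def)
  \<comment> \<open>Different cones containing \<open>w\<close> give the same point within radius
    \<epsilon>1, so the choice is immaterial there.\<close>
  define f where "f w = (SOME r. \<exists>x\<in>p. \<exists>v\<in>tangent_cone D x. w = c x * v \<and> r = pt D (fst x, snd x + v))" for w
  have ncv: "norm (c x * v) = norm v" if "x \<in> p" for x v
    using c[OF that] by (simp add: norm_mult)
  have f: "f (c x * v) = pt D (fst x, snd x + v)" if x: "x \<in> p" and v: "v \<in> tangent_cone D x" "norm v < \<epsilon>0" for x v
  proof -
    have ex: "\<exists>r. \<exists>x'\<in>p. \<exists>v'\<in>tangent_cone D x'. c x * v = c x' * v' \<and> r = pt D (fst x', snd x' + v')"
      by (intro exI[of _ "pt D (fst x, snd x + v)"] bexI[OF _ x] bexI[OF _ v(1)] conjI refl)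
    obtain x' v' where x': "x' \<in> p" "v' \<in> tangent_cone D x'" "c x * v = c x' * v'"
      "f (c x * v) = pt D (fst x', snd x' + v')"
      using someI_ex[OF ex] unfolding f_def by blast
    show ?thesis
      using wd(2)[OF x x'(1) v(1) x'(2,3)] v(2) \<epsilon>0(3) x'(4) by simp
  qed
  have tri: "snd x + v \<in> triangle D (fst x)" "fst x \<in> tris D"
    if x: "x \<in> p" and v: "v \<in> tangent_cone D x" "norm v < \<epsilon>0" for x v
    using mem_triangle_tangent_cone[OF surface_rep(1)[OF p x], of v] class_gap(2)[OF p x] \<epsilon>0(2) v
      surface_rep(1)[OF p x] by (auto simp: triangle_points_def)
  have fS: "f w \<in> surface D" if wH: "w \<in> H" and wn: "norm w < \<epsilon>0" for w
  proof -
    obtain x v where x: "x \<in> p" "v \<in> tangent_cone D x" "w = c x * v"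
      using iffD1[OF cover wH] by blast
    then have "norm v < \<epsilon>0"
      using wn ncv by simp
    then show ?thesis
      using f[OF x(1,2)] tri[OF x(1,2)] x(3) pt_mem_surface by simp
  qed
  have upper: "sdist (f z) (f w) \<le> dist z w" if z: "z \<in> ball 0 \<epsilon>0 \<inter> H" and w: "w \<in> ball 0 \<epsilon>0 \<inter> H" for z w
  proof (rule segment_cover_dist_le[where I = p and C = "\<lambda>x. (\<lambda>v. c x * v) ` tangent_cone D x" and N = "ball 0 \<epsilon>0 \<inter> H" and d = sdist])
    have hom: "linear (\<lambda>v. c x * v)" for x
      by (simp add: linear_iff algebra_simps)
    have inv: "(\<lambda>v. c x * v) ` A = (\<lambda>v. cnj (c x) * v) -` A" if "x \<in> p" for x A
    proof -
      have cc: "cnj (c x) * (c x * v) = v" "c x * (cnj (c x) * v) = v" for v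
        using c[OF that] by (simp_all add: mult.assoc[symmetric] complex_norm_square[symmetric] mult.commute[of "cnj _"])
      show ?thesis
      proof (intro equalityI subsetI)
        show "w \<in> (\<lambda>v. cnj (c x) * v) -` A" if "w \<in> (\<lambda>v. c x * v) ` A" for w
          using that by (elim imageE) (simp only: vimage_eq cc(1))
        show "w \<in> (\<lambda>v. c x * v) ` A" if "w \<in> (\<lambda>v. cnj (c x) * v) -` A" for w
          using that cc(2)[of w] by (metis imageI vimageD)
      qed
    qed
    show "closed ((\<lambda>v. c x * v) ` tangent_cone D x)" if "x \<in> p" for x
      unfolding inv[OF that] by (rule closed_vimage[OF closed_tangent_cone]) (intro continuous_intros)
    show "convex ((\<lambda>v. c x * v) ` tangent_cone D x)" for x
      by (rule convex_linear_image[OF hom convex_tangent_cone])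
    show "finite p"
      by (rule finite_class[OF p])
    show cN: "convex (ball 0 \<epsilon>0 \<inter> H)"
      by (intro convex_Int convex_ball H)
    show "sdist (f a) (f b) \<le> dist a b"
      if x: "x \<in> p" and a: "a \<in> (\<lambda>v. c x * v) ` tangent_cone D x \<inter> (ball 0 \<epsilon>0 \<inter> H)"
        and b: "b \<in> (\<lambda>v. c x * v) ` tangent_cone D x \<inter> (ball 0 \<epsilon>0 \<inter> H)" for x a b
    proof -
      obtain v where v: "v \<in> tangent_cone D x" "a = c x * v" "norm v < \<epsilon>0"
        using a ncv[OF x] by auto
      obtain w where w: "w \<in> tangent_cone D x" "b = c x * w" "norm w < \<epsilon>0"
        using b ncv[OF x] by auto
      have "sdist (f a) (f b) = surface_dist D (f a) (f b)"
        using fS[of a] fS[of b] a b by (simp add: sdist_def)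
      also have "\<dots> \<le> dist (snd x + v) (snd x + w)"
        unfolding v(2) w(2) f[OF x v(1,3)] f[OF x w(1,3)]
        by (rule surface_dist_segment[OF tri(2)[OF x v(1,3)] tri(1)[OF x v(1,3)] tri(1)[OF x w(1,3)]])
      also have "\<dots> = dist a b"
        unfolding v(2) w(2) dist_norm right_diff_distrib[symmetric] ncv[OF x] by simp
      finally show ?thesis .
    qed
    show "sdist (f a) (f b) \<le> sdist (f a) (f c) + sdist (f c) (f b)"
      if "a \<in> ball 0 \<epsilon>0 \<inter> H" "c \<in> ball 0 \<epsilon>0 \<inter> H" "b \<in> ball 0 \<epsilon>0 \<inter> H" for a b c
      using surf.triangle fS that by simp
    have "closed_segment z w \<subseteq> ball 0 \<epsilon>0 \<inter> H"
      using closed_segment_subset[OF z w cN] .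
    moreover have "a \<in> (\<Union>x\<in>p. (\<lambda>v. c x * v) ` tangent_cone D x)" if "a \<in> H" for a
      using iffD1[OF cover that] by blast
    ultimately show "closed_segment z w \<subseteq> (\<Union>x\<in>p. (\<lambda>v. c x * v) ` tangent_cone D x)"
      by blast
  qed (use z w in auto)
  have lower: "dist z w \<le> sdist (f z) (f w)" if z: "z \<in> ball 0 \<epsilon> \<inter> H" and w: "w \<in> ball 0 \<epsilon> \<inter> H" for z w
  proof -
    define \<rho> where "\<rho> x b = norm (c x * (b - snd x) - z)" for x b
    \<comment> \<open>The local functions measure the distance from \<open>z\<close> after placing.
      A value below \<open>K\<close> forces the placed point into the ball of radius \<epsilon>0,
      where gluing is understood, and \<open>K\<close> still exceeds
      \<open>dist z w\<close>.\<close>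
    define K where "K = \<epsilon>0 - norm z"
    let ?V = "cone_fun p K \<rho>"
    have nz: "norm z < \<epsilon>" "norm w < \<epsilon>"
      using z w by auto
    have inv: "?V X = ?V Y" if "(X, Y) \<in> glued D" for X Y
    proof (rule cone_fun_invariant[OF p _ _ that])
      fix x b assume x: "x \<in> p" and "\<rho> x b < K"
      then have "norm (c x * (b - snd x)) < \<epsilon>0"
        using norm_triangle_sub[of "c x * (b - snd x)" z] by (simp add: \<rho>_def K_def)
      then show "dist (snd x) b < class_gap p"
        using \<epsilon>0(2) by (simp add: ncv[OF x] dist_norm norm_minus_commute)
    next
      fix e s t assume e: "e \<in> edges D" "mate D e \<noteq> e" and s: "0 \<le> s" "s \<le> 1" and ep: "edge_point D e s \<in> p"
      have 1: "snd (edge_point D e t) - snd (edge_point D e s) = of_real ((t - s) * edge_length D e) * edge_dir D e"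
        by (simp add: edge_point_eq[OF e(1)] algebra_simps)
      have 2: "snd (edge_point D (mate D e) (1 - t)) - snd (edge_point D (mate D e) (1 - s)) =
        of_real ((t - s) * edge_length D e) * (- edge_dir D (mate D e))"
        by (simp add: edge_point_eq[OF mate_edges[OF e(1)]] mate_length[OF e(1)] algebra_simps)
      have "c (edge_point D (mate D e) (1 - s)) * (of_real ((t - s) * edge_length D e) * (- edge_dir D (mate D e))) =
        c (edge_point D e s) * (of_real ((t - s) * edge_length D e) * edge_dir D e)"
        using compat[OF e s ep] by (simp only: mult.left_commute[of "c _"] mult_minus_right minus_minus)
      then show "\<rho> (edge_point D (mate D e) (1 - s)) (snd (edge_point D (mate D e) (1 - t))) =
        \<rho> (edge_point D e s) (snd (edge_point D e t))"
        unfolding \<rho>_def 1 2 by simp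
    qed
    have lip: "\<bar>?V (i, a) - ?V (i, b)\<bar> \<le> dist a b" for i a b
    proof (rule cone_fun_lipschitz[OF p])
      fix x a b assume x: "x \<in> p"
      have "\<bar>\<rho> x a - \<rho> x b\<bar> \<le> norm ((c x * (a - snd x) - z) - (c x * (b - snd x) - z))"
        unfolding \<rho>_def by (rule norm_triangle_ineq3)
      also have "\<dots> = norm (c x * (a - b))"
        by (simp add: algebra_simps)
      finally show "\<bar>\<rho> x a - \<rho> x b\<bar> \<le> dist a b"
        by (simp add: ncv[OF x] dist_norm)
    qed
    obtain x v where x: "x \<in> p" "v \<in> tangent_cone D x" "z = c x * v"
      using iffD1[OF cover IntD2[OF z]] by blast
    obtain y u where y: "y \<in> p" "u \<in> tangent_cone D y" "w = c y * u"
      using iffD1[OF cover IntD2[OF w]] by blast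
    have nvu: "norm v < \<epsilon>" "norm u < \<epsilon>"
      using nz ncv[OF x(1), of v] ncv[OF y(1), of u] x(3) y(3) by auto
    have fz: "f z = pt D (fst x, snd x + v)" and fw: "f w = pt D (fst y, snd y + u)"
      using f[OF x(1,2)] f[OF y(1,2)] x(3) y(3) nvu \<epsilon> by auto
    have "?V (fst x, snd x + v) \<le> 0"
      using cone_fun_le(2)[OF p x(1), of "(fst x, snd x + v)" K \<rho>] x(3) by (simp add: \<rho>_def)
    moreover have "dist z w \<le> ?V (fst y, snd y + u)"
    proof (cases rule: cone_fun_cases[OF p, of K \<rho> "(fst y, snd y + u)"])
      case 1
      then show ?thesis
        unfolding 1 K_def dist_norm using nz \<epsilon> norm_triangle_ineq4[of z w] by linarith
    next
      case (2 x')
      show ?thesis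
      proof (cases "snd x' = snd y")
        case True
        then have "x' = y"
          using 2(2) by (simp add: prod_eq_iff)
        then show ?thesis
          using 2(3) y(3) by (simp add: \<rho>_def dist_norm norm_minus_commute)
      next
        case False
        \<comment> \<open>The minimum may be attained at another representative in the same
          triangle; it is then too far from the point for its value to fall below
          \<open>dist z w\<close>.\<close>
        have "4 * \<epsilon> \<le> norm (snd y - snd x')"
          using sep[OF 2(1) y(1) False] \<epsilon>0(4) \<epsilon>(2) by (simp add: dist_norm norm_minus_commute)
        also have "\<dots> \<le> norm (snd y + u - snd x') + norm u"
          using norm_triangle_ineq4[of "snd y + u - snd x'" u] by simp
        also have "norm (snd y + u - snd x') = norm (c x' * (snd y + u - snd x'))"
          using ncv[OF 2(1)] by simp
        also have "\<dots> \<le> \<rho> x' (snd y + u) + norm z"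
          using norm_triangle_sub[of "c x' * (snd y + u - snd x')" z] by (simp add: \<rho>_def add.commute)
        finally show ?thesis
          unfolding 2(3) dist_norm snd_conv using nvu nz norm_triangle_ineq4[of z w] by linarith
      qed
    qed
    moreover have "\<bar>?V (fst x, snd x + v) - ?V (fst y, snd y + u)\<bar> \<le> surface_dist D (f z) (f w)"
    proof (rule lipschitz_invariant[OF inv lip])
      show "f z \<in> surface D" "f w \<in> surface D"
        using fS z w \<epsilon> by auto
      show "(fst x, snd x + v) \<in> f z" "(fst y, snd y + u) \<in> f w"
        unfolding fz fw by (rule mem_pt_self)+
    qed
    ultimately show ?thesis
      using fS[of z] fS[of w] z w \<epsilon> by (simp add: sdist_def)
  qed
  obtain x0 where x0: "x0 \<in> p"
    using surface_rep_ex[OF p] by blast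
  have f0: "f 0 = p"
    using f[OF x0 zero_mem_tangent_cone] \<epsilon>0(1) surface_rep(2)[OF p x0] by simp
  have H0: "0 \<in> H"
    using x0 zero_mem_tangent_cone[of x0] by (intro iffD2[OF cover] bexI[of _ x0] bexI[of _ 0]) simp_all
  have iso: "sdist (f z) (f w) = dist z w" if "z \<in> ball 0 \<epsilon> \<inter> H" "w \<in> ball 0 \<epsilon> \<inter> H" for z w
    using upper[of z w] lower[OF that] that \<epsilon> by simp
  have img: "f ` (ball 0 \<epsilon> \<inter> H) = {r \<in> surface D. sdist p r < \<epsilon>}"
  proof (intro equalityI subsetI)
    fix r assume "r \<in> f ` (ball 0 \<epsilon> \<inter> H)"
    then obtain w where w: "w \<in> ball 0 \<epsilon> \<inter> H" "r = f w"
      by blast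
    have "sdist p r = norm w"
      using iso[of 0 w] w H0 \<epsilon>(1) f0 by simp
    then show "r \<in> {r \<in> surface D. sdist p r < \<epsilon>}"
      using w fS[of w] \<epsilon> by simp
  next
    fix r assume "r \<in> {r \<in> surface D. sdist p r < \<epsilon>}"
    then have r: "r \<in> surface D" "surface_dist D p r < \<epsilon>"
      using p by (auto simp: sdist_def)
    obtain y where y: "y \<in> r"
      using surface_rep_ex[OF r(1)] by blast
    have near: "surface_dist D p r < class_gap p"
      using r(2) \<epsilon> \<epsilon>0(2) by simp
    obtain x where x: "x \<in> p" "fst x = fst y" "dist (snd x) (snd y) \<le> surface_dist D p r"
      by (rule near_representative[OF p r(1) y near])
    define v where "v = snd y - snd x"
    have nv: "norm v < \<epsilon>"
      using x(3) r(2) by (simp add: v_def dist_norm norm_minus_commute)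
    have "snd x + v \<in> triangle D (fst x)"
      using surface_rep(1)[OF r(1) y] x(2) by (auto simp: triangle_points_def v_def)
    then have v: "v \<in> tangent_cone D x"
      using mem_triangle_tangent_cone[OF surface_rep(1)[OF p x(1)], of v] class_gap(2)[OF p x(1)] nv \<epsilon> \<epsilon>0(2) by simp
    have "f (c x * v) = r"
      using f[OF x(1) v] nv \<epsilon> surface_rep(2)[OF r(1) y] x(2) by (simp add: v_def)
    moreover have "c x * v \<in> ball 0 \<epsilon> \<inter> H"
      using coverI[OF x(1) v] nv ncv[OF x(1)] by simp
    ultimately show "r \<in> f ` (ball 0 \<epsilon> \<inter> H)"
      by (metis imageI)
  qed
  have "surf.chart H p \<epsilon> f"
    unfolding surf.chart_def using f0 img iso by (intro conjI ballI)
  moreover have "\<forall>x\<in>p. \<forall>v\<in>tangent_cone D x. norm v < \<epsilon> \<longrightarrow> c x * v \<in> H \<and> f (c x * v) = pt D (fst x, snd x + v)"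
  proof (intro ballI impI conjI)
    fix x v assume x: "x \<in> p" and v: "v \<in> tangent_cone D x" "norm v < \<epsilon>"
    show "c x * v \<in> H"
      by (rule coverI[OF x v(1)])
    show "f (c x * v) = pt D (fst x, snd x + v)"
      using f[OF x v(1)] v(2) \<epsilon> by simp
  qed
  ultimately show ?thesis
    using \<epsilon>(1) by (intro exI[of _ \<epsilon>] exI[of _ f] conjI)
qed

end

section \<open>Turning around a point along a fan\<close>

context glued_triangles begin

lemma fan_succ:
  assumes f: "closed_fan \<kappa> n \<or> open_fan \<kappa> n" and \<kappa>': "\<kappa>' \<in> corners" "glued_left \<kappa>'"
    and k: "k < n" "\<kappa>' = \<kappa> k \<or> next_corner \<kappa>' = \<kappa> k"
  shows "\<exists>m<n. \<kappa>' = \<kappa> m \<and> (Suc m < n \<and> next_corner \<kappa>' = \<kappa> (Suc m) \<or>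
     m = n - 1 \<and> closed_fan \<kappa> n \<and> next_corner \<kappa>' = \<kappa> 0)"
proof -
  have fan: "fan \<kappa> n"
    using f by (auto simp: closed_fan_def open_fan_def)
  have n: "0 < n"
    using k by simp
  have step: "\<kappa> (Suc m) = next_corner (\<kappa> m)" if "Suc m < n" for m
    using fan that by (simp add: fan_def)
  from k(2) show ?thesis
  proof
    assume eq: "\<kappa>' = \<kappa> k"
    show ?thesis
    proof (cases "Suc k < n")
      case True
      then show ?thesis
        using k(1) eq step by (intro exI[of _ k]) simp
    next
      case False
      then have k1: "k = n - 1"
        using k by simp
      then have "closed_fan \<kappa> n"
        using f \<kappa>'(2) eq by (auto simp: open_fan_def)
      then show ?thesis
        using k(1) eq k1 by (intro exI[of _ k]) (simp add: closed_fan_def)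
    qed
  next
    assume eq: "next_corner \<kappa>' = \<kappa> k"
    show ?thesis
    proof (cases "k = 0")
      case False
      then have s: "Suc (k - 1) < n" "Suc (k - 1) = k"
        using k by auto
      then have "next_corner \<kappa>' = next_corner (\<kappa> (k - 1))"
        using step[of "k - 1"] eq by simp
      then have "\<kappa>' = \<kappa> (k - 1)"
        using inj_onD[OF next_corner_inj _ \<kappa>'(1) fan_corner[OF fan]] s(1) by simp
      then show ?thesis
        using s eq by (intro exI[of _ "k - 1"]) simp
    next
      case True
      have c: "closed_fan \<kappa> n"
      proof (rule ccontr)
        assume "\<not> closed_fan \<kappa> n"
        then have fr: "mate D (fst (\<kappa> 0)) = fst (\<kappa> 0)"
          using f by (simp add: open_fan_def)
        have "mate D (fst (left_side \<kappa>')) = fst (\<kappa> 0)"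
          using eq True by (metis fst_conv next_corner_def)
        then have "fst (left_side \<kappa>') = fst (\<kappa> 0)"
          using mate_mate left_side_mem[OF \<kappa>'(1)] fr by metis
        then show False
          using \<kappa>'(2) fr by (simp add: glued_left_def)
      qed
      then have "next_corner \<kappa>' = next_corner (\<kappa> (n - 1))"
        using eq True by (simp add: closed_fan_def)
      then have "\<kappa>' = \<kappa> (n - 1)"
        using inj_onD[OF next_corner_inj _ \<kappa>'(1) fan_corner[OF fan]] n by simp
      then show ?thesis
        using n c eq True by (intro exI[of _ "n - 1"]) simp
    qed
  qed
qed

text \<open>The same distance \<open>r\<close> is measured along the left side of a corner and the
  right side of the next one. The bound on \<open>r\<close> is the distance to the start vertex of
  the left side.\<close>

lemma glue_left:
  assumes \<kappa>: "\<kappa> \<in> corners" "glued_left \<kappa>"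
    and r: "0 \<le> r" "r \<le> snd (left_side \<kappa>) * edge_length D (fst (left_side \<kappa>))"
  shows "pt D (fst (corner_point \<kappa>), snd (corner_point \<kappa>) - of_real r * left_dir \<kappa>) =
    pt D (fst (corner_point (next_corner \<kappa>)), snd (corner_point (next_corner \<kappa>)) + of_real r * corner_dir (next_corner \<kappa>))"
proof -
  let ?e = "fst (left_side \<kappa>)" and ?s = "snd (left_side \<kappa>)"
  have e: "?e \<in> edges D" and s: "0 < ?s" "?s \<le> 1"
    using left_side_mem[OF \<kappa>(1)] by auto
  let ?l = "edge_length D ?e"
  have l: "0 < ?l"
    by (rule edge_length_pos[OF e])
  define t where "t = ?s - r / ?l"
  have t: "0 \<le> t" "t \<le> 1"
    using r l s by (auto simp: t_def pos_divide_le_eq intro: order_trans[of _ ?s])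
  have tl: "t * ?l = ?s * ?l - r"
    using l by (simp add: t_def left_diff_distrib)
  have "edge_point D ?e t = (fst (corner_point \<kappa>), snd (corner_point \<kappa>) - of_real r * left_dir \<kappa>)"
    unfolding corner_point_left_side[of \<kappa>, symmetric] left_dir_def edge_point_eq[OF e] tl
    by (simp add: algebra_simps)
  moreover have "edge_point D (mate D ?e) (1 - t) =
     (fst (corner_point (next_corner \<kappa>)), snd (corner_point (next_corner \<kappa>)) + of_real r * corner_dir (next_corner \<kappa>))"
  proof -
    have m: "mate D ?e \<in> edges D"
      by (rule mate_edges[OF e])
    have "(1 - t) * ?l = (1 - ?s) * ?l + r"
      using tl by (simp add: algebra_simps)
    then show ?thesis
      unfolding corner_point_def next_corner_def corner_dir_def fst_conv snd_conv edge_point_eq[OF m] mate_length[OF e]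
      by (simp add: algebra_simps)
  qed
  moreover have "(edge_point D ?e t, edge_point D (mate D ?e) (1 - t)) \<in> glued D"
    unfolding glued_def mem_Collect_eq
    by (intro exI[of _ ?e] exI[of _ t] conjI) (use e t \<kappa>(2) in \<open>simp_all add: glued_left_def\<close>)
  ultimately show ?thesis
    unfolding pt_eq_iff by (simp add: pt_def r_into_rtrancl)
qed

text \<open>The angle swept before the corner with index \<open>k\<close>, so that its cone is
  placed between the angles \<open>turn \<kappa> k\<close> and
  \<open>turn \<kappa> (Suc k)\<close>.\<close>

definition turn :: "(nat \<Rightarrow> ('i \<times> 3) \<times> real) \<Rightarrow> nat \<Rightarrow> real" where
  "turn \<kappa> k = (\<Sum>j<k. corner_angle (\<kappa> j))"

lemma turn_Suc: "turn \<kappa> (Suc k) = turn \<kappa> k + corner_angle (\<kappa> k)"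
  by (simp add: turn_def)

lemma turn_0 [simp]: "turn \<kappa> 0 = 0"
  by (simp add: turn_def)

lemma turn_less:
  assumes "fan \<kappa> n" "k < l" "l \<le> n"
  shows "turn \<kappa> k < turn \<kappa> l"
  using assms(2,3)
proof (induction l)
  case (Suc l)
  have "0 < corner_angle (\<kappa> l)"
    using corner_angle(1) fan_corner[OF assms(1)] Suc.prems by simp
  then show ?case
    using Suc by (cases "k = l") (auto simp: turn_Suc)
qed simp

lemma turn_le:
  assumes "fan \<kappa> n" "k \<le> l" "l \<le> n"
  shows "turn \<kappa> k \<le> turn \<kappa> l"
  using turn_less[OF assms(1) _ assms(3), of k] assms(2) by (cases "k = l") auto

lemma turn_find:
  assumes "0 \<le> \<phi>" "\<phi> \<le> turn \<kappa> n" "0 < n"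
  shows "\<exists>k<n. turn \<kappa> k \<le> \<phi> \<and> \<phi> \<le> turn \<kappa> (Suc k)"
  using assms
proof (induction n)
  case (Suc n)
  show ?case
  proof (cases "turn \<kappa> n \<le> \<phi>")
    case True
    then show ?thesis
      using Suc.prems by (intro exI[of _ n]) simp
  next
    case False
    then have "0 < n"
      using Suc.prems(1) by (cases n) auto
    then show ?thesis
      using Suc.IH Suc.prems(1) False less_SucI by fastforce
  qed
qed simp

end

context connected_gluing begin

text \<open>Placed at their accumulated angles, consecutive cones share exactly the ray along their
  glued side. A total of \<open>2 * pi\<close> or \<open>pi\<close> makes them fill the plane or the
  half plane, the last ray falling on the first one in the closed case.\<close>

lemma chart_of_fan:
  assumes f: "closed_fan \<kappa> n \<and> turn \<kappa> n = 2 * pi \<and> H = UNIV \<or> open_fan \<kappa> n \<and> turn \<kappa> n = pi \<and> H = upper"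
    and p: "p = pt D (corner_point (\<kappa> 0))"
  shows "\<exists>\<epsilon>>0. \<exists>f c. surf.chart H p \<epsilon> f \<and> (\<forall>x\<in>p. norm (c x) = 1 \<and> (\<forall>v\<in>tangent_cone D x. norm v < \<epsilon> \<longrightarrow>
     c x * v \<in> H \<and> f (c x * v) = pt D (fst x, snd x + v)))"
proof -
  have f': "closed_fan \<kappa> n \<or> open_fan \<kappa> n"
    using f by blast
  have fan: "fan \<kappa> n"
    using f' by (auto simp: closed_fan_def open_fan_def)
  have n: "0 < n" and inj: "inj_on \<kappa> {..<n}"
    using fan by (auto simp: fan_def)
  note kc = fan_corner[OF fan]
  define X where "X k = corner_point (\<kappa> k)" for k
  have pX: "p = X ` {..<n}"
    using fan_class[OF f' n] by (simp add: p X_def)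
  have pS: "p \<in> surface D"
    unfolding p surface_def by (rule imageI[OF corner_point_mem[OF kc[OF n]]])
  have Xinj: "k = l" if "k < n" "l < n" "X k = X l" for k l
    using inj_onD[OF corner_point_inj _ kc[OF that(1)] kc[OF that(2)]] inj_onD[OF inj, of k l] that
    by (simp add: X_def)
  define ix where "ix x = (SOME k. k < n \<and> X k = x)" for x
  have ix: "ix (X k) = k" if "k < n" for k
  proof -
    have "ix (X k) < n \<and> X (ix (X k)) = X k"
      unfolding ix_def by (rule someI[of _ k]) (use that in simp)
    then show ?thesis
      using Xinj that by blast
  qed
  \<comment> \<open>Sends the right side of the corner to angle \<open>turn \<kappa> k\<close>, and
    therefore its left side to angle \<open>turn \<kappa> (Suc k)\<close>.\<close>
  define c where "c x = cis (turn \<kappa> (ix x)) / corner_dir (\<kappa> (ix x))" for x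
  have cX: "c (X k) = cis (turn \<kappa> k) / corner_dir (\<kappa> k)" if "k < n" for k
    by (simp add: c_def ix[OF that])
  have nd: "norm (corner_dir (\<kappa> k)) = 1" if "k < n" for k
    by (rule norm_corner_dir[OF kc[OF that]])
  have nz: "corner_dir (\<kappa> k) \<noteq> 0" if "k < n" for k
    using nd[OF that] by auto
  have cdir: "c (X k) * corner_dir (\<kappa> k) = cis (turn \<kappa> k)" if "k < n" for k
    using nz[OF that] by (simp add: cX[OF that])
  have cleft: "c (X k) * left_dir (\<kappa> k) = - cis (turn \<kappa> (Suc k))" if "k < n" for k
  proof -
    have "left_dir (\<kappa> k) = - (corner_dir (\<kappa> k) * cis (corner_angle (\<kappa> k)))"
      using corner_angle(3)[OF kc[OF that]] by (metis minus_minus)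
    then have "c (X k) * left_dir (\<kappa> k) = - ((c (X k) * corner_dir (\<kappa> k)) * cis (corner_angle (\<kappa> k)))"
      by simp
    then show ?thesis
      by (simp add: cdir[OF that] cis_mult turn_Suc)
  qed
  have polar: "\<exists>r a. 0 \<le> r \<and> 0 \<le> a \<and> a \<le> corner_angle (\<kappa> k) \<and> v = corner_dir (\<kappa> k) * (of_real r * cis a) \<and>
      c (X k) * v = of_real r * cis (turn \<kappa> k + a)"
    if k: "k < n" and v: "v \<in> tangent_cone D (X k)" for k v
  proof -
    obtain r a where ra: "0 \<le> r" "0 \<le> a" "a \<le> corner_angle (\<kappa> k)" "v = corner_dir (\<kappa> k) * (of_real r * cis a)"
      using v tangent_cone_polar[OF kc[OF k]] unfolding X_def by blast
    have "c (X k) * v = (c (X k) * corner_dir (\<kappa> k)) * (of_real r * cis a)"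
      by (simp add: ra(4))
    also have "\<dots> = of_real r * (cis (turn \<kappa> k) * cis a)"
      by (simp add: cdir[OF k])
    also have "\<dots> = of_real r * cis (turn \<kappa> k + a)"
      by (simp add: cis_mult)
    finally show ?thesis
      using ra by blast
  qed
  have cone_of_polar: "\<exists>v\<in>tangent_cone D (X k). of_real r * cis \<phi> = c (X k) * v"
    if k: "k < n" and r: "0 \<le> r" and \<phi>: "turn \<kappa> k \<le> \<phi>" "\<phi> \<le> turn \<kappa> (Suc k)" for k r \<phi>
  proof
    let ?v = "corner_dir (\<kappa> k) * (of_real r * cis (\<phi> - turn \<kappa> k))"
    show "?v \<in> tangent_cone D (X k)"
      unfolding X_def tangent_cone_polar[OF kc[OF k]]
      by (intro exI[of _ r] exI[of _ "\<phi> - turn \<kappa> k"]) (use r \<phi> in \<open>simp add: turn_Suc\<close>)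
    have "c (X k) * ?v = (c (X k) * corner_dir (\<kappa> k)) * (of_real r * cis (\<phi> - turn \<kappa> k))"
      by simp
    also have "\<dots> = of_real r * (cis (turn \<kappa> k) * cis (\<phi> - turn \<kappa> k))"
      by (simp add: cdir[OF k])
    also have "\<dots> = of_real r * cis \<phi>"
      by (simp add: cis_mult)
    finally show "of_real r * cis \<phi> = c (X k) * ?v"
      by (rule sym)
  qed
  have total: "turn \<kappa> n \<le> 2 * pi"
    using f pi_gt_zero by auto
  \<comment> \<open>Up to the shortest of the sides leaving the point, the rays are identified by
    the gluing.\<close>
  define \<epsilon>1 where "\<epsilon>1 = Min ((\<lambda>k. snd (left_side (\<kappa> k)) * edge_length D (fst (left_side (\<kappa> k)))) ` {..<n})"
  have \<epsilon>1: "0 < \<epsilon>1"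
  proof -
    have "0 < snd (left_side (\<kappa> k)) * edge_length D (fst (left_side (\<kappa> k)))" if "k < n" for k
      using left_side_mem[OF kc[OF that]] edge_length_pos by simp
    then show ?thesis
      unfolding \<epsilon>1_def using n by (subst Min_gr_iff) auto
  qed
  have \<epsilon>1le: "\<epsilon>1 \<le> snd (left_side (\<kappa> k)) * edge_length D (fst (left_side (\<kappa> k)))" if "k < n" for k
    unfolding \<epsilon>1_def by (rule Min_le) (use that in auto)
  have glue: "pt D (fst (X k), snd (X k) + corner_dir (\<kappa> k) * (of_real r * cis (corner_angle (\<kappa> k)))) =
      pt D (fst (X m), snd (X m) + corner_dir (\<kappa> m) * of_real r)"
    if k: "k < n" and g: "glued_left (\<kappa> k)" "\<kappa> m = next_corner (\<kappa> k)" and r: "0 \<le> r" "r < \<epsilon>1" for k m r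
  proof -
    have "corner_dir (\<kappa> k) * (of_real r * cis (corner_angle (\<kappa> k))) = of_real r * (corner_dir (\<kappa> k) * cis (corner_angle (\<kappa> k)))"
      by simp
    also have "\<dots> = - (of_real r * left_dir (\<kappa> k))"
      by (simp add: corner_angle(3)[OF kc[OF k], symmetric])
    finally have "snd (X k) + corner_dir (\<kappa> k) * (of_real r * cis (corner_angle (\<kappa> k))) =
       snd (X k) - of_real r * left_dir (\<kappa> k)"
      by simp
    then show ?thesis
      using glue_left[OF kc[OF k] g(1) r(1)] r(2) \<epsilon>1le[OF k] unfolding X_def g(2)
      by (simp add: mult.commute)
  qed
  have X_pt: "pt D (X k) = p" if "k < n" for k
    using surface_rep(2)[OF pS, of "X k"] that pX by simp
  \<comment> \<open>Equal angles in two different cones leave only the common ray, and since all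
    corner angles are positive the cones must be consecutive.\<close>
  have same: "pt D (fst (X k), snd (X k) + corner_dir (\<kappa> k) * (of_real r * cis a)) =
      pt D (fst (X l), snd (X l) + corner_dir (\<kappa> l) * (of_real r * cis b))"
    if k: "k < n" and l: "l < n" and a: "0 \<le> a" "a \<le> corner_angle (\<kappa> k)" and b: "0 \<le> b" "b \<le> corner_angle (\<kappa> l)"
      and kl: "k < l" and eq: "turn \<kappa> k + a = turn \<kappa> l + b" and r: "0 \<le> r" "r < \<epsilon>1" for k l a b r
  proof -
    have "turn \<kappa> (Suc k) \<le> turn \<kappa> l"
      by (rule turn_le[OF fan]) (use kl l in auto)
    then have e: "turn \<kappa> (Suc k) = turn \<kappa> l" "a = corner_angle (\<kappa> k)" "b = 0"
      using a b eq by (auto simp: turn_Suc)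
    have "l = Suc k"
    proof (rule ccontr)
      assume "l \<noteq> Suc k"
      then have "turn \<kappa> (Suc k) < turn \<kappa> l"
        by (intro turn_less[OF fan]) (use kl l in auto)
      then show False
        using e(1) by simp
    qed
    then have g: "glued_left (\<kappa> k)" "\<kappa> l = next_corner (\<kappa> k)"
      using fan l by (auto simp: fan_def)
    show ?thesis
      using glue[OF k g r] e by simp
  qed
  \<comment> \<open>Angles that differ by a full turn leave only the final ray of the last cone and
    the initial ray of the first one, in a closed fan.\<close>
  have wrap: "pt D (fst (X k), snd (X k) + corner_dir (\<kappa> k) * (of_real r * cis a)) =
      pt D (fst (X l), snd (X l) + corner_dir (\<kappa> l) * (of_real r * cis b))"
    if k: "k < n" and l: "l < n" and a: "0 \<le> a" "a \<le> corner_angle (\<kappa> k)" and b: "0 \<le> b" "b \<le> corner_angle (\<kappa> l)"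
      and eq: "turn \<kappa> k + a = turn \<kappa> l + b + 2 * pi" and r: "0 \<le> r" "r < \<epsilon>1" for k l a b r
  proof -
    have "turn \<kappa> k + a \<le> turn \<kappa> (Suc k)"
      using a by (simp add: turn_Suc)
    also have "\<dots> \<le> turn \<kappa> n"
      by (rule turn_le[OF fan]) (use k in auto)
    finally have 1: "turn \<kappa> k + a \<le> turn \<kappa> n" .
    have tl: "0 \<le> turn \<kappa> l"
      using turn_le[OF fan, of 0 l] l by simp
    have n2: "turn \<kappa> n = 2 * pi" "turn \<kappa> l = 0" "b = 0" "turn \<kappa> k + a = turn \<kappa> n"
      using 1 tl eq b total by auto
    have cl: "closed_fan \<kappa> n"
      using f n2(1) pi_gt_zero by auto
    have "l = 0"
      using turn_less[OF fan, of 0 l] n2(2) l by (cases l) auto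
    have k1: "k = n - 1"
    proof (rule ccontr)
      assume "k \<noteq> n - 1"
      then have "turn \<kappa> (Suc k) < turn \<kappa> n"
        by (intro turn_less[OF fan]) (use k in auto)
      then show False
        using n2(4) a by (simp add: turn_Suc)
    qed
    have "a = corner_angle (\<kappa> k)"
      using n2(4) k1 n turn_Suc[of \<kappa> "n - 1"] by simp
    moreover have "glued_left (\<kappa> k)" "\<kappa> l = next_corner (\<kappa> k)"
      using cl k1 \<open>l = 0\<close> by (auto simp: closed_fan_def)
    ultimately show ?thesis
      using glue[OF k _ _ r, of l] n2(3) by simp
  qed
  have "\<exists>\<epsilon>>0. \<exists>f. surf.chart H p \<epsilon> f \<and> (\<forall>x\<in>p. \<forall>v\<in>tangent_cone D x. norm v < \<epsilon> \<longrightarrow>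
     c x * v \<in> H \<and> f (c x * v) = pt D (fst x, snd x + v))"
  proof (rule chart_of_cones[OF pS])
    show "convex H"
      using f by (auto simp: upper_def convex_halfspace_Im_ge)
    show nc: "norm (c x) = 1" if xp: "x \<in> p" for x
    proof -
      obtain k where "k < n" "x = X k"
        using xp pX by blast
      then show ?thesis
        using cX nd by (simp add: norm_divide)
    qed
    show "c (edge_point D (mate D e) (1 - s)) * edge_dir D (mate D e) = - (c (edge_point D e s) * edge_dir D e)"
      if e: "e \<in> edges D" "mate D e \<noteq> e" and s: "0 \<le> s" "s \<le> 1" and ep: "edge_point D e s \<in> p" for e s
    proof -
      obtain k where k: "k < n" "edge_point D e s = X k"
        using ep pX by blast
      have wrap_cis: "cis (turn \<kappa> n) = 1" if "closed_fan \<kappa> n"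
      proof -
        have "turn \<kappa> n = 2 * pi"
          using f that by (auto simp: closed_fan_def open_fan_def)
        then show ?thesis
          by simp
      qed
      have succ: "c (X m) * left_dir (\<kappa> m) = - (c (corner_point (next_corner (\<kappa> m))) * corner_dir (next_corner (\<kappa> m)))"
        if m: "m < n" "Suc m < n \<and> next_corner (\<kappa> m) = \<kappa> (Suc m) \<or> m = n - 1 \<and> closed_fan \<kappa> n \<and> next_corner (\<kappa> m) = \<kappa> 0" for m
        using m(2)
      proof
        assume a: "Suc m < n \<and> next_corner (\<kappa> m) = \<kappa> (Suc m)"
        then have nx1: "next_corner (\<kappa> m) = \<kappa> (Suc m)" and m1: "Suc m < n"
          by blast+
        have "c (corner_point (next_corner (\<kappa> m))) * corner_dir (next_corner (\<kappa> m)) = cis (turn \<kappa> (Suc m))"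
          using cdir[OF m1] unfolding nx1 X_def by simp
        then show ?thesis
          using cleft[OF m(1)] by simp
      next
        assume a: "m = n - 1 \<and> closed_fan \<kappa> n \<and> next_corner (\<kappa> m) = \<kappa> 0"
        then have nx0: "next_corner (\<kappa> m) = \<kappa> 0"
          by blast
        have "c (corner_point (next_corner (\<kappa> m))) * corner_dir (next_corner (\<kappa> m)) = 1"
          using cdir[OF n] unfolding nx0 X_def by simp
        moreover have "cis (turn \<kappa> (Suc m)) = 1"
          using a n wrap_cis by simp
        ultimately show ?thesis
          using cleft[OF m(1)] by simp
      qed
      show ?thesis
      \<comment> \<open>For positive \<open>s\<close> the edge is the left side of a fan corner. For
        \<open>s = 0\<close> it is a right side, and the crossing is read in reverse from its
        mate.\<close>
      proof (cases "0 < s")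
        case True
        let ?\<kappa> = "right_side (e, s)"
        have L: "left_side ?\<kappa> = (e, s)" and mem: "?\<kappa> \<in> corners"
          using left_right_side right_side_mem e s True by auto
        have cp: "corner_point ?\<kappa> = edge_point D e s"
          using corner_point_left_side[of ?\<kappa>] L by simp
        have kk: "?\<kappa> = \<kappa> k"
          using inj_onD[OF corner_point_inj _ mem kc[OF k(1)]] cp k(2) by (simp add: X_def)
        have g: "glued_left ?\<kappa>"
          using L e by (simp add: glued_left_def)
        obtain m where m: "m < n" "?\<kappa> = \<kappa> m" "Suc m < n \<and> next_corner ?\<kappa> = \<kappa> (Suc m) \<or>
           m = n - 1 \<and> closed_fan \<kappa> n \<and> next_corner ?\<kappa> = \<kappa> 0"
          using fan_succ[OF f' mem g k(1)] kk by blast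
        have nx: "next_corner (\<kappa> m) = (mate D e, 1 - s)" "left_dir (\<kappa> m) = edge_dir D e" "X m = edge_point D e s"
          using L m(2) cp by (simp_all add: next_corner_def left_dir_def X_def)
        show ?thesis
          using succ[OF m(1)] m(2,3) unfolding nx by (simp add: corner_point_def corner_dir_def nx)
      next
        case False
        then have s0: "s = 0"
          using s by simp
        have me: "mate D e \<in> edges D" "mate D (mate D e) = e"
          using mate_edges mate_mate e by auto
        let ?\<kappa> = "right_side (mate D e, 1)"
        have L: "left_side ?\<kappa> = (mate D e, 1)" and mem: "?\<kappa> \<in> corners"
          using left_right_side right_side_mem me by auto
        have cp: "corner_point ?\<kappa> = edge_point D (mate D e) 1"
          using corner_point_left_side[of ?\<kappa>] L by simp
        have nx: "next_corner ?\<kappa> = (e, 0)"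
          using L me by (simp add: next_corner_def)
        have "(e, 0) = \<kappa> k"
          using inj_onD[OF corner_point_inj _ _ kc[OF k(1)], of "(e, 0)"] k(2) s0 e
          by (simp add: X_def corner_point_def corners_def)
        then have kk: "next_corner ?\<kappa> = \<kappa> k"
          using nx by simp
        have g: "glued_left ?\<kappa>"
          using L e me by (simp add: glued_left_def)
        obtain m where m: "m < n" "?\<kappa> = \<kappa> m" "Suc m < n \<and> next_corner ?\<kappa> = \<kappa> (Suc m) \<or>
           m = n - 1 \<and> closed_fan \<kappa> n \<and> next_corner ?\<kappa> = \<kappa> 0"
          using fan_succ[OF f' mem g k(1)] kk by blast
        have nx': "next_corner (\<kappa> m) = (e, 0)" "left_dir (\<kappa> m) = edge_dir D (mate D e)"
          "X m = edge_point D (mate D e) 1"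
          using L m(2) cp nx by (simp_all add: left_dir_def X_def)
        show ?thesis
          using succ[OF m(1)] m(2,3) s0 by (simp add: corner_point_def corner_dir_def nx')
      qed
    qed
    show "w \<in> H \<longleftrightarrow> (\<exists>x\<in>p. \<exists>v\<in>tangent_cone D x. w = c x * v)" for w
    proof
      assume w: "w \<in> H"
      obtain r \<phi> where r\<phi>: "0 \<le> r" "0 \<le> \<phi>" "\<phi> \<le> turn \<kappa> n" "w = of_real r * cis \<phi>"
      proof (cases "H = UNIV")
        case True
        have "upper \<noteq> UNIV"
          using upper_iff[of "- \<i>"] by auto
        then have "turn \<kappa> n = 2 * pi"
          using f True by auto
        moreover have "w = of_real (norm w) * cis (Arg2pi w)"
          using Arg2pi_eq[of w] by (simp add: cis_conv_exp)
        ultimately show ?thesis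
          using that[of "norm w" "Arg2pi w"] Arg2pi_ge_0[of w] Arg2pi_lt_2pi[of w] by simp
      next
        case False
        then have tn: "turn \<kappa> n = pi" "0 \<le> Im w"
          using f w by (auto simp: upper_iff)
        have "\<exists>r \<phi>. 0 \<le> r \<and> 0 \<le> \<phi> \<and> \<phi> \<le> pi \<and> w = of_real r * cis \<phi>"
          using polar_wedge[of pi w] tn(2) by (simp add: complex_eq_iff)
        then show ?thesis
          using that tn(1) by auto
      qed
      obtain k where k: "k < n" "turn \<kappa> k \<le> \<phi>" "\<phi> \<le> turn \<kappa> (Suc k)"
        using turn_find[OF r\<phi>(2,3) n] by blast
      have Xp: "X k \<in> p"
        using k(1) pX by simp
      show "\<exists>x\<in>p. \<exists>v\<in>tangent_cone D x. w = c x * v"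
        using cone_of_polar[OF k(1) r\<phi>(1) k(2,3)] unfolding r\<phi>(4) by (intro bexI[OF _ Xp])
    next
      assume "\<exists>x\<in>p. \<exists>v\<in>tangent_cone D x. w = c x * v"
      then obtain k v where k: "k < n" "v \<in> tangent_cone D (X k)" "w = c (X k) * v"
        using pX by blast
      obtain r a where ra: "0 \<le> r" "0 \<le> a" "a \<le> corner_angle (\<kappa> k)" "w = of_real r * cis (turn \<kappa> k + a)"
        using polar[OF k(1,2)] k(3) by metis
      have "turn \<kappa> k + a \<le> turn \<kappa> (Suc k)"
        using ra by (simp add: turn_Suc)
      also have "\<dots> \<le> turn \<kappa> n"
        by (rule turn_le[OF fan]) (use k in auto)
      finally have le: "turn \<kappa> k + a \<le> turn \<kappa> n" .
      have ge: "0 \<le> turn \<kappa> k + a"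
        using turn_le[OF fan, of 0 k] k ra(2) by simp
      show "w \<in> H"
      proof (cases "H = UNIV")
        case False
        then have "turn \<kappa> n = pi" "H = upper"
          using f by auto
        then have "0 \<le> sin (turn \<kappa> k + a)"
          using le ge by (intro sin_ge_zero) auto
        then show ?thesis
          using ra(1) \<open>H = upper\<close> by (simp add: ra(4) upper_iff)
      qed simp
    qed
    show "0 < \<epsilon>1"
      by (rule \<epsilon>1)
    show "pt D (fst x, snd x + v) = pt D (fst y, snd y + v')"
      if xy: "x \<in> p" "y \<in> p" and v: "v \<in> tangent_cone D x" "v' \<in> tangent_cone D y"
        and eq: "c x * v = c y * v'" and small: "norm v < \<epsilon>1" for x y v v'
    proof -
      obtain k where k: "k < n" "x = X k"
        using xy(1) pX by blast
      obtain l where l: "l < n" "y = X l"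
        using xy(2) pX by blast
      obtain r a where ra: "0 \<le> r" "0 \<le> a" "a \<le> corner_angle (\<kappa> k)" "v = corner_dir (\<kappa> k) * (of_real r * cis a)"
        "c x * v = of_real r * cis (turn \<kappa> k + a)"
        using polar[OF k(1)] v(1) k(2) by metis
      obtain r' b where rb: "0 \<le> r'" "0 \<le> b" "b \<le> corner_angle (\<kappa> l)" "v' = corner_dir (\<kappa> l) * (of_real r' * cis b)"
        "c y * v' = of_real r' * cis (turn \<kappa> l + b)"
        using polar[OF l(1)] v(2) l(2) by metis
      have "norm (c x * v) = r" "norm (c y * v') = r'"
        using ra(1,5) rb(1,5) by (simp_all add: norm_mult)
      then have rr: "r' = r"
        using eq by simp
      have "norm v = r"
        using ra(1) nd[OF k(1)] by (simp add: ra(4) norm_mult)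
      then have r\<epsilon>: "r < \<epsilon>1"
        using small by simp
      show ?thesis
      proof (cases "r = 0")
        case True
        then have "v = 0" "v' = 0"
          using ra(4) rb(4) rr by auto
        then show ?thesis
          using X_pt[OF k(1)] X_pt[OF l(1)] k(2) l(2) by simp
      next
        case False
        then have "cis (turn \<kappa> k + a) = cis (turn \<kappa> l + b)"
          using eq ra(5) rb(5) rr by simp
        then obtain m :: int where m: "turn \<kappa> k + a = turn \<kappa> l + b + 2 * pi * of_int m"
          using cis_eq_iff_2pi by blast
        \<comment> \<open>Both angles lie in one closed turn, so they differ by at most one
          period.\<close>
        have bd: "0 \<le> turn \<kappa> k + a \<and> turn \<kappa> k + a \<le> 2 * pi" if "k < n" "0 \<le> a" "a \<le> corner_angle (\<kappa> k)" for k a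
        proof -
          have "turn \<kappa> (Suc k) \<le> turn \<kappa> n" "0 \<le> turn \<kappa> k"
            using turn_le[OF fan, of "Suc k" n] turn_le[OF fan, of 0 k] that(1) by auto
          then show ?thesis
            using that total by (simp add: turn_Suc)
        qed
        have b1: "2 * pi * of_int m \<le> 2 * pi" "- (2 * pi) \<le> 2 * pi * of_int m"
          using m bd[OF k(1) ra(2,3)] bd[OF l(1) rb(2,3)] by linarith+
        then have "of_int m \<le> (1::real)" "- 1 \<le> (of_int m :: real)"
          using pi_gt_zero by (auto simp: mult_le_cancel_left2 mult_le_cancel_left1)
             (metis mult_le_cancel_left_pos mult_minus_right mult.right_neutral pi_gt_zero zero_less_mult_iff zero_less_numeral)
        then have "m \<le> 1" "- 1 \<le> m"
          by linarith+
        then consider "m = 0" | "m = 1" | "m = - 1"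
          by linarith
        then show ?thesis
        proof cases
          case 1
          then have e: "turn \<kappa> k + a = turn \<kappa> l + b"
            using m by simp
          consider "k < l" | "k = l" | "l < k"
            by linarith
          then show ?thesis
          proof cases
            case 1
            show ?thesis
              unfolding k(2) l(2) ra(4) rb(4) rr
              by (rule same[OF k(1) l(1) ra(2,3) rb(2,3) 1 e ra(1) r\<epsilon>])
          next
            case 2
            then show ?thesis
              using e k l ra rb rr by simp
          next
            case 3
            show ?thesis
              unfolding k(2) l(2) ra(4) rb(4) rr
              by (rule same[OF l(1) k(1) rb(2,3) ra(2,3) 3 e[symmetric] ra(1) r\<epsilon>, symmetric])
          qed
        next
          case 2
          then have e: "turn \<kappa> k + a = turn \<kappa> l + b + 2 * pi"
            using m by simp
          show ?thesis
            unfolding k(2) l(2) ra(4) rb(4) rr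
            by (rule wrap[OF k(1) l(1) ra(2,3) rb(2,3) e ra(1) r\<epsilon>])
        next
          case 3
          then have e: "turn \<kappa> l + b = turn \<kappa> k + a + 2 * pi"
            using m by simp
          show ?thesis
            unfolding k(2) l(2) ra(4) rb(4) rr
            by (rule wrap[OF l(1) k(1) rb(2,3) ra(2,3) e ra(1) r\<epsilon>, symmetric])
        qed
      qed
    qed
  qed
  moreover have "norm (c x) = 1" if xp: "x \<in> p" for x
  proof -
    obtain k where "k < n" "x = X k"
      using xp pX by blast
    then show ?thesis
      using cX nd by (simp add: norm_divide)
  qed
  ultimately show ?thesis
    by metis
qed

text \<open>Whether the fan is open or closed decides whether the point lies on the boundary, and
  nonsingularity then says that the angles add up to exactly the required total. Inside a triangle
  the single cone is already the plane.\<close>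

lemma nonsingular_chart:
  assumes p: "p \<in> surface D" "p \<notin> singular_points D"
  shows "\<exists>\<epsilon>>0. \<exists>f c. surf.chart (if p \<in> boundary_points D then upper else UNIV) p \<epsilon> f \<and>
    (\<forall>x\<in>p. norm (c x) = 1 \<and> (\<forall>v\<in>tangent_cone D x. norm v < \<epsilon> \<longrightarrow>
      c x * v \<in> (if p \<in> boundary_points D then upper else UNIV) \<and> f (c x * v) = pt D (fst x, snd x + v)))"
proof -
  have ang: "point_angle D p = (if p \<in> boundary_points D then pi else 2 * pi)"
    using p by (auto simp: singular_points_def)
  obtain x where x: "x \<in> triangle_points D" "p = pt D x"
    using p(1) surface_mem_iff by blast
  from x(1) show ?thesis
  proof (cases rule: corner_or_interior)
    case (corner \<kappa> n k)
    have n: "0 < n"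
      using corner(2) by simp
    have p0: "p = pt D (corner_point (\<kappa> 0))"
      using fan_class[OF corner(1,2)] fan_class[OF corner(1) n] x(2) corner(3) by simp
    have tn: "turn \<kappa> n = point_angle D p"
      using fan_point_angle[OF corner(1)] p0 by (simp add: turn_def)
    from corner(1) show ?thesis
    proof
      assume c: "closed_fan \<kappa> n"
      have nb: "p \<notin> boundary_points D"
        using closed_fan_interior[OF c] p0 by simp
      have "closed_fan \<kappa> n \<and> turn \<kappa> n = 2 * pi \<and> UNIV = UNIV \<or> open_fan \<kappa> n \<and> turn \<kappa> n = pi \<and> UNIV = upper"
        using c tn ang nb by simp
      from chart_of_fan[OF this p0] show ?thesis
        using nb by simp
    next
      assume c: "open_fan \<kappa> n"
      have b: "p \<in> boundary_points D"
        using open_fan_boundary[OF c] p0 by simp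
      have "closed_fan \<kappa> n \<and> turn \<kappa> n = 2 * pi \<and> upper = UNIV \<or> open_fan \<kappa> n \<and> turn \<kappa> n = pi \<and> upper = upper"
        using c tn ang b by simp
      from chart_of_fan[OF this p0] show ?thesis
        using b by simp
    qed
  next
    case interior
    have px: "p = {x}"
      using pt_interior[OF interior] x(2) by simp
    have nb: "p \<notin> boundary_points D"
      using interior_not_boundary[OF interior] x(2) by simp
    have cone: "tangent_cone D x = UNIV"
      by (rule sector_interior(1)[OF x(1) interior])
    have "\<exists>\<epsilon>>0. \<exists>f. surf.chart UNIV p \<epsilon> f \<and> (\<forall>x\<in>p. \<forall>v\<in>tangent_cone D x. norm v < \<epsilon> \<longrightarrow>
       1 * v \<in> UNIV \<and> f (1 * v) = pt D (fst x, snd x + v))"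
    proof (rule chart_of_cones[OF p(1)])
      show "1 * edge_dir D (mate D e) = - (1 * edge_dir D e)"
        if "e \<in> edges D" "edge_point D e s \<in> p" for e s
        using that interior[of "snd e"] height_edge_point_self[OF that(1), of s] px by auto
      show "(0::real) < 1"
        by simp
    qed (use px cone in auto)
    then obtain \<epsilon> f where "0 < \<epsilon>" "surf.chart UNIV p \<epsilon> f"
      "\<forall>x\<in>p. \<forall>v\<in>tangent_cone D x. norm v < \<epsilon> \<longrightarrow> f (1 * v) = pt D (fst x, snd x + v)"
      by blast
    then show ?thesis
      using nb px by (intro exI[of _ \<epsilon>] conjI exI[of _ f] exI[of _ "\<lambda>_. 1"]) auto
  qed
qed

text \<open>Away from vertices all corners have angle \<open>pi\<close>. An open fan then consists
  of one corner, and a closed fan of two, because crossing an edge and its mate leads back; so such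
  points are nonsingular.\<close>

lemma finite_singular_points: "finite (singular_points D)"
proof (rule finite_subset)
  show "finite ((\<lambda>e. pt D (edge_point D e 0)) ` edges D)"
    using finite_tris by (simp add: edges_def)
  show "singular_points D \<subseteq> (\<lambda>e. pt D (edge_point D e 0)) ` edges D"
  proof (rule ccontr)
    assume "\<not> singular_points D \<subseteq> (\<lambda>e. pt D (edge_point D e 0)) ` edges D"
    then obtain p where p: "p \<in> surface D" "p \<in> singular_points D"
      and nv: "p \<notin> (\<lambda>e. pt D (edge_point D e 0)) ` edges D"
      by (auto simp: singular_points_def)
    have ang: "point_angle D p \<noteq> (if p \<in> boundary_points D then pi else 2 * pi)"
      using p by (simp add: singular_points_def)
    obtain x where x: "x \<in> triangle_points D" "p = pt D x"
      using p(1) surface_mem_iff by blast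
    from x(1) show False
    proof (cases rule: corner_or_interior)
      case interior
      then show False
        using ang interior_not_boundary[OF interior] pt_interior[OF interior] sector_interior(2)[OF x(1) interior] x(2)
        by (simp add: point_angle_def)
    next
      case (corner \<kappa> n k)
      have n: "0 < n"
        using corner(2) by simp
      have fan: "fan \<kappa> n"
        using corner(1) by (auto simp: closed_fan_def open_fan_def)
      have pk: "p = pt D (corner_point (\<kappa> m))" if "m < n" for m
        using fan_class[OF corner(1,2)] fan_class[OF corner(1) that] x(2) corner(3) by simp
      have s0: "snd (\<kappa> m) \<noteq> 0" if "m < n" for m
      proof
        assume "snd (\<kappa> m) = 0"
        then have "p = pt D (edge_point D (fst (\<kappa> m)) 0)"
          using pk[OF that] by (simp add: corner_point_def)
        moreover have "fst (\<kappa> m) \<in> edges D"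
          using fan_corner[OF fan that] by (simp add: corners_def mem_Times_iff)
        ultimately show False
          using nv by blast
      qed
      have left: "left_side (\<kappa> m) = \<kappa> m" if "m < n" for m
        using s0[OF that] by (simp add: left_side_def)
      have angle: "corner_angle (\<kappa> m) = pi" if "m < n" for m
      proof -
        have "corner_dir (\<kappa> m) \<noteq> 0"
          using norm_corner_dir[OF fan_corner[OF fan that]] by auto
        then have "- left_dir (\<kappa> m) / corner_dir (\<kappa> m) = - 1"
          by (simp add: left_dir_def corner_dir_def left[OF that])
        then show ?thesis
          using Arg_of_real[of "- 1"] by (simp add: corner_angle_def)
      qed
      have total: "point_angle D p = real n * pi"
        using fan_point_angle[OF corner(1)] pk[OF n] angle by simp
      have nx: "next_corner (\<kappa> m) = (mate D (fst (\<kappa> m)), 1 - snd (\<kappa> m))" if "m < n" for m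
        by (simp add: next_corner_def left[OF that])
      from corner(1) show False
      proof
        assume o: "open_fan \<kappa> n"
        then have "\<not> glued_left (\<kappa> 0)"
          using left[OF n] by (simp add: open_fan_def glued_left_def)
        then have "n = 1"
          using fan n by (cases "Suc 0 < n") (auto simp: fan_def)
        then show False
          using total ang open_fan_boundary[OF o] pk[OF n] by simp
      next
        assume c: "closed_fan \<kappa> n"
        have "n \<noteq> 1"
        proof
          assume n1: "n = 1"
          then have "\<kappa> 0 = next_corner (\<kappa> 0)" "glued_left (\<kappa> 0)"
            using c by (auto simp: closed_fan_def)
          then show False
            using nx[OF n] left[OF n] by (metis fst_conv glued_left_def)
        qed
        moreover have "\<not> 2 < n"
        proof
          assume n2: "2 < n"
          then have "\<kappa> 1 = next_corner (\<kappa> 0)" "\<kappa> 2 = next_corner (\<kappa> 1)"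
            using fan by (auto simp: fan_def numeral_2_eq_2)
          moreover have "fst (\<kappa> 0) \<in> edges D"
            using fan_corner[OF fan n] by (simp add: corners_def mem_Times_iff)
          ultimately have "\<kappa> 2 = (fst (\<kappa> 0), snd (\<kappa> 0))"
            using nx[of 0] nx[of 1] n2 mate_mate by simp
          then have "\<kappa> 2 = \<kappa> 0"
            by simp
          then show False
            using fan n2 inj_onD[of \<kappa> "{..<n}" 2 0] by (simp add: fan_def)
        qed
        ultimately have "n = 2"
          using n by simp
        then show False
          using total ang closed_fan_interior[OF c] pk[OF n] by simp
      qed
    qed
  qed
qed

end

section \<open>Consequences of the disk topology\<close>

lemma glued_triangles_of_flat_disk: "flat_disk D \<Longrightarrow> glued_triangles D"
  by unfold_locales (auto simp: flat_disk_def)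

text \<open>The points reachable from \<open>p\<close> by polygonal paths form a set that contains
  the whole image of any triangle it meets. So it and its complement are open in the quotient, and
  the disk is connected.\<close>

lemma connected_gluing_of_flat_disk:
  assumes flat: "flat_disk D"
  shows "connected_gluing D"
proof -
  interpret glued_triangles D
    by (rule glued_triangles_of_flat_disk[OF flat])
  let ?T = "surface_topology D"
  have hom: "?T homeomorphic_space top_of_set (cball (0::complex) 1)"
    using flat by (simp add: flat_disk_def)
  have "connected_space (top_of_set (cball (0::complex) 1))"
    by (simp add: connected_space_subtopology convex_connected)
  then have conn: "connected_space ?T"
    using homeomorphic_connected_space[OF hom] by simp
  have opn: "openin ?T U" if U: "U \<subseteq> surface D"
    and tri: "\<And>i z w. i \<in> tris D \<Longrightarrow> z \<in> triangle D i \<Longrightarrow> w \<in> triangle D i \<Longrightarrow> pt D (i, z) \<in> U \<Longrightarrow> pt D (i, w) \<in> U" for U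
  proof -
    have op: "openin (top_of_set (triangle D i)) S" if "S = {} \<or> S = triangle D i" for S i
      using that by auto
    have "{z \<in> triangle D i. pt D (i, z) \<in> U} = {} \<or> {z \<in> triangle D i. pt D (i, z) \<in> U} = triangle D i"
      if "i \<in> tris D" for i
      using tri[OF that] by blast
    then have "openin (top_of_set (triangle D i)) {z \<in> triangle D i. pt D (i, z) \<in> U}" if "i \<in> tris D" for i
      using that by (intro op)
    moreover have "{z. (i, z) \<in> {x \<in> triangle_points D. pt D x \<in> U}} = {z \<in> triangle D i. pt D (i, z) \<in> U}" if "i \<in> tris D" for i
      using that by (auto simp: triangle_points_def)
    ultimately show ?thesis
      unfolding openin_surface_topology openin_sum_topology using U by (auto simp: triangle_points_def)
  qed
  have top: "topspace ?T = surface D"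
  proof -
    have "openin ?T (surface D)"
      by (rule opn) (auto intro: pt_mem_surface)
    then show ?thesis
      using openin_subset[of ?T "surface D"] openin_topspace[of ?T, unfolded openin_surface_topology]
      by (intro equalityI) (erule conjE, assumption)+
  qed
  have "\<exists>l. polygonal_length D p r l" if p: "p \<in> surface D" and r: "r \<in> surface D" for p r
  proof -
    let ?U = "{r \<in> surface D. \<exists>l. polygonal_length D p r l}"
    have "openin ?T ?U"
    proof (rule opn)
      show "pt D (i, w) \<in> ?U" if "i \<in> tris D" "z \<in> triangle D i" "w \<in> triangle D i" "pt D (i, z) \<in> ?U" for i z w
        using that(4) pt_mem_surface[OF that(1,3)] polygonal_length.segment[OF _ that(1-3), of p] by blast
    qed blast
    moreover have "openin ?T (surface D - ?U)"
    proof (rule opn)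
      show "pt D (i, w) \<in> surface D - ?U" if "i \<in> tris D" "z \<in> triangle D i" "w \<in> triangle D i" "pt D (i, z) \<in> surface D - ?U" for i z w
        using that(4) pt_mem_surface[OF that(1,3)] polygonal_length.segment[OF _ that(1,3,2), of p] by blast
    qed blast
    then have "closedin ?T ?U"
      unfolding closedin_def top by (intro conjI) blast
    ultimately have alt: "?U = {} \<or> ?U = topspace ?T"
      using conn unfolding connected_space_clopen_in by meson
    have pU: "p \<in> ?U"
      using p polygonal_length.start[OF p] by (intro CollectI conjI exI)
    have "r \<in> V" if "V = {} \<or> V = topspace ?T" "p \<in> V" for V
      using that r unfolding top by (elim disjE) simp_all
    from this[OF alt pU] have "r \<in> ?U" .
    then show ?thesis
      by (elim CollectE conjE)
  qed
  then show ?thesis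
    by unfold_locales
qed

subsection \<open>Billiard trajectories in a flat disk\<close>

text \<open>Polarisation turns equality of distances into \<open>w s \<bullet> w t = s * t\<close>,
  so \<open>w t\<close> and the multiple of the normalised probe \<open>u\<close> have the norms and
  the inner product of equal vectors.\<close>

lemma isometric_line:
  fixes w :: "real \<Rightarrow> complex"
  assumes \<eta>: "0 < \<eta>" and w0: "w 0 = 0"
    and iso: "\<And>s t. \<bar>s\<bar> < \<eta> \<Longrightarrow> \<bar>t\<bar> < \<eta> \<Longrightarrow> dist (w s) (w t) = \<bar>s - t\<bar>"
  obtains u where "norm u = 1" "\<And>t. \<bar>t\<bar> < \<eta> \<Longrightarrow> w t = of_real t * u"
proof -
  define h where "h = \<eta> / 2"
  have h: "0 < h" "\<bar>h\<bar> < \<eta>"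
    using \<eta> by (auto simp: h_def)
  have nrm: "norm (w t) = \<bar>t\<bar>" if "\<bar>t\<bar> < \<eta>" for t
    using iso[OF that, of 0] \<eta> w0 by simp
  have inn: "w s \<bullet> w t = s * t" if "\<bar>s\<bar> < \<eta>" "\<bar>t\<bar> < \<eta>" for s t
  proof -
    have "(norm (w s - w t))\<^sup>2 = (s - t)\<^sup>2"
      using iso[OF that] by (simp add: dist_norm)
    then show ?thesis
      using nrm[OF that(1)] nrm[OF that(2)] by (simp add: dot_norm_neg power2_diff)
  qed
  define u where "u = w h /\<^sub>R h"
  have "norm u = 1"
    using nrm[OF h(2)] h(1) by (simp add: u_def)
  moreover have "w t = of_real t * u" if t: "\<bar>t\<bar> < \<eta>" for t
  proof -
    have "w t \<bullet> (t *\<^sub>R u) = t * t"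
      using inn[OF t h(2)] h(1) by (simp add: u_def)
    moreover have "(norm (t *\<^sub>R u))\<^sup>2 = t\<^sup>2"
      using \<open>norm u = 1\<close> by simp
    moreover have "(norm (w t))\<^sup>2 = t\<^sup>2"
      using nrm[OF t] by simp
    moreover have "(norm (a - b))\<^sup>2 = (norm a)\<^sup>2 + (norm b)\<^sup>2 - 2 * (a \<bullet> b)" for a b :: complex
      by (simp add: dot_norm_neg field_simps)
    then have "(norm (w t - t *\<^sub>R u))\<^sup>2 = (norm (w t))\<^sup>2 + (norm (t *\<^sub>R u))\<^sup>2 - 2 * (w t \<bullet> (t *\<^sub>R u))" .
    ultimately have "(norm (w t - t *\<^sub>R u))\<^sup>2 = 0"
      unfolding power2_eq_square by linarith
    then show ?thesis
      by (simp add: scaleR_conv_of_real)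
  qed
  ultimately show ?thesis
    using that by blast
qed

text \<open>This is the billiard law: the two halves of a straight line fold to an outgoing ray and
  its mirror image in the normal, in the form used by \<open>reflects_at\<close>.\<close>

lemma fold_upper_scale:
  assumes "0 \<le> t"
  shows "fold_into upper (of_real t * w) = of_real t * fold_into upper w"
    "fold_into upper (of_real (- t) * w) = of_real t * - cnj (fold_into upper w)"
proof -
  show "fold_into upper (of_real t * w) = of_real t * fold_into upper w"
    using assms by (cases "t = 0") (auto simp: fold_into_def upper_iff zero_le_mult_iff)
  show "fold_into upper (of_real (- t) * w) = of_real t * - cnj (fold_into upper w)"
  proof (cases "t = 0")
    case False
    then have t: "0 < t"
      using assms by simp
    consider "0 < Im w" | "Im w = 0" | "Im w < 0"
      by linarith
    then show ?thesis
    proof cases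
      case 1
      then have "of_real (- t) * w \<notin> upper" "w \<in> upper"
        using t by (auto simp: upper_iff mult_le_0_iff not_le)
      then show ?thesis
        by (simp add: fold_into_def)
    next
      case 2
      then have "of_real (- t) * w \<in> upper" "w \<in> upper" "cnj w = w"
        by (auto simp: upper_iff complex_eq_iff)
      then show ?thesis
        by (simp add: fold_into_def)
    next
      case 3
      then have "of_real (- t) * w \<in> upper" "w \<notin> upper"
        using t by (auto simp: upper_iff mult_le_0_iff)
      then show ?thesis
        by (simp add: fold_into_def)
    qed
  qed simp
qed

locale flat_disk_surface =
  fixes D :: "'i triangle_gluing"
  assumes flat: "flat_disk D"

sublocale flat_disk_surface \<subseteq> connected_gluing D
  by (rule connected_gluing_of_flat_disk[OF flat])

sublocale flat_disk_surface \<subseteq> fs: flat_space "surface D" sdist "singular_points D" "boundary_points D"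
proof
  have "compact_space (top_of_set (cball (0::complex) 1))"
    by (simp add: compact_space_subtopology)
  moreover have "surface_topology D homeomorphic_space top_of_set (cball (0::complex) 1)"
    using flat by (simp add: flat_disk_def)
  ultimately show "compact_space surf.mtopology"
    unfolding surface_topology_metric using homeomorphic_compact_space by blast
  show "finite (singular_points D)"
    by (rule finite_singular_points)
  fix p assume p: "p \<in> surface D - singular_points D"
  then have "p \<in> surface D" "p \<notin> singular_points D"
    by auto
  from nonsingular_chart[OF this] obtain \<epsilon> f
    where "0 < \<epsilon>" "surf.chart (if p \<in> boundary_points D then upper else UNIV) p \<epsilon> f"
    by (elim exE conjE) (rule that)
  then have ch: "\<exists>\<epsilon>>0. \<exists>f. surf.chart (if p \<in> boundary_points D then upper else UNIV) p \<epsilon> f"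
    by blast
  show "\<exists>\<epsilon>>0. \<exists>f. surf.chart UNIV p \<epsilon> f" if "p \<notin> boundary_points D"
    using ch that by simp
  show "\<exists>\<epsilon>>0. \<exists>f. surf.chart upper p \<epsilon> f" if "p \<in> boundary_points D"
    using ch that by simp
qed

context flat_disk_surface begin

lemma fchart_of_chart:
  assumes H: "H \<in> {UNIV, upper}" and ch: "surf.chart H p \<epsilon> f" and \<epsilon>: "0 < \<epsilon>"
    and p: "p \<in> surface D" "p \<notin> singular_points D" and L: "orthogonal_transformation L"
  obtains \<delta> where "0 < \<delta>" "\<delta> \<le> \<epsilon>" "fs.fchart p \<delta> (\<lambda>v. f (fold_into H (L v)))"
proof -
  obtain \<epsilon>2 F2 where F2: "fs.fchart p \<epsilon>2 F2"
    using fs.fchart_exists[of p] p by blast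
  define \<delta> where "\<delta> = min \<epsilon> \<epsilon>2"
  have \<delta>: "0 < \<delta>" "\<delta> \<le> \<epsilon>" "\<delta> \<le> \<epsilon>2"
    using \<epsilon> fs.fchart_pos[OF F2] by (auto simp: \<delta>_def)
  have "0 \<in> H"
    using H by (auto simp: upper_iff)
  then have ch': "surf.chart H p \<delta> f"
    using surf.chart_shrink[OF ch \<delta>(1,2)] by blast
  have "surf.mball p \<delta> \<inter> singular_points D = {}"
    using F2 surf.mball_subset_concentric[OF \<delta>(3), of p] unfolding fs.fchart_def by blast
  then have "fs.fchart p \<delta> (\<lambda>v. f (fold_into H (L v)))"
    unfolding fs.fchart_def using \<delta>(1) H ch' L
    by (intro conjI exI[of _ H] exI[of _ f] exI[of _ L]) auto
  then show ?thesis
    using that \<delta> by blast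
qed

text \<open>A folded chart whose coordinates are those of the triangle containing \<open>x\<close>,
  so that the direction \<open>cis t\<close> at \<open>x\<close> is also the direction of angle
  \<open>t\<close> in the chart.\<close>

lemma aligned_fchart:
  assumes p: "p \<in> surface D" "p \<notin> singular_points D" and x: "x \<in> p"
  obtains \<epsilon> F where "fs.fchart p \<epsilon> F" "\<And>v. v \<in> tangent_cone D x \<Longrightarrow> norm v < \<epsilon> \<Longrightarrow> F v = pt D (fst x, snd x + v)"
proof -
  define H where "H = (if p \<in> boundary_points D then upper else UNIV)"
  obtain \<epsilon> f c where *: "0 < \<epsilon>" "surf.chart H p \<epsilon> f"
    "\<forall>x\<in>p. norm (c x) = 1 \<and> (\<forall>v\<in>tangent_cone D x. norm v < \<epsilon> \<longrightarrow> c x * v \<in> H \<and> f (c x * v) = pt D (fst x, snd x + v))"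
    using nonsingular_chart[OF p] unfolding H_def by blast
  have H: "H \<in> {UNIV, upper}"
    by (simp add: H_def)
  have orth: "orthogonal_transformation (\<lambda>v. c x * v)"
    using orthogonal_transformation_mult *(3) x by blast
  obtain \<delta> where \<delta>: "0 < \<delta>" "\<delta> \<le> \<epsilon>" "fs.fchart p \<delta> (\<lambda>v. f (fold_into H (c x * v)))"
    by (rule fchart_of_chart[OF H *(2,1) p orth])
  have "f (fold_into H (c x * v)) = pt D (fst x, snd x + v)" if "v \<in> tangent_cone D x" "norm v < \<delta>" for v
    using bspec[OF *(3) x] that \<delta>(2) by auto
  then show ?thesis
    using that[OF \<delta>(3)] by blast
qed

text \<open>\<open>x\<close> itself may be singular; the segment is only followed through later
  points, up to the first further singular one, and is straight in the aligned chart at each of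
  them.\<close>

lemma start_traj:
  assumes x: "x \<in> triangle_points D" and u: "norm u = 1" "u \<in> tangent_cone D x"
  obtains \<eta> where "0 < \<eta>" "fs.traj {0<..<\<eta>} (\<lambda>t. pt D (fst x, snd x + of_real t * u))"
    "\<And>t. 0 \<le> t \<Longrightarrow> t \<le> \<eta> \<Longrightarrow> snd x + of_real t * u \<in> triangle D (fst x)"
proof -
  define b where "b t = (fst x, snd x + of_real t * u)" for t
  have i: "fst x \<in> tris D"
    using x by (auto simp: triangle_points_def)
  have u0: "u \<noteq> 0"
    using u(1) by auto
  have bi: "inj b"
    using u0 by (auto simp: b_def inj_def)
  \<comment> \<open>Finitely many singular classes, each finite, meet the injective segment at
    finitely many times.\<close>
  have "finite (\<Union>(singular_points D))"
    by (rule finite_Union[OF finite_singular_points]) (rule finite_class, simp add: singular_points_def)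
  then have "finite (b -` \<Union>(singular_points D))"
    by (rule finite_vimageI[OF _ bi])
  then have "finite {t \<in> b -` \<Union>(singular_points D). 0 < t}"
    by (rule rev_finite_subset) blast
  then have finB: "finite (insert (gap x / 2) {t \<in> b -` \<Union>(singular_points D). 0 < t})"
    by (simp only: finite_insert)
  define \<eta> where "\<eta> = Min (insert (gap x / 2) {t \<in> b -` \<Union>(singular_points D). 0 < t})"
  have \<eta>: "0 < \<eta>" "\<eta> \<le> gap x / 2"
  proof -
    show "0 < \<eta>"
      unfolding \<eta>_def using gap_pos[OF x] by (subst Min_gr_iff[OF finB]) auto
    show "\<eta> \<le> gap x / 2"
      unfolding \<eta>_def by (rule Min_le[OF finB insertI1])
  qed
  have nonsing: "pt D (b t) \<notin> singular_points D" if "0 < t" "t < \<eta>" for t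
  proof
    assume "pt D (b t) \<in> singular_points D"
    then have "t \<in> {t \<in> b -` \<Union>(singular_points D). 0 < t}"
      using mem_pt_self[of "b t"] that(1) by blast
    then have "\<eta> \<le> t"
      unfolding \<eta>_def by (intro Min_le[OF finB]) simp
    then show False
      using that(2) by simp
  qed
  have tri: "snd x + of_real t * u \<in> triangle D (fst x)" if "0 \<le> t" "t \<le> \<eta>" for t
    using mem_triangle_tangent_cone[OF x, of "of_real t * u"] tangent_cone_scale[OF u(2) that(1)] u(1) that \<eta> gap_pos[OF x]
    by (simp add: norm_mult)
  have "fs.traj {0<..<\<eta>} (\<lambda>t. pt D (b t))"
    unfolding fs.traj_def
  proof (intro conjI ballI)
    fix s assume s: "s \<in> {0<..<\<eta>}"
    have bs: "b s \<in> triangle_points D"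
      using tri[of s] s i by (simp add: triangle_points_def b_def)
    have pS: "pt D (b s) \<in> surface D"
      unfolding surface_def by (rule imageI[OF bs])
    have ns: "pt D (b s) \<notin> singular_points D"
      using nonsing s by simp
    obtain \<epsilon> F where F: "fs.fchart (pt D (b s)) \<epsilon> F"
      "\<And>v. v \<in> tangent_cone D (b s) \<Longrightarrow> norm v < \<epsilon> \<Longrightarrow> F v = pt D (fst (b s), snd (b s) + v)"
      by (rule aligned_fchart[OF pS ns mem_pt_self]) blast
    define \<rho> where "\<rho> = min (min \<epsilon> (gap (b s))) (min s (\<eta> - s))"
    have \<rho>: "0 < \<rho>" "\<rho> \<le> \<epsilon>" "\<rho> \<le> gap (b s)" "\<rho> \<le> s" "\<rho> \<le> \<eta> - s"
      using fs.fchart_pos[OF F(1)] gap_pos[OF bs] s by (auto simp: \<rho>_def)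
    have "pt D (b (s + \<tau>)) = F (of_real \<tau> * u)" if \<tau>: "\<bar>\<tau>\<bar> < \<rho>" for \<tau>
    proof -
      have n: "norm (of_real \<tau> * u) < gap (b s)" "norm (of_real \<tau> * u) < \<epsilon>"
        using \<tau> \<rho> u(1) by (auto simp: norm_mult)
      have eq: "snd (b s) + of_real \<tau> * u = snd x + of_real (s + \<tau>) * u"
        by (simp add: b_def algebra_simps)
      have "snd x + of_real (s + \<tau>) * u \<in> triangle D (fst x)"
        by (rule tri) (use \<tau> \<rho> in auto)
      then have "of_real \<tau> * u \<in> tangent_cone D (b s)"
        using mem_triangle_tangent_cone[OF bs n(1)] unfolding eq by (simp add: b_def)
      then have "F (of_real \<tau> * u) = pt D (fst (b s), snd (b s) + of_real \<tau> * u)"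
        using F(2) n(2) by blast
      then show ?thesis
        unfolding eq by (simp add: b_def)
    qed
    moreover have "ball s \<rho> \<subseteq> {0<..<\<eta>}"
      using \<rho> by (auto simp: dist_real_def)
    moreover have "fs.fchart (pt D (b s)) \<rho> F"
      by (rule fs.fchart_shrink[OF F(1) \<rho>(1,2)])
    ultimately show "\<exists>\<epsilon>>0. ball s \<epsilon> \<subseteq> {0<..<\<eta>} \<and> (\<exists>F v. fs.fchart (pt D (b s)) \<epsilon> F \<and> norm v = 1 \<and>
       (\<forall>\<tau>. \<bar>\<tau>\<bar> < \<epsilon> \<longrightarrow> pt D (b (s + \<tau>)) = F (of_real \<tau> * v)))"
      using \<rho>(1) u(1) by (intro exI[of _ \<rho>] conjI exI[of _ F] exI[of _ u]) auto
  qed simp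
  then show ?thesis
    using that \<eta>(1) tri unfolding b_def by blast
qed

text \<open>Disk and half disk charts cannot coexist at one point, so the model used by any chart
  reveals whether its centre is on the boundary.\<close>

lemma chart_boundary_iff:
  assumes H: "H \<in> {UNIV, upper}" and ch: "surf.chart H p \<epsilon> f" "0 < \<epsilon>" and p: "p \<in> surface D" "p \<notin> singular_points D"
  shows "p \<in> boundary_points D \<longleftrightarrow> H = upper"
proof -
  define H' where "H' = (if p \<in> boundary_points D then upper else UNIV)"
  have H': "H' \<in> {UNIV, upper}"
    by (simp add: H'_def)
  obtain \<epsilon>' f' where f': "0 < \<epsilon>'" "surf.chart H' p \<epsilon>' f'"
    using nonsingular_chart[OF p] unfolding H'_def by blast
  have 0: "0 \<in> H" "0 \<in> H'"
    using H H' by (auto simp: upper_iff)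
  have m: "0 < min \<epsilon> \<epsilon>'"
    using ch(2) f'(1) by simp
  have "H = H'"
    using surf.chart_transition[OF surf.chart_shrink[OF ch(1) m _ 0(1)] surf.chart_shrink[OF f'(2) m _ 0(2)] m H H']
    by simp
  moreover have "upper \<noteq> UNIV"
    using upper_iff[of "- \<i>"] by auto
  ultimately show ?thesis
    by (auto simp: H'_def)
qed

lemma chart_dist:
  assumes "surf.chart H p \<epsilon> f" "z \<in> ball 0 \<epsilon> \<inter> H" "w \<in> ball 0 \<epsilon> \<inter> H"
  shows "surface_dist D (f z) (f w) = dist z w" "f z \<in> surface D"
proof -
  have img: "f ` (ball 0 \<epsilon> \<inter> H) = {r \<in> surface D. sdist p r < \<epsilon>}"
    using assms(1) unfolding surf.chart_def by blast
  have S: "f z \<in> surface D" "f w \<in> surface D"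
    using imageI[OF assms(2), of f] imageI[OF assms(3), of f] unfolding img by auto
  then show "f z \<in> surface D"
    by simp
  have "sdist (f z) (f w) = dist z w"
    using assms unfolding surf.chart_def by blast
  then show "surface_dist D (f z) (f w) = dist z w"
    using S by (simp add: sdist_def)
qed

lemma half_disk_chart_iff:
  assumes p: "p \<in> surface D" and \<epsilon>: "0 < \<epsilon>"
  shows "half_disk_chart D p \<epsilon> f \<longleftrightarrow> surf.chart upper p \<epsilon> f"
proof
  have eq: "{z \<in> ball 0 \<epsilon>. 0 \<le> Im z} = ball 0 \<epsilon> \<inter> upper"
    by (auto simp: upper_def)
  have eq2: "{r \<in> surface D. surface_dist D p r < \<epsilon>} = {r \<in> surface D. sdist p r < \<epsilon>}"
    using p by (auto simp: sdist_def)
  {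
    assume h: "half_disk_chart D p \<epsilon> f"
    then have img: "f ` (ball 0 \<epsilon> \<inter> upper) = {r \<in> surface D. sdist p r < \<epsilon>}"
      unfolding half_disk_chart_def eq eq2 by blast
    have iso: "sdist (f z) (f w) = dist z w" if zw: "z \<in> ball 0 \<epsilon> \<inter> upper" "w \<in> ball 0 \<epsilon> \<inter> upper" for z w
    proof -
      have "f z \<in> surface D" "f w \<in> surface D"
        using imageI[OF zw(1), of f] imageI[OF zw(2), of f] unfolding img by auto
      then show ?thesis
        using h zw by (simp add: sdist_def half_disk_chart_def upper_iff)
    qed
    have "f 0 = p"
      using h unfolding half_disk_chart_def by (rule conjunct1)
    then show "surf.chart upper p \<epsilon> f"
      unfolding surf.chart_def by (intro conjI ballI img iso)
  }
  assume c: "surf.chart upper p \<epsilon> f"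
  have iso: "surface_dist D (f z) (f w) = dist z w" if "z \<in> ball 0 \<epsilon>" "w \<in> ball 0 \<epsilon>" "0 \<le> Im z" "0 \<le> Im w" for z w
    by (rule chart_dist(1)[OF c]) (use that in \<open>auto simp: upper_iff\<close>)
  have f0: "f 0 = p"
    using c unfolding surf.chart_def by (rule conjunct1)
  have img: "f ` (ball 0 \<epsilon> \<inter> upper) = {r \<in> surface D. sdist p r < \<epsilon>}"
    using c unfolding surf.chart_def by (elim conjE)
  show "half_disk_chart D p \<epsilon> f"
    unfolding half_disk_chart_def eq eq2 by (intro conjI ballI impI f0 img iso)
qed

lemma traj_imp_billiard:
  assumes g: "fs.traj S \<gamma>" and s: "s \<in> S"
  shows "\<gamma> s \<notin> singular_points D" "if \<gamma> s \<in> boundary_points D then reflects_at D J \<gamma> s else locally_geodesic_at D J \<gamma> s"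
proof -
  let ?p = "\<gamma> s"
  have p: "?p \<in> surface D" "?p \<notin> singular_points D"
    using fs.traj_mem[OF g s] by auto
  show "\<gamma> s \<notin> singular_points D"
    by (rule p(2))
  obtain \<epsilon> F u where F: "0 < \<epsilon>" "fs.fchart ?p \<epsilon> F" "norm u = 1" "\<And>\<tau>. \<bar>\<tau>\<bar> < \<epsilon> \<Longrightarrow> \<gamma> (s + \<tau>) = F (of_real \<tau> * u)"
    by (rule fs.trajE[OF g s zero_less_one]) blast
  obtain H f L where *: "H \<in> {UNIV, upper}" "surf.chart H ?p \<epsilon> f" "orthogonal_transformation L"
    "\<And>v. v \<in> ball 0 \<epsilon> \<Longrightarrow> F v = f (fold_into H (L v))" "\<And>v. v \<in> ball 0 \<epsilon> \<Longrightarrow> fold_into H (L v) \<in> ball 0 \<epsilon> \<inter> H"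
    by (rule fs.fchartE[OF F(2)]) blast
  have bd: "?p \<in> boundary_points D \<longleftrightarrow> H = upper"
    by (rule chart_boundary_iff[OF *(1,2) F(1) p])
  have nLu: "norm (L u) = 1"
    using orthogonal_transformation_norm_eq[OF *(3), of u] F(3) by simp
  have line: "\<gamma> (s + \<tau>) = f (fold_into H (of_real \<tau> * L u))" "fold_into H (of_real \<tau> * L u) \<in> ball 0 \<epsilon> \<inter> H" if "\<bar>\<tau>\<bar> < \<epsilon>" for \<tau>
  proof -
    have b: "of_real \<tau> * u \<in> ball 0 \<epsilon>"
      using that F(3) by (simp add: norm_mult)
    show "\<gamma> (s + \<tau>) = f (fold_into H (of_real \<tau> * L u))" "fold_into H (of_real \<tau> * L u) \<in> ball 0 \<epsilon> \<inter> H"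
      using F(4)[OF that] *(4,5)[OF b] by (simp_all add: orthogonal_transformation_of_real_mult[OF *(3)])
  qed
  show "if \<gamma> s \<in> boundary_points D then reflects_at D J \<gamma> s else locally_geodesic_at D J \<gamma> s"
  proof (cases "H = upper")
    case True
    define u' where "u' = fold_into upper (L u)"
    have u': "norm u' = 1" "0 \<le> Im u'"
      using nLu fold_into_mem[of upper "L u"] by (auto simp: u'_def upper_iff)
    have "half_disk_chart D (\<gamma> s) \<epsilon> f"
      using half_disk_chart_iff[OF p(1) F(1)] *(2) True by simp
    moreover have "\<gamma> (s + t) = f (of_real t * u') \<and> \<gamma> (s - t) = f (of_real t * - cnj u')" if "t \<in> {0..<\<epsilon>}" for t
      using line(1)[of t] line(1)[of "- t"] that fold_upper_scale[of t "L u"] True by (simp add: u'_def)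
    ultimately have "reflects_at D J \<gamma> s"
      unfolding reflects_at_def using F(1) u'
      by (intro exI[of _ \<epsilon>] conjI exI[of _ f] exI[of _ u']) auto
    then show ?thesis
      using bd True by simp
  next
    case False
    then have H: "H = UNIV"
      using *(1) by simp
    have "surface_dist D (\<gamma> t) (\<gamma> t') = \<bar>t - t'\<bar>" if t: "t \<in> ball s \<epsilon>" "t' \<in> ball s \<epsilon>" for t t'
    proof -
      have \<tau>: "\<bar>t - s\<bar> < \<epsilon>" "\<bar>t' - s\<bar> < \<epsilon>"
        using t by (auto simp: dist_real_def abs_minus_commute)
      have "surface_dist D (\<gamma> (s + (t - s))) (\<gamma> (s + (t' - s))) = dist (of_real (t - s) * L u) (of_real (t' - s) * L u)"
        using chart_dist(1)[OF *(2) line(2)[OF \<tau>(1)] line(2)[OF \<tau>(2)]]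
        unfolding line(1)[OF \<tau>(1)] line(1)[OF \<tau>(2)] H by simp
      also have "\<dots> = \<bar>t - t'\<bar>"
        using nLu by (simp add: dist_norm left_diff_distrib[symmetric] norm_mult del: of_real_diff)
           (simp add: norm_mult flip: of_real_diff)
      finally show ?thesis
        by simp
    qed
    then have "locally_geodesic_at D J \<gamma> s"
      unfolding locally_geodesic_at_def using F(1) by (intro exI[of _ \<epsilon>]) auto
    then show ?thesis
      using bd False by simp
  qed
qed

text \<open>At a boundary point the reflection law is literally a folded line. At an interior point
  a locally geodesic path is, in a disk chart, an isometric image of an interval, hence
  straight.\<close>

lemma billiard_imp_traj:
  assumes b: "billiard_trajectory D x u J \<gamma>"
  shows "fs.traj (interior J) \<gamma>"
  unfolding fs.traj_def
proof (intro conjI ballI)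
  fix s assume s: "s \<in> interior J"
  have J: "interior J \<subseteq> J"
    by (rule interior_subset)
  have cont: "continuous_map (top_of_set J) surf.mtopology \<gamma>"
    using b by (simp add: billiard_trajectory_def surface_topology_metric)
  have \<gamma>S: "\<gamma> t \<in> surface D" if "t \<in> J" for t
    using continuous_map_image_subset_topspace[OF cont] that by auto
  let ?p = "\<gamma> s"
  have p: "?p \<in> surface D" "?p \<notin> singular_points D"
    and c: "if ?p \<in> boundary_points D then reflects_at D J \<gamma> s else locally_geodesic_at D J \<gamma> s"
    using b s J \<gamma>S unfolding billiard_trajectory_def by auto
  obtain e where e: "0 < e" "ball s e \<subseteq> interior J"
    using openE[OF open_interior s] by blast
  have mem: "s + \<tau> \<in> J" if "\<bar>\<tau>\<bar> < e" for \<tau>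
  proof -
    have "s + \<tau> \<in> ball s e"
      using that by (simp add: dist_real_def)
    then show ?thesis
      using e(2) J by blast
  qed
  have "\<exists>\<epsilon>>0. \<epsilon> \<le> e \<and> (\<exists>F v. fs.fchart ?p \<epsilon> F \<and> norm v = 1 \<and> (\<forall>\<tau>. \<bar>\<tau>\<bar> < \<epsilon> \<longrightarrow> \<gamma> (s + \<tau>) = F (of_real \<tau> * v)))"
  proof (cases "?p \<in> boundary_points D")
    case True
    then have "reflects_at D J \<gamma> s"
      using c by simp
    then obtain \<epsilon> f u0 where r: "\<epsilon> > 0" "half_disk_chart D ?p \<epsilon> f" "norm u0 = 1" "0 \<le> Im u0"
      "\<And>t. t \<in> {0..<\<epsilon>} \<Longrightarrow> (s + t \<in> J \<longrightarrow> \<gamma> (s + t) = f (of_real t * u0)) \<and> (s - t \<in> J \<longrightarrow> \<gamma> (s - t) = f (of_real t * - cnj u0))"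
      unfolding reflects_at_def by blast
    have ch: "surf.chart upper ?p \<epsilon> f"
      using half_disk_chart_iff[OF p(1) r(1)] r(2) by simp
    have up: "upper \<in> {UNIV, upper}"
      by simp
    obtain \<delta> where \<delta>: "0 < \<delta>" "\<delta> \<le> \<epsilon>" "fs.fchart ?p \<delta> (\<lambda>v. f (fold_into upper (u0 * v)))"
      by (rule fchart_of_chart[OF up ch r(1) p orthogonal_transformation_mult[OF r(3)]])
    have fu: "fold_into upper u0 = u0"
      using r(4) by (simp add: upper_iff)
    define \<rho> where "\<rho> = min \<delta> e"
    have \<rho>: "0 < \<rho>" "\<rho> \<le> \<delta>" "\<rho> \<le> e"
      using \<delta> e by (auto simp: \<rho>_def)
    have "\<gamma> (s + \<tau>) = f (fold_into upper (u0 * (of_real \<tau> * 1)))" if \<tau>: "\<bar>\<tau>\<bar> < \<rho>" for \<tau>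
    proof (cases "0 \<le> \<tau>")
      case True
      then show ?thesis
        using r(5)[of \<tau>] mem[of \<tau>] \<tau> \<rho> \<delta>(2) fold_upper_scale(1)[OF True, of u0] fu by (simp add: mult.commute)
    next
      case False
      then have "0 \<le> - \<tau>"
        by simp
      then show ?thesis
        using r(5)[of "- \<tau>"] mem[of \<tau>] \<tau> \<rho> \<delta>(2) fold_upper_scale(2)[of "- \<tau>" u0] fu by (simp add: mult.commute)
    qed
    then show ?thesis
      using \<rho> fs.fchart_shrink[OF \<delta>(3) \<rho>(1,2)]
      by (intro exI[of _ \<rho>] conjI exI[of _ "\<lambda>v. f (fold_into upper (u0 * v))"] exI[of _ 1]) auto
  next
    case False
    then have "locally_geodesic_at D J \<gamma> s"
      using c by simp
    then obtain \<epsilon>1 where l: "\<epsilon>1 > 0" "\<And>t t'. t \<in> J \<inter> ball s \<epsilon>1 \<Longrightarrow> t' \<in> J \<inter> ball s \<epsilon>1 \<Longrightarrow> surface_dist D (\<gamma> t) (\<gamma> t') = \<bar>t - t'\<bar>"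
      unfolding locally_geodesic_at_def by blast
    obtain \<epsilon> f where ch: "0 < \<epsilon>" "surf.chart UNIV ?p \<epsilon> f"
      using nonsingular_chart[OF p] False by auto
    have un: "(UNIV :: complex set) \<in> {UNIV, upper}"
      by simp
    obtain \<delta> where \<delta>: "0 < \<delta>" "\<delta> \<le> \<epsilon>" "fs.fchart ?p \<delta> (\<lambda>v. f (fold_into UNIV (id v)))"
      by (rule fchart_of_chart[OF un ch(2,1) p orthogonal_transformation_id'])
    define \<rho> where "\<rho> = min (min \<delta> e) \<epsilon>1"
    have \<rho>: "0 < \<rho>" "\<rho> \<le> \<delta>" "\<rho> \<le> e" "\<rho> \<le> \<epsilon>1"
      using \<delta> e l by (auto simp: \<rho>_def)
    have img: "f ` (ball 0 \<epsilon> \<inter> UNIV) = {r \<in> surface D. sdist ?p r < \<epsilon>}"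
      using ch(2) unfolding surf.chart_def by blast
    have dom: "s + \<tau> \<in> J \<inter> ball s \<epsilon>1" if "\<bar>\<tau>\<bar> < \<rho>" for \<tau>
      using mem[of \<tau>] that \<rho> by (simp add: dist_real_def)
    have "\<exists>w. norm w < \<epsilon> \<and> \<gamma> (s + \<tau>) = f w" if \<tau>: "\<bar>\<tau>\<bar> < \<rho>" for \<tau>
    proof -
      have "surface_dist D (\<gamma> (s + 0)) (\<gamma> (s + \<tau>)) = \<bar>(s + 0) - (s + \<tau>)\<bar>"
        by (rule l(2)[OF dom dom]) (use \<tau> \<rho> in auto)
      then have "\<gamma> (s + \<tau>) \<in> {r \<in> surface D. sdist ?p r < \<epsilon>}"
        using \<gamma>S[of "s + \<tau>"] dom[OF \<tau>] p(1) \<tau> \<rho> \<delta> by (simp add: sdist_def)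
      then show ?thesis
        unfolding img[symmetric] by auto
    qed
    then obtain w where w: "\<And>\<tau>. \<bar>\<tau>\<bar> < \<rho> \<Longrightarrow> norm (w \<tau>) < \<epsilon>" "\<And>\<tau>. \<bar>\<tau>\<bar> < \<rho> \<Longrightarrow> \<gamma> (s + \<tau>) = f (w \<tau>)"
      by metis
    have iso: "dist (w \<tau>) (w \<tau>') = \<bar>\<tau> - \<tau>'\<bar>" if "\<bar>\<tau>\<bar> < \<rho>" "\<bar>\<tau>'\<bar> < \<rho>" for \<tau> \<tau>'
    proof -
      have "surface_dist D (f (w \<tau>)) (f (w \<tau>')) = dist (w \<tau>) (w \<tau>')"
        by (rule chart_dist(1)[OF ch(2)]) (use w(1) that in auto)
      then show ?thesis
        using l(2)[OF dom[OF that(1)] dom[OF that(2)]] w(2)[OF that(1)] w(2)[OF that(2)] by simp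
    qed
    have "w 0 = 0"
    proof -
      have "surface_dist D (f 0) (f (w 0)) = dist 0 (w 0)"
        by (rule chart_dist(1)[OF ch(2)]) (use w(1)[of 0] \<rho>(1) ch(1) in auto)
      moreover have "f (w 0) = ?p" "f 0 = ?p"
        using w(2)[of 0] \<rho>(1) ch(2) by (auto simp: surf.chart_def)
      moreover have "surface_dist D ?p ?p = 0"
        using surf.mdist_zero[OF p(1)] p(1) by (simp add: sdist_def)
      ultimately show ?thesis
        by simp
    qed
    then obtain v where v: "norm v = 1" "\<And>t. \<bar>t\<bar> < \<rho> \<Longrightarrow> w t = of_real t * v"
      using isometric_line[OF \<rho>(1) _ iso] by blast
    show ?thesis
      using \<rho> v w(2) fs.fchart_shrink[OF \<delta>(3) \<rho>(1,2)]
      by (intro exI[of _ \<rho>] conjI exI[of _ "\<lambda>v. f (fold_into UNIV (id v))"] exI[of _ v]) auto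
  qed
  then obtain \<epsilon> F v where "\<epsilon> > 0" "\<epsilon> \<le> e" "fs.fchart ?p \<epsilon> F" "norm v = 1" "\<forall>\<tau>. \<bar>\<tau>\<bar> < \<epsilon> \<longrightarrow> \<gamma> (s + \<tau>) = F (of_real \<tau> * v)"
    by blast
  then show "\<exists>\<epsilon>>0. ball s \<epsilon> \<subseteq> interior J \<and> (\<exists>F v. fs.fchart ?p \<epsilon> F \<and> norm v = 1 \<and> (\<forall>\<tau>. \<bar>\<tau>\<bar> < \<epsilon> \<longrightarrow> \<gamma> (s + \<tau>) = F (of_real \<tau> * v)))"
    using e(2) subset_ball[of \<epsilon> e s] by (intro exI[of _ \<epsilon>] conjI exI[of _ F] exI[of _ v]) auto
qed simp

end

section \<open>Existence of trajectories and the exceptional null set\<close>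

context flat_disk_surface begin

lemma singular_point_exists: "singular_points D \<noteq> {}"
proof -
  have "surf.mtopology homeomorphic_space top_of_set (cball (0::complex) 1)"
    unfolding surface_topology_metric using flat by (simp add: flat_disk_def)
  then show ?thesis
    using fs.singular_point_exists by blast
qed

lemma polygonal_lift:
  assumes "polygonal_length D p r l" and \<Phi>: "fs.dev (ball m R) \<Phi>" and "\<Phi> m = p" and "l < R"
  shows "\<exists>z. dist m z \<le> l \<and> \<Phi> z = r"
  using assms(1,3,4)
proof (induction rule: polygonal_length.induct)
  case (start p)
  then show ?case
    by (intro exI[of _ m]) simp
next
  case (segment p i z l w)
  have "l < R"
    using segment.prems(2) zero_le_dist[of z w] by linarith
  then obtain \<zeta> where \<zeta>: "dist m \<zeta> \<le> l" "\<Phi> \<zeta> = pt D (i, z)"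
    using segment.IH segment.prems(1) by blast
  define g where "g t = pt D (i, z + of_real t * sgn (w - z))" for t
  have tri: "z + of_real t * sgn (w - z) \<in> triangle D i" if t: "0 \<le> t" "t \<le> dist z w" for t
  proof (cases "z = w")
    case False
    then have d: "0 < dist z w"
      by simp
    have "z + of_real t * sgn (w - z) = (1 - t / dist z w) *\<^sub>R z + (t / dist z w) *\<^sub>R w"
      using d by (simp add: sgn_div_norm dist_norm norm_minus_commute scaleR_conv_of_real field_simps)
    moreover have "convex (triangle D i)"
      by (simp add: triangle_def)
    ultimately show ?thesis
      using convexD_alt[of "triangle D i" z w "t / dist z w"] segment.hyps(3,4) t d by simp
  qed (use segment.hyps in simp)
  have "\<exists>z'. dist \<zeta> z' \<le> dist z w \<and> \<Phi> z' = g (dist z w)"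
  proof (rule fs.path_lift[OF \<Phi> zero_le_dist])
    show "g t \<in> surface D" if "0 \<le> t" "t \<le> dist z w" for t
      unfolding g_def by (rule pt_mem_surface[OF segment.hyps(2) tri[OF that]])
    show "sdist (g s) (g t) \<le> t - s" if st: "0 \<le> s" "s \<le> t" "t \<le> dist z w" for s t
    proof -
      have t1: "z + of_real s * sgn (w - z) \<in> triangle D i" "z + of_real t * sgn (w - z) \<in> triangle D i"
        using tri[of s] tri[of t] st by auto
      have "sdist (g s) (g t) \<le> dist (z + of_real s * sgn (w - z)) (z + of_real t * sgn (w - z))"
        using surface_dist_segment[OF segment.hyps(2) t1] pt_mem_surface[OF segment.hyps(2) t1(1)]
          pt_mem_surface[OF segment.hyps(2) t1(2)] by (simp add: sdist_def g_def)
      also have "\<dots> = norm (of_real (s - t) * sgn (w - z))"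
        by (simp add: dist_norm algebra_simps)
      also have "\<dots> \<le> \<bar>s - t\<bar>"
        by (simp add: norm_mult norm_sgn del: of_real_diff)
      finally show ?thesis
        using st by simp
    qed
    show "\<Phi> \<zeta> = g 0"
      using \<zeta>(2) by (simp add: g_def)
    show "dist m \<zeta> + dist z w < R"
      using \<zeta>(1) segment.prems(2) by simp
  qed
  then obtain z' where z': "dist \<zeta> z' \<le> dist z w" "\<Phi> z' = g (dist z w)"
    by blast
  have "g (dist z w) = pt D (i, w)"
    by (cases "z = w") (simp_all add: g_def sgn_eq dist_norm norm_minus_commute)
  then show ?case
    using z' \<zeta>(1) dist_triangle[of m z' \<zeta>] by (intro exI[of _ z']) auto
qed

lemma no_large_development:
  obtains R where "0 < R" "\<And>m \<Phi>. \<not> fs.dev (ball m R) \<Phi>"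
proof -
  obtain s0 where s0: "s0 \<in> singular_points D"
    using singular_point_exists by blast
  then have s0S: "s0 \<in> surface D"
    by (simp add: singular_points_def)
  have "surf.mbounded (surface D)"
    using surf.compactin_imp_mbounded fs.compact by (simp add: compact_space_def)
  then obtain a b where ab: "surface D \<subseteq> surf.mcball a b" "0 < b"
    unfolding surf.mbounded_pos by blast
  \<comment> \<open>More than the diameter, so some polygonal path from the image of the centre to a
    singular point is shorter than \<open>R\<close> and lifts into the disk, where all values are
    nonsingular.\<close>
  define R where "R = 2 * b + 1"
  have R: "0 < R"
    using ab(2) by (simp add: R_def)
  have "False" if \<Phi>: "fs.dev (ball m R) \<Phi>" for m \<Phi>
  proof -
    have m: "\<Phi> m \<in> surface D"
      using fs.dev_mem[OF \<Phi>, of m] R by simp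
    have "sdist a (\<Phi> m) \<le> b" "sdist a s0 \<le> b" "a \<in> surface D"
      using ab(1) m s0S by auto
    then have "sdist (\<Phi> m) s0 \<le> 2 * b"
      using surf.triangle''[OF m _ s0S, of a] by simp
    then have lt: "surface_dist D (\<Phi> m) s0 < R"
      using m s0S by (simp add: sdist_def R_def)
    obtain l where l: "polygonal_length D (\<Phi> m) s0 l" "l < R"
      using cInf_lessD[of "{l. polygonal_length D (\<Phi> m) s0 l}" R] lt polygonally_connected[OF m s0S]
      unfolding surface_dist_def by auto
    obtain z where z: "dist m z \<le> l" "\<Phi> z = s0"
      using polygonal_lift[OF l(1) \<Phi> refl l(2)] by blast
    then have "\<Phi> z \<notin> singular_points D"
      using fs.dev_mem[OF \<Phi>, of z] l(2) by simp
    then show False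
      using z(2) s0 by simp
  qed
  then show ?thesis
    using that R by blast
qed

text \<open>Keeps the statement about all trajectories from being vacuous. The initial segment is
  extended maximally; what remains is continuity, obtained from a Lipschitz bound that includes the
  two end points.\<close>

lemma trajectory_exists:
  assumes x: "x \<in> triangle_points D" and u: "norm u = 1" "u \<in> tangent_cone D x"
  shows "\<exists>J \<gamma>. billiard_trajectory D x u J \<gamma>"
proof -
  let ?b = "\<lambda>t. pt D (fst x, snd x + of_real t * u)"
  obtain \<eta> where \<eta>: "0 < \<eta>" "fs.traj {0<..<\<eta>} ?b"
    and tri: "\<And>t. 0 \<le> t \<Longrightarrow> t \<le> \<eta> \<Longrightarrow> snd x + of_real t * u \<in> triangle D (fst x)"
    by (rule start_traj[OF x u]) blast
  have i: "fst x \<in> tris D"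
    using x by (auto simp: triangle_points_def)
  obtain g where g: "\<forall>t\<in>{0<..<\<eta>}. g t = ?b t" and
    alt: "fs.traj {0<..} g \<or> (\<exists>L\<ge>\<eta>. fs.traj {0<..<L} g \<and> g L \<in> singular_points D \<inter> surface D \<and>
      (\<forall>t. 0 < t \<and> t < L \<longrightarrow> sdist (g t) (g L) \<le> L - t))"
    using fs.traj_extend[OF \<eta>(2,1)] by blast
  \<comment> \<open>The extension is controlled only at positive times, so the value at the start is
    supplied here.\<close>
  define \<gamma> where "\<gamma> t = (if t \<le> 0 then pt D x else g t)" for t
  have bS: "?b t \<in> surface D" if "0 \<le> t" "t \<le> \<eta>" for t
    by (rule pt_mem_surface[OF i tri[OF that]])
  have \<gamma>b: "\<gamma> t = ?b t" if "0 \<le> t" "t < \<eta>" for t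
    using g that by (cases "t = 0") (auto simp: \<gamma>_def)
  \<comment> \<open>Infinite and terminating trajectories are brought into one form, with the
    Lipschitz bound at positive times including the final one.\<close>
  have "\<exists>J S. (J = {0..} \<or> (\<exists>L>0. J = {0..L} \<and> \<gamma> L \<in> singular_points D)) \<and> interior J = S \<and> fs.traj S \<gamma> \<and>
    (\<forall>s t. 0 < s \<and> s \<le> t \<and> t \<in> J \<longrightarrow> sdist (\<gamma> s) (\<gamma> t) \<le> t - s \<and> \<gamma> t \<in> surface D)"
    using alt
  proof
    assume t: "fs.traj {0<..} g"
    have t\<gamma>: "fs.traj {0<..} \<gamma>"
      by (rule fs.traj_local) (use t in \<open>auto simp: \<gamma>_def intro!: exI[of _ "{0<..}"] exI[of _ g]\<close>)
    have "sdist (\<gamma> s) (\<gamma> t) \<le> t - s \<and> \<gamma> t \<in> surface D" if "0 < s" "s \<le> t" for s t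
    proof -
      have "{s..t} \<subseteq> {0<..}"
        using that(1) by (auto intro: less_le_trans)
      then show ?thesis
        using fs.traj_lipschitz[OF t\<gamma> that(2)] fs.traj_mem[OF t\<gamma>, of t] that by simp
    qed
    moreover have "interior {0::real..} = {0<..}"
      by (rule interior_real_atLeast)
    ultimately show ?thesis
      using t\<gamma> by (intro exI[of _ "{0..}"] exI[of _ "{0<..}"]) auto
  next
    assume "\<exists>L\<ge>\<eta>. fs.traj {0<..<L} g \<and> g L \<in> singular_points D \<inter> surface D \<and>
      (\<forall>t. 0 < t \<and> t < L \<longrightarrow> sdist (g t) (g L) \<le> L - t)"
    then obtain L where L: "\<eta> \<le> L" "fs.traj {0<..<L} g" "g L \<in> singular_points D" "g L \<in> surface D"
      "\<And>t. 0 < t \<Longrightarrow> t < L \<Longrightarrow> sdist (g t) (g L) \<le> L - t"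
      by blast
    have L0: "0 < L"
      using L(1) \<eta>(1) by simp
    have t\<gamma>: "fs.traj {0<..<L} \<gamma>"
      by (rule fs.traj_local) (use L(2) in \<open>auto simp: \<gamma>_def intro!: exI[of _ "{0<..<L}"] exI[of _ g]\<close>)
    have \<gamma>L: "\<gamma> L = g L"
      using L0 by (simp add: \<gamma>_def)
    have "sdist (\<gamma> s) (\<gamma> t) \<le> t - s \<and> \<gamma> t \<in> surface D" if st: "0 < s" "s \<le> t" "t \<le> L" for s t
    proof (cases "t < L")
      case True
      then have "{s..t} \<subseteq> {0<..<L}"
        using st(1) by auto
      then show ?thesis
        using fs.traj_lipschitz[OF t\<gamma> st(2)] fs.traj_mem[OF t\<gamma>, of t] st True by simp
    next
      case False
      then have t: "t = L"
        using st by simp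
      show ?thesis
      proof (cases "s < L")
        case True
        then show ?thesis
          using L(4) L(5)[OF st(1) True] st(1) unfolding t \<gamma>L by (simp add: \<gamma>_def)
      next
        case False
        then have "s = L"
          using st t by simp
        then show ?thesis
          using L(4) surf.mdist_zero[OF L(4)] t \<gamma>L by simp
      qed
    qed
    moreover have "interior {0..L} = {0<..<L}"
      by (rule interior_atLeastAtMost_real)
    ultimately show ?thesis
      using t\<gamma> L(3) L0 \<gamma>L by (intro exI[of _ "{0..L}"] exI[of _ "{0<..<L}"]) auto
  qed
  then obtain J S where J: "J = {0..} \<or> (\<exists>L>0. J = {0..L} \<and> \<gamma> L \<in> singular_points D)" "interior J = S" "fs.traj S \<gamma>"
    and lip: "\<And>s t. 0 < s \<Longrightarrow> s \<le> t \<Longrightarrow> t \<in> J \<Longrightarrow> sdist (\<gamma> s) (\<gamma> t) \<le> t - s \<and> \<gamma> t \<in> surface D"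
    by blast
  have J0: "0 \<le> t" "0 \<le> s \<Longrightarrow> s \<le> t \<Longrightarrow> s \<in> J" if "t \<in> J" for s t
    using J(1) that by auto
  have \<gamma>0: "\<gamma> 0 = pt D x"
    by (simp add: \<gamma>_def)
  have \<gamma>S: "\<gamma> t \<in> surface D" if "t \<in> J" for t
    using lip[of t t] J0(1)[OF that] that \<gamma>0 bS[of 0] \<eta>(1) by (cases "t = 0") auto
  have lip0: "sdist (\<gamma> s) (\<gamma> t) \<le> t - s" if st: "0 \<le> s" "s \<le> t" "t \<in> J" for s t
  proof (cases "s = 0")
    case False
    then show ?thesis
      using lip st by simp
  next
    case s0: True
    show ?thesis
    proof (cases "t = 0")
      case True
      then show ?thesis
        using s0 surf.mdist_zero[OF \<gamma>S[OF st(3)]] by simp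
    next
      case False
      \<comment> \<open>The bound from time 0 passes through an early time at which the path is
        still a segment in the first triangle.\<close>
      define r where "r = min t (\<eta> / 2)"
      have r: "0 < r" "r \<le> t" "r < \<eta>"
        using False st \<eta>(1) s0 by (auto simp: r_def)
      have rJ: "r \<in> J" "0 \<in> J"
        using J0(2)[OF st(3)] r by auto
      have "sdist (\<gamma> 0) (\<gamma> r) \<le> r"
      proof -
        have "sdist (\<gamma> 0) (\<gamma> r) = surface_dist D (?b 0) (?b r)"
          using \<gamma>S[OF rJ(1)] \<gamma>S[OF rJ(2)] \<gamma>b[of r] \<gamma>b[of 0] r \<eta>(1) by (simp add: sdist_def)
        also have "\<dots> \<le> dist (snd x + of_real 0 * u) (snd x + of_real r * u)"
          by (rule surface_dist_segment[OF i tri tri]) (use r \<eta>(1) in auto)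
        also have "\<dots> = r"
          using r u(1) by (simp add: dist_norm norm_mult)
        finally show ?thesis .
      qed
      then show ?thesis
        using lip[OF r(1,2) st(3)] surf.triangle[OF \<gamma>S[OF rJ(2)] \<gamma>S[OF rJ(1)] \<gamma>S[OF st(3)]] s0 by simp
    qed
  qed
  have "continuous_map (top_of_set J) surf.mtopology \<gamma>"
    unfolding surf.continuous_map_to_metric
  proof (intro ballI allI impI)
    fix s e assume "s \<in> topspace (top_of_set J)" and e: "(0::real) < e"
    then have s: "s \<in> J"
      by simp
    have "\<gamma> t \<in> surf.mball (\<gamma> s) e" if t: "t \<in> J \<inter> ball s e" for t
    proof -
      have "sdist (\<gamma> s) (\<gamma> t) \<le> \<bar>t - s\<bar>"
        using lip0[of s t] lip0[of t s] J0(1)[OF s] J0(1)[of t] s t surf.commute[of "\<gamma> s" "\<gamma> t"]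
        by (cases "s \<le> t") auto
      then show ?thesis
        using t s \<gamma>S by (auto simp: dist_real_def abs_minus_commute)
    qed
    moreover have "openin (top_of_set J) (J \<inter> ball s e)"
      by (simp add: openin_open_Int)
    ultimately show "\<exists>U. openin (top_of_set J) U \<and> s \<in> U \<and> (\<forall>y\<in>U. \<gamma> y \<in> surf.mball (\<gamma> s) e)"
      using s e by (intro exI[of _ "J \<inter> ball s e"]) auto
  qed
  then have cont: "continuous_map (top_of_set J) (surface_topology D) \<gamma>"
    by (simp add: surface_topology_metric)
  have init: "\<exists>\<epsilon>>0. \<forall>t\<in>J \<inter> {0..\<epsilon>}. snd x + of_real t * u \<in> triangle D (fst x) \<and> \<gamma> t = ?b t"
    using \<eta>(1) tri \<gamma>b by (intro exI[of _ "\<eta> / 2"]) auto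
  have loc: "\<forall>s\<in>interior J. \<gamma> s \<notin> singular_points D \<and>
    (if \<gamma> s \<in> boundary_points D then reflects_at D J \<gamma> s else locally_geodesic_at D J \<gamma> s)"
    unfolding J(2) using traj_imp_billiard[OF J(3)] by blast
  show ?thesis
    unfolding billiard_trajectory_def
    by (rule exI[of _ J], rule exI[of _ \<gamma>]) (intro conjI J(1) cont init loc)
qed

lemma billiard_start:
  assumes b: "billiard_trajectory D x u J \<gamma>"
  shows "0 \<in> J" "\<gamma> 0 = pt D x"
proof -
  show J0: "0 \<in> J"
    using b unfolding billiard_trajectory_def by auto
  obtain \<epsilon> where "\<epsilon> > 0" "\<forall>t\<in>J \<inter> {0..\<epsilon>}. \<gamma> t = pt D (fst x, snd x + of_real t * u)"
    using b unfolding billiard_trajectory_def by blast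
  then show "\<gamma> 0 = pt D x"
    using J0 by (simp add: bspec[of _ _ 0])
qed

lemma image_subset_surface:
  assumes b: "billiard_trajectory D x u J \<gamma>"
  shows "\<gamma> ` J \<subseteq> surface D"
proof -
  have "continuous_map (top_of_set J) surf.mtopology \<gamma>"
    using b by (simp add: billiard_trajectory_def surface_topology_metric)
  then show ?thesis
    using continuous_map_image_subset_topspace by fastforce
qed

lemma in_closure_of_mem:
  assumes b: "billiard_trajectory D x u J \<gamma>" and t: "t \<in> J" "\<gamma> t \<in> singular_points D"
  shows "\<exists>p\<in>singular_points D. p \<in> surface_topology D closure_of (\<gamma> ` J)"
proof -
  have "\<gamma> ` J \<subseteq> surf.mtopology closure_of (\<gamma> ` J)"
    by (rule closure_of_subset) (use image_subset_surface[OF b] in simp)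
  then show ?thesis
    using t unfolding surface_topology_metric by blast
qed

text \<open>The approached singular point may depend on \<open>n\<close>. As there are finitely
  many, balls missed by the trajectory around each of them would have a common positive
  radius.\<close>

lemma closure_contains_singular:
  assumes b: "billiard_trajectory D x u J \<gamma>"
    and approach: "\<And>n. \<exists>t\<in>J. \<exists>s\<in>singular_points D. sdist (\<gamma> t) s < 1 / (real n + 1)"
  shows "\<exists>p\<in>singular_points D. p \<in> surface_topology D closure_of (\<gamma> ` J)"
proof (rule ccontr)
  assume "\<not> ?thesis"
  then have "\<forall>p\<in>singular_points D. \<exists>r>0. \<forall>t\<in>J. \<gamma> t \<notin> surf.mball p r"
    unfolding surface_topology_metric[symmetric] surf.metric_closure_of by (auto simp: singular_points_def)
  then obtain r where r: "\<And>p. p \<in> singular_points D \<Longrightarrow> 0 < r p"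
    "\<And>p t. p \<in> singular_points D \<Longrightarrow> t \<in> J \<Longrightarrow> \<gamma> t \<notin> surf.mball p (r p)"
    by metis
  define \<rho> where "\<rho> = Min (insert 1 (r ` singular_points D))"
  have fin: "finite (insert 1 (r ` singular_points D))"
    using finite_singular_points by simp
  have \<rho>: "0 < \<rho>"
    unfolding \<rho>_def using r(1) by (subst Min_gr_iff[OF fin]) auto
  have \<rho>le: "\<rho> \<le> r p" if "p \<in> singular_points D" for p
    unfolding \<rho>_def using that by (intro Min_le[OF fin]) simp
  obtain n where n: "inverse (real (Suc n)) < \<rho>"
    using reals_Archimedean[OF \<rho>] by blast
  obtain t s where ts: "t \<in> J" "s \<in> singular_points D" "sdist (\<gamma> t) s < 1 / (real n + 1)"
    using approach[of n] by blast
  have "sdist s (\<gamma> t) < r s"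
    using ts(3) n \<rho>le[OF ts(2)] surf.commute[of s "\<gamma> t"] by (simp add: inverse_eq_divide add.commute)
  moreover have "\<gamma> t \<in> surface D"
    using image_subset_surface[OF b] ts(1) by blast
  moreover have "s \<in> surface D"
    using ts(2) by (simp add: singular_points_def)
  ultimately show False
    using r(2)[OF ts(2,1)] by simp
qed

lemma almost_all_directions:
  assumes q: "q \<in> surface D" and x: "x \<in> q"
  shows "\<exists>N\<in>null_sets lborel. \<forall>t\<in>sector D x - N. (\<exists>J \<gamma>. billiard_trajectory D x (cis t) J \<gamma>) \<and>
     (\<forall>J \<gamma>. billiard_trajectory D x (cis t) J \<gamma> \<longrightarrow>
       (\<exists>p\<in>singular_points D. p \<in> surface_topology D closure_of (\<gamma> ` J)))"
proof -
  have xt: "x \<in> triangle_points D" and qx: "q = pt D x"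
    using surface_rep[OF q x] by auto
  have cone: "cis t \<in> tangent_cone D x" if "t \<in> sector D x" for t
    using that points_into_iff[OF xt, of "cis t"] by (simp add: sector_def)
  have ex: "\<exists>J \<gamma>. billiard_trajectory D x (cis t) J \<gamma>" if "t \<in> sector D x" for t
    by (rule trajectory_exists[OF xt _ cone[OF that]]) simp
  show ?thesis
  proof (cases "q \<in> singular_points D")
    \<comment> \<open>A trajectory contains its starting point, so here every direction is
      good.\<close>
    case True
    have "\<exists>p\<in>singular_points D. p \<in> surface_topology D closure_of (\<gamma> ` J)"
      if b: "billiard_trajectory D x (cis t) J \<gamma>" for t J \<gamma>
      by (rule in_closure_of_mem[OF b billiard_start(1)[OF b]]) (use billiard_start(2)[OF b] True qx in simp)
    then show ?thesis
      using ex by (intro bexI[of _ "{}"]) auto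
  next
    case False
    obtain \<epsilon> F where F: "fs.fchart q \<epsilon> F" "\<And>v. v \<in> tangent_cone D x \<Longrightarrow> norm v < \<epsilon> \<Longrightarrow> F v = pt D (fst x, snd x + v)"
      by (rule aligned_fchart[OF q False x]) blast
    obtain R where R: "0 < R" "\<And>m \<Phi>. \<not> fs.dev (ball m R) \<Phi>"
      by (rule no_large_development) blast
    \<comment> \<open>Keeping a positive distance from the singular points means keeping distance
      \<open>1 / (n + 1)\<close> for some \<open>n\<close>, so countably many null sets
      suffice.\<close>
    have "\<exists>N\<in>null_sets lborel. {\<theta>. fs.avoids F (1 / (real n + 1)) \<theta>} \<subseteq> N" for n
      by (rule fs.avoiding_directions_null[OF F(1) R]) simp
    then obtain N where N: "\<And>n. N n \<in> null_sets lborel" "\<And>n. {\<theta>. fs.avoids F (1 / (real n + 1)) \<theta>} \<subseteq> N n"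
      by metis
    have null: "(\<Union>n. N n) \<in> null_sets lborel"
      using N(1) by (intro null_sets_UN)
    have "\<exists>p\<in>singular_points D. p \<in> surface_topology D closure_of (\<gamma> ` J)"
      if t: "t \<in> sector D x - (\<Union>n. N n)" and b: "billiard_trajectory D x (cis t) J \<gamma>" for t J \<gamma>
    proof (cases "J = {0..}")
      case False
      then obtain L where "L > 0" "J = {0..L}" "\<gamma> L \<in> singular_points D"
        using b unfolding billiard_trajectory_def by blast
      then show ?thesis
        by (intro in_closure_of_mem[OF b, of L]) auto
    next
      case J: True
      have tr: "fs.traj {0<..} \<gamma>"
        using billiard_imp_traj[OF b] unfolding J by (simp add: interior_real_atLeast)
      obtain \<epsilon>' where \<epsilon>': "\<epsilon>' > 0" "\<forall>s\<in>J \<inter> {0..\<epsilon>'}. \<gamma> s = pt D (fst x, snd x + of_real s * cis t)"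
        using b unfolding billiard_trajectory_def by blast
      have start: "\<gamma> s = F (of_real s * cis t)" if s: "0 < s" "s < min \<epsilon> \<epsilon>'" for s
      proof -
        have "of_real s * cis t \<in> tangent_cone D x"
          by (rule tangent_cone_scale[OF cone]) (use t s in auto)
        moreover have "norm (of_real s * cis t) < \<epsilon>"
          using s by (simp add: norm_mult)
        ultimately have "F (of_real s * cis t) = pt D (fst x, snd x + of_real s * cis t)"
          by (rule F(2))
        moreover have "\<gamma> s = pt D (fst x, snd x + of_real s * cis t)"
          by (rule bspec[OF \<epsilon>'(2)]) (use s J in auto)
        ultimately show ?thesis
          by simp
      qed
      have pos: "0 < min \<epsilon> \<epsilon>'"
        using \<epsilon>'(1) fs.fchart_pos[OF F(1)] by simp
      show ?thesis
      proof (rule closure_contains_singular[OF b])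
        fix n
        have "\<not> fs.avoids F (1 / (real n + 1)) t"
          using t N(2)[of n] by blast
        then have "\<not> (\<forall>s>0. \<forall>p\<in>singular_points D \<inter> surface D. 1 / (real n + 1) \<le> sdist (\<gamma> s) p)"
          unfolding fs.avoids_def using tr start pos by blast
        then obtain s p where "s > 0" "p \<in> singular_points D" "sdist (\<gamma> s) p < 1 / (real n + 1)"
          by (auto simp: not_le)
        then show "\<exists>t\<in>J. \<exists>s\<in>singular_points D. sdist (\<gamma> t) s < 1 / (real n + 1)"
          unfolding J by (intro bexI[of _ s] bexI[of _ p]) auto
      qed
    qed
    then show ?thesis
      using ex null by (intro bexI[of _ "\<Union>n. N n"]) auto
  qed
qed

lemma sector_borel:
  assumes "x \<in> triangle_points D"
  shows "sector D x \<in> sets borel"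
  using assms
proof (cases rule: corner_or_interior)
  case interior
  then show ?thesis
    using sector_interior(2)[OF assms interior] by simp
next
  case (corner \<kappa> n k)
  then have "\<kappa> k \<in> corners"
    by (auto simp: closed_fan_def open_fan_def fan_def)
  then show ?thesis
    using sector_corner(1) corner(3) by simp
qed

text \<open>The class of \<open>q\<close> is finite, so the exceptional directions lie in a finite
  union of slices \<open>{x} \<times> N x\<close>, each null for the product measure.\<close>

lemma AE_direction_measure:
  assumes q: "q \<in> surface D"
    and P: "\<And>x. x \<in> q \<Longrightarrow> \<exists>N\<in>null_sets lborel. \<forall>t\<in>sector D x - N. P x t"
  shows "AE (x, t) in direction_measure D q. P x t"
proof -
  let ?M = "count_space q \<Otimes>\<^sub>M lborel :: (('i \<times> complex) \<times> real) measure"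
  have fin: "finite q"
    by (rule finite_class[OF q])
  have rect: "A \<times> N \<in> sets ?M" if "A \<subseteq> q" "N \<in> sets borel" for A and N :: "real set"
    using that by (intro pair_measureI) auto
  have Sig: "Sigma q (sector D) = (\<Union>x\<in>q. {x} \<times> sector D x)"
    by auto
  have "Sigma q (sector D) \<in> sets ?M"
    unfolding Sig
  proof (intro sets.finite_UN fin rect)
    show "sector D x \<in> sets borel" if "x \<in> q" for x
      by (rule sector_borel[OF surface_rep(1)[OF q that]])
  qed auto
  then have *: "Sigma q (sector D) \<inter> space ?M \<in> sets ?M"
    by (intro sets.Int) auto
  obtain N where N: "\<And>x. x \<in> q \<Longrightarrow> N x \<in> null_sets lborel" "\<And>x t. x \<in> q \<Longrightarrow> t \<in> sector D x - N x \<Longrightarrow> P x t"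
    using P by metis
  have "(\<Union>x\<in>q. {x} \<times> N x) \<in> null_sets ?M"
  proof (intro null_sets.finite_UN fin)
    fix x assume x: "x \<in> q"
    have "emeasure ?M ({x} \<times> N x) = emeasure (count_space q) {x} * emeasure lborel (N x)"
      using N(1)[OF x] x by (intro lborel.emeasure_pair_measure_Times) auto
    also have "\<dots> = 0"
      using N(1)[OF x] by (simp add: null_sets_def)
    finally show "{x} \<times> N x \<in> null_sets ?M"
      using N(1)[OF x] rect[of "{x}" "N x"] x by (simp add: null_sets_def)
  qed
  then have "AE y in ?M. y \<in> Sigma q (sector D) \<longrightarrow> (case y of (x, t) \<Rightarrow> P x t)"
  proof (rule AE_I')
    show "{y \<in> space ?M. \<not> (y \<in> Sigma q (sector D) \<longrightarrow> (case y of (x, t) \<Rightarrow> P x t))} \<subseteq> (\<Union>x\<in>q. {x} \<times> N x)"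
      using N(2) by fastforce
  qed
  then show ?thesis
    unfolding direction_measure_def AE_restrict_space_iff[OF *] .
qed

end

theorem theorem1:
  fixes D :: "'i triangle_gluing" and q :: "('i \<times> complex) set"
  assumes "flat_disk D" and "q \<in> surface D"
  shows "AE (x, t) in direction_measure D q.
           (\<exists>J \<gamma>. billiard_trajectory D x (cis t) J \<gamma>) \<and>
           (\<forall>J \<gamma>. billiard_trajectory D x (cis t) J \<gamma> \<longrightarrow>
              (\<exists>p\<in>singular_points D. p \<in> surface_topology D closure_of (\<gamma> ` J)))"
proof -
  interpret flat_disk_surface D
    by (rule flat_disk_surface.intro[OF assms(1)])
  show ?thesis
    by (rule AE_direction_measure[OF assms(2) almost_all_directions[OF assms(2)]])
qed

end
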